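(* Let $c>0$ be given and assume that $(\lambda_1,\lambda_2)$ is in the unstable regime. Then there exists $a_0>0$ such that for any $a\in(0,a_0]$ the functional $E_a$ restricted to $S(c)$ admits ground states and these are orbitally stable: denoting by $\mathcal G_a\subset S(c)$ the set of all ground states of $E_a$ restricted to $S(c)$, for every $\varepsilon>0$ there exists $\delta>0$ such that for any $\psi_0\in\Sigma$ with $\inf_{v\in\mathcal G_a}\|v-\psi_0\|_\Sigma<\delta$, the solution $\psi$ of $$i\partial_t\psi=-\tfrac12\Delta\psi+\tfrac{a^2}{2}|x|^2\psi+\lambda_1|\psi|^2\psi+\lambda_2(K\star|\psi|^2)\psi,\qquad \psi(0,\cdot)=\psi_0,$$ is defined for all $t>0$ and satisfies $$\inf_{v\in\mathcal G_a}\|\psi(t,\cdot)-v\|_\Sigma<\varepsilon\qquad\text{for all }t>0.$$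
   Context: $f\mapsto K\star f$ is the Fourier multiplier with symbol $\hat K(\xi)=\frac43\pi\,\frac{2\xi_3^2-\xi_1^2-\xi_2^2}{|\xi|^2}$ (convolution with the dipolar kernel $K(x)=\frac{1-3\cos^2\theta}{|x|^3}$, $\theta$ the angle between $x$ and $(0,0,1)$). The pair $(\lambda_1,\lambda_2)\in\mathbb{R}^2$ with $\lambda_2\ne0$ is in the unstable regime if $\lambda_1-\frac43\pi\lambda_2<0$ when $\lambda_2>0$, and $\lambda_1+\frac83\pi\lambda_2<0$ when $\lambda_2<0$. $\Sigma=\{u\in H^1(\mathbb{R}^3,\mathbb{C}):\int|x|^2|u|^2dx<\infty\}$ with norm $\|u\|_\Sigma^2=\|u\|_{H^1}^2+\||x|u\|_2^2$; $S(c)=\{u\in\Sigma:\|u\|_2^2=c\}$; and $$E_a(u)=\tfrac12\|\nabla u\|_2^2+\tfrac{a^2}{2}\||x|u\|_2^2+\tfrac{\lambda_1}2\|u\|_4^4+\tfrac{\lambda_2}2\int_{\mathbb{R}^3}(K\star|u|^2)|u|^2dx.$$ Ground state of $E_a$ on $S(c)$: a critical point $u\in S(c)$ of $E_a|_{S(c)}$ with $E_a(u)=\inf\{E_a(w):w\in S(c),\ E_a'|_{S(c)}(w)=0\}$. By known local theory, each $\psi_0\in\Sigma$ gives a unique maximal solution continuous in time with values in $\Sigma$, conserving $\|\psi\|_2^2$ and $E_a(\psi)$, and either global or with $\|\nabla\psi(t)\|_2$ blowing up at the end of its finite existence interval. *)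

theory Defs
  imports "HOL-Analysis.Analysis"
begin

text \<open>
  Elements of \<open>L\<^sup>2(\<real>\<^sup>3)\<close>, \<open>H\<^sup>1(\<real>\<^sup>3)\<close> and \<open>\<Sigma>\<close> are represented by Borel functions on \<open>real^3\<close>,
  not by equivalence classes; every notion below is invariant under modification on null sets.
\<close>

section \<open>Square integrable functions and weak gradients\<close>

definition L2 :: "(real^3 \<Rightarrow> 'b::euclidean_space) set" where
  "L2 = {u. u \<in> borel_measurable lborel \<and> integrable lborel (\<lambda>x. (norm (u x))\<^sup>2)}"

definition L2_norm :: "(real^3 \<Rightarrow> 'b::euclidean_space) \<Rightarrow> real" where
  "L2_norm u = sqrt (\<integral>x. (norm (u x))\<^sup>2 \<partial>lborel)"

primrec Ck :: "nat \<Rightarrow> (real^3 \<Rightarrow> complex) \<Rightarrow> bool" where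
  "Ck 0 f \<longleftrightarrow> continuous_on UNIV f"
| "Ck (Suc k) f \<longleftrightarrow> (\<exists>f'. (\<forall>x. (f has_derivative f' x) (at x)) \<and> (\<forall>i. Ck k (\<lambda>x. f' x (axis i 1))))"

definition test_functions :: "(real^3 \<Rightarrow> complex) set" where
  "test_functions = {\<phi>. (\<forall>k. Ck k \<phi>) \<and> compact (closure {x. \<phi> x \<noteq> 0})}"

definition partial_deriv :: "3 \<Rightarrow> (real^3 \<Rightarrow> complex) \<Rightarrow> real^3 \<Rightarrow> complex" where
  "partial_deriv i \<phi> x = frechet_derivative \<phi> (at x) (axis i 1)"

definition is_weak_gradient :: "(real^3 \<Rightarrow> complex) \<Rightarrow> (real^3 \<Rightarrow> complex^3) \<Rightarrow> bool" where
  "is_weak_gradient u g \<longleftrightarrow> g \<in> L2 \<and>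
     (\<forall>i. \<forall>\<phi>\<in>test_functions.
        (\<integral>x. u x * partial_deriv i \<phi> x \<partial>lborel) = - (\<integral>x. (g x $ i) * \<phi> x \<partial>lborel))"

definition H1 :: "(real^3 \<Rightarrow> complex) set" where
  "H1 = {u \<in> L2. \<exists>g. is_weak_gradient u g}"

definition weak_grad :: "(real^3 \<Rightarrow> complex) \<Rightarrow> real^3 \<Rightarrow> complex^3" where
  "weak_grad u = (SOME g. is_weak_gradient u g)"

section \<open>The energy space\<close>

definition Sigma_space :: "(real^3 \<Rightarrow> complex) set" where
  "Sigma_space = {u \<in> H1. (\<lambda>x. norm x *\<^sub>R u x) \<in> L2}"

definition Sigma_norm :: "(real^3 \<Rightarrow> complex) \<Rightarrow> real" where
  "Sigma_norm u = sqrt ((L2_norm u)\<^sup>2 + (L2_norm (weak_grad u))\<^sup>2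
                        + (L2_norm (\<lambda>x. norm x *\<^sub>R u x))\<^sup>2)"

definition mass_sphere :: "real \<Rightarrow> (real^3 \<Rightarrow> complex) set" where
  "mass_sphere c = {u \<in> Sigma_space. (L2_norm u)\<^sup>2 = c}"

section \<open>The dipolar Fourier multiplier\<close>

definition fourier_integral :: "(real^3 \<Rightarrow> complex) \<Rightarrow> real^3 \<Rightarrow> complex" where
  "fourier_integral f \<xi> = (\<integral>x. exp (- \<i> * complex_of_real (x \<bullet> \<xi>)) * f x \<partial>lborel)"

text \<open>
  \<open>F\<close> is the Plancherel transform of \<open>f\<close>: the \<open>L\<^sup>2\<close> limit of the Fourier integrals of the
  truncations of \<open>f\<close> to balls. The normalisation is immaterial for multipliers with a symbol
  that is homogeneous of degree 0.
\<close>
definition is_fourier_L2 :: "(real^3 \<Rightarrow> complex) \<Rightarrow> (real^3 \<Rightarrow> complex) \<Rightarrow> bool" where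
  "is_fourier_L2 f F \<longleftrightarrow> f \<in> L2 \<and> F \<in> L2 \<and>
     (\<lambda>n. \<integral>\<^sup>+\<xi>. ennreal ((cmod (F \<xi> -
             fourier_integral (\<lambda>x. indicator (cball 0 (real n)) x *\<^sub>R f x) \<xi>))\<^sup>2) \<partial>lborel)
       \<longlonglongrightarrow> 0"

definition dipolar_symbol :: "real^3 \<Rightarrow> real" where
  "dipolar_symbol \<xi> = 4/3 * pi * (2 * (\<xi>$3)\<^sup>2 - (\<xi>$1)\<^sup>2 - (\<xi>$2)\<^sup>2) / (norm \<xi>)\<^sup>2"

text \<open>\<open>K \<star> f\<close> for \<open>f \<in> L\<^sup>2\<close>, determined up to a null set.\<close>
definition dipolar_conv :: "(real^3 \<Rightarrow> complex) \<Rightarrow> real^3 \<Rightarrow> complex" where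
  "dipolar_conv f =
     (SOME g. \<exists>F. is_fourier_L2 f F \<and>
                  is_fourier_L2 g (\<lambda>\<xi>. complex_of_real (dipolar_symbol \<xi>) * F \<xi>))"

definition particle_density :: "(real^3 \<Rightarrow> complex) \<Rightarrow> real^3 \<Rightarrow> complex" where
  "particle_density u x = complex_of_real ((cmod (u x))\<^sup>2)"

section \<open>Energy, critical points and ground states\<close>

definition unstable_regime :: "real \<Rightarrow> real \<Rightarrow> bool" where
  "unstable_regime lam1 lam2 \<longleftrightarrow> lam2 \<noteq> 0 \<and>
     (lam2 > 0 \<longrightarrow> lam1 - 4/3 * pi * lam2 < 0) \<and>
     (lam2 < 0 \<longrightarrow> lam1 + 8/3 * pi * lam2 < 0)"

text \<open>The dipolar integral is real because the symbol is real and even; \<open>Re\<close> is only a coercion.\<close>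
definition energy :: "real \<Rightarrow> real \<Rightarrow> real \<Rightarrow> (real^3 \<Rightarrow> complex) \<Rightarrow> real" where
  "energy lam1 lam2 a u =
     1/2 * (L2_norm (weak_grad u))\<^sup>2
     + a\<^sup>2 / 2 * (L2_norm (\<lambda>x. norm x *\<^sub>R u x))\<^sup>2
     + lam1 / 2 * (\<integral>x. (cmod (u x))^4 \<partial>lborel)
     + lam2 / 2 * Re (\<integral>x. dipolar_conv (particle_density u) x * particle_density u x \<partial>lborel)"

text \<open>Frechet derivative, with \<open>\<Sigma>\<close> regarded as a real Hilbert space.\<close>
definition has_Sigma_derivative ::
  "((real^3 \<Rightarrow> complex) \<Rightarrow> real) \<Rightarrow> ((real^3 \<Rightarrow> complex) \<Rightarrow> real) \<Rightarrow> (real^3 \<Rightarrow> complex) \<Rightarrow> bool" where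
  "has_Sigma_derivative J D u \<longleftrightarrow>
     (\<forall>v\<in>Sigma_space. \<forall>w\<in>Sigma_space. D (\<lambda>x. v x + w x) = D v + D w) \<and>
     (\<forall>v\<in>Sigma_space. \<forall>r::real. D (\<lambda>x. r *\<^sub>R v x) = r * D v) \<and>
     (\<exists>C. \<forall>v\<in>Sigma_space. \<bar>D v\<bar> \<le> C * Sigma_norm v) \<and>
     (\<forall>\<epsilon>>0. \<exists>\<delta>>0. \<forall>v\<in>Sigma_space. Sigma_norm v < \<delta> \<longrightarrow>
        \<bar>J (\<lambda>x. u x + v x) - J u - D v\<bar> \<le> \<epsilon> * Sigma_norm v)"

text \<open>The tangent space of \<open>S(c)\<close> at \<open>u\<close> consists of the \<open>v \<in> \<Sigma>\<close> with \<open>Re \<integral> v cnj(u) = 0\<close>.\<close>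
definition critical_points :: "((real^3 \<Rightarrow> complex) \<Rightarrow> real) \<Rightarrow> real \<Rightarrow> (real^3 \<Rightarrow> complex) set" where
  "critical_points J c = {u \<in> mass_sphere c.
     \<exists>D. has_Sigma_derivative J D u \<and>
         (\<forall>v\<in>Sigma_space. Re (\<integral>x. v x * cnj (u x) \<partial>lborel) = 0 \<longrightarrow> D v = 0)}"

text \<open>The infimum is taken in \<open>ereal\<close>, so that it has its usual meaning without a lower bound.\<close>
definition ground_states :: "real \<Rightarrow> real \<Rightarrow> real \<Rightarrow> real \<Rightarrow> (real^3 \<Rightarrow> complex) set" where
  "ground_states lam1 lam2 a c = {u \<in> critical_points (energy lam1 lam2 a) c.
     ereal (energy lam1 lam2 a u) =
       (INF w\<in>critical_points (energy lam1 lam2 a) c. ereal (energy lam1 lam2 a w))}"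

section \<open>The evolution equation\<close>

text \<open>
  \<open>\<psi> \<in> C([0,T), \<Sigma>)\<close> solves the Cauchy problem. The equation is tested in space against
  \<open>C\<^sub>c\<^sup>\<infinity>\<close> functions and holds at every time (one-sided at \<open>t = 0\<close>), that is, it holds in the
  dual of \<open>\<Sigma>\<close>. Values \<open>\<psi> t\<close> for \<open>t\<close> outside \<open>[0,T)\<close> are irrelevant.
\<close>
definition solves_on ::
  "real \<Rightarrow> real \<Rightarrow> real \<Rightarrow> (real^3 \<Rightarrow> complex) \<Rightarrow> ereal \<Rightarrow> (real \<Rightarrow> real^3 \<Rightarrow> complex) \<Rightarrow> bool" where
  "solves_on lam1 lam2 a \<psi>0 T \<psi> \<longleftrightarrow> 0 < T \<and>
     (let I = {t. 0 \<le> t \<and> ereal t < T} in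
       (AE x in lborel. \<psi> 0 x = \<psi>0 x) \<and>
       (\<forall>t\<in>I. \<psi> t \<in> Sigma_space) \<and>
       (\<forall>t\<in>I. ((\<lambda>s. Sigma_norm (\<lambda>x. \<psi> s x - \<psi> t x)) \<longlongrightarrow> 0) (at t within I)) \<and>
       (\<forall>t\<in>I. \<forall>\<phi>\<in>test_functions. \<exists>D.
          ((\<lambda>s. \<integral>x. \<psi> s x * \<phi> x \<partial>lborel) has_vector_derivative D) (at t within I) \<and>
          \<i> * D =
            1/2 * (\<Sum>i\<in>UNIV. \<integral>x. (weak_grad (\<psi> t) x $ i) * partial_deriv i \<phi> x \<partial>lborel)
            + complex_of_real (a\<^sup>2 / 2) *
                (\<integral>x. complex_of_real ((norm x)\<^sup>2) * \<psi> t x * \<phi> x \<partial>lborel)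
            + complex_of_real lam1 * (\<integral>x. particle_density (\<psi> t) x * \<psi> t x * \<phi> x \<partial>lborel)
            + complex_of_real lam2 *
                (\<integral>x. dipolar_conv (particle_density (\<psi> t)) x * \<psi> t x * \<phi> x \<partial>lborel)))"

text \<open>\<open>\<psi>\<close> is a solution on \<open>[0,T)\<close> of which every other solution is a restriction.\<close>
definition maximal_solution ::
  "real \<Rightarrow> real \<Rightarrow> real \<Rightarrow> (real^3 \<Rightarrow> complex) \<Rightarrow> ereal \<Rightarrow> (real \<Rightarrow> real^3 \<Rightarrow> complex) \<Rightarrow> bool" where
  "maximal_solution lam1 lam2 a \<psi>0 T \<psi> \<longleftrightarrow> solves_on lam1 lam2 a \<psi>0 T \<psi> \<and>
     (\<forall>T' \<phi>. solves_on lam1 lam2 a \<psi>0 T' \<phi> \<longrightarrow>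
        T' \<le> T \<and> (\<forall>t. 0 \<le> t \<and> ereal t < T' \<longrightarrow> (AE x in lborel. \<phi> t x = \<psi> t x)))"

text \<open>
  The known local theory in \<open>\<Sigma>\<close>: unique maximal solutions, conservation of mass and energy, and
  the blow-up alternative.
\<close>
definition local_theory :: "real \<Rightarrow> real \<Rightarrow> real \<Rightarrow> bool" where
  "local_theory lam1 lam2 a \<longleftrightarrow> (\<forall>\<psi>0\<in>Sigma_space. \<exists>T \<psi>.
     maximal_solution lam1 lam2 a \<psi>0 T \<psi> \<and>
     (\<forall>t. 0 \<le> t \<and> ereal t < T \<longrightarrow>
        L2_norm (\<psi> t) = L2_norm \<psi>0 \<and> energy lam1 lam2 a (\<psi> t) = energy lam1 lam2 a \<psi>0) \<and>
     (T = \<infinity> \<or>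
      filterlim (\<lambda>t. L2_norm (weak_grad (\<psi> t))) at_top (at_left (real_of_ereal T))))"

end

theory Submission
  imports Defs "HOL-Probability.Characteristic_Functions" "HOL-Complex_Analysis.Great_Picard" "HOL-Library.Diagonal_Subsequence"
begin

text \<open>
  The Gagliardo--Nirenberg inequality bounds the interaction, which is quartic, by
  \<open>C \<parallel>\<nabla>u\<parallel>\<^sup>3 \<parallel>u\<parallel>\<close>. On the mass sphere it is therefore dominated by the quadratic part of the
  energy as long as that part is below a level \<open>k\<close> depending on \<open>c\<close> but not on \<open>a\<close>, whereas
  widely spread functions have energy \<open>O(a)\<close>. For small \<open>a\<close> the energy thus has a well: minimising
  sequences inside the level \<open>k\<close> stay away from its boundary, and they are precompact because the
  trap makes the embedding of \<open>\<Sigma>\<close> into \<open>L\<^sup>2\<close> compact. Minimisers in the well are critical points.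
  Conversely the virial identity bounds the quadratic part of a critical point by six times its
  energy, so that a critical point of no larger energy lies in the well; hence the ground states are
  exactly the minimisers in the well. A trajectory starting near one of them cannot cross the
  boundary of the well, is therefore global, and compactness of minimising sequences gives stability
  by the argument of Cazenave and Lions.
\<close>

section \<open>Square integrable functions\<close>

text \<open>The margins of the well fit together as follows. Up to mass \<open>4 * c\<close> and
  level \<open>2 * k\<close> the interaction is at most a quarter of
  \<open>(pnorm a u)\<^sup>2\<close>, so \<open>E\<close> lies between 1/4 and 3/4 of it. A
  competitor at level \<open>k / 64\<close> forces \<open>m \<le> k / 32\<close>; then minimisers
  lie below level \<open>k / 8\<close>, critical points of energy at most \<open>m\<close> below
  \<open>6 * k / 32\<close>, and the edge of the well has energy at least \<open>k / 4\<close>. The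
  slack in the mass is there because perturbed initial data, midpoints and straight variations leave
  the sphere; they are rescaled onto it at a cost proportional to the mass defect.

  Two obstacles shape the rest. The interaction is a Fourier multiplier given through limits of
  transforms of truncations, so the transform on \<open>L2\<close> is constructed by Gaussian
  regularisation, and uniqueness of weak gradients and the estimates on them are read off on the
  Fourier side. And the dilations of a function in the energy space need not form a differentiable
  curve there, so the derivative of the energy along them at a critical point is not a matter of the
  chain rule.\<close>

lemma L2_measurable: "u \<in> L2 \<Longrightarrow> u \<in> borel_measurable borel"
  by (simp add: L2_def)

lemma L2_integrable: "u \<in> L2 \<Longrightarrow> integrable lborel (\<lambda>x. (norm (u x))\<^sup>2)"
  by (simp add: L2_def)

lemma L2I: "u \<in> borel_measurable borel \<Longrightarrow> integrable lborel (\<lambda>x. (norm (u x))\<^sup>2) \<Longrightarrow> u \<in> L2"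
  by (simp add: L2_def)

lemma L2_norm_nonneg [simp]: "0 \<le> L2_norm u"
  by (simp add: L2_norm_def)

lemma L2_norm_sq: "(L2_norm u)\<^sup>2 = (\<integral>x. (norm (u x))\<^sup>2 \<partial>lborel)"
  by (simp add: L2_norm_def)

lemma L2_norm_sq_ennreal:
  "u \<in> L2 \<Longrightarrow> ennreal ((L2_norm u)\<^sup>2) = (\<integral>\<^sup>+x. ennreal ((norm (u x))\<^sup>2) \<partial>lborel)"
  unfolding L2_norm_sq by (rule nn_integral_eq_integral[symmetric]) (auto simp: L2_def)

lemma L2_bounded_nn:
  assumes [measurable]: "u \<in> borel_measurable borel"
    and "(\<integral>\<^sup>+x. ennreal ((norm (u x))\<^sup>2) \<partial>lborel) \<le> ennreal C" "0 \<le> C"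
  shows "u \<in> L2" "(L2_norm u)\<^sup>2 \<le> C"
proof -
  have "(\<integral>\<^sup>+x. ennreal ((norm (u x))\<^sup>2) \<partial>lborel) < \<infinity>"
    using assms(2) by (metis ennreal_less_top infinity_ennreal_def order_le_less_trans)
  then show "u \<in> L2"
    by (intro L2I integrableI_bounded) auto
  from L2_norm_sq_ennreal[OF this] assms show "(L2_norm u)\<^sup>2 \<le> C"
    by (metis ennreal_le_iff)
qed

lemma L2_mono:
  fixes f :: "real^3 \<Rightarrow> 'b::euclidean_space" and g :: "real^3 \<Rightarrow> 'c::euclidean_space"
  assumes g: "g \<in> L2" and f [measurable]: "f \<in> borel_measurable borel"
    and le: "AE x in lborel. norm (f x) \<le> C * norm (g x)" and "0 \<le> C"
  shows "f \<in> L2" "L2_norm f \<le> C * L2_norm g"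
proof -
  have le2: "AE x in lborel. (norm (f x))\<^sup>2 \<le> C\<^sup>2 * (norm (g x))\<^sup>2"
    using le by eventually_elim (metis norm_ge_zero power_mono power_mult_distrib)
  have i: "integrable lborel (\<lambda>x. C\<^sup>2 * (norm (g x))\<^sup>2)"
    using L2_integrable[OF g] by simp
  have j: "integrable lborel (\<lambda>x. (norm (f x))\<^sup>2)"
    by (rule Bochner_Integration.integrable_bound[OF i]) (use le2 in auto)
  then show "f \<in> L2" by (intro L2I) auto
  have "(\<integral>x. (norm (f x))\<^sup>2 \<partial>lborel) \<le> (\<integral>x. C\<^sup>2 * (norm (g x))\<^sup>2 \<partial>lborel)"
    by (rule integral_mono_AE[OF j i le2])
  then have "(L2_norm f)\<^sup>2 \<le> (C * L2_norm g)\<^sup>2"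
    by (simp add: L2_norm_sq power_mult_distrib)
  then show "L2_norm f \<le> C * L2_norm g"
    using \<open>0 \<le> C\<close> by (meson L2_norm_nonneg mult_nonneg_nonneg power2_le_imp_le)
qed

lemma L2_norm_mono:
  fixes f :: "real^3 \<Rightarrow> 'b::euclidean_space" and g :: "real^3 \<Rightarrow> 'c::euclidean_space"
  assumes "g \<in> L2" "f \<in> borel_measurable borel" "\<And>x. norm (f x) \<le> norm (g x)"
  shows "f \<in> L2" "L2_norm f \<le> L2_norm g"
  using L2_mono[of g f 1] assms by auto

lemma L2_norm_cong_AE:
  fixes f g :: "real^3 \<Rightarrow> 'b::euclidean_space"
  assumes "f \<in> borel_measurable borel" "g \<in> borel_measurable borel" "AE x in lborel. f x = g x"
  shows "L2_norm f = L2_norm g"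
  unfolding L2_norm_def using assms by (intro arg_cong[where f=sqrt] integral_cong_AE) auto

lemma L2_cong_AE:
  fixes f g :: "real^3 \<Rightarrow> 'b::euclidean_space"
  assumes "f \<in> L2" "g \<in> borel_measurable borel" "AE x in lborel. f x = g x"
  shows "g \<in> L2"
  by (rule L2_mono(1)[where C=1 and g=f]) (use assms in \<open>auto elim: eventually_mono\<close>)

lemma L2_zero [simp]: "(\<lambda>x. 0) \<in> L2" "L2_norm (\<lambda>x. 0) = 0"
  by (auto simp: L2_def L2_norm_def)

lemma L2_mult_integrable:
  fixes f :: "real^3 \<Rightarrow> 'b::euclidean_space" and g :: "real^3 \<Rightarrow> 'c::euclidean_space"
  assumes f: "f \<in> L2" and g: "g \<in> L2"
  shows "integrable lborel (\<lambda>x. norm (f x) * norm (g x))"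
proof (rule Bochner_Integration.integrable_bound)
  show "integrable lborel (\<lambda>x. (norm (f x))\<^sup>2 + (norm (g x))\<^sup>2)"
    using f g by (auto simp: L2_def)
  have "norm (f x) * norm (g x) \<le> (norm (f x))\<^sup>2 + (norm (g x))\<^sup>2" for x
    using sum_squares_bound[of "norm (f x)" "norm (g x)"] mult_nonneg_nonneg[OF norm_ge_zero norm_ge_zero, of "f x" "g x"]
    by linarith
  then show "AE x in lborel. norm (norm (f x) * norm (g x)) \<le> norm ((norm (f x))\<^sup>2 + (norm (g x))\<^sup>2)"
    by (simp add: abs_mult)
qed (use L2_measurable[OF f] L2_measurable[OF g] in measurable)

lemma L2_Cauchy_Schwarz:
  fixes f :: "real^3 \<Rightarrow> 'b::euclidean_space" and g :: "real^3 \<Rightarrow> 'c::euclidean_space"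
  assumes f: "f \<in> L2" and g: "g \<in> L2"
  shows "(\<integral>x. norm (f x) * norm (g x) \<partial>lborel) \<le> L2_norm f * L2_norm g"
proof -
  let ?I = "\<integral>x. norm (f x) * norm (g x) \<partial>lborel"
  \<comment> \<open>A quadratic polynomial in \<open>s\<close> that is nonnegative has nonpositive
    discriminant; the two cases below separate the degenerate leading coefficient.\<close>
  have q: "0 \<le> s\<^sup>2 * (L2_norm f)\<^sup>2 - 2 * s * ?I + (L2_norm g)\<^sup>2" for s
  proof -
    have "0 \<le> (\<integral>x. (s * norm (f x) - norm (g x))\<^sup>2 \<partial>lborel)"
      by simp
    also have "\<dots> = (\<integral>x. s\<^sup>2 * (norm (f x))\<^sup>2 - 2 * s * (norm (f x) * norm (g x)) + (norm (g x))\<^sup>2 \<partial>lborel)"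
      by (rule Bochner_Integration.integral_cong) (auto simp: power2_eq_square algebra_simps)
    also have "\<dots> = s\<^sup>2 * (L2_norm f)\<^sup>2 - 2 * s * ?I + (L2_norm g)\<^sup>2"
      using L2_mult_integrable[OF f g] L2_integrable[OF f] L2_integrable[OF g]
      by (simp add: L2_norm_sq)
    finally show ?thesis .
  qed
  have "?I\<^sup>2 \<le> (L2_norm f)\<^sup>2 * (L2_norm g)\<^sup>2"
  proof (cases "L2_norm f = 0")
    case True
    have "0 \<le> - 2 * s * ?I + (L2_norm g)\<^sup>2" for s using q[of s] True by simp
    \<comment> \<open>With a nonzero slope the affine function would take the value -1 at this
      \<open>s\<close>.\<close>
    from this[of "((L2_norm g)\<^sup>2 + 1) / (2 * ?I)"] have "?I = 0"
      by (cases "?I = 0") (auto simp: field_simps)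
    then show ?thesis by simp
  next
    case False
    \<comment> \<open>The quadratic is evaluated at its minimiser.\<close>
    have "0 \<le> (L2_norm f)\<^sup>2 * ((?I/(L2_norm f)\<^sup>2)\<^sup>2 * (L2_norm f)\<^sup>2 - 2 * (?I/(L2_norm f)\<^sup>2) * ?I + (L2_norm g)\<^sup>2)"
      using q[of "?I / (L2_norm f)\<^sup>2"] by (intro mult_nonneg_nonneg) auto
    also have "\<dots> = (L2_norm f)\<^sup>2 * (L2_norm g)\<^sup>2 - ?I\<^sup>2"
      using False by (simp add: field_simps power2_eq_square)
    finally show ?thesis by simp
  qed
  then show ?thesis
    by (metis L2_norm_nonneg mult_nonneg_nonneg power2_le_imp_le power_mult_distrib)
qed

lemma L2_inner_integrable:
  fixes f g :: "real^3 \<Rightarrow> 'b::euclidean_space"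
  assumes f: "f \<in> L2" and g: "g \<in> L2"
  shows "integrable lborel (\<lambda>x. f x \<bullet> g x)"
  by (rule Bochner_Integration.integrable_bound[OF L2_mult_integrable[OF f g]])
     (use L2_measurable[OF f] L2_measurable[OF g] in \<open>auto simp: Cauchy_Schwarz_ineq2\<close>)

text \<open>For complex functions this is the real part of the Hermitian product
  (\<open>rip_eq_Re\<close>). The energy is differentiable only over the reals, hence the real
  form.\<close>

definition rip :: "(real^3 \<Rightarrow> 'b::euclidean_space) \<Rightarrow> (real^3 \<Rightarrow> 'b) \<Rightarrow> real" where
  "rip f g = (\<integral>x. f x \<bullet> g x \<partial>lborel)"

lemma rip_CS:
  fixes f g :: "real^3 \<Rightarrow> 'b::euclidean_space"
  assumes f: "f \<in> L2" and g: "g \<in> L2"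
  shows "\<bar>rip f g\<bar> \<le> L2_norm f * L2_norm g"
proof -
  have "\<bar>rip f g\<bar> \<le> (\<integral>x. \<bar>f x \<bullet> g x\<bar> \<partial>lborel)"
    unfolding rip_def using integral_abs_bound by blast
  also have "\<dots> \<le> (\<integral>x. norm (f x) * norm (g x) \<partial>lborel)"
    by (intro integral_mono L2_mult_integrable f g integrable_abs L2_inner_integrable)
       (simp add: Cauchy_Schwarz_ineq2)
  also have "\<dots> \<le> L2_norm f * L2_norm g" by (rule L2_Cauchy_Schwarz[OF f g])
  finally show ?thesis .
qed

lemma rip_self: "rip f f = (L2_norm f)\<^sup>2"
  by (simp add: rip_def L2_norm_sq power2_norm_eq_inner)

lemma rip_commute: "rip f g = rip g f"
  by (simp add: rip_def inner_commute)

lemma L2_add [intro]: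
  fixes f g :: "real^3 \<Rightarrow> 'b::euclidean_space"
  assumes f: "f \<in> L2" and g: "g \<in> L2"
  shows "(\<lambda>x. f x + g x) \<in> L2"
proof (rule L2I)
  show "integrable lborel (\<lambda>x. (norm (f x + g x))\<^sup>2)"
    unfolding power2_norm_eq_inner
    using L2_inner_integrable[OF f g] L2_inner_integrable[OF f f] L2_inner_integrable[OF g g]
      L2_inner_integrable[OF g f]
    by (simp add: inner_add_left inner_add_right)
qed (use L2_measurable[OF f] L2_measurable[OF g] in measurable)

lemma L2_scaleR [intro]:
  fixes f :: "real^3 \<Rightarrow> 'b::euclidean_space"
  assumes "f \<in> L2" shows "(\<lambda>x. r *\<^sub>R f x) \<in> L2"
  by (rule L2_mono(1)[where g=f and C="\<bar>r\<bar>"]) (use assms L2_measurable[OF assms] in auto)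

lemma L2_norm_scaleR:
  fixes f :: "real^3 \<Rightarrow> 'b::euclidean_space"
  shows "L2_norm (\<lambda>x. r *\<^sub>R f x) = \<bar>r\<bar> * L2_norm f"
  by (simp add: L2_norm_def power_mult_distrib real_sqrt_mult)

lemma L2_cmult [intro]:
  fixes f :: "real^3 \<Rightarrow> complex"
  assumes "f \<in> L2" shows "(\<lambda>x. c * f x) \<in> L2"
  by (rule L2_mono(1)[where g=f and C="cmod c"]) (use assms L2_measurable[OF assms] in \<open>auto simp: norm_mult\<close>)

lemma L2_norm_cmult:
  fixes f :: "real^3 \<Rightarrow> complex"
  shows "L2_norm (\<lambda>x. c * f x) = cmod c * L2_norm f"
  by (simp add: L2_norm_def norm_mult power_mult_distrib real_sqrt_mult)

lemma L2_minus [intro]: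
  fixes f :: "real^3 \<Rightarrow> 'b::euclidean_space"
  shows "f \<in> L2 \<Longrightarrow> (\<lambda>x. - f x) \<in> L2"
  using L2_scaleR[of f "-1"] by simp

lemma L2_diff [intro]:
  fixes f g :: "real^3 \<Rightarrow> 'b::euclidean_space"
  shows "f \<in> L2 \<Longrightarrow> g \<in> L2 \<Longrightarrow> (\<lambda>x. f x - g x) \<in> L2"
  using L2_add[of f "\<lambda>x. - g x"] L2_minus[of g] by simp

lemma L2_cnj [intro]:
  assumes "f \<in> L2" shows "(\<lambda>x. cnj (f x)) \<in> L2"
  by (rule L2_mono(1)[where g=f and C=1])
     (use assms L2_measurable[OF assms] in \<open>auto intro!: measurable_compose[OF _ borel_measurable_continuous_onI[of cnj]] continuous_intros\<close>)

lemma L2_norm_cnj [simp]: "L2_norm (\<lambda>x. cnj (f x)) = L2_norm f"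
  by (simp add: L2_norm_def)

lemma L2_norm_minus_commute:
  fixes f g :: "real^3 \<Rightarrow> 'b::euclidean_space"
  shows "L2_norm (\<lambda>x. f x - g x) = L2_norm (\<lambda>x. g x - f x)"
  by (simp add: L2_norm_def norm_minus_commute)

lemma rip_add_left:
  fixes f g h :: "real^3 \<Rightarrow> 'b::euclidean_space"
  assumes "f \<in> L2" "g \<in> L2" "h \<in> L2"
  shows "rip (\<lambda>x. f x + g x) h = rip f h + rip g h"
  unfolding rip_def inner_add_left
  by (intro Bochner_Integration.integral_add L2_inner_integrable assms)

lemma rip_scaleR_left:
  fixes f h :: "real^3 \<Rightarrow> 'b::euclidean_space"
  shows "rip (\<lambda>x. r *\<^sub>R f x) h = r * rip f h"
  by (simp add: rip_def)

lemma rip_diff_left: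
  fixes f g h :: "real^3 \<Rightarrow> 'b::euclidean_space"
  assumes "f \<in> L2" "g \<in> L2" "h \<in> L2"
  shows "rip (\<lambda>x. f x - g x) h = rip f h - rip g h"
  unfolding rip_def inner_diff_left
  by (intro Bochner_Integration.integral_diff L2_inner_integrable assms)

lemma rip_add_right:
  fixes f g h :: "real^3 \<Rightarrow> 'b::euclidean_space"
  assumes "f \<in> L2" "g \<in> L2" "h \<in> L2"
  shows "rip h (\<lambda>x. f x + g x) = rip h f + rip h g"
  by (simp add: rip_commute[of h] rip_add_left assms)

lemma rip_diff_right:
  fixes f g h :: "real^3 \<Rightarrow> 'b::euclidean_space"
  assumes "f \<in> L2" "g \<in> L2" "h \<in> L2"
  shows "rip h (\<lambda>x. f x - g x) = rip h f - rip h g"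
  by (simp add: rip_commute[of h] rip_diff_left assms)

lemma rip_scaleR_right:
  fixes f h :: "real^3 \<Rightarrow> 'b::euclidean_space"
  shows "rip h (\<lambda>x. r *\<^sub>R f x) = r * rip h f"
  by (simp add: rip_def)

lemma L2_norm_add_sq:
  fixes f g :: "real^3 \<Rightarrow> 'b::euclidean_space"
  assumes "f \<in> L2" "g \<in> L2"
  shows "(L2_norm (\<lambda>x. f x + g x))\<^sup>2 = (L2_norm f)\<^sup>2 + 2 * rip f g + (L2_norm g)\<^sup>2"
  using assms
  by (simp add: rip_self[symmetric] rip_add_left rip_add_right L2_add rip_commute[of g f])

lemma L2_norm_diff_sq:
  fixes f g :: "real^3 \<Rightarrow> 'b::euclidean_space"
  assumes "f \<in> L2" "g \<in> L2"
  shows "(L2_norm (\<lambda>x. f x - g x))\<^sup>2 = (L2_norm f)\<^sup>2 - 2 * rip f g + (L2_norm g)\<^sup>2"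
  using assms
  by (simp add: rip_self[symmetric] rip_diff_left rip_diff_right L2_diff rip_commute[of g f])

lemma L2_norm_triangle:
  fixes f g :: "real^3 \<Rightarrow> 'b::euclidean_space"
  assumes f: "f \<in> L2" and g: "g \<in> L2"
  shows "L2_norm (\<lambda>x. f x + g x) \<le> L2_norm f + L2_norm g"
proof (rule power2_le_imp_le)
  have "(L2_norm (\<lambda>x. f x + g x))\<^sup>2 \<le> (L2_norm f)\<^sup>2 + 2 * (L2_norm f * L2_norm g) + (L2_norm g)\<^sup>2"
    unfolding L2_norm_add_sq[OF f g] using rip_CS[OF f g] by linarith
  also have "\<dots> = (L2_norm f + L2_norm g)\<^sup>2" by (simp add: power2_sum)
  finally show "(L2_norm (\<lambda>x. f x + g x))\<^sup>2 \<le> (L2_norm f + L2_norm g)\<^sup>2" .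
qed simp

lemma L2_norm_triangle_diff:
  fixes f g h :: "real^3 \<Rightarrow> 'b::euclidean_space"
  assumes "f \<in> L2" "g \<in> L2" "h \<in> L2"
  shows "L2_norm (\<lambda>x. f x - h x) \<le> L2_norm (\<lambda>x. f x - g x) + L2_norm (\<lambda>x. g x - h x)"
  using L2_norm_triangle[of "\<lambda>x. f x - g x" "\<lambda>x. g x - h x"] assms by (simp add: L2_diff)

lemma L2_norm_triangle_sub:
  fixes f g :: "real^3 \<Rightarrow> 'b::euclidean_space"
  assumes "f \<in> L2" "g \<in> L2"
  shows "L2_norm f \<le> L2_norm g + L2_norm (\<lambda>x. f x - g x)"
  using L2_norm_triangle[of g "\<lambda>x. f x - g x"] assms by (simp add: L2_diff)

lemma L2_norm_triangle_minus:
  fixes f g :: "real^3 \<Rightarrow> 'b::euclidean_space"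
  assumes "f \<in> L2" "g \<in> L2"
  shows "L2_norm (\<lambda>x. f x - g x) \<le> L2_norm f + L2_norm g"
  using L2_norm_triangle[of f "\<lambda>x. - g x"] assms L2_norm_scaleR[of "-1" g] by (simp add: L2_minus)

lemma L2_norm_abs_diff:
  fixes f g :: "real^3 \<Rightarrow> 'b::euclidean_space"
  assumes "f \<in> L2" "g \<in> L2"
  shows "\<bar>L2_norm f - L2_norm g\<bar> \<le> L2_norm (\<lambda>x. f x - g x)"
  using L2_norm_triangle_sub[OF assms] L2_norm_triangle_sub[OF assms(2,1)]
    L2_norm_minus_commute[of f g] by simp

lemma L2_norm_eq_0:
  fixes f :: "real^3 \<Rightarrow> 'b::euclidean_space"
  assumes "f \<in> L2"
  shows "L2_norm f = 0 \<longleftrightarrow> (AE x in lborel. f x = 0)"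
  using integral_nonneg_eq_0_iff_AE[OF L2_integrable[OF assms]] by (simp add: L2_norm_def)

lemma L2_eq_AE_iff:
  fixes f g :: "real^3 \<Rightarrow> 'b::euclidean_space"
  assumes "f \<in> L2" "g \<in> L2"
  shows "L2_norm (\<lambda>x. f x - g x) = 0 \<longleftrightarrow> (AE x in lborel. f x = g x)"
  using L2_norm_eq_0[OF L2_diff[OF assms]] by simp

section \<open>Limits, completeness and truncation in L2\<close>

lemma L2_LIMSEQ_unique:
  fixes f g :: "real^3 \<Rightarrow> 'b::euclidean_space"
  assumes F: "\<And>n. F n \<in> L2" and f: "f \<in> L2" and g: "g \<in> L2"
    and lf: "(\<lambda>n. L2_norm (\<lambda>x. F n x - f x)) \<longlonglongrightarrow> 0"
    and lg: "(\<lambda>n. L2_norm (\<lambda>x. F n x - g x)) \<longlonglongrightarrow> 0"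
  shows "AE x in lborel. f x = g x"
proof -
  have "(\<lambda>n. L2_norm (\<lambda>x. F n x - f x) + L2_norm (\<lambda>x. F n x - g x)) \<longlonglongrightarrow> 0"
    by (rule tendsto_add_zero[OF lf lg])
  moreover have "L2_norm (\<lambda>x. f x - g x) \<le> L2_norm (\<lambda>x. F n x - f x) + L2_norm (\<lambda>x. F n x - g x)" for n
    using L2_norm_triangle_diff[OF f F g, of n] L2_norm_minus_commute[of f "F n"] by simp
  ultimately have "L2_norm (\<lambda>x. f x - g x) \<le> 0"
    by (meson LIMSEQ_le_const)
  then have "L2_norm (\<lambda>x. f x - g x) = 0" by (simp add: order_antisym)
  then show ?thesis using L2_eq_AE_iff[OF f g] by simp
qed

lemma tendsto_L2_norm:
  fixes f :: "real^3 \<Rightarrow> 'b::euclidean_space"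
  assumes F: "\<And>n. F n \<in> L2" and f: "f \<in> L2"
    and lf: "((\<lambda>n. L2_norm (\<lambda>x. F n x - f x)) \<longlongrightarrow> 0) X"
  shows "((\<lambda>n. L2_norm (F n)) \<longlongrightarrow> L2_norm f) X"
proof -
  have "((\<lambda>n. L2_norm (F n) - L2_norm f) \<longlongrightarrow> 0) X"
    by (rule Lim_null_comparison[OF _ lf]) (use L2_norm_abs_diff[OF F f] in auto)
  then show ?thesis by (simp add: LIM_zero_iff)
qed

lemma tendsto_rip:
  fixes f g :: "real^3 \<Rightarrow> 'b::euclidean_space"
  assumes F: "\<And>n. F n \<in> L2" and f: "f \<in> L2" and g: "g \<in> L2"
    and lf: "((\<lambda>n. L2_norm (\<lambda>x. F n x - f x)) \<longlongrightarrow> 0) X"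
  shows "((\<lambda>n. rip (F n) g) \<longlongrightarrow> rip f g) X"
proof -
  have "((\<lambda>n. rip (F n) g - rip f g) \<longlongrightarrow> 0) X"
  proof (rule Lim_null_comparison)
    show "((\<lambda>n. L2_norm (\<lambda>x. F n x - f x) * L2_norm g) \<longlongrightarrow> 0) X"
      using tendsto_mult_right[OF lf, of "L2_norm g"] by simp
    show "\<forall>\<^sub>F n in X. norm (rip (F n) g - rip f g) \<le> L2_norm (\<lambda>x. F n x - f x) * L2_norm g"
      using rip_CS[OF L2_diff[OF F f] g] rip_diff_left[OF F f g] by auto
  qed
  then show ?thesis by (simp add: LIM_zero_iff)
qed

text \<open>Membership of the limit and the norm bound come out together. Both are wanted for
  completeness of \<open>L2\<close> and for letting the Gaussian weight tend to 1 in
  \<open>fourier_integral_Bessel\<close>.\<close>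

lemma L2_Fatou:
  fixes u :: "real^3 \<Rightarrow> 'b::euclidean_space"
  assumes F: "\<And>n. F n \<in> L2" and [measurable]: "u \<in> borel_measurable borel"
    and lim: "AE x in lborel. (\<lambda>n. F n x) \<longlonglongrightarrow> u x"
    and bd: "\<forall>\<^sub>F n in sequentially. L2_norm (F n) \<le> e" and "0 \<le> e"
  shows "u \<in> L2" "L2_norm u \<le> e"
proof -
  note [measurable] = F[THEN L2_measurable]
  have "(\<integral>\<^sup>+x. ennreal ((norm (u x))\<^sup>2) \<partial>lborel)
      = (\<integral>\<^sup>+x. liminf (\<lambda>n. ennreal ((norm (F n x))\<^sup>2)) \<partial>lborel)"
  proof (rule nn_integral_cong_AE)
    show "AE x in lborel. ennreal ((norm (u x))\<^sup>2) = liminf (\<lambda>n. ennreal ((norm (F n x))\<^sup>2))"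
      using lim
    proof eventually_elim
      case (elim x)
      then have "(\<lambda>n. ennreal ((norm (F n x))\<^sup>2)) \<longlonglongrightarrow> ennreal ((norm (u x))\<^sup>2)"
        by (intro tendsto_intros) auto
      then show ?case using lim_imp_Liminf[OF trivial_limit_sequentially] by metis
    qed
  qed
  also have "\<dots> \<le> liminf (\<lambda>n. \<integral>\<^sup>+x. ennreal ((norm (F n x))\<^sup>2) \<partial>lborel)"
    by (rule nn_integral_liminf) measurable
  also have "\<dots> \<le> liminf (\<lambda>n::nat. ennreal (e\<^sup>2))"
    using bd by (intro Liminf_mono)
      (auto elim!: eventually_mono simp: L2_norm_sq_ennreal[OF F, symmetric] intro!: ennreal_leI power_mono)
  also have "\<dots> = ennreal (e\<^sup>2)" by (simp add: Liminf_const)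
  finally have *: "(\<integral>\<^sup>+x. ennreal ((norm (u x))\<^sup>2) \<partial>lborel) \<le> ennreal (e\<^sup>2)" .
  from L2_bounded_nn[OF _ this] show "u \<in> L2" by simp
  from L2_bounded_nn[OF _ *] have "(L2_norm u)\<^sup>2 \<le> e\<^sup>2" by simp
  then show "L2_norm u \<le> e" using \<open>0 \<le> e\<close> by (rule power2_le_imp_le)
qed

text \<open>Riesz--Fischer. Weighting the increments of a fast subsequence by \<open>2^k\<close> makes
  \<open>\<integral> \<Sum>k. 2^k |\<Delta>\<^sub>k|\<^sup>2\<close> finite, which gives pointwise convergence without Minkowski's
  inequality for series.\<close>

lemma L2_complete:
  fixes F :: "nat \<Rightarrow> real^3 \<Rightarrow> 'b::euclidean_space"
  assumes F: "\<And>n. F n \<in> L2"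
    and cauchy: "\<And>e. e > 0 \<Longrightarrow> \<exists>N. \<forall>m\<ge>N. \<forall>n\<ge>N. L2_norm (\<lambda>x. F m x - F n x) < e"
  obtains f where "f \<in> L2" "(\<lambda>n. L2_norm (\<lambda>x. F n x - f x)) \<longlonglongrightarrow> 0"
proof -
  note [measurable] = F[THEN L2_measurable]
  have "\<forall>k. \<exists>N. \<forall>m\<ge>N. \<forall>n\<ge>N. L2_norm (\<lambda>x. F m x - F n x) < (1/2)^k"
    by (intro allI cauchy) simp
  then obtain N where N: "\<And>k m n. m \<ge> N k \<Longrightarrow> n \<ge> N k \<Longrightarrow> L2_norm (\<lambda>x. F m x - F n x) < (1/2)^k"
    by metis
  \<comment> \<open>The sum dominates every \<open>N j\<close> with \<open>j \<le> k\<close>, so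
    both \<open>r k\<close> and \<open>r (Suc k)\<close> are at least \<open>N k\<close>; the
    summand \<open>k\<close> makes \<open>r\<close> tend to infinity.\<close>
  define r where "r k = (\<Sum>j\<le>k. N j) + k" for k
  have rN: "r k \<ge> N k" for k unfolding r_def
    by (simp add: sum.atMost_Suc trans_le_add1 member_le_sum)
  have "r k \<le> r (Suc k)" for k by (simp add: r_def)
  then have rN': "r (Suc k) \<ge> N k" for k using rN[of k] order_trans by blast
  define D where "D k x = F (r (Suc k)) x - F (r k) x" for k x
  have D: "L2_norm (D k) < (1/2)^k" for k unfolding D_def using N[OF rN' rN] .
  have DL: "D k \<in> L2" for k unfolding D_def using F by auto
  have [measurable]: "D k \<in> borel_measurable borel" for k using DL L2_measurable by auto
  have "(\<integral>\<^sup>+x. (\<Sum>k. ennreal (2^k * (norm (D k x))\<^sup>2)) \<partial>lborel)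
      = (\<Sum>k. \<integral>\<^sup>+x. ennreal (2^k * (norm (D k x))\<^sup>2) \<partial>lborel)"
    by (rule nn_integral_suminf) measurable
  also have "\<dots> \<le> (\<Sum>k. ennreal ((1/2)^k))"
  proof (rule suminf_le)
    fix k
    have "(\<integral>\<^sup>+x. ennreal (2^k * (norm (D k x))\<^sup>2) \<partial>lborel) = ennreal (2^k) * (\<integral>\<^sup>+x. ennreal ((norm (D k x))\<^sup>2) \<partial>lborel)"
      by (subst nn_integral_cmult[symmetric]) (auto simp: ennreal_mult)
    also have "\<dots> = ennreal (2^k * (L2_norm (D k))\<^sup>2)"
      by (simp add: L2_norm_sq_ennreal[OF DL, symmetric] ennreal_mult)
    also have "\<dots> \<le> ennreal ((1/2)^k)"
    proof (rule ennreal_leI)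
      have "(L2_norm (D k))\<^sup>2 \<le> ((1/2)^k)\<^sup>2" using D[of k] by (intro power_mono) auto
      then have "2^k * (L2_norm (D k))\<^sup>2 \<le> 2^k * ((1/2)^k)\<^sup>2" by simp
      also have "\<dots> = ((1/2)^k :: real)" by (simp add: power2_eq_square power_divide)
      finally show "2^k * (L2_norm (D k))\<^sup>2 \<le> (1/2)^k" .
    qed
    finally show "(\<integral>\<^sup>+x. ennreal (2^k * (norm (D k x))\<^sup>2) \<partial>lborel) \<le> ennreal ((1/2)^k)" .
  qed auto
  also have "\<dots> < \<infinity>"
    by (subst suminf_ennreal2) (auto intro!: summable_geometric)
  finally have "AE x in lborel. (\<Sum>k. ennreal (2^k * (norm (D k x))\<^sup>2)) \<noteq> \<infinity>"
    by (intro nn_integral_PInf_AE) auto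
  then have conv: "AE x in lborel. convergent (\<lambda>k. F (r k) x)"
  proof eventually_elim
    case (elim x)
    then have "summable (\<lambda>k. 2^k * (norm (D k x))\<^sup>2)"
      by (intro summable_suminf_not_top) auto
    then have "(\<lambda>k. 2^k * (norm (D k x))\<^sup>2) \<longlonglongrightarrow> 0" by (rule summable_LIMSEQ_zero)
    \<comment> \<open>Boundedness of the weighted terms already makes the increments decay like
      powers of \<open>sqrt (1/2)\<close>, which is summable.\<close>
    then obtain C where C: "\<And>k. norm (2^k * (norm (D k x))\<^sup>2) \<le> C"
      using convergent_imp_Bseq[of "\<lambda>k. 2^k * (norm (D k x))\<^sup>2"] by (auto simp: convergent_def Bseq_def)
    have "norm (D k x) \<le> sqrt C * (sqrt (1/2))^k" for k
    proof -
      have "(norm (D k x))\<^sup>2 \<le> C * (1/2)^k" using C[of k] by (simp add: field_simps power_divide)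
      then have "norm (D k x) \<le> sqrt (C * (1/2)^k)" by (rule real_le_rsqrt)
      then show ?thesis by (simp add: real_sqrt_mult real_sqrt_power)
    qed
    moreover have "summable (\<lambda>k. sqrt C * (sqrt (1/2))^k)"
      by (intro summable_mult summable_geometric) (auto simp: real_sqrt_divide)
    ultimately have "summable (\<lambda>k. D k x)"
      by (metis summable_comparison_test')
    then have "convergent (\<lambda>n. \<Sum>k<n. D k x)" by (simp add: summable_iff_convergent)
    moreover have "(\<Sum>k<n. D k x) = F (r n) x - F (r 0) x" for n
      unfolding D_def by (rule sum_lessThan_telescope)
    ultimately have "convergent (\<lambda>n. F (r n) x - F (r 0) x)" by simp
    then have "convergent (\<lambda>n. (F (r n) x - F (r 0) x) + F (r 0) x)"
      by (intro convergent_add convergent_const)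
    then show ?case by simp
  qed
  define f where "f x = lim (\<lambda>k. F (r k) x)" for x
  have [measurable]: "f \<in> borel_measurable borel" unfolding f_def by measurable
  have lim: "AE x in lborel. (\<lambda>k. F (r k) x) \<longlonglongrightarrow> f x"
    using conv by eventually_elim (simp add: f_def convergent_LIMSEQ_iff)
  have rge: "r k \<ge> k" for k by (simp add: r_def)
  \<comment> \<open>Fatou along the subsequence transfers Cauchy bounds for the whole sequence to
    the limit. Membership of \<open>f\<close> in \<open>L2\<close> follows as well, since
    \<open>f\<close> differs from \<open>F (N 0)\<close> by an element of \<open>L2\<close>.\<close>
  have key: "(\<lambda>x. f x - F n x) \<in> L2 \<and> L2_norm (\<lambda>x. f x - F n x) \<le> e"
    if "e > 0" "\<And>m. m \<ge> K \<Longrightarrow> L2_norm (\<lambda>x. F m x - F n x) \<le> e" for n e K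
  proof -
    have A: "\<And>k. (\<lambda>x. F (r k) x - F n x) \<in> L2" using F by auto
    have B: "(\<lambda>x. f x - F n x) \<in> borel_measurable borel" by measurable
    have C: "AE x in lborel. (\<lambda>k. F (r k) x - F n x) \<longlonglongrightarrow> f x - F n x"
      using lim by eventually_elim (intro tendsto_intros)
    have D: "\<forall>\<^sub>F k in sequentially. L2_norm (\<lambda>x. F (r k) x - F n x) \<le> e"
      using eventually_ge_at_top[of K] by eventually_elim (use that rge order_trans in blast)
    show ?thesis using L2_Fatou[OF A B C D] that(1) by auto
  qed
  have "(\<lambda>x. f x - F (N 0) x) \<in> L2"
    using key[of 1 "N 0" "N 0"] N[of 0 _ "N 0"] by (auto intro: less_imp_le)
  from L2_add[OF this F[of "N 0"]] have fL: "f \<in> L2" by simp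
  moreover have "(\<lambda>n. L2_norm (\<lambda>x. F n x - f x)) \<longlonglongrightarrow> 0"
  proof (rule LIMSEQ_I)
    fix e :: real assume "e > 0"
    then obtain M where M: "\<forall>m\<ge>M. \<forall>n\<ge>M. L2_norm (\<lambda>x. F m x - F n x) < e/2"
      using cauchy[of "e/2"] by auto
    have "L2_norm (\<lambda>x. F n x - f x) < e" if "n \<ge> M" for n
    proof -
      have "L2_norm (\<lambda>x. F m x - F n x) \<le> e/2" if "m \<ge> M" for m
        using M that \<open>n \<ge> M\<close> by (meson less_imp_le)
      with \<open>e > 0\<close> show ?thesis
        using key[of "e/2" M n] L2_norm_minus_commute[of f "F n"] by auto
    qed
    then show "\<exists>M. \<forall>n\<ge>M. norm (L2_norm (\<lambda>x. F n x - f x) - 0) < e" by auto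
  qed
  ultimately show ?thesis by (rule that)
qed

lemma L2_dominated_convergence:
  fixes f :: "real^3 \<Rightarrow> 'b::euclidean_space" and g :: "real^3 \<Rightarrow> 'c::euclidean_space"
  assumes [measurable]: "\<And>n. F n \<in> borel_measurable borel" "f \<in> borel_measurable borel"
    and g: "g \<in> L2" and lim: "AE x in lborel. (\<lambda>n. F n x) \<longlonglongrightarrow> f x"
    and dom: "\<And>n. AE x in lborel. norm (F n x) \<le> norm (g x)"
  shows "(\<lambda>n. L2_norm (\<lambda>x. F n x - f x)) \<longlonglongrightarrow> 0"
proof -
  have dom': "AE x in lborel. norm (f x) \<le> norm (g x)"
  proof -
    have "AE x in lborel. \<forall>n. norm (F n x) \<le> norm (g x)" using dom by (simp add: AE_all_countable)
    with lim show ?thesis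
      by eventually_elim (auto intro: LIMSEQ_le_const2[OF tendsto_norm])
  qed
  have "(\<lambda>n. \<integral>x. (norm (F n x - f x))\<^sup>2 \<partial>lborel) \<longlonglongrightarrow> (\<integral>x. 0 \<partial>(lborel :: (real^3) measure))"
  proof (rule integral_dominated_convergence[where w="\<lambda>x. 4 * (norm (g x))\<^sup>2"])
    show "integrable lborel (\<lambda>x. 4 * (norm (g x))\<^sup>2)" using L2_integrable[OF g] by simp
    show "AE x in lborel. (\<lambda>n. (norm (F n x - f x))\<^sup>2) \<longlonglongrightarrow> 0"
      using lim
    proof eventually_elim
      case (elim x)
      then have "(\<lambda>n. (norm (F n x - f x))\<^sup>2) \<longlonglongrightarrow> (norm (f x - f x))\<^sup>2" by (intro tendsto_intros)
      then show ?case by simp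
    qed
    show "AE x in lborel. norm ((norm (F n x - f x))\<^sup>2) \<le> 4 * (norm (g x))\<^sup>2" for n
      using dom[of n] dom'
    proof eventually_elim
      case (elim x)
      then have "norm (F n x - f x) \<le> 2 * norm (g x)" using norm_triangle_ineq4[of "F n x" "f x"] by simp
      then have "(norm (F n x - f x))\<^sup>2 \<le> (2 * norm (g x))\<^sup>2" by (intro power_mono) auto
      then show ?case by (simp add: power_mult_distrib)
    qed
  qed auto
  then have "(\<lambda>n. sqrt (\<integral>x. (norm (F n x - f x))\<^sup>2 \<partial>lborel)) \<longlonglongrightarrow> sqrt 0"
    by (intro tendsto_real_sqrt) simp
  then show ?thesis by (simp add: L2_norm_def)
qed

lemma L2_truncate:
  fixes f :: "real^3 \<Rightarrow> 'b::euclidean_space"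
  assumes "f \<in> L2" and [measurable]: "S \<in> sets borel"
  shows "(\<lambda>x. indicator S x *\<^sub>R f x) \<in> L2" "L2_norm (\<lambda>x. indicator S x *\<^sub>R f x) \<le> L2_norm f"
proof -
  note [measurable] = L2_measurable[OF assms(1)]
  have "norm (indicator S x *\<^sub>R f x) \<le> norm (f x)" for x by (simp split: split_indicator)
  then show "(\<lambda>x. indicator S x *\<^sub>R f x) \<in> L2" "L2_norm (\<lambda>x. indicator S x *\<^sub>R f x) \<le> L2_norm f"
    by (intro L2_norm_mono[OF assms(1)]; measurable)+
qed

lemma L2_truncate_tendsto:
  fixes f :: "real^3 \<Rightarrow> 'b::euclidean_space"
  assumes f: "f \<in> L2" and S: "\<And>n. S n \<in> sets borel" and ev: "\<And>x. \<forall>\<^sub>F n in sequentially. x \<in> S n"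
  shows "(\<lambda>n. L2_norm (\<lambda>x. indicator (S n) x *\<^sub>R f x - f x)) \<longlonglongrightarrow> 0"
proof (rule L2_dominated_convergence[where g=f])
  show "AE x in lborel. (\<lambda>n. indicator (S n) x *\<^sub>R f x) \<longlonglongrightarrow> f x"
  proof (rule AE_I2)
    fix x show "(\<lambda>n. indicator (S n) x *\<^sub>R f x) \<longlonglongrightarrow> f x"
      by (rule tendsto_eventually) (use ev[of x] in eventually_elim, auto)
  qed
  show "(\<lambda>x. indicator (S n) x *\<^sub>R f x) \<in> borel_measurable borel" for n
    using L2_measurable[OF f] S[of n] by measurable
  show "AE x in lborel. norm (indicator (S n) x *\<^sub>R f x) \<le> norm (f x)" for n
    by (simp split: split_indicator)
qed (use f L2_measurable[OF f] in auto)

lemma L2_compact_support_integrable: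
  fixes f :: "real^3 \<Rightarrow> 'b::euclidean_space"
  assumes f: "f \<in> L2"
  shows "integrable lborel (\<lambda>x. indicator (cball 0 R) x *\<^sub>R f x)"
proof -
  have "(\<lambda>x. indicator (cball 0 R) x :: real) \<in> (L2 :: (real^3 \<Rightarrow> real) set)"
  proof (rule L2I)
    have "integrable lborel (\<lambda>x::real^3. indicator (cball 0 R) x :: real)"
      using emeasure_bounded_finite[of "cball (0::real^3) R"] by (intro integrable_real_indicator) auto
    moreover have "(norm (indicator (cball 0 R) x :: real))\<^sup>2 = indicator (cball 0 R) x" for x :: "real^3"
      by (simp split: split_indicator)
    ultimately show "integrable lborel (\<lambda>x::real^3. (norm (indicator (cball 0 R) x :: real))\<^sup>2)"
      by simp
  qed (intro borel_measurable_indicator borel_closed closed_cball)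
  from L2_mult_integrable[OF this f] show ?thesis
  proof (rule Bochner_Integration.integrable_bound)
    have [measurable]: "cball (0::real^3) R \<in> sets borel" by (intro borel_closed closed_cball)
    show "(\<lambda>x. indicator (cball 0 R) x *\<^sub>R f x) \<in> borel_measurable lborel"
      using L2_measurable[OF f] by measurable
  qed auto
qed

lemma eventually_in_cball: "\<forall>\<^sub>F n in sequentially. (x::real^3) \<in> cball 0 (real n)"
proof -
  have "\<forall>\<^sub>F n in sequentially. n \<ge> nat \<lceil>norm x\<rceil>" by (rule eventually_ge_at_top)
  then show ?thesis by eventually_elim (simp add: nat_ceiling_le_eq)
qed

section \<open>The Fourier transform on integrable functions\<close>

lemma lborel_scale_shift:
  fixes f :: "real^3 \<Rightarrow> 'b::{banach, second_countable_topology}"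
  assumes [measurable]: "f \<in> borel_measurable borel" and "t > 0"
  shows "(\<integral>x. f (a + t *\<^sub>R x) \<partial>lborel) = (1/t^3) *\<^sub>R (\<integral>x. f x \<partial>lborel)"
    and "integrable lborel (\<lambda>x. f (a + t *\<^sub>R x)) \<longleftrightarrow> integrable lborel f"
proof -
  have eq: "(lborel :: (real^3) measure) = density (distr lborel borel (\<lambda>x. a + t *\<^sub>R x)) (\<lambda>_. ennreal (t^3))"
    using lborel_affine[of t a] \<open>t > 0\<close> by simp
  have "(\<integral>x. f x \<partial>lborel) = t^3 *\<^sub>R (\<integral>x. f (a + t *\<^sub>R x) \<partial>lborel)"
    by (subst eq, subst integral_density) (use \<open>t > 0\<close> in \<open>auto simp: integral_distr\<close>)
  then show "(\<integral>x. f (a + t *\<^sub>R x) \<partial>lborel) = (1/t^3) *\<^sub>R (\<integral>x. f x \<partial>lborel)"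
    using \<open>t > 0\<close> by simp
  have "integrable lborel f \<longleftrightarrow> integrable (density (distr lborel borel (\<lambda>x. a + t *\<^sub>R x)) (\<lambda>_. ennreal (t^3))) f"
    using eq by simp
  also have "\<dots> \<longleftrightarrow> integrable lborel (\<lambda>x. f (a + t *\<^sub>R x))"
  proof (subst integrable_density)
    have "integrable lborel (\<lambda>x. f (a + t *\<^sub>R x))" if "integrable lborel (\<lambda>x. t^3 *\<^sub>R f (a + t *\<^sub>R x))"
      using integrable_scaleR_right[OF that, of "1/t^3"] \<open>t > 0\<close> by simp
    then show "integrable (distr lborel borel (\<lambda>x. a + t *\<^sub>R x)) (\<lambda>x. (t^3) *\<^sub>R f x) \<longleftrightarrow> integrable lborel (\<lambda>x. f (a + t *\<^sub>R x))"
      by (auto simp: integrable_distr_eq)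
  qed (use \<open>t > 0\<close> in auto)
  finally show "integrable lborel (\<lambda>x. f (a + t *\<^sub>R x)) \<longleftrightarrow> integrable lborel f" by simp
qed

lemma L2_scale_shift:
  fixes f :: "real^3 \<Rightarrow> 'b::euclidean_space"
  assumes f: "f \<in> L2" and "t > 0"
  shows "(\<lambda>x. f (a + t *\<^sub>R x)) \<in> L2"
    and "L2_norm (\<lambda>x. f (a + t *\<^sub>R x)) = t powr (-3/2) * L2_norm f"
proof -
  note [measurable] = L2_measurable[OF f]
  have m: "(\<lambda>x. (norm (f x))\<^sup>2) \<in> borel_measurable borel" by measurable
  show "(\<lambda>x. f (a + t *\<^sub>R x)) \<in> L2"
    using lborel_scale_shift(2)[OF m \<open>t > 0\<close>, of a] L2_integrable[OF f] by (intro L2I) auto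
  have "t powr (-3/2) = sqrt (1/t^3)"
  proof -
    have "1/t^3 = t powr (-3)" using powr_realpow[of t 3] \<open>t > 0\<close> by (simp add: powr_minus_divide)
    then show ?thesis using \<open>t > 0\<close> by (simp add: powr_half_sqrt[symmetric] powr_powr)
  qed
  then show "L2_norm (\<lambda>x. f (a + t *\<^sub>R x)) = t powr (-3/2) * L2_norm f"
    unfolding L2_norm_def lborel_scale_shift(1)[OF m \<open>t > 0\<close>, of a] real_scaleR_def real_sqrt_mult by simp
qed

text \<open>This reduces the Gaussian Fourier integrals on \<open>real^3\<close> to one
  variable.\<close>

lemma lborel_integral_prod:
  fixes f :: "'a::euclidean_space \<Rightarrow> real \<Rightarrow> complex"
  assumes f: "\<And>b. b \<in> Basis \<Longrightarrow> integrable lborel (f b)"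
  shows "(\<integral>x. (\<Prod>b\<in>Basis. f b (x \<bullet> b)) \<partial>lborel) = (\<Prod>b\<in>Basis. \<integral>s. f b s \<partial>lborel)"
    and "integrable lborel (\<lambda>x::'a. \<Prod>b\<in>Basis. f b (x \<bullet> b))"
proof -
  interpret product_sigma_finite "\<lambda>_::'a. lborel :: real measure" ..
  have m: "f b \<in> borel_measurable borel" if "b \<in> Basis" for b
    using borel_measurable_integrable[OF f[OF that]] by simp
  have [measurable]: "(\<lambda>x::'a. \<Prod>b\<in>Basis. f b (x \<bullet> b)) \<in> borel_measurable borel"
    by (intro borel_measurable_prod measurable_compose[OF _ m]) auto
  have *: "(\<Prod>b\<in>Basis. f b ((\<Sum>b\<in>Basis. g b *\<^sub>R b) \<bullet> b)) = (\<Prod>b\<in>Basis. f b (g b))" for g :: "'a \<Rightarrow> real"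
    by (intro prod.cong) auto
  show "(\<integral>x. (\<Prod>b\<in>Basis. f b (x \<bullet> b)) \<partial>lborel) = (\<Prod>b\<in>Basis. \<integral>s. f b s \<partial>lborel)"
    by (subst lborel_eq, subst integral_distr) (auto simp: * product_integral_prod f)
  show "integrable lborel (\<lambda>x::'a. \<Prod>b\<in>Basis. f b (x \<bullet> b))"
    by (subst lborel_eq, subst integrable_distr_eq) (auto simp: * product_integrable_prod f)
qed

section \<open>Gaussian integrals in one variable\<close>

lemma gauss1_integrable: "integrable lborel (\<lambda>t::real. exp (- t\<^sup>2 / 2))"
proof -
  have "integrable lborel (\<lambda>t. sqrt (2 * pi) * (std_normal_density t * t ^ 0))"
    by (intro integrable_mult_right integrable_std_normal_moment)
  then show ?thesis by (simp add: std_normal_density_def)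
qed

lemma gauss1_moment_integrable: "integrable lborel (\<lambda>t::real. t * exp (- t\<^sup>2 / 2))"
proof -
  have "integrable lborel (\<lambda>t. sqrt (2 * pi) * (std_normal_density t * t ^ 1))"
    by (intro integrable_mult_right integrable_std_normal_moment)
  then show ?thesis by (simp add: std_normal_density_def mult.commute)
qed

lemma gauss1_cexp_integrable:
  "integrable lborel (\<lambda>t. exp (\<i> * complex_of_real (t * x)) * complex_of_real (exp (- t\<^sup>2 / 2)))"
  by (rule Bochner_Integration.integrable_bound[OF gauss1_integrable]) (auto simp: norm_mult norm_exp_eq_Re)

lemma gauss1_moment_cexp_integrable:
  "integrable lborel (\<lambda>t. complex_of_real t * (exp (\<i> * complex_of_real (t * x)) * complex_of_real (exp (- t\<^sup>2 / 2))))"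
  by (rule Bochner_Integration.integrable_bound[OF gauss1_moment_integrable]) (auto simp: norm_mult norm_exp_eq_Re)

lemma gauss1_fourier:
  "(\<integral>t. exp (\<i> * complex_of_real (t * x)) * complex_of_real (exp (- t\<^sup>2 / 2)) \<partial>lborel)
     = complex_of_real (sqrt (2 * pi) * exp (- x\<^sup>2 / 2))"
proof -
  have "complex_of_real (exp (- x\<^sup>2 / 2)) = char std_normal_distribution x"
    by (simp add: char_std_normal_distribution)
  also have "\<dots> = (\<integral>t. std_normal_density t *\<^sub>R exp (\<i> * complex_of_real (x * t)) \<partial>lborel)"
    unfolding char_def by (subst integral_density) (auto simp: normal_density_nonneg)
  also have "\<dots> = (\<integral>t. complex_of_real (1 / sqrt (2 * pi)) * (exp (\<i> * complex_of_real (t * x)) * complex_of_real (exp (- t\<^sup>2 / 2))) \<partial>lborel)"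
    by (rule Bochner_Integration.integral_cong) (auto simp: std_normal_density_def scaleR_conv_of_real mult_ac)
  also have "\<dots> = complex_of_real (1 / sqrt (2 * pi)) * (\<integral>t. exp (\<i> * complex_of_real (t * x)) * complex_of_real (exp (- t\<^sup>2 / 2)) \<partial>lborel)"
    by (rule integral_mult_right_zero)
  finally show ?thesis by (simp add: field_simps)
qed

text \<open>Integration by parts: \<open>?f\<close> is the derivative of \<open>?F\<close>, which
  vanishes at both ends, so the integral of \<open>?f\<close> is zero and the factor
  \<open>t\<close> may be traded for \<open>\<i> * x\<close>.\<close>

lemma gauss1_moment_fourier:
  "(\<integral>t. complex_of_real t * (exp (\<i> * complex_of_real (t * x)) * complex_of_real (exp (- t\<^sup>2 / 2))) \<partial>lborel)
     = \<i> * complex_of_real x * complex_of_real (sqrt (2 * pi) * exp (- x\<^sup>2 / 2))"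
proof -
  let ?F = "\<lambda>t. exp (\<i> * complex_of_real (t * x)) * complex_of_real (exp (- t\<^sup>2 / 2))"
  let ?f = "\<lambda>t. \<i> * complex_of_real x * ?F t - complex_of_real t * ?F t"
  have i: "integrable lborel ?f"
    by (intro Bochner_Integration.integrable_diff integrable_mult_right gauss1_cexp_integrable gauss1_moment_cexp_integrable)
  have lim: "((\<lambda>t. ?F t) \<longlongrightarrow> 0) F" if "filterlim (\<lambda>t::real. t\<^sup>2) at_top F" for F
  proof (rule Lim_null_comparison)
    have "((\<lambda>s::real. exp (- s / 2)) \<longlongrightarrow> 0) at_top" by real_asymp
    from filterlim_compose[OF this that] show "((\<lambda>t. exp (- t\<^sup>2 / 2)) \<longlongrightarrow> 0) F" .
  qed (auto simp: norm_mult norm_exp_eq_Re)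
  have "(LBINT t=-\<infinity>..\<infinity>. ?f t) = 0 - 0"
  proof (rule interval_integral_FTC_integrable)
    define h where "h = (1/2 :: complex)"
    have *: "((\<lambda>z. exp (\<i> * (z * complex_of_real x)) * exp (- (h * z\<^sup>2))) has_field_derivative ?f t) (at (complex_of_real t))" for t
    proof -
      have "((\<lambda>z. exp (\<i> * (z * complex_of_real x)) * exp (- (h * z\<^sup>2))) has_field_derivative
          \<i> * complex_of_real x * exp (\<i> * (complex_of_real t * complex_of_real x)) * exp (- (h * (complex_of_real t)\<^sup>2))
          - 2 * h * complex_of_real t * exp (\<i> * (complex_of_real t * complex_of_real x)) * exp (- (h * (complex_of_real t)\<^sup>2)))
          (at (complex_of_real t))"
        by (auto intro!: derivative_eq_intros simp: algebra_simps)
      then show ?thesis by (simp add: h_def exp_of_real[symmetric] algebra_simps)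
    qed
    show "(?F has_vector_derivative ?f t) (at t)" for t
      using has_vector_derivative_real_field[OF *[of t]] by (simp add: h_def exp_of_real[symmetric])
    show "isCont ?f t" for t by (intro continuous_intros) simp_all
    show "set_integrable lborel (einterval (- \<infinity>) \<infinity>) ?f"
      using i by (simp add: set_integrable_def)
    show "((?F \<circ> real_of_ereal) \<longlongrightarrow> 0) (at_right (- \<infinity>))"
      unfolding ereal_tendsto_simps1 by (rule lim) real_asymp
    show "((?F \<circ> real_of_ereal) \<longlongrightarrow> 0) (at_left \<infinity>)"
      unfolding ereal_tendsto_simps1 by (rule lim) real_asymp
  qed simp
  then have A: "(\<integral>t. ?f t \<partial>lborel) = 0"
    by (simp add: interval_lebesgue_integral_def set_lebesgue_integral_def)
  have B: "(\<integral>t. ?f t \<partial>lborel) = \<i> * complex_of_real x * (\<integral>t. ?F t \<partial>lborel) - (\<integral>t. complex_of_real t * ?F t \<partial>lborel)"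
    unfolding integral_mult_right_zero[symmetric]
    by (rule Bochner_Integration.integral_diff[OF integrable_mult_right[OF gauss1_cexp_integrable] gauss1_moment_cexp_integrable])
  show ?thesis using trans[OF B[symmetric] A] unfolding gauss1_fourier right_minus_eq by (rule sym)
qed

section \<open>The Gaussian on real^3\<close>

definition gauss :: "real^3 \<Rightarrow> real" where
  "gauss x = exp (- (norm x)\<^sup>2 / 2)"

lemma gauss_pos [simp]: "gauss x > 0" and gauss_le_1: "gauss x \<le> 1"
  by (auto simp: gauss_def)

lemma gauss_measurable [measurable]: "gauss \<in> borel_measurable borel"
  unfolding gauss_def by measurable

lemma gauss_prod: "complex_of_real (gauss x) = (\<Prod>b\<in>Basis. complex_of_real (exp (- (x \<bullet> b)\<^sup>2 / 2)))"
proof -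
  have "(norm x)\<^sup>2 = (\<Sum>b\<in>Basis. (x \<bullet> b)\<^sup>2)"
    unfolding power2_norm_eq_inner unfolding power2_eq_square by (rule euclidean_inner)
  then have "gauss x = (\<Prod>b\<in>Basis. exp (- (x \<bullet> b)\<^sup>2 / 2))"
    by (simp add: gauss_def exp_sum[symmetric] sum_negf sum_divide_distrib[symmetric])
  then show ?thesis by simp
qed

lemma cexp_inner_prod:
  "exp (\<i> * complex_of_real (x \<bullet> z)) = (\<Prod>b\<in>Basis. exp (\<i> * complex_of_real ((x \<bullet> b) * (z \<bullet> b))))"
  for x z :: "real^3"
  by (simp add: exp_sum[symmetric] sum_distrib_left[symmetric] euclidean_inner[of x z])

text \<open>The Plancherel constant: the transform \<open>fourier_integral\<close> carries no
  normalising factor, so it multiplies squared norms by this number.\<close>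

definition fkappa :: real where "fkappa = (2 * pi)^3"

lemma fkappa_pos [simp]: "fkappa > 0" by (simp add: fkappa_def)

lemma gauss_integrable: "integrable lborel gauss"
proof -
  have "integrable lborel (\<lambda>x::real^3. \<Prod>b\<in>Basis. complex_of_real (exp (- (x \<bullet> b)\<^sup>2 / 2)))"
    by (rule lborel_integral_prod(2)) (use gauss1_integrable in auto)
  then have "integrable lborel (\<lambda>x. complex_of_real (gauss x))" by (simp add: gauss_prod)
  then show ?thesis by (rule Bochner_Integration.integrable_bound) auto
qed

lemma gauss_sq: "(gauss x)\<^sup>2 = gauss (sqrt 2 *\<^sub>R x)"
  by (simp add: gauss_def exp_double[symmetric] power_mult_distrib)

lemma gauss_L2: "gauss \<in> L2"
proof (rule L2I)
  have "integrable lborel (\<lambda>x::real^3. gauss (0 + sqrt 2 *\<^sub>R x))"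
    by (subst lborel_scale_shift(2)) (use gauss_integrable in auto)
  then show "integrable lborel (\<lambda>x. (norm (gauss x))\<^sup>2)" by (simp add: gauss_sq)
qed simp

text \<open>The sign of \<open>z\<close> is immaterial in the first formula; \<open>exp (\<i> x \<bullet> z)\<close> is the conjugate kernel.\<close>

lemma gauss_fourier:
  "(\<integral>x. exp (\<i> * complex_of_real (x \<bullet> z)) * complex_of_real (gauss x) \<partial>lborel)
     = complex_of_real (sqrt fkappa * gauss z)"
proof -
  have "(\<integral>x. exp (\<i> * complex_of_real (x \<bullet> z)) * complex_of_real (gauss x) \<partial>lborel)
      = (\<integral>x. (\<Prod>b\<in>Basis. exp (\<i> * complex_of_real ((x \<bullet> b) * (z \<bullet> b))) * complex_of_real (exp (- (x \<bullet> b)\<^sup>2 / 2))) \<partial>(lborel :: (real^3) measure))"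
    by (simp only: gauss_prod cexp_inner_prod prod.distrib)
  also have "\<dots> = (\<Prod>b\<in>Basis. \<integral>s. exp (\<i> * complex_of_real (s * (z \<bullet> b))) * complex_of_real (exp (- s\<^sup>2 / 2)) \<partial>lborel)"
    by (rule lborel_integral_prod(1)) (rule gauss1_cexp_integrable)
  also have "\<dots> = (\<Prod>b\<in>(Basis::(real^3) set). complex_of_real (sqrt (2 * pi))) * (\<Prod>b\<in>Basis. complex_of_real (exp (- (z \<bullet> b)\<^sup>2 / 2)))"
    unfolding gauss1_fourier unfolding of_real_mult prod.distrib ..
  also have "(\<Prod>b\<in>(Basis::(real^3) set). complex_of_real (sqrt (2 * pi))) = complex_of_real (sqrt fkappa)"
  proof -
    have "sqrt fkappa = sqrt (2 * pi) ^ 3" by (simp only: fkappa_def real_sqrt_power)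
    then show ?thesis by (simp del: real_sqrt_mult)
  qed
  finally show ?thesis by (simp add: gauss_prod)
qed

lemma gauss_moment_fourier:
  "(\<integral>x. complex_of_real (x $ j) * (exp (\<i> * complex_of_real (x \<bullet> z)) * complex_of_real (gauss x)) \<partial>lborel)
     = \<i> * complex_of_real (z $ j) * complex_of_real (sqrt fkappa * gauss z)" (is "?L = _")
    and gauss_moment_integrable: "integrable lborel (\<lambda>x. complex_of_real (x $ j) * (exp (\<i> * complex_of_real (x \<bullet> z)) * complex_of_real (gauss x)))"
proof -
  let ?e = "axis j (1::real) :: real^3"
  have eB: "?e \<in> Basis" by (simp add: axis_in_Basis_iff)
  have e: "y \<bullet> ?e = y $ j" for y :: "real^3" by (simp add: inner_axis)
  define G where "G b s = exp (\<i> * complex_of_real (s * (z \<bullet> b))) * complex_of_real (exp (- s\<^sup>2 / 2))" for b :: "real^3" and s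
  \<comment> \<open>The moment factor belongs to the single coordinate \<open>j\<close>; all other
    factors are the plain ones, so the product still factorises.\<close>
  define M where "M b s = (if b = ?e then complex_of_real s * G b s else G b s)" for b s
  have Mi: "integrable lborel (M b)" for b
    unfolding M_def G_def by (cases "b = ?e") (simp_all only: simp_thms if_True if_False gauss1_cexp_integrable gauss1_moment_cexp_integrable)
  have split: "(\<Prod>b\<in>Basis. M b (x \<bullet> b)) = complex_of_real (x $ j) * (\<Prod>b\<in>Basis. G b (x \<bullet> b))" for x
    using eB by (simp add: prod.remove[of Basis ?e] M_def e cong: prod.cong_simp)
  have int: "complex_of_real (x $ j) * (exp (\<i> * complex_of_real (x \<bullet> z)) * complex_of_real (gauss x)) = (\<Prod>b\<in>Basis. M b (x \<bullet> b))" for x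
    unfolding split G_def by (simp only: gauss_prod cexp_inner_prod prod.distrib)
  show "integrable lborel (\<lambda>x. complex_of_real (x $ j) * (exp (\<i> * complex_of_real (x \<bullet> z)) * complex_of_real (gauss x)))"
    unfolding int by (rule lborel_integral_prod(2)) (rule Mi)
  have "?L = (\<Prod>b\<in>Basis. \<integral>s. M b s \<partial>lborel)"
    unfolding int by (rule lborel_integral_prod(1)) (rule Mi)
  also have "\<dots> = (\<Prod>b\<in>Basis. (if b = ?e then \<i> * complex_of_real (z $ j) else 1) * (\<integral>s. G b s \<partial>lborel))"
  proof (rule prod.cong)
    fix b :: "real^3"
    show "(\<integral>s. M b s \<partial>lborel) = (if b = ?e then \<i> * complex_of_real (z $ j) else 1) * (\<integral>s. G b s \<partial>lborel)"
      unfolding M_def G_def by (cases "b = ?e") (simp_all only: simp_thms if_True if_False gauss1_fourier gauss1_moment_fourier e mult_1 mult.assoc)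
  qed simp
  also have "\<dots> = \<i> * complex_of_real (z $ j) * (\<Prod>b\<in>Basis. \<integral>s. G b s \<partial>lborel)"
    using eB by (simp add: prod.distrib prod.delta)
  also have "(\<Prod>b\<in>Basis. \<integral>s. G b s \<partial>lborel) = complex_of_real (sqrt fkappa * gauss z)"
  proof -
    have "(\<Prod>b\<in>Basis. \<integral>s. G b s \<partial>lborel) = (\<integral>x. (\<Prod>b\<in>Basis. G b (x \<bullet> b)) \<partial>lborel)"
      unfolding G_def by (rule lborel_integral_prod(1)[symmetric]) (rule gauss1_cexp_integrable)
    also have "\<dots> = complex_of_real (sqrt fkappa * gauss z)"
      unfolding G_def prod.distrib cexp_inner_prod[symmetric] gauss_prod[symmetric] by (rule gauss_fourier)
    finally show ?thesis .
  qed
  finally show "?L = \<i> * complex_of_real (z $ j) * complex_of_real (sqrt fkappa * gauss z)" .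
qed

section \<open>Fourier integrals of integrable functions\<close>

lemma fourier_integral_bound: "cmod (fourier_integral f \<xi>) \<le> (\<integral>x. cmod (f x) \<partial>lborel)"
proof -
  have "cmod (fourier_integral f \<xi>) \<le> (\<integral>x. cmod (exp (- \<i> * complex_of_real (x \<bullet> \<xi>)) * f x) \<partial>lborel)"
    unfolding fourier_integral_def by (rule integral_norm_bound)
  then show ?thesis by (simp add: norm_mult norm_exp_eq_Re)
qed

lemma fourier_kernel_integrable:
  assumes "integrable lborel f"
  shows "integrable lborel (\<lambda>x. exp (- \<i> * complex_of_real (x \<bullet> \<xi>)) * f x)"
  by (rule Bochner_Integration.integrable_bound[OF assms])
     (use borel_measurable_integrable[OF assms] in \<open>auto simp: norm_mult norm_exp_eq_Re\<close>)

lemma fourier_integral_measurable [measurable]: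
  assumes [measurable]: "f \<in> borel_measurable borel"
  shows "fourier_integral f \<in> borel_measurable borel"
proof -
  have "(\<lambda>\<xi>. \<integral>x. exp (- \<i> * complex_of_real (x \<bullet> \<xi>)) * f x \<partial>lborel) \<in> borel_measurable borel"
    by (intro lborel.borel_measurable_lebesgue_integral) measurable
  then show ?thesis unfolding fourier_integral_def[abs_def] .
qed

lemma fourier_integral_add:
  assumes "integrable lborel f" "integrable lborel g"
  shows "fourier_integral (\<lambda>x. f x + g x) \<xi> = fourier_integral f \<xi> + fourier_integral g \<xi>"
  unfolding fourier_integral_def ring_distribs
  by (intro Bochner_Integration.integral_add fourier_kernel_integrable assms)

lemma fourier_integral_diff:
  assumes "integrable lborel f" "integrable lborel g"
  shows "fourier_integral (\<lambda>x. f x - g x) \<xi> = fourier_integral f \<xi> - fourier_integral g \<xi>"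
  unfolding fourier_integral_def ring_distribs
  by (intro Bochner_Integration.integral_diff fourier_kernel_integrable assms)

lemma fourier_integral_cmult:
  "fourier_integral (\<lambda>x. c * f x) \<xi> = c * fourier_integral f \<xi>"
  unfolding fourier_integral_def mult.left_commute[of _ c] by (rule integral_mult_right_zero)

text \<open>Fubini and the symmetry of the kernel. This duality is the source of the regularised
  Plancherel identity and, in its \<open>L2\<close> form, of the inversion formula and of the
  Fourier description of weak gradients.\<close>

lemma fourier_integral_mult_formula:
  assumes f: "integrable lborel f" and g: "integrable lborel g"
  shows "(\<integral>\<xi>. fourier_integral f \<xi> * g \<xi> \<partial>lborel) = (\<integral>x. f x * fourier_integral g x \<partial>lborel)"
proof -
  note [measurable] = borel_measurable_integrable[OF f, simplified] borel_measurable_integrable[OF g, simplified]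
  let ?h = "\<lambda>x \<xi>. exp (- \<i> * complex_of_real (x \<bullet> \<xi>)) * f x * g \<xi>"
  have n: "norm (?h x \<xi>) = cmod (f x) * cmod (g \<xi>)" for x \<xi>
    by (simp add: norm_mult norm_exp_eq_Re)
  have "integrable (lborel \<Otimes>\<^sub>M lborel) (case_prod ?h)"
  proof (rule lborel_pair.Fubini_integrable)
    show "case_prod ?h \<in> borel_measurable (lborel \<Otimes>\<^sub>M lborel)" by measurable
    show "integrable lborel (\<lambda>x. \<integral>y. norm (case_prod ?h (x, y)) \<partial>lborel)"
      unfolding case_prod_conv n using f by (simp add: integrable_norm)
    have "integrable lborel (\<lambda>\<xi>. ?h x \<xi>)" for x
      by (rule Bochner_Integration.integrable_bound[where f="\<lambda>\<xi>. cmod (f x) * cmod (g \<xi>)"])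
         (use g n in \<open>auto simp: integrable_norm\<close>)
    then show "AE x in lborel. integrable lborel (\<lambda>y. case_prod ?h (x, y))" by simp
  qed
  from lborel_pair.Fubini_integral[OF this]
  have "(\<integral>\<xi>. (\<integral>x. ?h x \<xi> \<partial>lborel) \<partial>lborel) = (\<integral>x. (\<integral>\<xi>. ?h x \<xi> \<partial>lborel) \<partial>lborel)" .
  moreover have "(\<integral>x. ?h x \<xi> \<partial>lborel) = fourier_integral f \<xi> * g \<xi>" for \<xi>
    unfolding fourier_integral_def by (rule integral_mult_left_zero)
  moreover have "(\<integral>\<xi>. ?h x \<xi> \<partial>lborel) = f x * fourier_integral g x" for x
    unfolding fourier_integral_def integral_mult_right_zero[symmetric] by (simp add: mult_ac inner_commute)
  ultimately show ?thesis by (simp only:)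
qed

section \<open>Plancherel's theorem\<close>

lemma fkappa_nonzero [simp]: "fkappa \<noteq> 0" by (simp add: fkappa_def)

lemma sqrt_fkappa_sq [simp]: "(sqrt fkappa)\<^sup>2 = fkappa" by (simp add: less_imp_le)

text \<open>As \<open>s\<close> tends to 0 these transforms, as functions of \<open>y\<close>,
  concentrate at \<open>x\<close>: they are the approximate identity behind Plancherel's
  theorem.\<close>

lemma gauss_scaled_fourier:
  assumes "s > 0"
  shows "fourier_integral (\<lambda>\<xi>. exp (\<i> * complex_of_real (x \<bullet> \<xi>)) * complex_of_real (gauss (s *\<^sub>R \<xi>))) y
    = complex_of_real (sqrt fkappa / s^3 * gauss ((1/s) *\<^sub>R (y - x)))"
proof -
  let ?h = "\<lambda>\<xi>. exp (\<i> * complex_of_real (\<xi> \<bullet> ((1/s) *\<^sub>R (x - y)))) * complex_of_real (gauss \<xi>)"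
  have "fourier_integral (\<lambda>\<xi>. exp (\<i> * complex_of_real (x \<bullet> \<xi>)) * complex_of_real (gauss (s *\<^sub>R \<xi>))) y
      = (\<integral>\<xi>. ?h (0 + s *\<^sub>R \<xi>) \<partial>lborel)"
    unfolding fourier_integral_def
  proof (rule Bochner_Integration.integral_cong)
    fix \<xi> :: "real^3"
    have "exp (- \<i> * complex_of_real (\<xi> \<bullet> y)) * exp (\<i> * complex_of_real (x \<bullet> \<xi>)) = exp (\<i> * complex_of_real (\<xi> \<bullet> (x - y)))"
      by (simp add: exp_add[symmetric] inner_diff_right algebra_simps inner_commute)
    then show "exp (- \<i> * complex_of_real (\<xi> \<bullet> y)) * (exp (\<i> * complex_of_real (x \<bullet> \<xi>)) * complex_of_real (gauss (s *\<^sub>R \<xi>))) = ?h (0 + s *\<^sub>R \<xi>)"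
      using \<open>s > 0\<close> by (simp add: mult.assoc[symmetric])
  qed simp
  also have "\<dots> = (1/s^3) *\<^sub>R (\<integral>\<xi>. ?h \<xi> \<partial>lborel)"
    by (rule lborel_scale_shift(1)) (use \<open>s > 0\<close> in auto)
  also have "\<dots> = complex_of_real (sqrt fkappa / s^3 * gauss ((1/s) *\<^sub>R (x - y)))"
    unfolding gauss_fourier by (simp add: scaleR_conv_of_real)
  also have "gauss ((1/s) *\<^sub>R (x - y)) = gauss ((1/s) *\<^sub>R (y - x))"
    by (simp add: gauss_def norm_minus_commute)
  finally show ?thesis .
qed

lemma gauss_scaled_integrable: "s > 0 \<Longrightarrow> integrable lborel (\<lambda>\<xi>. gauss (s *\<^sub>R \<xi>))"
  using lborel_scale_shift(2)[of gauss s 0] gauss_integrable by simp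

lemma cexp_gauss_scaled_integrable:
  "s > 0 \<Longrightarrow> integrable lborel (\<lambda>\<xi>. exp (\<i> * complex_of_real (x \<bullet> \<xi>)) * complex_of_real (gauss (s *\<^sub>R \<xi>)))"
  by (rule Bochner_Integration.integrable_bound[OF gauss_scaled_integrable[of s]])
     (auto simp: norm_mult norm_exp_eq_Re)

text \<open>The weight \<open>gauss (s *\<^sub>R \<xi>)\<close> makes everything absolutely
  convergent for merely integrable \<open>f\<close>. The multiplication formula, applied with the
  weighted conjugate transform as second function, turns the left side into a pairing of
  \<open>f\<close> with its Gaussian averages at scale \<open>s\<close>; letting \<open>s\<close>
  tend to 0 formally gives Plancherel's identity.\<close>

lemma fourier_integral_gauss_regularised:
  assumes f: "integrable lborel f" and "s > 0"
  shows "complex_of_real (\<integral>\<xi>. (cmod (fourier_integral f \<xi>))\<^sup>2 * gauss (s *\<^sub>R \<xi>) \<partial>lborel)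
    = complex_of_real (sqrt fkappa) * (\<integral>x. f x * cnj (\<integral>w. f (x + s *\<^sub>R w) * complex_of_real (gauss w) \<partial>lborel) \<partial>lborel)"
proof -
  note [measurable] = borel_measurable_integrable[OF f, simplified]
  let ?H = "\<lambda>\<xi>. complex_of_real (gauss (s *\<^sub>R \<xi>))"
  let ?g = "\<lambda>\<xi>. cnj (fourier_integral f \<xi>) * ?H \<xi>"
  have [measurable]: "(\<lambda>\<xi>. cnj (fourier_integral f \<xi>)) \<in> borel_measurable borel"
    by (rule measurable_compose[OF fourier_integral_measurable borel_measurable_continuous_onI[of cnj]])
       (auto intro: continuous_intros)
  have gi: "integrable lborel ?g"
  proof (rule Bochner_Integration.integrable_bound)
    show "integrable lborel (\<lambda>\<xi>. (\<integral>x. cmod (f x) \<partial>lborel) * gauss (s *\<^sub>R \<xi>))"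
      using gauss_scaled_integrable[OF \<open>s > 0\<close>] by simp
    show "AE \<xi> in lborel. norm (?g \<xi>) \<le> norm ((\<integral>x. cmod (f x) \<partial>lborel) * gauss (s *\<^sub>R \<xi>))"
      unfolding norm_mult norm_of_real complex_mod_cnj real_norm_def abs_mult
      by (intro AE_I2 mult_right_mono abs_ge_zero order_trans[OF fourier_integral_bound abs_ge_self])
  qed measurable
  have FIg: "fourier_integral ?g x = complex_of_real (sqrt fkappa) * cnj (\<integral>w. f (x + s *\<^sub>R w) * complex_of_real (gauss w) \<partial>lborel)" for x
  proof -
    let ?k = "\<lambda>\<xi>. exp (\<i> * complex_of_real (x \<bullet> \<xi>)) * ?H \<xi>"
    have "fourier_integral ?g x = (\<integral>\<xi>. cnj (fourier_integral f \<xi> * ?k \<xi>) \<partial>lborel)"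
      unfolding fourier_integral_def[of ?g]
      by (rule Bochner_Integration.integral_cong) (auto simp: exp_cnj inner_commute)
    also have "\<dots> = cnj (\<integral>\<xi>. fourier_integral f \<xi> * ?k \<xi> \<partial>lborel)"
      by (rule Bochner_Integration.integral_cnj)
    also have "(\<integral>\<xi>. fourier_integral f \<xi> * ?k \<xi> \<partial>lborel) = (\<integral>y. f y * fourier_integral ?k y \<partial>lborel)"
      by (rule fourier_integral_mult_formula[OF f cexp_gauss_scaled_integrable[OF \<open>s > 0\<close>]])
    also have "\<dots> = (\<integral>y. f y * complex_of_real (sqrt fkappa / s^3 * gauss ((1/s) *\<^sub>R (y - x))) \<partial>lborel)"
      unfolding gauss_scaled_fourier[OF \<open>s > 0\<close>] ..
    also have "\<dots> = s^3 *\<^sub>R (\<integral>w. f (x + s *\<^sub>R w) * complex_of_real (sqrt fkappa / s^3 * gauss ((1/s) *\<^sub>R ((x + s *\<^sub>R w) - x))) \<partial>lborel)"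
      using \<open>s > 0\<close> by (subst lborel_scale_shift(1)) auto
    also have "\<dots> = s^3 *\<^sub>R (\<integral>w. complex_of_real (sqrt fkappa / s^3) * (f (x + s *\<^sub>R w) * complex_of_real (gauss w)) \<partial>lborel)"
      using \<open>s > 0\<close> by (intro arg_cong[where f="\<lambda>z. s^3 *\<^sub>R z"] Bochner_Integration.integral_cong) auto
    also have "\<dots> = complex_of_real (sqrt fkappa) * (\<integral>w. f (x + s *\<^sub>R w) * complex_of_real (gauss w) \<partial>lborel)"
      unfolding integral_mult_right_zero using \<open>s > 0\<close> by (simp add: scaleR_conv_of_real)
    finally show ?thesis by simp
  qed
  have "complex_of_real (\<integral>\<xi>. (cmod (fourier_integral f \<xi>))\<^sup>2 * gauss (s *\<^sub>R \<xi>) \<partial>lborel)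
      = (\<integral>\<xi>. complex_of_real ((cmod (fourier_integral f \<xi>))\<^sup>2 * gauss (s *\<^sub>R \<xi>)) \<partial>lborel)"
    by (rule integral_complex_of_real[symmetric])
  also have "\<dots> = (\<integral>\<xi>. fourier_integral f \<xi> * ?g \<xi> \<partial>lborel)"
    by (rule Bochner_Integration.integral_cong) (auto simp flip: complex_norm_square)
  also have "\<dots> = (\<integral>x. f x * fourier_integral ?g x \<partial>lborel)"
    by (rule fourier_integral_mult_formula[OF f gi])
  also have "\<dots> = (\<integral>x. complex_of_real (sqrt fkappa) * (f x * cnj (\<integral>w. f (x + s *\<^sub>R w) * complex_of_real (gauss w) \<partial>lborel)) \<partial>lborel)"
    unfolding FIg by (rule Bochner_Integration.integral_cong) auto
  also have "\<dots> = complex_of_real (sqrt fkappa) * (\<integral>x. f x * cnj (\<integral>w. f (x + s *\<^sub>R w) * complex_of_real (gauss w) \<partial>lborel) \<partial>lborel)"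
    by (rule integral_mult_right_zero)
  finally show ?thesis .
qed

lemma gauss_integral: "(\<integral>x. gauss x \<partial>lborel) = sqrt fkappa"
proof -
  have "complex_of_real (\<integral>x. gauss x \<partial>lborel) = complex_of_real (sqrt fkappa)"
    using gauss_fourier[of 0] by (simp add: integral_complex_of_real gauss_def)
  then show ?thesis by (simp only: of_real_eq_iff)
qed

text \<open>Cauchy-Schwarz in \<open>x\<close> for each fixed displacement \<open>w\<close>, then
  integration over \<open>w\<close>. By translation invariance the bound is uniform in
  \<open>s\<close>; \<open>sqrt fkappa\<close> is the total mass of \<open>gauss\<close>.\<close>

lemma gauss_convolution_bound:
  assumes f: "f \<in> L2" and fi: "integrable lborel f" and "s > 0"
  shows "cmod (\<integral>x. f x * cnj (\<integral>w. f (x + s *\<^sub>R w) * complex_of_real (gauss w) \<partial>lborel) \<partial>lborel)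
     \<le> sqrt fkappa * (L2_norm f)\<^sup>2"
proof -
  note [measurable] = L2_measurable[OF f]
  let ?c = "\<lambda>x. \<integral>w. f (x + s *\<^sub>R w) * complex_of_real (gauss w) \<partial>lborel"
  have sh: "(\<lambda>x. f (x + s *\<^sub>R w)) \<in> L2 \<and> L2_norm (\<lambda>x. f (x + s *\<^sub>R w)) = L2_norm f" for w
    using L2_scale_shift[OF f, of 1 "s *\<^sub>R w"] by (simp add: add.commute)
  \<comment> \<open>If the integrand is not integrable, its integral is 0 by convention and the
    bound is trivial; the inner integral is treated in the same way.\<close>
  have "ennreal (cmod (\<integral>x. f x * cnj (?c x) \<partial>lborel)) \<le> (\<integral>\<^sup>+x. ennreal (cmod (f x * cnj (?c x))) \<partial>lborel)"
    by (cases "integrable lborel (\<lambda>x. f x * cnj (?c x))")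
       (auto simp: integral_norm_bound_ennreal not_integrable_integral_eq)
  also have "\<dots> \<le> (\<integral>\<^sup>+x. (\<integral>\<^sup>+w. ennreal (cmod (f x) * cmod (f (x + s *\<^sub>R w)) * gauss w) \<partial>lborel) \<partial>lborel)"
  proof (rule nn_integral_mono)
    fix x
    have "ennreal (cmod (?c x)) \<le> (\<integral>\<^sup>+w. ennreal (cmod (f (x + s *\<^sub>R w) * complex_of_real (gauss w))) \<partial>lborel)"
      by (cases "integrable lborel (\<lambda>w. f (x + s *\<^sub>R w) * complex_of_real (gauss w))")
         (auto simp: integral_norm_bound_ennreal not_integrable_integral_eq)
    then have "ennreal (cmod (f x)) * ennreal (cmod (?c x)) \<le> ennreal (cmod (f x)) * (\<integral>\<^sup>+w. ennreal (cmod (f (x + s *\<^sub>R w) * complex_of_real (gauss w))) \<partial>lborel)"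
      by (intro mult_left_mono) auto
    also have "\<dots> = (\<integral>\<^sup>+w. ennreal (cmod (f x) * cmod (f (x + s *\<^sub>R w)) * gauss w) \<partial>lborel)"
      by (subst nn_integral_cmult[symmetric]) (auto simp: norm_mult ennreal_mult less_imp_le mult.assoc)
    finally show "ennreal (cmod (f x * cnj (?c x))) \<le> (\<integral>\<^sup>+w. ennreal (cmod (f x) * cmod (f (x + s *\<^sub>R w)) * gauss w) \<partial>lborel)"
      by (simp add: norm_mult ennreal_mult)
  qed
  also have "\<dots> = (\<integral>\<^sup>+w. (\<integral>\<^sup>+x. ennreal (cmod (f x) * cmod (f (x + s *\<^sub>R w)) * gauss w) \<partial>lborel) \<partial>lborel)"
    by (rule lborel_pair.Fubini') measurable
  also have "\<dots> \<le> (\<integral>\<^sup>+w. ennreal ((L2_norm f)\<^sup>2) * ennreal (gauss w) \<partial>lborel)"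
  proof (rule nn_integral_mono)
    fix w
    have "(\<integral>\<^sup>+x. ennreal (cmod (f x) * cmod (f (x + s *\<^sub>R w)) * gauss w) \<partial>lborel)
       = (\<integral>\<^sup>+x. ennreal (cmod (f x) * cmod (f (x + s *\<^sub>R w))) \<partial>lborel) * ennreal (gauss w)"
      by (subst nn_integral_multc[symmetric]) (auto simp: ennreal_mult less_imp_le)
    also have "(\<integral>\<^sup>+x. ennreal (cmod (f x) * cmod (f (x + s *\<^sub>R w))) \<partial>lborel)
       = ennreal (\<integral>x. cmod (f x) * cmod (f (x + s *\<^sub>R w)) \<partial>lborel)"
      using L2_mult_integrable[OF f] sh by (intro nn_integral_eq_integral) auto
    also have "\<dots> \<le> ennreal ((L2_norm f)\<^sup>2)"
      using L2_Cauchy_Schwarz[OF f conjunct1[OF sh], of w] sh[of w] by (intro ennreal_leI) (auto simp: power2_eq_square)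
    finally show "(\<integral>\<^sup>+x. ennreal (cmod (f x) * cmod (f (x + s *\<^sub>R w)) * gauss w) \<partial>lborel) \<le> ennreal ((L2_norm f)\<^sup>2) * ennreal (gauss w)"
      by (simp add: mult_right_mono)
  qed
  also have "\<dots> = ennreal ((L2_norm f)\<^sup>2) * (\<integral>\<^sup>+w. ennreal (gauss w) \<partial>lborel)"
    by (rule nn_integral_cmult) measurable
  also have "(\<integral>\<^sup>+w. ennreal (gauss w) \<partial>lborel) = ennreal (sqrt fkappa)"
    unfolding gauss_integral[symmetric] by (intro nn_integral_eq_integral gauss_integrable) (auto simp: less_imp_le)
  finally have "ennreal (cmod (\<integral>x. f x * cnj (?c x) \<partial>lborel)) \<le> ennreal ((L2_norm f)\<^sup>2 * sqrt fkappa)"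
    by (simp add: ennreal_mult less_imp_le)
  then show ?thesis by (subst (asm) ennreal_le_iff) (auto simp: less_imp_le mult.commute)
qed

lemma gauss_scaled_tendsto: "(\<lambda>n. gauss ((1 / real (Suc n)) *\<^sub>R x)) \<longlonglongrightarrow> 1"
proof -
  have lim: "(\<lambda>n. (1 / real (Suc n)) *\<^sub>R x) \<longlonglongrightarrow> 0 *\<^sub>R x"
    by (intro tendsto_scaleR tendsto_const LIMSEQ_Suc[of "\<lambda>n. 1 / real n"] lim_1_over_n)
  have "(\<lambda>n. exp (- (norm ((1 / real (Suc n)) *\<^sub>R x))\<^sup>2 / 2)) \<longlonglongrightarrow> exp (- (norm (0 *\<^sub>R x))\<^sup>2 / 2)"
    by (intro tendsto_exp tendsto_divide tendsto_minus tendsto_power tendsto_norm lim tendsto_const) simp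
  then show ?thesis by (simp add: gauss_def)
qed

text \<open>Removing the Gaussian weight with Fatou's lemma yields only an inequality. It
  nevertheless puts the transform into \<open>L2\<close> and controls the errors when the equality
  is later extended from continuous functions by density.\<close>

lemma fourier_integral_Bessel:
  assumes f: "f \<in> L2" and fi: "integrable lborel f"
  shows "fourier_integral f \<in> L2" and "L2_norm (fourier_integral f) \<le> sqrt fkappa * L2_norm f"
proof -
  note [measurable] = L2_measurable[OF f]
  let ?s = "\<lambda>n. 1 / real (Suc n)"
  \<comment> \<open>The square root of the weight is attached to the transform, so that the
    regularised integral becomes a squared norm.\<close>
  let ?F = "\<lambda>n \<xi>. sqrt (gauss (?s n *\<^sub>R \<xi>)) *\<^sub>R fourier_integral f \<xi>"
  have m: "?F n \<in> borel_measurable borel" for n by measurable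
  have sq: "(norm (?F n \<xi>))\<^sup>2 = (cmod (fourier_integral f \<xi>))\<^sup>2 * gauss (?s n *\<^sub>R \<xi>)" for n \<xi>
    by (simp add: power_mult_distrib less_imp_le mult.commute)
  have *: "?F n \<in> L2 \<and> L2_norm (?F n) \<le> sqrt fkappa * L2_norm f" for n
  proof -
    have i: "integrable lborel (\<lambda>\<xi>. (cmod (fourier_integral f \<xi>))\<^sup>2 * gauss (?s n *\<^sub>R \<xi>))"
    proof (rule Bochner_Integration.integrable_bound)
      show "integrable lborel (\<lambda>\<xi>. (\<integral>x. cmod (f x) \<partial>lborel)\<^sup>2 * gauss (?s n *\<^sub>R \<xi>))"
        using gauss_scaled_integrable[of "?s n"] by simp
      show "AE \<xi> in lborel. norm ((cmod (fourier_integral f \<xi>))\<^sup>2 * gauss (?s n *\<^sub>R \<xi>)) \<le> norm ((\<integral>x. cmod (f x) \<partial>lborel)\<^sup>2 * gauss (?s n *\<^sub>R \<xi>))"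
        using fourier_integral_bound[of f]
        by (auto simp: abs_mult less_imp_le intro!: mult_right_mono power_mono)
    qed measurable
    have "complex_of_real ((L2_norm (?F n))\<^sup>2) = complex_of_real (sqrt fkappa) * (\<integral>x. f x * cnj (\<integral>w. f (x + ?s n *\<^sub>R w) * complex_of_real (gauss w) \<partial>lborel) \<partial>lborel)"
      unfolding L2_norm_sq sq by (rule fourier_integral_gauss_regularised[OF fi]) simp
    then have "(L2_norm (?F n))\<^sup>2 = sqrt fkappa * cmod (\<integral>x. f x * cnj (\<integral>w. f (x + ?s n *\<^sub>R w) * complex_of_real (gauss w) \<partial>lborel) \<partial>lborel)"
    proof -
      assume eq: "complex_of_real ((L2_norm (?F n))\<^sup>2) = complex_of_real (sqrt fkappa) * (\<integral>x. f x * cnj (\<integral>w. f (x + ?s n *\<^sub>R w) * complex_of_real (gauss w) \<partial>lborel) \<partial>lborel)"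
      have "\<bar>(L2_norm (?F n))\<^sup>2\<bar> = \<bar>sqrt fkappa\<bar> * cmod (\<integral>x. f x * cnj (\<integral>w. f (x + ?s n *\<^sub>R w) * complex_of_real (gauss w) \<partial>lborel) \<partial>lborel)"
        using arg_cong[where f=cmod, OF eq] unfolding norm_mult norm_of_real .
      then show ?thesis by (simp only: abs_of_nonneg zero_le_power2 real_sqrt_ge_zero less_imp_le[OF fkappa_pos])
    qed
    also have "\<dots> \<le> sqrt fkappa * (sqrt fkappa * (L2_norm f)\<^sup>2)"
      by (intro mult_left_mono gauss_convolution_bound f fi) (auto simp: less_imp_le)
    also have "\<dots> = (sqrt fkappa * L2_norm f)\<^sup>2" by (simp add: power_mult_distrib power2_eq_square)
    finally have "L2_norm (?F n) \<le> sqrt fkappa * L2_norm f"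
      by (rule power2_le_imp_le) (simp add: less_imp_le)
    moreover have "?F n \<in> L2" using i m by (intro L2I) (simp_all only: sq)
    ultimately show ?thesis by simp
  qed
  have lim: "AE \<xi> in lborel. (\<lambda>n. ?F n \<xi>) \<longlonglongrightarrow> fourier_integral f \<xi>"
  proof (rule AE_I2)
    fix \<xi> have "(\<lambda>n. ?F n \<xi>) \<longlonglongrightarrow> sqrt 1 *\<^sub>R fourier_integral f \<xi>"
      by (intro tendsto_intros gauss_scaled_tendsto)
    then show "(\<lambda>n. ?F n \<xi>) \<longlonglongrightarrow> fourier_integral f \<xi>" by simp
  qed
  show "fourier_integral f \<in> L2" "L2_norm (fourier_integral f) \<le> sqrt fkappa * L2_norm f"
    using L2_Fatou[OF conjunct1[OF *] _ lim, of "sqrt fkappa * L2_norm f"] * by (auto simp: less_imp_le)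
qed

text \<open>After truncation in space and in height, \<open>measurable_on\<close> provides
  continuous functions converging almost everywhere. They may be large or widely supported; cutting
  them back in both respects makes dominated convergence applicable.\<close>

lemma L2_continuous_compact_support_dense:
  fixes f :: "real^3 \<Rightarrow> complex"
  assumes f: "f \<in> L2" and "e > 0"
  obtains g B R where "continuous_on UNIV g" "\<And>x. norm (g x) \<le> B" "\<And>x. norm x > R \<Longrightarrow> g x = 0"
    "L2_norm (\<lambda>x. f x - g x) < e"
proof -
  note [measurable] = L2_measurable[OF f]
  define S where "S n = {x. norm x \<le> real n \<and> norm (f x) \<le> real n}" for n
  have [measurable]: "S n \<in> sets borel" for n unfolding S_def by measurable
  have "(\<lambda>n. L2_norm (\<lambda>x. indicator (S n) x *\<^sub>R f x - f x)) \<longlonglongrightarrow> 0"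
  proof (rule L2_truncate_tendsto[OF f])
    fix x
    have "\<forall>\<^sub>F n in sequentially. nat \<lceil>norm x\<rceil> \<le> n \<and> nat \<lceil>norm (f x)\<rceil> \<le> n"
      by (intro eventually_conj eventually_ge_at_top)
    then show "\<forall>\<^sub>F n in sequentially. x \<in> S n"
      by eventually_elim (simp add: S_def nat_ceiling_le_eq)
  qed simp
  then have "\<forall>\<^sub>F n in sequentially. L2_norm (\<lambda>x. indicator (S n) x *\<^sub>R f x - f x) < e/2"
    using \<open>e > 0\<close> by (intro order_tendstoD) auto
  then obtain N where N: "L2_norm (\<lambda>x. indicator (S N) x *\<^sub>R f x - f x) < e/2"
    using eventually_happens'[OF sequentially_bot] by blast
  define F where "F x = indicator (S N) x *\<^sub>R f x" for x
  have FL: "F \<in> L2" unfolding F_def by (rule L2_truncate(1)[OF f]) simp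
  note [measurable] = L2_measurable[OF FL]
  have Fb: "norm (F x) \<le> real N" for x by (auto simp: F_def S_def indicator_def)
  have F0: "F x = 0" if "norm x > real N" for x using that by (auto simp: F_def S_def)
  have "F \<in> borel_measurable lebesgue"
    by (rule measurable_completion) simp
  then have "F measurable_on UNIV" by (intro lebesgue_measurable_imp_measurable_on) auto
  then obtain Z g where Z: "negligible Z" and gc: "\<And>n. continuous_on UNIV (g n)"
    and gl: "\<And>x. x \<notin> Z \<Longrightarrow> (\<lambda>n. g n x) \<longlonglongrightarrow> F x"
    unfolding measurable_on_def by auto
  \<comment> \<open>\<open>clamp\<close> retracts radially onto the ball of radius
    \<open>N + 1\<close>, and \<open>th\<close> is 1 up to radius \<open>N\<close> and 0 beyond
    \<open>N + 1\<close>. Neither affects the limit \<open>F\<close>, which is bounded by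
    \<open>N\<close> and supported within radius \<open>N\<close>.\<close>
  define clamp where "clamp z = ((real N + 1) / max (real N + 1) (norm z)) *\<^sub>R z" for z :: complex
  define th where "th x = max 0 (min 1 (real N + 1 - norm x))" for x :: "real^3"
  define G where "G n x = th x *\<^sub>R clamp (g n x)" for n x
  have pos: "max (real N + 1) (norm z) > 0" for z :: complex by (simp add: max.strict_coboundedI1)
  have cb: "norm (clamp z) \<le> real N + 1" for z
  proof -
    have "(real N + 1) * norm z \<le> (real N + 1) * max (real N + 1) (norm z)"
      by (intro mult_left_mono) auto
    then show ?thesis using pos[of z] by (simp add: clamp_def divide_le_eq)
  qed
  have ci: "clamp z = z" if "norm z \<le> real N" for z using that by (simp add: clamp_def max_absorb1)
  have cc: "isCont clamp z" for z
    unfolding clamp_def using pos[of z] by (intro continuous_intros) auto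
  have thb: "0 \<le> th x" "th x \<le> 1" for x by (auto simp: th_def)
  have Gc: "continuous_on UNIV (G n)" for n
  proof -
    have "continuous_on UNIV (\<lambda>x. clamp (g n x))"
      using gc[of n] cc by (metis continuous_at_imp_continuous_on continuous_on_compose2 subset_UNIV)
    moreover have "continuous_on UNIV th" unfolding th_def by (intro continuous_intros)
    ultimately show ?thesis unfolding G_def by (intro continuous_intros)
  qed
  have Gb: "norm (G n x) \<le> real N + 1" for n x
    unfolding G_def norm_scaleR using thb[of x] cb[of "g n x"] mult_mono[of "\<bar>th x\<bar>" 1 "norm (clamp (g n x))" "real N + 1"]
    by simp
  have G0: "G n x = 0" if "norm x > real N + 1" for n x using that by (auto simp: G_def th_def)
  have dom: "(\<lambda>x. (real N + 1) *\<^sub>R indicator (cball (0::real^3) (real N + 1)) x :: real) \<in> L2"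
  proof (intro L2_scaleR L2I)
    show m: "(indicator (cball (0::real^3) (real N + 1)) :: _ \<Rightarrow> real) \<in> borel_measurable borel"
      by (intro borel_measurable_indicator borel_closed closed_cball)
    have "integrable lborel (indicator (cball (0::real^3) (real N + 1)) :: _ \<Rightarrow> real)"
      using emeasure_bounded_finite[of "cball (0::real^3) (real N + 1)"] by (intro integrable_real_indicator) auto
    then show "integrable lborel (\<lambda>x::real^3. (norm (indicator (cball 0 (real N + 1)) x :: real))\<^sup>2)"
      by (rule Bochner_Integration.integrable_bound) (use m in \<open>auto split: split_indicator\<close>)
  qed
  have "(\<lambda>n. L2_norm (\<lambda>x. G n x - F x)) \<longlonglongrightarrow> 0"
  proof (rule L2_dominated_convergence[OF _ _ dom])
    show "G n \<in> borel_measurable borel" for n using Gc by (rule borel_measurable_continuous_onI)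
    have "AE x in lebesgue. (\<lambda>n. G n x) \<longlonglongrightarrow> F x"
    proof (rule AE_I'[of Z])
      show "{x \<in> space lebesgue. \<not> (\<lambda>n. G n x) \<longlonglongrightarrow> F x} \<subseteq> Z"
      proof safe
        fix x assume "\<not> (\<lambda>n. G n x) \<longlonglongrightarrow> F x"
        show "x \<in> Z"
        proof (rule ccontr)
          assume "x \<notin> Z"
          have "(\<lambda>n. clamp (g n x)) \<longlonglongrightarrow> clamp (F x)"
            using gl[OF \<open>x \<notin> Z\<close>] cc by (rule isCont_tendsto_compose[rotated])
          then have "(\<lambda>n. G n x) \<longlonglongrightarrow> th x *\<^sub>R F x"
            unfolding G_def using ci[OF Fb] by (intro tendsto_intros) simp
          moreover have "th x *\<^sub>R F x = F x"
            using F0[of x] by (cases "norm x > real N") (auto simp: th_def)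
          ultimately show False using \<open>\<not> (\<lambda>n. G n x) \<longlonglongrightarrow> F x\<close> by simp
        qed
      qed
    qed (use Z in \<open>simp add: negligible_iff_null_sets\<close>)
    then show "AE x in lborel. (\<lambda>n. G n x) \<longlonglongrightarrow> F x" by (simp add: AE_completion_iff)
    show "AE x in lborel. norm (G n x) \<le> norm ((real N + 1) *\<^sub>R indicator (cball (0::real^3) (real N + 1)) x :: real)" for n
      using Gb[of n] G0[of _ n] by (intro AE_I2) (auto split: split_indicator simp: not_le)
  qed simp
  then have "\<forall>\<^sub>F n in sequentially. L2_norm (\<lambda>x. G n x - F x) < e/2"
    using \<open>e > 0\<close> by (intro order_tendstoD) auto
  then obtain n where n: "L2_norm (\<lambda>x. G n x - F x) < e/2"
    using eventually_happens'[OF sequentially_bot] by blast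
  have GL: "G n \<in> L2"
  proof (rule L2_norm_mono(1)[OF dom])
    show "G n \<in> borel_measurable borel" using Gc by (rule borel_measurable_continuous_onI)
    show "norm (G n x) \<le> norm ((real N + 1) *\<^sub>R indicator (cball (0::real^3) (real N + 1)) x :: real)" for x
      using Gb[of n x] G0[of x n] by (auto split: split_indicator simp: not_le)
  qed
  show ?thesis
  proof (rule that[OF Gc Gb G0])
    show "L2_norm (\<lambda>x. f x - G n x) < e"
      using L2_norm_triangle_diff[OF f FL GL] N n L2_norm_minus_commute[of f F] L2_norm_minus_commute[of "G n" F]
      by (simp add: F_def)
  qed
qed

lemma continuous_compact_support_L1_L2:
  fixes g :: "real^3 \<Rightarrow> complex"
  assumes gc: "continuous_on UNIV g" and B: "\<And>x. norm (g x) \<le> B" and R: "\<And>x. norm x > R \<Longrightarrow> g x = 0"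
  shows "g \<in> L2" "integrable lborel g"
proof -
  have [measurable]: "g \<in> borel_measurable borel" using gc by (rule borel_measurable_continuous_onI)
  have i: "integrable lborel (\<lambda>x. C * indicator (cball (0::real^3) R) x :: real)" for C
    using emeasure_bounded_finite[of "cball (0::real^3) R"] by (intro integrable_mult_right integrable_real_indicator) auto
  have "0 \<le> B" using B[of 0] norm_ge_zero order_trans by blast
  show "integrable lborel g"
    by (rule Bochner_Integration.integrable_bound[OF i[of B]])
       (use B R \<open>0 \<le> B\<close> in \<open>auto split: split_indicator simp: not_le\<close>)
  have "(norm (g x))\<^sup>2 \<le> B\<^sup>2" for x using B by (intro power_mono) auto
  then show "g \<in> L2"
    by (intro L2I Bochner_Integration.integrable_bound[OF i[of "B\<^sup>2"]])
       (use R in \<open>auto split: split_indicator simp: not_le\<close>)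
qed

text \<open>For continuous \<open>g\<close> the Gaussian averages converge pointwise, so both sides
  of the regularised identity have a limit by dominated convergence; on the Fourier side the
  majorant is supplied by \<open>fourier_integral_Bessel\<close>.\<close>

lemma fourier_integral_isometry_continuous:
  fixes g :: "real^3 \<Rightarrow> complex"
  assumes gc: "continuous_on UNIV g" and B: "\<And>x. norm (g x) \<le> B" and R: "\<And>x. norm x > R \<Longrightarrow> g x = 0"
  shows "L2_norm (fourier_integral g) = sqrt fkappa * L2_norm g"
proof -
  have gL: "g \<in> L2" "integrable lborel g"
    using continuous_compact_support_L1_L2[of g B R] gc B R by blast+
  have [measurable]: "g \<in> borel_measurable borel" using gc by (rule borel_measurable_continuous_onI)
  note FL = fourier_integral_Bessel(1)[OF gL]
  have "0 \<le> B" using B[of 0] norm_ge_zero order_trans by blast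
  let ?s = "\<lambda>n. 1 / real (Suc n)"
  let ?c = "\<lambda>n x. \<integral>w. g (x + ?s n *\<^sub>R w) * complex_of_real (gauss w) \<partial>lborel"
  have s0: "?s \<longlonglongrightarrow> 0" by (intro LIMSEQ_Suc[of "\<lambda>n. 1 / real n"] lim_1_over_n)
  have gi: "integrable lborel (\<lambda>w. B * gauss w)" using gauss_integrable by simp
  have gcb: "AE w in lborel. norm (g (y w) * complex_of_real (gauss w)) \<le> B * gauss w" for y
    using B by (intro AE_I2) (auto simp: norm_mult less_imp_le intro!: mult_right_mono)
  have c: "(\<lambda>n. ?c n x) \<longlonglongrightarrow> g x * complex_of_real (sqrt fkappa)" for x
  proof -
    have "(\<lambda>n. ?c n x) \<longlonglongrightarrow> (\<integral>w. g x * complex_of_real (gauss w) \<partial>lborel)"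
    proof (rule integral_dominated_convergence[OF _ _ gi])
      show "AE w in lborel. (\<lambda>n. g (x + ?s n *\<^sub>R w) * complex_of_real (gauss w)) \<longlonglongrightarrow> g x * complex_of_real (gauss w)"
      proof (rule AE_I2, rule tendsto_mult_right)
        fix w
        have "(\<lambda>n. x + ?s n *\<^sub>R w) \<longlonglongrightarrow> x + 0 *\<^sub>R w" by (intro tendsto_intros s0)
        then have "(\<lambda>n. x + ?s n *\<^sub>R w) \<longlonglongrightarrow> x" by simp
        moreover have "isCont g x" using gc by (simp add: continuous_on_eq_continuous_at)
        ultimately show "(\<lambda>n. g (x + ?s n *\<^sub>R w)) \<longlonglongrightarrow> g x" by (rule isCont_tendsto_compose[rotated])
      qed
    qed (use gcb in auto)
    also have "(\<integral>w. g x * complex_of_real (gauss w) \<partial>lborel) = g x * complex_of_real (sqrt fkappa)"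
      unfolding integral_mult_right_zero by (simp add: integral_complex_of_real gauss_integral)
    finally show ?thesis .
  qed
  have cb: "cmod (?c n x) \<le> B * sqrt fkappa" for n x
  proof -
    have "cmod (?c n x) \<le> (\<integral>w. cmod (g (x + ?s n *\<^sub>R w) * complex_of_real (gauss w)) \<partial>lborel)"
      by (rule integral_norm_bound)
    also have "\<dots> \<le> (\<integral>w. B * gauss w \<partial>lborel)"
      by (intro integral_mono_AE gi integrable_norm Bochner_Integration.integrable_bound[OF gi])
         (use gcb \<open>0 \<le> B\<close> in \<open>auto simp: less_imp_le elim!: eventually_mono\<close>)
    also have "\<dots> = B * sqrt fkappa" by (simp add: gauss_integral)
    finally show ?thesis .
  qed
  have "(\<lambda>n. \<integral>x. g x * cnj (?c n x) \<partial>lborel) \<longlonglongrightarrow> (\<integral>x. g x * cnj (g x * complex_of_real (sqrt fkappa)) \<partial>lborel)"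
  proof (rule integral_dominated_convergence[where w="\<lambda>x. cmod (g x) * (B * sqrt fkappa)"])
    have [measurable]: "cnj \<in> borel_measurable borel"
      by (rule borel_measurable_continuous_onI) (auto intro: continuous_intros)
    show "(\<lambda>x. g x * cnj (?c n x)) \<in> borel_measurable lborel" for n by measurable
    show "(\<lambda>x. g x * cnj (g x * complex_of_real (sqrt fkappa))) \<in> borel_measurable lborel" by measurable
    show "AE x in lborel. (\<lambda>n. g x * cnj (?c n x)) \<longlonglongrightarrow> g x * cnj (g x * complex_of_real (sqrt fkappa))"
      by (intro AE_I2 tendsto_intros c)
    show "AE x in lborel. norm (g x * cnj (?c n x)) \<le> cmod (g x) * (B * sqrt fkappa)" for n
      using cb by (intro AE_I2) (auto simp: norm_mult intro!: mult_left_mono)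
  qed (use gL in \<open>auto intro!: integrable_norm\<close>)
  also have "(\<integral>x. g x * cnj (g x * complex_of_real (sqrt fkappa)) \<partial>lborel)
      = (\<integral>x. complex_of_real (sqrt fkappa * (cmod (g x))\<^sup>2) \<partial>lborel)"
    by (rule Bochner_Integration.integral_cong) (auto simp flip: complex_norm_square)
  also have "\<dots> = complex_of_real (sqrt fkappa * (L2_norm g)\<^sup>2)"
    unfolding integral_complex_of_real L2_norm_sq by simp
  finally have lim: "(\<lambda>n. \<integral>x. g x * cnj (?c n x) \<partial>lborel) \<longlonglongrightarrow> complex_of_real (sqrt fkappa * (L2_norm g)\<^sup>2)" .
  have "(\<lambda>n. \<integral>\<xi>. (cmod (fourier_integral g \<xi>))\<^sup>2 * gauss (?s n *\<^sub>R \<xi>) \<partial>lborel) \<longlonglongrightarrow> (\<integral>\<xi>. (cmod (fourier_integral g \<xi>))\<^sup>2 * 1 \<partial>lborel)"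
  proof (rule integral_dominated_convergence[OF _ _ L2_integrable[OF FL]])
    show "AE \<xi> in lborel. (\<lambda>n. (cmod (fourier_integral g \<xi>))\<^sup>2 * gauss (?s n *\<^sub>R \<xi>)) \<longlonglongrightarrow> (cmod (fourier_integral g \<xi>))\<^sup>2 * 1"
      by (intro AE_I2 tendsto_intros gauss_scaled_tendsto)
    show "AE \<xi> in lborel. norm ((cmod (fourier_integral g \<xi>))\<^sup>2 * gauss (?s n *\<^sub>R \<xi>)) \<le> (norm (fourier_integral g \<xi>))\<^sup>2" for n
      using gauss_le_1 by (intro AE_I2) (auto simp: abs_mult less_imp_le intro!: mult_left_le)
  qed auto
  then have "(\<lambda>n. complex_of_real (\<integral>\<xi>. (cmod (fourier_integral g \<xi>))\<^sup>2 * gauss (?s n *\<^sub>R \<xi>) \<partial>lborel)) \<longlonglongrightarrow> complex_of_real ((L2_norm (fourier_integral g))\<^sup>2)"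
    by (intro tendsto_of_real) (simp add: L2_norm_sq)
  moreover have "(\<lambda>n. complex_of_real (\<integral>\<xi>. (cmod (fourier_integral g \<xi>))\<^sup>2 * gauss (?s n *\<^sub>R \<xi>) \<partial>lborel)) \<longlonglongrightarrow> complex_of_real (sqrt fkappa) * complex_of_real (sqrt fkappa * (L2_norm g)\<^sup>2)"
  proof -
    have pos: "?s n > 0" for n by simp
    show ?thesis
      unfolding fourier_integral_gauss_regularised[OF gL(2) pos] by (intro tendsto_intros lim)
  qed
  ultimately have "complex_of_real ((L2_norm (fourier_integral g))\<^sup>2) = complex_of_real (sqrt fkappa) * complex_of_real (sqrt fkappa * (L2_norm g)\<^sup>2)"
    by (rule LIMSEQ_unique)
  then have "(L2_norm (fourier_integral g))\<^sup>2 = (sqrt fkappa * L2_norm g)\<^sup>2"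
    unfolding of_real_mult[symmetric] of_real_eq_iff by (simp add: power2_eq_square)
  then show ?thesis by (subst (asm) power2_eq_iff_nonneg) (auto simp: less_imp_le)
qed

lemma fourier_integral_isometry:
  assumes f: "f \<in> L2" and fi: "integrable lborel f"
  shows "L2_norm (fourier_integral f) = sqrt fkappa * L2_norm f"
proof (rule antisym[OF fourier_integral_Bessel(2)[OF f fi]], rule field_le_epsilon)
  fix e :: real assume "e > 0"
  define d where "d = e / (2 * sqrt fkappa)"
  have "d > 0" using \<open>e > 0\<close> by (simp add: d_def)
  obtain g B R where g: "continuous_on UNIV g" "\<And>x. norm (g x) \<le> B" "\<And>x. norm x > R \<Longrightarrow> g x = 0"
    and d: "L2_norm (\<lambda>x. f x - g x) < d"
    using L2_continuous_compact_support_dense[OF f \<open>d > 0\<close>] by blast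
  have gL: "g \<in> L2" "integrable lborel g"
    using continuous_compact_support_L1_L2[of g B R] g by blast+
  have D: "(\<lambda>x. f x - g x) \<in> L2" "integrable lborel (\<lambda>x. f x - g x)" using f fi gL by auto
  have "L2_norm (\<lambda>\<xi>. fourier_integral f \<xi> - fourier_integral g \<xi>) \<le> sqrt fkappa * L2_norm (\<lambda>x. f x - g x)"
    using fourier_integral_Bessel(2)[OF D] unfolding fourier_integral_diff[OF fi gL(2), abs_def] .
  also have "\<dots> \<le> sqrt fkappa * d" using d by (intro mult_left_mono) (auto simp: less_imp_le)
  finally have 1: "L2_norm (\<lambda>\<xi>. fourier_integral f \<xi> - fourier_integral g \<xi>) \<le> e/2"
    by (simp add: d_def)
  have "sqrt fkappa * L2_norm f \<le> sqrt fkappa * (L2_norm g + d)"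
    using L2_norm_triangle_sub[OF f gL(1)] d by (intro mult_left_mono) (auto simp: less_imp_le)
  also have "\<dots> = L2_norm (fourier_integral g) + e/2"
    using fourier_integral_isometry_continuous[of g B R] g by (simp add: d_def ring_distribs)
  also have "\<dots> \<le> L2_norm (fourier_integral f) + e/2 + e/2"
    using L2_norm_triangle_sub[OF fourier_integral_Bessel(1)[OF gL] fourier_integral_Bessel(1)[OF f fi]]
      L2_norm_minus_commute[of "fourier_integral f" "fourier_integral g"] 1 by simp
  finally show "sqrt fkappa * L2_norm f \<le> L2_norm (fourier_integral f) + e" by simp
qed

section \<open>Extension of the transform to L2\<close>

lemma is_fourier_L2_iff:
  assumes f: "f \<in> L2" and F: "F \<in> L2"
  shows "is_fourier_L2 f F \<longleftrightarrow>
    (\<lambda>n. L2_norm (\<lambda>\<xi>. fourier_integral (\<lambda>x. indicator (cball 0 (real n)) x *\<^sub>R f x) \<xi> - F \<xi>)) \<longlonglongrightarrow> 0"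
proof -
  let ?f = "\<lambda>n x. indicator (cball 0 (real n)) x *\<^sub>R f x"
  have cb: "cball (0::real^3) (real n) \<in> sets borel" for n by (intro borel_closed closed_cball)
  have FL: "fourier_integral (?f n) \<in> L2" for n
    by (intro fourier_integral_Bessel L2_truncate f L2_compact_support_integrable cb)
  have "(\<integral>\<^sup>+\<xi>. ennreal ((cmod (F \<xi> - fourier_integral (?f n) \<xi>))\<^sup>2) \<partial>lborel)
      = ennreal ((L2_norm (\<lambda>\<xi>. fourier_integral (?f n) \<xi> - F \<xi>))\<^sup>2)" for n
    using L2_norm_sq_ennreal[OF L2_diff[OF FL F], of n] by (simp add: norm_minus_commute)
  then have "is_fourier_L2 f F \<longleftrightarrow> (\<lambda>n. ennreal ((L2_norm (\<lambda>\<xi>. fourier_integral (?f n) \<xi> - F \<xi>))\<^sup>2)) \<longlonglongrightarrow> ennreal 0"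
    using f F by (simp add: is_fourier_L2_def)
  also have "\<dots> \<longleftrightarrow> (\<lambda>n. (L2_norm (\<lambda>\<xi>. fourier_integral (?f n) \<xi> - F \<xi>))\<^sup>2) \<longlonglongrightarrow> 0"
    by (rule tendsto_ennreal_iff) auto
  also have "\<dots> \<longleftrightarrow> (\<lambda>n. L2_norm (\<lambda>\<xi>. fourier_integral (?f n) \<xi> - F \<xi>)) \<longlonglongrightarrow> 0"
    using tendsto_real_sqrt[of "\<lambda>n. (L2_norm (\<lambda>\<xi>. fourier_integral (?f n) \<xi> - F \<xi>))\<^sup>2" 0 sequentially]
      tendsto_power[of "\<lambda>n. L2_norm (\<lambda>\<xi>. fourier_integral (?f n) \<xi> - F \<xi>)" 0 sequentially 2] by auto
  finally show ?thesis .
qed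

lemma fourier_truncations_L2:
  assumes f: "f \<in> L2"
  shows "(\<lambda>x. indicator (cball 0 R) x *\<^sub>R f x) \<in> L2" "integrable lborel (\<lambda>x. indicator (cball 0 R) x *\<^sub>R f x)"
    "fourier_integral (\<lambda>x. indicator (cball 0 R) x *\<^sub>R f x) \<in> L2"
proof -
  have cb: "cball (0::real^3) R \<in> sets borel" by (intro borel_closed closed_cball)
  show "(\<lambda>x. indicator (cball 0 R) x *\<^sub>R f x) \<in> L2" "integrable lborel (\<lambda>x. indicator (cball 0 R) x *\<^sub>R f x)"
    "fourier_integral (\<lambda>x. indicator (cball 0 R) x *\<^sub>R f x) \<in> L2"
    by (intro fourier_integral_Bessel L2_truncate f L2_compact_support_integrable cb)+
qed

lemma truncations_tendsto:
  fixes f :: "real^3 \<Rightarrow> 'b::euclidean_space"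
  assumes f: "f \<in> L2"
  shows "(\<lambda>n. L2_norm (\<lambda>x. indicator (cball 0 (real n)) x *\<^sub>R f x - f x)) \<longlonglongrightarrow> 0"
  by (rule L2_truncate_tendsto[OF f borel_closed[OF closed_cball] eventually_in_cball])

lemma L2_norm_fourier_diff:
  assumes "f \<in> L2" "integrable lborel f" "g \<in> L2" "integrable lborel g"
  shows "L2_norm (\<lambda>\<xi>. fourier_integral f \<xi> - fourier_integral g \<xi>) = sqrt fkappa * L2_norm (\<lambda>x. f x - g x)"
proof -
  have "fourier_integral (\<lambda>x. f x - g x) = (\<lambda>\<xi>. fourier_integral f \<xi> - fourier_integral g \<xi>)"
    by (rule ext) (rule fourier_integral_diff[OF assms(2,4)])
  with fourier_integral_isometry[of "\<lambda>x. f x - g x"] assms show ?thesis by (simp add: L2_diff)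
qed

lemma fourier_L2_exists:
  assumes f: "f \<in> L2"
  shows "\<exists>F. is_fourier_L2 f F"
proof -
  let ?f = "\<lambda>n x. indicator (cball 0 (real n)) x *\<^sub>R f x"
  note T = fourier_truncations_L2[OF f]
  have "\<exists>N. \<forall>m\<ge>N. \<forall>n\<ge>N. L2_norm (\<lambda>\<xi>. fourier_integral (?f m) \<xi> - fourier_integral (?f n) \<xi>) < e" if "e > 0" for e
  proof -
    have "\<forall>\<^sub>F n in sequentially. L2_norm (\<lambda>x. ?f n x - f x) < e / (2 * sqrt fkappa)"
      using truncations_tendsto[OF f] that by (intro order_tendstoD) (auto simp: less_imp_le)
    then obtain N where N: "\<And>n. n \<ge> N \<Longrightarrow> L2_norm (\<lambda>x. ?f n x - f x) < e / (2 * sqrt fkappa)"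
      by (auto simp: eventually_sequentially)
    have "L2_norm (\<lambda>\<xi>. fourier_integral (?f m) \<xi> - fourier_integral (?f n) \<xi>) < e" if mn: "m \<ge> N" "n \<ge> N" for m n
    proof -
      have "L2_norm (\<lambda>x. ?f m x - ?f n x) < e / (2 * sqrt fkappa) + e / (2 * sqrt fkappa)"
        using L2_norm_triangle_diff[OF T(1) f T(1), of "real m" "real n"] N[OF mn(1)] N[OF mn(2)] L2_norm_minus_commute[of "?f n" f]
        by linarith
      also have "\<dots> = e / sqrt fkappa" by simp
      finally show ?thesis
        unfolding L2_norm_fourier_diff[OF T(1,2) T(1,2)] by (simp add: pos_less_divide_eq mult.commute)
    qed
    then show ?thesis by blast
  qed
  from L2_complete[OF T(3) this] obtain F where "F \<in> L2"
    "(\<lambda>n. L2_norm (\<lambda>\<xi>. fourier_integral (?f n) \<xi> - F \<xi>)) \<longlonglongrightarrow> 0" by blast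
  then show ?thesis using is_fourier_L2_iff[OF f] by blast
qed

text \<open>A chosen representative, determined up to a null set; this is why the rules for
  \<open>FT\<close> hold almost everywhere only.\<close>

definition FT :: "(real^3 \<Rightarrow> complex) \<Rightarrow> real^3 \<Rightarrow> complex" where
  "FT f = (SOME F. is_fourier_L2 f F)"

lemma is_fourier_FT: "f \<in> L2 \<Longrightarrow> is_fourier_L2 f (FT f)"
  unfolding FT_def by (rule someI_ex[OF fourier_L2_exists])

lemma FT_L2 [intro]: "f \<in> L2 \<Longrightarrow> FT f \<in> L2"
  using is_fourier_FT by (auto simp: is_fourier_L2_def)

lemma is_fourier_L2_D: "is_fourier_L2 f F \<Longrightarrow> f \<in> L2" "is_fourier_L2 f F \<Longrightarrow> F \<in> L2"
  by (auto simp: is_fourier_L2_def)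

lemma is_fourier_L2_unique: "is_fourier_L2 f F \<Longrightarrow> AE \<xi> in lborel. F \<xi> = FT f \<xi>"
proof -
  assume F: "is_fourier_L2 f F"
  note L = is_fourier_L2_D[OF F]
  show ?thesis
    by (rule L2_LIMSEQ_unique[OF fourier_truncations_L2(3)[OF L(1)] L(2) FT_L2[OF L(1)]])
       (use F is_fourier_FT[OF L(1)] in \<open>auto simp: is_fourier_L2_iff[OF L] is_fourier_L2_iff[OF L(1) FT_L2[OF L(1)]]\<close>)
qed

text \<open>The transform is freed from the particular truncations in its definition. In
  \<open>FT_scale\<close> the approximants are dilated truncations, and a constant sequence gives
  \<open>FT_eq_fourier_integral\<close>.\<close>

lemma FT_tendsto:
  assumes f: "f \<in> L2" and g: "\<And>n. g n \<in> L2" "\<And>n. integrable lborel (g n)"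
    and lim: "(\<lambda>n. L2_norm (\<lambda>x. g n x - f x)) \<longlonglongrightarrow> 0"
  shows "(\<lambda>n. L2_norm (\<lambda>\<xi>. fourier_integral (g n) \<xi> - FT f \<xi>)) \<longlonglongrightarrow> 0"
proof -
  let ?f = "\<lambda>n x. indicator (cball 0 (real n)) x *\<^sub>R f x"
  note T = fourier_truncations_L2[OF f]
  have a: "(\<lambda>n. L2_norm (\<lambda>\<xi>. fourier_integral (?f n) \<xi> - FT f \<xi>)) \<longlonglongrightarrow> 0"
    using is_fourier_FT[OF f] is_fourier_L2_iff[OF f FT_L2[OF f]] by simp
  have b: "(\<lambda>n. sqrt fkappa * (L2_norm (\<lambda>x. g n x - f x) + L2_norm (\<lambda>x. ?f n x - f x))
       + L2_norm (\<lambda>\<xi>. fourier_integral (?f n) \<xi> - FT f \<xi>)) \<longlonglongrightarrow> sqrt fkappa * (0 + 0) + 0"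
    by (intro tendsto_intros lim truncations_tendsto f a)
  show ?thesis
  proof (rule Lim_null_comparison[OF always_eventually])
    show "\<forall>n. norm (L2_norm (\<lambda>\<xi>. fourier_integral (g n) \<xi> - FT f \<xi>)) \<le> sqrt fkappa * (L2_norm (\<lambda>x. g n x - f x) + L2_norm (\<lambda>x. ?f n x - f x))
       + L2_norm (\<lambda>\<xi>. fourier_integral (?f n) \<xi> - FT f \<xi>)"
    proof
      fix n
      have "L2_norm (\<lambda>\<xi>. fourier_integral (g n) \<xi> - FT f \<xi>) \<le>
          sqrt fkappa * L2_norm (\<lambda>x. g n x - ?f n x) + L2_norm (\<lambda>\<xi>. fourier_integral (?f n) \<xi> - FT f \<xi>)"
        using L2_norm_triangle_diff[OF fourier_integral_Bessel(1)[OF g] T(3) FT_L2[OF f], of n "real n"]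
          L2_norm_fourier_diff[OF g T(1,2), of n "real n"] by simp
      moreover have "sqrt fkappa * L2_norm (\<lambda>x. g n x - ?f n x) \<le> sqrt fkappa * (L2_norm (\<lambda>x. g n x - f x) + L2_norm (\<lambda>x. ?f n x - f x))"
        using L2_norm_triangle_diff[OF g(1) f T(1), of n "real n"] L2_norm_minus_commute[of f "?f n"]
        by (intro mult_left_mono) (auto simp: less_imp_le)
      ultimately show "norm (L2_norm (\<lambda>\<xi>. fourier_integral (g n) \<xi> - FT f \<xi>)) \<le> sqrt fkappa * (L2_norm (\<lambda>x. g n x - f x) + L2_norm (\<lambda>x. ?f n x - f x))
       + L2_norm (\<lambda>\<xi>. fourier_integral (?f n) \<xi> - FT f \<xi>)" unfolding real_norm_def abs_of_nonneg[OF L2_norm_nonneg] by linarith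
    qed
  qed (use b in simp)
qed

lemma FT_eq_fourier_integral:
  assumes "f \<in> L2" "integrable lborel f"
  shows "AE \<xi> in lborel. FT f \<xi> = fourier_integral f \<xi>"
proof -
  have "(\<lambda>n::nat. L2_norm (\<lambda>\<xi>. fourier_integral f \<xi> - FT f \<xi>)) \<longlonglongrightarrow> 0"
    by (rule FT_tendsto) (use assms in auto)
  then have "L2_norm (\<lambda>\<xi>. fourier_integral f \<xi> - FT f \<xi>) = 0" by (simp add: LIMSEQ_const_iff)
  then show ?thesis
    using L2_eq_AE_iff[OF fourier_integral_Bessel(1)[OF assms] FT_L2[OF assms(1)]] by (auto elim: eventually_mono)
qed

theorem Plancherel:
  assumes f: "f \<in> L2"
  shows "L2_norm (FT f) = sqrt fkappa * L2_norm f"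
proof -
  let ?f = "\<lambda>n x. indicator (cball 0 (real n)) x *\<^sub>R f x"
  note T = fourier_truncations_L2[OF f]
  have "(\<lambda>n. L2_norm (fourier_integral (?f n))) \<longlonglongrightarrow> L2_norm (FT f)"
    by (rule tendsto_L2_norm[OF T(3) FT_L2[OF f] FT_tendsto[OF f T(1,2) truncations_tendsto[OF f]]])
  moreover have "(\<lambda>n. L2_norm (fourier_integral (?f n))) \<longlonglongrightarrow> sqrt fkappa * L2_norm f"
    unfolding fourier_integral_isometry[OF T(1,2)]
    by (intro tendsto_intros tendsto_L2_norm[OF T(1) f truncations_tendsto[OF f]])
  ultimately show ?thesis by (rule LIMSEQ_unique)
qed

section \<open>Linearity, Parseval's identity and the multiplication formula\<close>

lemma L2_tendsto_add:
  fixes f g :: "real^3 \<Rightarrow> 'b::euclidean_space"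
  assumes "\<And>n. F n \<in> L2" "\<And>n. G n \<in> L2" "f \<in> L2" "g \<in> L2"
    and "(\<lambda>n. L2_norm (\<lambda>x. F n x - f x)) \<longlonglongrightarrow> 0" "(\<lambda>n. L2_norm (\<lambda>x. G n x - g x)) \<longlonglongrightarrow> 0"
  shows "(\<lambda>n. L2_norm (\<lambda>x. (F n x + G n x) - (f x + g x))) \<longlonglongrightarrow> 0"
proof (rule Lim_null_comparison[OF always_eventually])
  show "\<forall>n. norm (L2_norm (\<lambda>x. (F n x + G n x) - (f x + g x))) \<le> L2_norm (\<lambda>x. F n x - f x) + L2_norm (\<lambda>x. G n x - g x)"
  proof
    fix n show "norm (L2_norm (\<lambda>x. (F n x + G n x) - (f x + g x))) \<le> L2_norm (\<lambda>x. F n x - f x) + L2_norm (\<lambda>x. G n x - g x)"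
      using L2_norm_triangle[OF L2_diff[OF assms(1,3)] L2_diff[OF assms(2,4)], of n n]
      by (simp add: algebra_simps)
  qed
  show "(\<lambda>n. L2_norm (\<lambda>x. F n x - f x) + L2_norm (\<lambda>x. G n x - g x)) \<longlonglongrightarrow> 0"
    by (rule tendsto_add_zero[OF assms(5,6)])
qed

lemma FT_add:
  assumes f: "f \<in> L2" and g: "g \<in> L2"
  shows "AE \<xi> in lborel. FT (\<lambda>x. f x + g x) \<xi> = FT f \<xi> + FT g \<xi>"
proof -
  let ?t = "\<lambda>f n x. indicator (cball 0 (real n)) x *\<^sub>R (f x :: complex)"
  note Tf = fourier_truncations_L2[OF f] and Tg = fourier_truncations_L2[OF g]
  have fg: "(\<lambda>x. f x + g x) \<in> L2" using f g by auto
  have eq: "fourier_integral (\<lambda>x. ?t f n x + ?t g n x) = (\<lambda>\<xi>. fourier_integral (?t f n) \<xi> + fourier_integral (?t g n) \<xi>)" for n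
    by (rule ext) (rule fourier_integral_add[OF Tf(2) Tg(2)])
  have "(\<lambda>n. L2_norm (\<lambda>\<xi>. fourier_integral (\<lambda>x. ?t f n x + ?t g n x) \<xi> - FT (\<lambda>x. f x + g x) \<xi>)) \<longlonglongrightarrow> 0"
    by (intro FT_tendsto[OF fg] L2_add Tf Tg Bochner_Integration.integrable_add L2_tendsto_add f g truncations_tendsto)
  then have 1: "(\<lambda>n. L2_norm (\<lambda>\<xi>. (fourier_integral (?t f n) \<xi> + fourier_integral (?t g n) \<xi>) - FT (\<lambda>x. f x + g x) \<xi>)) \<longlonglongrightarrow> 0"
    unfolding eq .
  have 2: "(\<lambda>n. L2_norm (\<lambda>\<xi>. (fourier_integral (?t f n) \<xi> + fourier_integral (?t g n) \<xi>) - (FT f \<xi> + FT g \<xi>))) \<longlonglongrightarrow> 0"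
    by (intro L2_tendsto_add Tf Tg FT_L2 f g FT_tendsto truncations_tendsto)
  show ?thesis
    by (rule L2_LIMSEQ_unique[OF _ _ _ 1 2]) (intro L2_add Tf Tg FT_L2 f g)+
qed

lemma FT_cmult:
  assumes f: "f \<in> L2"
  shows "AE \<xi> in lborel. FT (\<lambda>x. c * f x) \<xi> = c * FT f \<xi>"
proof -
  let ?f = "\<lambda>n x. indicator (cball 0 (real n)) x *\<^sub>R f x"
  note T = fourier_truncations_L2[OF f]
  have eq: "fourier_integral (\<lambda>x. c * ?f n x) = (\<lambda>\<xi>. c * fourier_integral (?f n) \<xi>)" for n
    by (rule ext) (rule fourier_integral_cmult)
  have n: "L2_norm (\<lambda>x. c * F x - c * G x) = cmod c * L2_norm (\<lambda>x. F x - G x)" for F G :: "real^3 \<Rightarrow> complex"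
    using L2_norm_cmult[of c "\<lambda>x. F x - G x"] by (simp add: right_diff_distrib)
  have "(\<lambda>n. L2_norm (\<lambda>\<xi>. fourier_integral (\<lambda>x. c * ?f n x) \<xi> - FT (\<lambda>x. c * f x) \<xi>)) \<longlonglongrightarrow> 0"
  proof (intro FT_tendsto L2_cmult f T)
    show "integrable lborel (\<lambda>x. c * ?f n x)" for n using T(2) by (rule integrable_mult_right)
    show "(\<lambda>n. L2_norm (\<lambda>x. c * ?f n x - c * f x)) \<longlonglongrightarrow> 0"
      unfolding n by (rule tendsto_mult_right_zero[OF truncations_tendsto[OF f]])
  qed
  then have 1: "(\<lambda>n. L2_norm (\<lambda>\<xi>. c * fourier_integral (?f n) \<xi> - FT (\<lambda>x. c * f x) \<xi>)) \<longlonglongrightarrow> 0"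
    unfolding eq .
  have 2: "(\<lambda>n. L2_norm (\<lambda>\<xi>. c * fourier_integral (?f n) \<xi> - c * FT f \<xi>)) \<longlonglongrightarrow> 0"
    unfolding n by (rule tendsto_mult_right_zero[OF FT_tendsto[OF f T(1,2) truncations_tendsto[OF f]]])
  show ?thesis
    by (rule L2_LIMSEQ_unique[OF _ _ _ 1 2]) (intro L2_cmult T FT_L2 f)+
qed

lemma FT_diff:
  assumes f: "f \<in> L2" and g: "g \<in> L2"
  shows "AE \<xi> in lborel. FT (\<lambda>x. f x - g x) \<xi> = FT f \<xi> - FT g \<xi>"
  using FT_add[OF f L2_cmult[OF g, of "-1"]] FT_cmult[OF g, of "-1"] by eventually_elim simp

theorem Parseval:
  assumes f: "f \<in> L2" and g: "g \<in> L2"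
  shows "rip (FT f) (FT g) = fkappa * rip f g"
proof -
  have fg: "(\<lambda>x. f x + g x) \<in> L2" using f g by auto
  have "L2_norm (\<lambda>\<xi>. FT f \<xi> + FT g \<xi>) = L2_norm (FT (\<lambda>x. f x + g x))"
    using FT_add[OF f g] by (intro L2_norm_cong_AE L2_measurable L2_add FT_L2 f g fg) (auto elim: eventually_mono)
  also have "\<dots> = sqrt fkappa * L2_norm (\<lambda>x. f x + g x)" by (rule Plancherel[OF fg])
  finally have "(L2_norm (\<lambda>\<xi>. FT f \<xi> + FT g \<xi>))\<^sup>2 = fkappa * (L2_norm (\<lambda>x. f x + g x))\<^sup>2"
    by (simp add: power_mult_distrib)
  then show ?thesis
    unfolding L2_norm_add_sq[OF f g] L2_norm_add_sq[OF FT_L2[OF f] FT_L2[OF g]] Plancherel[OF f] Plancherel[OF g]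
    by (simp add: power_mult_distrib ring_distribs)
qed

lemma L2_complex_mult_integrable:
  fixes f g :: "real^3 \<Rightarrow> complex"
  assumes "f \<in> L2" "g \<in> L2"
  shows "integrable lborel (\<lambda>x. f x * g x)"
  by (rule Bochner_Integration.integrable_bound[OF L2_mult_integrable[OF assms]])
     (use L2_measurable[OF assms(1)] L2_measurable[OF assms(2)] in \<open>auto simp: norm_mult\<close>)

lemma L2_complex_mult_bound:
  fixes f g :: "real^3 \<Rightarrow> complex"
  assumes "f \<in> L2" "g \<in> L2"
  shows "cmod (\<integral>x. f x * g x \<partial>lborel) \<le> L2_norm f * L2_norm g"
proof -
  have "cmod (\<integral>x. f x * g x \<partial>lborel) \<le> (\<integral>x. cmod (f x * g x) \<partial>lborel)" by (rule integral_norm_bound)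
  also have "\<dots> \<le> L2_norm f * L2_norm g"
    unfolding norm_mult by (rule L2_Cauchy_Schwarz[OF assms])
  finally show ?thesis .
qed

lemma tendsto_L2_complex_mult:
  fixes f g :: "real^3 \<Rightarrow> complex"
  assumes F: "\<And>n. F n \<in> L2" and G: "\<And>n. G n \<in> L2" and f: "f \<in> L2" and g: "g \<in> L2"
    and lF: "(\<lambda>n. L2_norm (\<lambda>x. F n x - f x)) \<longlonglongrightarrow> 0" and lG: "(\<lambda>n. L2_norm (\<lambda>x. G n x - g x)) \<longlonglongrightarrow> 0"
  shows "(\<lambda>n. \<integral>x. F n x * G n x \<partial>lborel) \<longlonglongrightarrow> (\<integral>x. f x * g x \<partial>lborel)"
proof -
  have "(\<lambda>n. (\<integral>x. F n x * G n x \<partial>lborel) - (\<integral>x. f x * g x \<partial>lborel)) \<longlonglongrightarrow> 0"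
  proof (rule Lim_null_comparison[OF always_eventually])
    show "\<forall>n. norm ((\<integral>x. F n x * G n x \<partial>lborel) - (\<integral>x. f x * g x \<partial>lborel))
       \<le> L2_norm (\<lambda>x. F n x - f x) * L2_norm (G n) + L2_norm f * L2_norm (\<lambda>x. G n x - g x)"
    proof
      fix n
      have "(\<integral>x. F n x * G n x \<partial>lborel) - (\<integral>x. f x * g x \<partial>lborel)
          = (\<integral>x. (F n x - f x) * G n x \<partial>lborel) + (\<integral>x. f x * (G n x - g x) \<partial>lborel)"
        using F[of n] G[of n] f g
        by (simp add: left_diff_distrib right_diff_distrib L2_complex_mult_integrable)
      also have "norm \<dots> \<le> L2_norm (\<lambda>x. F n x - f x) * L2_norm (G n) + L2_norm f * L2_norm (\<lambda>x. G n x - g x)"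
        by (intro order_trans[OF norm_triangle_ineq] add_mono L2_complex_mult_bound L2_diff F G f g)
      finally show "norm ((\<integral>x. F n x * G n x \<partial>lborel) - (\<integral>x. f x * g x \<partial>lborel))
       \<le> L2_norm (\<lambda>x. F n x - f x) * L2_norm (G n) + L2_norm f * L2_norm (\<lambda>x. G n x - g x)" .
    qed
    have "(\<lambda>n. L2_norm (\<lambda>x. F n x - f x) * L2_norm (G n) + L2_norm f * L2_norm (\<lambda>x. G n x - g x)) \<longlonglongrightarrow> 0 * L2_norm g + L2_norm f * 0"
      by (intro tendsto_intros lF lG tendsto_L2_norm[OF G g lG])
    then show "(\<lambda>n. L2_norm (\<lambda>x. F n x - f x) * L2_norm (G n) + L2_norm f * L2_norm (\<lambda>x. G n x - g x)) \<longlonglongrightarrow> 0"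
      by simp
  qed
  then show ?thesis by (simp add: LIM_zero_iff)
qed

lemma FT_mult_formula:
  assumes f: "f \<in> L2" and g: "g \<in> L2"
  shows "(\<integral>\<xi>. FT f \<xi> * g \<xi> \<partial>lborel) = (\<integral>x. f x * FT g x \<partial>lborel)"
proof -
  let ?t = "\<lambda>f n x. indicator (cball 0 (real n)) x *\<^sub>R (f x :: complex)"
  note Tf = fourier_truncations_L2[OF f] and Tg = fourier_truncations_L2[OF g]
  have 1: "(\<lambda>n. \<integral>\<xi>. fourier_integral (?t f n) \<xi> * ?t g n \<xi> \<partial>lborel) \<longlonglongrightarrow> (\<integral>\<xi>. FT f \<xi> * g \<xi> \<partial>lborel)"
    by (intro tendsto_L2_complex_mult Tf Tg FT_L2 f g FT_tendsto truncations_tendsto)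
  have 2: "(\<lambda>n. \<integral>\<xi>. ?t f n \<xi> * fourier_integral (?t g n) \<xi> \<partial>lborel) \<longlonglongrightarrow> (\<integral>\<xi>. f \<xi> * FT g \<xi> \<partial>lborel)"
    by (intro tendsto_L2_complex_mult Tf Tg FT_L2 f g FT_tendsto truncations_tendsto)
  show ?thesis
    by (rule LIMSEQ_unique[OF 1]) (use 2 in \<open>simp only: fourier_integral_mult_formula[OF Tf(2) Tg(2)]\<close>)
qed

section \<open>Inversion and behaviour under dilation\<close>

lemma rip_eq_Re:
  fixes f g :: "real^3 \<Rightarrow> complex"
  assumes "f \<in> L2" "g \<in> L2"
  shows "rip f g = Re (\<integral>x. f x * cnj (g x) \<partial>lborel)"
proof -
  have "rip f g = (\<integral>x. Re (f x * cnj (g x)) \<partial>lborel)"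
    unfolding rip_def by (simp add: inner_complex_def)
  also have "\<dots> = Re (\<integral>x. f x * cnj (g x) \<partial>lborel)"
    by (rule integral_Re) (intro L2_complex_mult_integrable L2_cnj assms)
  finally show ?thesis .
qed

text \<open>Conjugation before and after the transform reverses the sign in the exponent of the
  kernel, so this is the usual inverse transform.\<close>

definition Finv :: "(real^3 \<Rightarrow> complex) \<Rightarrow> real^3 \<Rightarrow> complex" where
  "Finv F x = cnj (FT (\<lambda>\<xi>. cnj (F \<xi>)) x) / complex_of_real fkappa"

lemma Finv_L2 [intro]: "F \<in> L2 \<Longrightarrow> Finv F \<in> L2"
  using L2_cmult[OF L2_cnj[OF FT_L2[OF L2_cnj]], of F "1 / complex_of_real fkappa"]
  by (simp add: Finv_def[abs_def])

text \<open>By the multiplication formula \<open>cnj \<circ> FT \<circ> cnj\<close> is the adjoint of \<open>FT\<close>, and an isometry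
  composed with its adjoint is the identity; no kernel is needed for the inversion.\<close>

lemma Finv_FT:
  assumes f: "f \<in> L2"
  shows "AE x in lborel. Finv (FT f) x = f x"
proof -
  define h where "h x = cnj (FT (\<lambda>\<xi>. cnj (FT f \<xi>)) x)" for x
  have c: "(\<lambda>\<xi>. cnj (FT f \<xi>)) \<in> L2" using f by auto
  have hL: "h \<in> L2" unfolding h_def using c by auto
  have "L2_norm h = sqrt fkappa * (sqrt fkappa * L2_norm f)"
    unfolding h_def by (simp add: Plancherel[OF c] Plancherel[OF f])
  then have hn: "(L2_norm h)\<^sup>2 = fkappa\<^sup>2 * (L2_norm f)\<^sup>2"
    by (simp add: power_mult_distrib power2_eq_square[of fkappa])
  have "rip f h = Re (\<integral>x. f x * FT (\<lambda>\<xi>. cnj (FT f \<xi>)) x \<partial>lborel)"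
    by (simp add: rip_eq_Re[OF f hL] h_def)
  also have "(\<integral>x. f x * FT (\<lambda>\<xi>. cnj (FT f \<xi>)) x \<partial>lborel) = (\<integral>\<xi>. FT f \<xi> * cnj (FT f \<xi>) \<partial>lborel)"
    by (rule FT_mult_formula[OF f c, symmetric])
  also have "Re \<dots> = (L2_norm (FT f))\<^sup>2"
    using rip_eq_Re[OF FT_L2[OF f] FT_L2[OF f]] by (simp add: rip_self)
  also have "\<dots> = fkappa * (L2_norm f)\<^sup>2" by (simp add: Plancherel[OF f] power_mult_distrib)
  finally have rp: "rip f h = fkappa * (L2_norm f)\<^sup>2" .
  \<comment> \<open>Equality in Cauchy-Schwarz: all three terms of the expanded square are multiples
    of \<open>fkappa\<^sup>2 * (L2_norm f)\<^sup>2\<close>, with factors 1, -2 and 1.\<close>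
  have "(L2_norm (\<lambda>x. fkappa *\<^sub>R f x - h x))\<^sup>2 = 0"
    by (simp add: L2_norm_diff_sq L2_scaleR f hL hn rp rip_scaleR_left L2_norm_scaleR power_mult_distrib)
       (simp add: power2_eq_square)
  then have "AE x in lborel. fkappa *\<^sub>R f x = h x"
    using L2_eq_AE_iff[OF L2_scaleR[OF f] hL] by simp
  then show ?thesis
  proof eventually_elim
    case (elim x)
    have "Finv (FT f) x = h x / complex_of_real fkappa" by (simp add: Finv_def h_def)
    also have "\<dots> = f x" unfolding elim[symmetric] by (simp add: scaleR_conv_of_real)
    finally show ?case .
  qed
qed

text \<open>Conjugation interchanges the two compositions of \<open>FT\<close> and
  \<open>Finv\<close>, so this is \<open>Finv_FT\<close> for the conjugate of
  \<open>F\<close>.\<close>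

lemma FT_Finv:
  assumes F: "F \<in> L2"
  shows "AE \<xi> in lborel. FT (Finv F) \<xi> = F \<xi>"
proof -
  have cF: "(\<lambda>\<xi>. cnj (F \<xi>)) \<in> L2" using F by auto
  define h where "h x = cnj (FT (\<lambda>\<xi>. cnj (F \<xi>)) x)" for x
  have hL: "h \<in> L2" unfolding h_def using cF by auto
  have e: "Finv F = (\<lambda>x. (1 / complex_of_real fkappa) * h x)" by (simp add: Finv_def[abs_def] h_def)
  from FT_cmult[OF hL, of "1 / complex_of_real fkappa"] Finv_FT[OF cF]
  show ?thesis
  proof eventually_elim
    case (elim x)
    have "Finv (FT (\<lambda>\<xi>. cnj (F \<xi>))) x = cnj (FT h x) / complex_of_real fkappa"
      by (simp add: Finv_def h_def[abs_def])
    with elim(2) have "cnj (FT h x) / complex_of_real fkappa = cnj (F x)" by simp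
    then have "cnj (FT h x / complex_of_real fkappa) = cnj (F x)" by simp
    then have "FT h x / complex_of_real fkappa = F x" by (simp only: complex_cnj_cancel_iff)
    with elim(1) show ?case unfolding e by simp
  qed
qed

lemma FT_inj:
  assumes "f \<in> L2" "AE \<xi> in lborel. FT f \<xi> = 0"
  shows "AE x in lborel. f x = 0"
proof -
  have "L2_norm (FT f) = 0" using L2_norm_eq_0[OF FT_L2[OF assms(1)]] assms(2) by simp
  then have "L2_norm f = 0" by (simp add: Plancherel[OF assms(1)])
  then show ?thesis using L2_norm_eq_0[OF assms(1)] by simp
qed

lemma FT_scale:
  assumes f: "f \<in> L2" and "t > 0"
  shows "AE \<xi> in lborel. FT (\<lambda>x. f (t *\<^sub>R x)) \<xi> = complex_of_real (1/t^3) * FT f ((1/t) *\<^sub>R \<xi>)"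
proof -
  let ?f = "\<lambda>n x. indicator (cball 0 (real n)) x *\<^sub>R f x"
  note T = fourier_truncations_L2[OF f]
  let ?g = "\<lambda>n x. ?f n (t *\<^sub>R x)"
  have [measurable]: "?f n \<in> borel_measurable borel" for n using T(1) by (rule L2_measurable)
  have g: "?g n \<in> L2" for n using L2_scale_shift(1)[OF T(1) \<open>t > 0\<close>, of "real n" 0] by simp
  have gi: "integrable lborel (?g n)" for n
    using lborel_scale_shift(2)[of "?f n" t 0] T(2) \<open>t > 0\<close> by simp
  have ft: "(\<lambda>x. f (t *\<^sub>R x)) \<in> L2" using L2_scale_shift(1)[OF f \<open>t > 0\<close>, of 0] by simp
  have Fg: "fourier_integral (?g n) \<xi> = complex_of_real (1/t^3) * fourier_integral (?f n) ((1/t) *\<^sub>R \<xi>)" for n \<xi>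
  proof -
    have "fourier_integral (?g n) \<xi> = (\<integral>x. (\<lambda>y. exp (- \<i> * complex_of_real (y \<bullet> ((1/t) *\<^sub>R \<xi>))) * ?f n y) (0 + t *\<^sub>R x) \<partial>lborel)"
      unfolding fourier_integral_def using \<open>t > 0\<close> by (intro Bochner_Integration.integral_cong) auto
    also have "\<dots> = (1/t^3) *\<^sub>R (\<integral>y. exp (- \<i> * complex_of_real (y \<bullet> ((1/t) *\<^sub>R \<xi>))) * ?f n y \<partial>lborel)"
      by (rule lborel_scale_shift(1)) (use \<open>t > 0\<close> in measurable)
    finally show ?thesis unfolding fourier_integral_def by (simp add: scaleR_conv_of_real)
  qed
  have sc: "(\<lambda>n. L2_norm (\<lambda>x. G n (r *\<^sub>R x) - G' (r *\<^sub>R x))) \<longlonglongrightarrow> 0"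
    if "r > 0" "\<And>n. G n \<in> L2" "G' \<in> L2" "(\<lambda>n. L2_norm (\<lambda>x. G n x - G' x)) \<longlonglongrightarrow> 0" for r G and G' :: "real^3 \<Rightarrow> complex"
    using L2_scale_shift(2)[OF L2_diff[OF that(2,3)] \<open>r > 0\<close>, of _ 0]
      tendsto_mult_right_zero[OF that(4), of "r powr (-3/2)"] by simp
  have 1: "(\<lambda>n. L2_norm (\<lambda>\<xi>. fourier_integral (?g n) \<xi> - FT (\<lambda>x. f (t *\<^sub>R x)) \<xi>)) \<longlonglongrightarrow> 0"
    by (intro FT_tendsto ft g gi sc \<open>t > 0\<close> T f truncations_tendsto)
  have "(\<lambda>n. L2_norm (\<lambda>\<xi>. fourier_integral (?f n) ((1/t) *\<^sub>R \<xi>) - FT f ((1/t) *\<^sub>R \<xi>))) \<longlonglongrightarrow> 0"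
    using \<open>t > 0\<close> by (intro sc T FT_L2 f FT_tendsto truncations_tendsto) auto
  from tendsto_mult_right_zero[OF this, of "1/t^3"]
  have 2: "(\<lambda>n. L2_norm (\<lambda>\<xi>. fourier_integral (?g n) \<xi> - complex_of_real (1/t^3) * FT f ((1/t) *\<^sub>R \<xi>))) \<longlonglongrightarrow> 0"
    unfolding Fg right_diff_distrib[symmetric] L2_norm_cmult using \<open>t > 0\<close> by (simp del: of_real_divide add: norm_of_real[of "1/t^3", unfolded abs_of_pos])
  show ?thesis
  proof (rule L2_LIMSEQ_unique[OF _ _ _ 1 2])
    show "fourier_integral (?g n) \<in> L2" for n by (rule fourier_integral_Bessel(1)[OF g gi])
    show "FT (\<lambda>x. f (t *\<^sub>R x)) \<in> L2" using ft by auto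
    show "(\<lambda>\<xi>. complex_of_real (1/t^3) * FT f ((1/t) *\<^sub>R \<xi>)) \<in> L2"
      using L2_scale_shift(1)[OF FT_L2[OF f], of "1/t" 0] \<open>t > 0\<close> by (intro L2_cmult) simp
  qed
qed

section \<open>The interaction form\<close>

lemma norm_sq_vec3: "(norm x)\<^sup>2 = (x$1)\<^sup>2 + (x$2)\<^sup>2 + (x$3)\<^sup>2" for x :: "real^3"
  unfolding power2_norm_eq_inner by (simp add: inner_vec_def sum_3 power2_eq_square)

lemma dipolar_symbol_measurable [measurable]: "dipolar_symbol \<in> borel_measurable borel"
  unfolding dipolar_symbol_def by measurable

lemma dipolar_symbol_bound: "\<bar>dipolar_symbol \<xi>\<bar> \<le> 8/3 * pi"
proof (cases "\<xi> = 0")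
  case False
  have "\<bar>2 * (\<xi>$3)\<^sup>2 - (\<xi>$1)\<^sup>2 - (\<xi>$2)\<^sup>2\<bar> \<le> 2 * (norm \<xi>)\<^sup>2"
  proof -
    have "\<bar>2 * c - a - b\<bar> \<le> 2 * (a + b + c)" if "0 \<le> a" "0 \<le> b" "0 \<le> c" for a b c :: real
      using that by (simp add: abs_le_iff)
    then show ?thesis unfolding norm_sq_vec3 by simp
  qed
  then have "\<bar>2 * (\<xi>$3)\<^sup>2 - (\<xi>$1)\<^sup>2 - (\<xi>$2)\<^sup>2\<bar> / (norm \<xi>)\<^sup>2 \<le> 2"
    using False by (simp add: divide_le_eq)
  then have "4/3 * pi * (\<bar>2 * (\<xi>$3)\<^sup>2 - (\<xi>$1)\<^sup>2 - (\<xi>$2)\<^sup>2\<bar> / (norm \<xi>)\<^sup>2) \<le> 4/3 * pi * 2"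
    by (intro mult_left_mono) auto
  moreover have "\<bar>dipolar_symbol \<xi>\<bar> = 4/3 * pi * (\<bar>2 * (\<xi>$3)\<^sup>2 - (\<xi>$1)\<^sup>2 - (\<xi>$2)\<^sup>2\<bar> / (norm \<xi>)\<^sup>2)"
    by (simp add: dipolar_symbol_def abs_mult)
  ultimately show ?thesis by simp
qed (simp add: dipolar_symbol_def)

lemma dipolar_symbol_scale: "t \<noteq> 0 \<Longrightarrow> dipolar_symbol (t *\<^sub>R \<xi>) = dipolar_symbol \<xi>"
proof -
  assume "t \<noteq> 0"
  have "dipolar_symbol (t *\<^sub>R \<xi>) = 4/3 * pi * (t\<^sup>2 * (2 * (\<xi>$3)\<^sup>2 - (\<xi>$1)\<^sup>2 - (\<xi>$2)\<^sup>2)) / (t\<^sup>2 * (norm \<xi>)\<^sup>2)"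
    by (simp add: dipolar_symbol_def power_mult_distrib algebra_simps)
  also have "\<dots> = dipolar_symbol \<xi>" using \<open>t \<noteq> 0\<close> by (simp add: dipolar_symbol_def)
  finally show ?thesis .
qed

definition dip_mult :: "(real^3 \<Rightarrow> complex) \<Rightarrow> real^3 \<Rightarrow> complex" where
  "dip_mult F \<xi> = complex_of_real (dipolar_symbol \<xi>) * F \<xi>"

lemma dip_mult_L2:
  assumes "F \<in> L2"
  shows "dip_mult F \<in> L2" "L2_norm (dip_mult F) \<le> 8/3 * pi * L2_norm F"
proof -
  note [measurable] = L2_measurable[OF assms]
  have m: "dip_mult F \<in> borel_measurable borel" unfolding dip_mult_def by measurable
  have "AE \<xi> in lborel. norm (dip_mult F \<xi>) \<le> 8/3 * pi * norm (F \<xi>)"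
    unfolding dip_mult_def norm_mult norm_of_real by (intro AE_I2 mult_right_mono dipolar_symbol_bound) auto
  from L2_mono[OF assms m this] show "dip_mult F \<in> L2" "L2_norm (dip_mult F) \<le> 8/3 * pi * L2_norm F" by auto
qed

lemma is_fourier_L2_I:
  assumes f: "f \<in> L2" and F: "F \<in> L2" and eq: "AE \<xi> in lborel. FT f \<xi> = F \<xi>"
  shows "is_fourier_L2 f F"
proof -
  have "L2_norm (\<lambda>\<xi>. fourier_integral (\<lambda>x. indicator (cball 0 (real n)) x *\<^sub>R f x) \<xi> - F \<xi>)
      = L2_norm (\<lambda>\<xi>. fourier_integral (\<lambda>x. indicator (cball 0 (real n)) x *\<^sub>R f x) \<xi> - FT f \<xi>)" for n
    using eq by (intro L2_norm_cong_AE L2_measurable L2_diff fourier_truncations_L2 f F FT_L2) (auto elim: eventually_mono)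
  then show ?thesis
    using is_fourier_FT[OF f] unfolding is_fourier_L2_iff[OF f F] is_fourier_L2_iff[OF f FT_L2[OF f]] by simp
qed

text \<open>\<open>dipolar_conv\<close> is a choice. The inverse transform shows that there is
  something to choose, and uniqueness of the transform replaces the unspecified \<open>F\<close> of
  the definition by \<open>FT f\<close>.\<close>

lemma dipolar_conv_fourier:
  assumes f: "f \<in> L2"
  shows "dipolar_conv f \<in> L2" "AE \<xi> in lborel. FT (dipolar_conv f) \<xi> = dip_mult (FT f) \<xi>"
proof -
  have mL: "dip_mult (FT f) \<in> L2" using dip_mult_L2 f by blast
  have ex: "\<exists>g. \<exists>F. is_fourier_L2 f F \<and> is_fourier_L2 g (\<lambda>\<xi>. complex_of_real (dipolar_symbol \<xi>) * F \<xi>)"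
    using is_fourier_FT[OF f] is_fourier_L2_I[OF Finv_L2[OF mL] mL FT_Finv[OF mL]]
    unfolding dip_mult_def[abs_def] by blast
  from someI_ex[OF ex] obtain F where F: "is_fourier_L2 f F"
    and g: "is_fourier_L2 (dipolar_conv f) (\<lambda>\<xi>. complex_of_real (dipolar_symbol \<xi>) * F \<xi>)"
    unfolding dipolar_conv_def by blast
  show "dipolar_conv f \<in> L2" using is_fourier_L2_D(1)[OF g] .
  show "AE \<xi> in lborel. FT (dipolar_conv f) \<xi> = dip_mult (FT f) \<xi>"
    using is_fourier_L2_unique[OF F] is_fourier_L2_unique[OF g] by eventually_elim (simp add: dip_mult_def)
qed

section \<open>The symmetric form behind the interaction energy\<close>

lemma rip_cong_AE:
  fixes f g :: "real^3 \<Rightarrow> 'b::euclidean_space"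
  assumes "f \<in> L2" "g \<in> L2" "f' \<in> L2" "g' \<in> L2" "AE x in lborel. f x = f' x" "AE x in lborel. g x = g' x"
  shows "rip f g = rip f' g'"
  unfolding rip_def
proof (rule integral_cong_AE)
  show "AE x in lborel. f x \<bullet> g x = f' x \<bullet> g' x" using assms(5,6) by eventually_elim simp
qed (use L2_measurable[OF assms(1)] L2_measurable[OF assms(2)] L2_measurable[OF assms(3)] L2_measurable[OF assms(4)] in measurable)

text \<open>The bilinear form whose value on the density is twice the interaction energy. With the
  dipolar part on the Fourier side, symmetry and boundedness are immediate from the real and bounded
  symbol; the division by \<open>fkappa\<close> undoes the Plancherel factor.\<close>

definition dform :: "real \<Rightarrow> real \<Rightarrow> (real^3 \<Rightarrow> complex) \<Rightarrow> (real^3 \<Rightarrow> complex) \<Rightarrow> real" where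
  "dform l1 l2 f g = l1 * rip f g + l2 / fkappa * rip (dip_mult (FT f)) (FT g)"

lemma dform_commute: "dform l1 l2 f g = dform l1 l2 g f"
proof -
  have "rip (dip_mult F) G = rip (dip_mult G) F" for F G :: "real^3 \<Rightarrow> complex"
    unfolding rip_def dip_mult_def by (intro Bochner_Integration.integral_cong) (auto simp: inner_complex_def)
  then show ?thesis by (simp add: dform_def rip_commute[of f g])
qed

lemma dform_add_right:
  assumes "f \<in> L2" "g \<in> L2" "h \<in> L2"
  shows "dform l1 l2 f (\<lambda>x. g x + h x) = dform l1 l2 f g + dform l1 l2 f h"
proof -
  have m: "dip_mult (FT f) \<in> L2" by (intro dip_mult_L2 FT_L2 assms)
  have "rip (dip_mult (FT f)) (FT (\<lambda>x. g x + h x)) = rip (dip_mult (FT f)) (\<lambda>\<xi>. FT g \<xi> + FT h \<xi>)"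
    by (intro rip_cong_AE m FT_L2 L2_add assms FT_add AE_I2) simp
  also have "\<dots> = rip (dip_mult (FT f)) (FT g) + rip (dip_mult (FT f)) (FT h)"
    by (intro rip_add_right m FT_L2 assms)
  finally show ?thesis
    by (simp add: dform_def rip_add_right assms ring_distribs)
qed

lemma dform_add_left:
  assumes "f \<in> L2" "g \<in> L2" "h \<in> L2"
  shows "dform l1 l2 (\<lambda>x. f x + g x) h = dform l1 l2 f h + dform l1 l2 g h"
  using dform_add_right[OF assms(3,1,2)] by (simp add: dform_commute[of _ _ _ h])

lemma dform_scaleR_right:
  assumes "f \<in> L2" "g \<in> L2"
  shows "dform l1 l2 f (\<lambda>x. r *\<^sub>R g x) = r * dform l1 l2 f g"
proof -
  have m: "dip_mult (FT f) \<in> L2" by (intro dip_mult_L2 FT_L2 assms)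
  have "rip (dip_mult (FT f)) (FT (\<lambda>x. r *\<^sub>R g x)) = rip (dip_mult (FT f)) (\<lambda>\<xi>. r *\<^sub>R FT g \<xi>)"
  proof (intro rip_cong_AE m FT_L2 L2_scaleR assms)
    show "AE \<xi> in lborel. FT (\<lambda>x. r *\<^sub>R g x) \<xi> = r *\<^sub>R FT g \<xi>"
      using FT_cmult[OF assms(2), of "complex_of_real r"] by (simp add: scaleR_conv_of_real)
  qed simp
  then show ?thesis by (simp add: dform_def rip_scaleR_right ring_distribs)
qed

lemma dform_scaleR_left:
  assumes "f \<in> L2" "g \<in> L2"
  shows "dform l1 l2 (\<lambda>x. r *\<^sub>R f x) g = r * dform l1 l2 f g"
  using dform_scaleR_right[OF assms(2,1)] by (simp add: dform_commute[of _ _ _ g])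

definition dbound :: "real \<Rightarrow> real \<Rightarrow> real" where
  "dbound l1 l2 = \<bar>l1\<bar> + \<bar>l2\<bar> * (8/3 * pi)"

lemma dbound_nonneg [simp]: "0 \<le> dbound l1 l2" by (simp add: dbound_def)

lemma dform_bound:
  assumes f: "f \<in> L2" and g: "g \<in> L2"
  shows "\<bar>dform l1 l2 f g\<bar> \<le> dbound l1 l2 * (L2_norm f * L2_norm g)"
proof -
  have "\<bar>rip (dip_mult (FT f)) (FT g)\<bar> \<le> L2_norm (dip_mult (FT f)) * L2_norm (FT g)"
    by (intro rip_CS dip_mult_L2 FT_L2 f g)
  also have "\<dots> \<le> (8/3 * pi * L2_norm (FT f)) * L2_norm (FT g)"
    by (intro mult_right_mono dip_mult_L2 FT_L2 f) simp
  also have "\<dots> = 8/3 * pi * ((sqrt fkappa)\<^sup>2 * (L2_norm f * L2_norm g))"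
    unfolding Plancherel[OF f] Plancherel[OF g] by (simp only: power2_eq_square mult_ac)
  finally have 1: "\<bar>rip (dip_mult (FT f)) (FT g)\<bar> \<le> fkappa * (8/3 * pi * (L2_norm f * L2_norm g))" by (simp add: mult.left_commute)
  have "\<bar>dform l1 l2 f g\<bar> \<le> \<bar>l1\<bar> * \<bar>rip f g\<bar> + \<bar>l2\<bar> / fkappa * \<bar>rip (dip_mult (FT f)) (FT g)\<bar>"
    unfolding dform_def by (rule order_trans[OF abs_triangle_ineq]) (simp add: abs_mult less_imp_le)
  also have "\<dots> \<le> \<bar>l1\<bar> * (L2_norm f * L2_norm g) + \<bar>l2\<bar> / fkappa * (fkappa * (8/3 * pi * (L2_norm f * L2_norm g)))"
    by (intro add_mono mult_left_mono rip_CS f g 1) (auto simp: less_imp_le)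
  also have "\<dots> = dbound l1 l2 * (L2_norm f * L2_norm g)" by (simp add: dbound_def algebra_simps)
  finally show ?thesis .
qed

lemma rip_scale:
  fixes f g :: "real^3 \<Rightarrow> 'b::euclidean_space"
  assumes "f \<in> L2" "g \<in> L2" "t > 0"
  shows "rip (\<lambda>x. f (t *\<^sub>R x)) (\<lambda>x. g (t *\<^sub>R x)) = (1/t^3) * rip f g"
  using lborel_scale_shift(1)[of "\<lambda>x. f x \<bullet> g x" t 0] L2_measurable[OF assms(1)] L2_measurable[OF assms(2)] assms(3)
  by (simp add: rip_def)

text \<open>The symbol is homogeneous of degree 0, so the nonlocal form scales exactly like the
  \<open>L2\<close> product. This makes the interaction a pure cube along mass-preserving
  dilations.\<close>

lemma dform_scale:
  assumes f: "f \<in> L2" and g: "g \<in> L2" and t: "t > 0"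
  shows "dform l1 l2 (\<lambda>x. f (t *\<^sub>R x)) (\<lambda>x. g (t *\<^sub>R x)) = (1/t^3) * dform l1 l2 f g"
proof -
  have it: "1/t > 0" using t by simp
  have ft: "(\<lambda>x. f (t *\<^sub>R x)) \<in> L2" and gt: "(\<lambda>x. g (t *\<^sub>R x)) \<in> L2"
    using L2_scale_shift(1)[OF f t, of 0] L2_scale_shift(1)[OF g t, of 0] by auto
  have FL: "(\<lambda>\<xi>. FT h ((1/t) *\<^sub>R \<xi>)) \<in> L2" if "h \<in> L2" for h
    using L2_scale_shift(1)[OF FT_L2[OF that] it, of 0] by simp
  have mL: "(\<lambda>\<xi>. dip_mult (FT f) ((1/t) *\<^sub>R \<xi>)) \<in> L2"
    using L2_scale_shift(1)[OF dip_mult_L2(1)[OF FT_L2[OF f]] it, of 0] by simp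
  have "rip (dip_mult (FT (\<lambda>x. f (t *\<^sub>R x)))) (FT (\<lambda>x. g (t *\<^sub>R x)))
     = rip (\<lambda>\<xi>. (1/t^3) *\<^sub>R dip_mult (FT f) ((1/t) *\<^sub>R \<xi>)) (\<lambda>\<xi>. (1/t^3) *\<^sub>R FT g ((1/t) *\<^sub>R \<xi>))"
  proof (intro rip_cong_AE dip_mult_L2 FT_L2 ft gt L2_scaleR FL mL g)
    show "AE x in lborel. dip_mult (FT (\<lambda>x. f (t *\<^sub>R x))) x = (1/t^3) *\<^sub>R dip_mult (FT f) ((1/t) *\<^sub>R x)"
      using FT_scale[OF f t] by eventually_elim
        (use it in \<open>simp add: dip_mult_def dipolar_symbol_scale scaleR_conv_of_real[where 'a=complex]\<close>)
    show "AE x in lborel. FT (\<lambda>x. g (t *\<^sub>R x)) x = (1/t^3) *\<^sub>R FT g ((1/t) *\<^sub>R x)"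
      using FT_scale[OF g t] by eventually_elim (simp add: scaleR_conv_of_real[where 'a=complex])
  qed
  also have "\<dots> = (1/t^3) * ((1/t^3) * ((1/(1/t)^3) * rip (dip_mult (FT f)) (FT g)))"
    unfolding rip_scaleR_left rip_scaleR_right rip_scale[OF dip_mult_L2(1)[OF FT_L2[OF f]] FT_L2[OF g] it] ..
  also have "\<dots> = (1/t^3) * rip (dip_mult (FT f)) (FT g)" using t by (simp add: field_simps)
  finally show ?thesis
    unfolding dform_def rip_scale[OF f g t] by (simp add: ring_distribs)
qed

text \<open>Parseval carries the dipolar integral to the Fourier side, where the choice inside
  \<open>dipolar_conv\<close> is no longer visible.\<close>

lemma energy_dform:
  assumes r: "particle_density u \<in> L2"
  shows "energy l1 l2 a u = 1/2 * (L2_norm (weak_grad u))\<^sup>2 + a\<^sup>2 / 2 * (L2_norm (\<lambda>x. norm x *\<^sub>R u x))\<^sup>2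
     + 1/2 * dform l1 l2 (particle_density u) (particle_density u)"
proof -
  let ?r = "particle_density u"
  have 4: "(\<integral>x. (cmod (u x))^4 \<partial>lborel) = rip ?r ?r"
    unfolding rip_def by (intro Bochner_Integration.integral_cong) (auto simp: particle_density_def inner_complex_def power2_eq_square power4_eq_xxxx)
  have "Re (\<integral>x. dipolar_conv ?r x * ?r x \<partial>lborel) = rip (dipolar_conv ?r) ?r"
    unfolding rip_eq_Re[OF dipolar_conv_fourier(1)[OF r] r] by (simp add: particle_density_def)
  also have "\<dots> = rip (FT (dipolar_conv ?r)) (FT ?r) / fkappa"
    by (simp add: Parseval[OF dipolar_conv_fourier(1)[OF r] r])
  also have "rip (FT (dipolar_conv ?r)) (FT ?r) = rip (dip_mult (FT ?r)) (FT ?r)"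
    by (intro rip_cong_AE FT_L2 dip_mult_L2 dipolar_conv_fourier r) simp
  finally show ?thesis by (simp add: energy_def 4 dform_def)
qed

section \<open>Test functions\<close>

lemma Ck_SucI:
  assumes "\<And>x. (f has_derivative f' x) (at x)" "\<And>i. Ck k (\<lambda>x. f' x (axis i 1))"
  shows "Ck (Suc k) f"
  using assms by auto

lemma Ck_Suc_imp: "Ck (Suc k) f \<Longrightarrow> Ck k f"
proof (induction k arbitrary: f)
  case 0
  then obtain f' where "\<And>x. (f has_derivative f' x) (at x)" by auto
  then show ?case by (auto intro: continuous_at_imp_continuous_on has_derivative_continuous)
next
  case (Suc k)
  then obtain f' where "\<And>x. (f has_derivative f' x) (at x)" "\<And>i. Ck (Suc k) (\<lambda>x. f' x (axis i 1))"
    by (metis Ck.simps(2))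
  with Suc.IH show ?case by (auto intro!: Ck_SucI simp del: Ck.simps)
qed

lemma Ck_const: "Ck k (\<lambda>x. c)"
proof (induction k arbitrary: c)
  case (Suc k) show ?case by (rule Ck_SucI[where f'="\<lambda>x v. 0"]) (auto intro: Suc simp del: Ck.simps)
qed simp

lemma Ck_add: "Ck k f \<Longrightarrow> Ck k g \<Longrightarrow> Ck k (\<lambda>x. f x + g x)"
proof (induction k arbitrary: f g)
  case (Suc k)
  obtain f' where f: "\<And>x. (f has_derivative f' x) (at x)" "\<And>i. Ck k (\<lambda>x. f' x (axis i 1))"
    using Suc.prems(1) by auto
  obtain g' where g: "\<And>x. (g has_derivative g' x) (at x)" "\<And>i. Ck k (\<lambda>x. g' x (axis i 1))"
    using Suc.prems(2) by auto
  show ?case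
    by (rule Ck_SucI[where f'="\<lambda>x v. f' x v + g' x v"]) (intro has_derivative_add f g Suc.IH)+
qed (auto intro: continuous_intros)

lemma Ck_mult: "Ck k f \<Longrightarrow> Ck k g \<Longrightarrow> Ck k (\<lambda>x. f x * g x)"
proof (induction k arbitrary: f g)
  case (Suc k)
  obtain f' where f: "\<And>x. (f has_derivative f' x) (at x)" "\<And>i. Ck k (\<lambda>x. f' x (axis i 1))"
    using Suc.prems(1) by auto
  obtain g' where g: "\<And>x. (g has_derivative g' x) (at x)" "\<And>i. Ck k (\<lambda>x. g' x (axis i 1))"
    using Suc.prems(2) by auto
  show ?case
    by (rule Ck_SucI[where f'="\<lambda>x v. f x * g' x v + f' x v * g x"])
       (intro has_derivative_mult Ck_add f g Suc.IH Ck_Suc_imp[OF Suc.prems(1)] Ck_Suc_imp[OF Suc.prems(2)])+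
qed (auto intro: continuous_intros)

lemma Ck_coord: "Ck k (\<lambda>x. complex_of_real (x $ i))"
proof (cases k)
  case (Suc m)
  have "((\<lambda>x::real^3. complex_of_real (x $ i)) has_derivative (\<lambda>v. complex_of_real (v $ i))) (at x)" for x
    by (intro has_derivative_of_real bounded_linear_imp_has_derivative bounded_linear_vec_nth)
  then show ?thesis unfolding Suc by (rule Ck_SucI) (rule Ck_const)
qed (auto intro!: continuous_intros)

lemma Ck_exp: "Ck k p \<Longrightarrow> Ck k (\<lambda>x. exp (p x))"
proof (induction k arbitrary: p)
  case (Suc k)
  obtain p' where p: "\<And>x. (p has_derivative p' x) (at x)" "\<And>i. Ck k (\<lambda>x. p' x (axis i 1))"
    using Suc.prems by auto
  have "((\<lambda>x. exp (p x)) has_derivative (\<lambda>v. exp (p x) * p' x v)) (at x)" for x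
    using has_derivative_compose[OF p(1), of exp "(*) (exp (p x))" x]
      DERIV_exp[of "p x", unfolded has_field_derivative_def] by (simp add: o_def)
  then show ?case
    by (rule Ck_SucI) (intro Ck_mult p Suc.IH Ck_Suc_imp[OF Suc.prems])
qed (auto intro: continuous_intros)

text \<open>The family \<open>s\<^sup>-\<^sup>m exp (-1/s)\<close>, \<open>s > 0\<close>, is closed under differentiation.\<close>

definition flat :: "nat \<Rightarrow> real \<Rightarrow> real" where
  "flat m s = (if s > 0 then exp (- (1/s)) / s^m else 0)"

lemma exp_ge_power_fact: "0 \<le> y \<Longrightarrow> y^n / fact n \<le> exp (y::real)"
proof -
  assume "0 \<le> y"
  have "(\<Sum>k\<in>{n}. y^k /\<^sub>R fact k) \<le> (\<Sum>k. y^k /\<^sub>R fact k)"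
    using \<open>0 \<le> y\<close> by (intro sum_le_suminf summable_exp_generic) auto
  then show ?thesis by (simp add: exp_def divide_inverse mult.commute)
qed

text \<open>A single term of the exponential series at \<open>1/s\<close>. The free exponent
  \<open>n\<close> is used with value 2 for the derivative at 0 and with value 0 for uniform
  bounds.\<close>

lemma flat_bound: "\<bar>flat m s\<bar> \<le> fact (m + n) * \<bar>s\<bar>^n"
proof (cases "s > 0")
  case True
  have "(1/s)^(m + n) / fact (m + n) \<le> exp (1/s)" using True by (intro exp_ge_power_fact) simp
  then have "exp (- (1/s)) \<le> fact (m + n) * s^(m + n)"
    using True by (simp add: exp_minus field_simps)
  then have "exp (- (1/s)) / s^m \<le> fact (m + n) * s^(m + n) / s^m"
    using True by (intro divide_right_mono) auto
  then show ?thesis using True by (simp add: flat_def power_add)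
qed (simp add: flat_def)

lemma flat_nonneg: "0 \<le> flat m s" by (simp add: flat_def)

lemma flat_deriv: "(flat m has_real_derivative (flat (m + 2) s - real m * flat (m + 1) s)) (at s)"
proof -
  consider "s > 0" | "s < 0" | "s = 0" by linarith
  then show ?thesis
  proof cases
    case 1
    have "((\<lambda>s. exp (- (1/s)) / s^m) has_real_derivative (flat (m + 2) s - real m * flat (m + 1) s)) (at s)"
    proof -
      have "((\<lambda>s. exp (- (1/s)) * inverse s ^ m) has_real_derivative
         (exp (- (1/s)) * (1/s\<^sup>2) * inverse s ^ m + exp (- (1/s)) * (real m * inverse s ^ (m - 1) * (- (1/s\<^sup>2))))) (at s)"
        using 1 by (auto intro!: derivative_eq_intros simp: power2_eq_square divide_inverse algebra_simps)
      moreover have "exp (- (1/s)) * (1/s\<^sup>2) * inverse s ^ m + exp (- (1/s)) * (real m * inverse s ^ (m - 1) * (- (1/s\<^sup>2)))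
         = flat (m + 2) s - real m * flat (m + 1) s"
        using 1 by (cases m) (auto simp: flat_def field_simps power2_eq_square)
      moreover have "(\<lambda>s. exp (- (1/s)) * inverse s ^ m) = (\<lambda>s::real. exp (- (1/s)) / s^m)"
        by (rule ext) (simp add: field_simps)
      ultimately show ?thesis by simp
    qed
    moreover have "\<forall>\<^sub>F t in nhds s. exp (- (1/t)) / t^m = flat m t"
      using eventually_nhds_in_open[of "{0<..}" s] 1 by (auto simp: flat_def elim!: eventually_mono)
    ultimately show ?thesis by (subst (asm) DERIV_cong_ev[OF refl _ refl]) auto
  next
    case 2
    have "((\<lambda>s. 0) has_real_derivative 0) (at s)" by simp
    moreover have "\<forall>\<^sub>F t in nhds s. 0 = flat m t"
      using eventually_nhds_in_open[of "{..<0}" s] 2 by (auto simp: flat_def elim!: eventually_mono)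
    moreover have "flat (m + 2) s - real m * flat (m + 1) s = 0" using 2 by (simp add: flat_def)
    ultimately show ?thesis by (subst (asm) DERIV_cong_ev[OF refl _ refl]) auto
  next
    case 3
    have "((\<lambda>h. (flat m (0 + h) - flat m 0) / h) \<longlongrightarrow> 0) (at 0)"
    proof (rule Lim_null_comparison)
      show "((\<lambda>h. fact (m + 2) * \<bar>h\<bar>) \<longlongrightarrow> 0) (at (0::real))" by (auto intro!: tendsto_eq_intros)
      have "norm ((flat m (0 + h) - flat m 0) / h) \<le> fact (m + 2) * \<bar>h\<bar>" if "h \<noteq> 0" for h
        using flat_bound[of m h 2] that by (simp add: flat_def[of m 0] divide_le_eq power2_eq_square mult.assoc)
      then show "\<forall>\<^sub>F h in at 0. norm ((flat m (0 + h) - flat m 0) / h) \<le> fact (m + 2) * \<bar>h\<bar>"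
        by (auto simp: eventually_at intro!: exI[of _ 1])
    qed
    then show ?thesis using 3 by (simp add: DERIV_def flat_def[of "Suc m" 0] flat_def[of "Suc (Suc m)" 0])
  qed
qed

lemma flat_comp_derivative:
  assumes "(p has_derivative p') (at x)"
  shows "((\<lambda>x. complex_of_real (flat m (p x))) has_derivative
      (\<lambda>v. complex_of_real (flat (m + 2) (p x) - real m * flat (m + 1) (p x)) * complex_of_real (p' v))) (at x)"
proof -
  have "((\<lambda>x. flat m (p x)) has_derivative (\<lambda>v. (flat (m + 2) (p x) - real m * flat (m + 1) (p x)) * p' v)) (at x)"
    using has_derivative_compose[OF assms flat_deriv[unfolded has_field_derivative_def]] by (simp add: o_def)
  from has_derivative_of_real[OF this, where 'a=complex] show ?thesis by simp
qed

lemma Ck_flat: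
  assumes p: "\<And>x. (p has_derivative p' x) (at x)" "\<And>k i. Ck k (\<lambda>x. complex_of_real (p' x (axis i 1)))"
  shows "Ck k (\<lambda>x. complex_of_real (flat m (p x)))"
proof (induction k arbitrary: m)
  case 0
  show ?case unfolding Ck.simps
    by (rule continuous_at_imp_continuous_on) (use has_derivative_continuous[OF flat_comp_derivative[OF p(1)]] in blast)
next
  case (Suc k)
  have eq: "complex_of_real (flat (m + 2) (p x) - real m * flat (m + 1) (p x))
     = complex_of_real (flat (m + 2) (p x)) + (- of_nat m) * complex_of_real (flat (m + 1) (p x))" for x by simp
  show ?case
    by (rule Ck_SucI[OF flat_comp_derivative[OF p(1)]]) (unfold eq, intro Ck_mult Ck_add Ck_const Suc p)
qed

section \<open>Bump functions and compact supports\<close>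

lemma partial_deriv_eq: "(f has_derivative f') (at x) \<Longrightarrow> partial_deriv i f x = f' (axis i 1)"
  unfolding partial_deriv_def by (simp add: frechet_derivative_at[symmetric])

text \<open>The standard mollifier profile on the ball of radius \<open>1/r\<close>, without
  normalisation. As \<open>r\<close> tends to 0 it becomes slowly varying.\<close>

definition bump :: "real \<Rightarrow> real^3 \<Rightarrow> real" where
  "bump r x = flat 0 (1 - (norm (r *\<^sub>R x))\<^sup>2)"

lemma bump_arg_derivative:
  "((\<lambda>x::real^3. 1 - (norm (r *\<^sub>R x))\<^sup>2) has_derivative (\<lambda>v. - (2 * r\<^sup>2 * (x \<bullet> v)))) (at x)"
proof -
  have "((\<lambda>x::real^3. 1 - r\<^sup>2 * (x \<bullet> x)) has_derivative (\<lambda>v. - (2 * r\<^sup>2 * (x \<bullet> v)))) (at x)"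
    by (auto intro!: derivative_eq_intros simp: inner_commute algebra_simps)
  moreover have "(norm (r *\<^sub>R x))\<^sup>2 = r\<^sup>2 * (x \<bullet> x)" for x :: "real^3"
    unfolding power2_norm_eq_inner by (simp add: power2_eq_square)
  ultimately show ?thesis by simp
qed

lemma bump_derivative:
  "((\<lambda>x. complex_of_real (bump r x)) has_derivative
      (\<lambda>v. complex_of_real (flat 2 (1 - (norm (r *\<^sub>R x))\<^sup>2) * (- (2 * r\<^sup>2 * (x \<bullet> v)))))) (at x)"
  using flat_comp_derivative[OF bump_arg_derivative, of 0 r x] unfolding bump_def
  by (simp only: add_0_left of_nat_0 mult_zero_left diff_0_right of_real_mult)

lemma Ck_bump: "Ck k (\<lambda>x. complex_of_real (bump r x))"
  unfolding bump_def
proof (rule Ck_flat[OF bump_arg_derivative])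
  fix k i
  have "Ck k (\<lambda>x. complex_of_real (- (2 * r\<^sup>2)) * complex_of_real (x $ i))" by (intro Ck_mult Ck_const Ck_coord)
  then show "Ck k (\<lambda>x. complex_of_real (- (2 * r\<^sup>2 * (x \<bullet> axis i 1))))" by (simp add: inner_axis)
qed

lemma bump_nonneg: "0 \<le> bump r x" by (simp add: bump_def flat_nonneg)

lemma bump_le_1: "bump r x \<le> 1"
  using flat_bound[of 0 "1 - (norm (r *\<^sub>R x))\<^sup>2" 0] by (simp add: bump_def)

lemma bump_zero: "r > 0 \<Longrightarrow> norm x \<ge> 1/r \<Longrightarrow> bump r x = 0"
proof -
  assume "r > 0" "norm x \<ge> 1/r"
  then have "1 \<le> norm (r *\<^sub>R x)" by (simp add: divide_le_eq mult.commute)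
  then have "1 \<le> (norm (r *\<^sub>R x))\<^sup>2" by (rule one_le_power)
  then show ?thesis by (simp add: bump_def flat_def)
qed

lemma compact_closure_support:
  fixes f :: "real^3 \<Rightarrow> complex"
  assumes "\<And>x. norm x > R \<Longrightarrow> f x = 0"
  shows "compact (closure {x. f x \<noteq> 0})"
proof -
  have "{x. f x \<noteq> 0} \<subseteq> cball 0 R" using assms by force
  then show ?thesis by (meson bounded_cball bounded_subset compact_closure)
qed

lemma test_functionsI:
  assumes "\<And>k. Ck k f" "\<And>x. norm x > R \<Longrightarrow> f x = 0"
  shows "f \<in> test_functions"
  unfolding test_functions_def using assms compact_closure_support[of R f] by blast

lemma test_functions_support:
  assumes "f \<in> test_functions"
  obtains R where "R > 0" "\<And>x. norm x > R \<Longrightarrow> f x = 0"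
proof -
  have "bounded (closure {x. f x \<noteq> 0})" using assms by (simp add: test_functions_def compact_imp_bounded)
  then obtain R where "R > 0" "\<And>x. x \<in> closure {x. f x \<noteq> 0} \<Longrightarrow> norm x \<le> R"
    using bounded_pos by metis
  then have "f x = 0" if "norm x > R" for x
    using that closure_subset[of "{x. f x \<noteq> 0}"] by (meson mem_Collect_eq not_le subsetD)
  with \<open>R > 0\<close> show ?thesis using that by blast
qed

section \<open>Weak gradients\<close>

lemma borel_measurable_vec_nth_vec [measurable]: "(\<lambda>x::('b::real_normed_vector)^3. x $ i) \<in> borel_measurable borel"
  by (intro borel_measurable_continuous_onI continuous_intros)

lemma L2_component:
  fixes g :: "real^3 \<Rightarrow> complex^3"
  assumes "g \<in> L2"
  shows "(\<lambda>x. g x $ i) \<in> L2" "L2_norm (\<lambda>x. g x $ i) \<le> L2_norm g"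
proof -
  have m: "(\<lambda>x. g x $ i) \<in> borel_measurable borel"
    by (rule measurable_compose[OF L2_measurable[OF assms] borel_measurable_vec_nth_vec])
  show "(\<lambda>x. g x $ i) \<in> L2" "L2_norm (\<lambda>x. g x $ i) \<le> L2_norm g"
    using L2_norm_mono[OF assms m] Finite_Cartesian_Product.norm_nth_le by blast+
qed

lemma norm_sq_vec3_gen: "(norm x)\<^sup>2 = (norm (x$1))\<^sup>2 + (norm (x$2))\<^sup>2 + (norm (x$3))\<^sup>2" for x :: "'b::euclidean_space^3"
  unfolding power2_norm_eq_inner by (simp add: inner_vec_def sum_3)

lemma L2_norm_component_sum:
  fixes g :: "real^3 \<Rightarrow> complex^3"
  assumes "g \<in> L2"
  shows "(L2_norm g)\<^sup>2 = (L2_norm (\<lambda>x. g x $ 1))\<^sup>2 + (L2_norm (\<lambda>x. g x $ 2))\<^sup>2 + (L2_norm (\<lambda>x. g x $ 3))\<^sup>2"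
  unfolding L2_norm_sq norm_sq_vec3_gen
  using L2_integrable[OF L2_component(1)[OF assms]] by simp

lemma L2_vec3_I:
  fixes g :: "real^3 \<Rightarrow> complex^3"
  assumes "\<And>i. (\<lambda>x. g x $ i) \<in> L2"
  shows "g \<in> L2"
proof (rule L2I)
  have "(\<lambda>x. g x \<bullet> b) \<in> borel_measurable borel" if b: "b \<in> Basis" for b
  proof -
    obtain i c where "b = axis i c" "c \<in> Basis" using b by (auto simp: Basis_vec_def)
    then have eq: "(\<lambda>x. g x \<bullet> b) = (\<lambda>x. g x $ i \<bullet> c)" by (simp add: inner_axis)
    show ?thesis unfolding eq by (intro borel_measurable_inner L2_measurable assms borel_measurable_const)
  qed
  then show "g \<in> borel_measurable borel" unfolding borel_measurable_euclidean_space[of g] by blast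
  show "integrable lborel (\<lambda>x. (norm (g x))\<^sup>2)"
    unfolding norm_sq_vec3_gen using L2_integrable[OF assms] by simp
qed

lemma bounded_support_L2:
  fixes f :: "real^3 \<Rightarrow> 'b::euclidean_space"
  assumes [measurable]: "f \<in> borel_measurable borel" and B: "\<And>x. norm (f x) \<le> B" and R: "\<And>x. norm x > R \<Longrightarrow> f x = 0"
  shows "f \<in> L2"
proof -
  have i: "integrable lborel (\<lambda>x. B\<^sup>2 * indicator (cball (0::real^3) R) x :: real)"
    using emeasure_bounded_finite[of "cball (0::real^3) R"] by (intro integrable_mult_right integrable_real_indicator) auto
  have "(norm (f x))\<^sup>2 \<le> B\<^sup>2" for x using B by (intro power_mono) auto
  then show "f \<in> L2"
    by (intro L2I Bochner_Integration.integrable_bound[OF i])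
       (use R in \<open>auto split: split_indicator simp: not_le\<close>)
qed

lemma continuous_support_bounded:
  fixes f :: "real^3 \<Rightarrow> 'b::euclidean_space"
  assumes c: "continuous_on UNIV f" and R: "\<And>x. norm x > R \<Longrightarrow> f x = 0"
  obtains B where "\<And>x. norm (f x) \<le> B"
proof -
  have "compact (f ` cball 0 R)" by (intro compact_continuous_image continuous_on_subset[OF c]) auto
  from compact_imp_bounded[OF this] obtain B where B: "\<forall>y\<in>f ` cball 0 R. norm y \<le> B"
    unfolding bounded_iff by blast
  have "norm (f x) \<le> max B 0" for x
    using B R[of x] by (cases "norm x > R") (auto simp: not_less max.coboundedI1)
  then show ?thesis by (rule that)
qed

text \<open>Each order \<open>k\<close> comes with a derivative of its own; uniqueness of
  derivatives merges them into one \<open>f'\<close> that serves all orders.\<close>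

lemma test_functions_derivative:
  assumes "f \<in> test_functions"
  obtains f' where "\<And>x. (f has_derivative f' x) (at x)" "\<And>i k. Ck k (\<lambda>x. f' x (axis i 1))"
proof -
  have C: "Ck k f" for k using assms by (simp add: test_functions_def)
  from C[of "Suc 0"] obtain f' where f': "\<And>x. (f has_derivative f' x) (at x)" by auto
  have "Ck k (\<lambda>x. f' x (axis i 1))" for i k
  proof -
    from C[of "Suc k"] obtain h where h: "\<And>x. (f has_derivative h x) (at x)" "\<And>i. Ck k (\<lambda>x. h x (axis i 1))" by auto
    have "h = f'" using has_derivative_unique[OF h(1) f'] by blast
    with h(2) show ?thesis by blast
  qed
  with f' show ?thesis by (rule that)
qed

section \<open>Test functions and integration by parts\<close>

lemma test_functions_props:
  assumes f: "f \<in> test_functions"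
  shows "f \<in> L2" "continuous_on UNIV f"
    "\<And>x. (f has_derivative (\<lambda>v. frechet_derivative f (at x) v)) (at x)"
    and test_functions_partial: "partial_deriv i f \<in> L2" "continuous_on UNIV (partial_deriv i f)"
    "\<exists>R. \<forall>x. norm x > R \<longrightarrow> f x = 0 \<and> partial_deriv i f x = 0"
proof -
  obtain R where R: "R > 0" "\<And>x. norm x > R \<Longrightarrow> f x = 0" using test_functions_support[OF f] by blast
  obtain f' where f': "\<And>x. (f has_derivative f' x) (at x)" "\<And>i k. Ck k (\<lambda>x. f' x (axis i 1))"
    using test_functions_derivative[OF f] by blast
  have p: "partial_deriv i f = (\<lambda>x. f' x (axis i 1))" by (rule ext) (rule partial_deriv_eq[OF f'(1)])
  show fc: "continuous_on UNIV f" using f by (auto simp: test_functions_def dest: spec[of _ 0])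
  show pc: "continuous_on UNIV (partial_deriv i f)" unfolding p using f'(2)[of 0] by simp
  have p0: "partial_deriv i f x = 0" if "norm x > R" for x
  proof -
    have "(f has_derivative (\<lambda>_. 0)) (at x)"
      by (rule has_derivative_transform_within_open[of "\<lambda>_. 0" "\<lambda>_. 0" x UNIV "- cball 0 R"])
         (use that R(2) in \<open>auto simp: open_Compl\<close>)
    from partial_deriv_eq[OF this] show ?thesis by simp
  qed
  then show "\<exists>R. \<forall>x. norm x > R \<longrightarrow> f x = 0 \<and> partial_deriv i f x = 0" using R by blast
  obtain B where "\<And>x. norm (f x) \<le> B" using continuous_support_bounded[OF fc R(2)] by blast
  then show "f \<in> L2" using R(2) by (intro bounded_support_L2[of f B R] borel_measurable_continuous_onI fc)
  obtain B where "\<And>x. norm (partial_deriv i f x) \<le> B" using continuous_support_bounded[OF pc p0] by blast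
  then show "partial_deriv i f \<in> L2" using p0 by (intro bounded_support_L2[of _ B R] borel_measurable_continuous_onI pc)
  show "(f has_derivative (\<lambda>v. frechet_derivative f (at x) v)) (at x)" for x
    using frechet_derivative_works[THEN iffD1, OF differentiableI[OF f'(1)]] by simp
qed

text \<open>By translation invariance every difference quotient of \<open>f\<close> has integral
  zero, and dominated convergence passes this on to the derivative.\<close>

lemma integral_partial_deriv_zero:
  assumes f: "f \<in> test_functions"
  shows "(\<integral>x. partial_deriv i f x \<partial>lborel) = 0"
proof -
  let ?e = "axis i (1::real) :: real^3" and ?D = "partial_deriv i f"
  note P = test_functions_props(1,2)[OF f] test_functions_partial[OF f, of i] test_functions_props(3)[OF f]
  obtain R where R: "\<And>x. norm x > R \<Longrightarrow> f x = 0" "\<And>x. norm x > R \<Longrightarrow> ?D x = 0" using P(5) by blast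
  obtain B where B: "\<And>x. norm (?D x) \<le> B" using continuous_support_bounded[OF P(4) R(2)] by blast
  have [measurable]: "f \<in> borel_measurable borel" "?D \<in> borel_measurable borel"
    using P(1,3) L2_measurable by auto
  have "0 \<le> B" using B[of 0] norm_ge_zero order_trans by blast
  have ld: "((\<lambda>s. f (x + s *\<^sub>R ?e)) has_vector_derivative ?D (x + s *\<^sub>R ?e)) (at s)" for x s
  proof -
    have "((\<lambda>s. x + s *\<^sub>R ?e) has_derivative (\<lambda>s. s *\<^sub>R ?e)) (at s)" by (auto intro!: derivative_eq_intros)
    from has_derivative_compose[OF this P(6)]
    have "((\<lambda>s. f (x + s *\<^sub>R ?e)) has_derivative (\<lambda>r. frechet_derivative f (at (x + s *\<^sub>R ?e)) (r *\<^sub>R ?e))) (at s)" .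
    moreover have "frechet_derivative f (at (x + s *\<^sub>R ?e)) (r *\<^sub>R ?e) = r *\<^sub>R ?D (x + s *\<^sub>R ?e)" for r
      unfolding partial_deriv_def using P(6)[of "x + s *\<^sub>R ?e"]
      by (simp add: has_derivative_bounded_linear bounded_linear.linear linear_cmul)
    ultimately show ?thesis by (simp add: has_vector_derivative_def)
  qed
  let ?s = "\<lambda>n. 1 / real (Suc n)"
  let ?q = "\<lambda>n x. real (Suc n) *\<^sub>R (f (x + ?s n *\<^sub>R ?e) - f x)"
  have on: "onorm (\<lambda>r. r *\<^sub>R d) \<le> B" if "norm d \<le> B" for d :: complex
  proof (rule onorm_le)
    show "norm (r *\<^sub>R d) \<le> B * norm r" for r :: real
      using mult_left_mono[OF that, of "norm r"] by (simp add: mult.commute)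
  qed
  have qb: "norm (?q n x) \<le> B" for n x
  proof -
    have "norm (f (x + ?s n *\<^sub>R ?e) - f (x + 0 *\<^sub>R ?e)) \<le> B * norm (?s n - 0)"
      by (rule differentiable_bound[where f="\<lambda>s. f (x + s *\<^sub>R ?e)" and S=UNIV and f'="\<lambda>s r. r *\<^sub>R ?D (x + s *\<^sub>R ?e)"])
         (use ld on[OF B] in \<open>auto simp: has_vector_derivative_def\<close>)
    then show ?thesis unfolding norm_scaleR by (simp add: field_simps del: of_nat_Suc)
  qed
  \<comment> \<open>The increments are at most 1, so all quotients vanish outside the ball of radius
    \<open>R + 1\<close>.\<close>
  have q0: "?q n x = 0" if "norm x > R + 1" for n x
  proof -
    have "norm x \<le> norm (x + ?s n *\<^sub>R ?e) + norm (?s n *\<^sub>R ?e)"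
      using norm_triangle_ineq4[of "x + ?s n *\<^sub>R ?e" "?s n *\<^sub>R ?e"] by simp
    moreover have "norm (?s n *\<^sub>R ?e) \<le> 1" by simp
    ultimately have "norm (x + ?s n *\<^sub>R ?e) > R" using that by linarith
    then show ?thesis using R(1)[of x] R(1)[of "x + ?s n *\<^sub>R ?e"] that by simp
  qed
  have fi: "integrable lborel f"
  proof -
    have "(\<lambda>x. indicator (cball 0 R) x *\<^sub>R f x) = f" using R(1) by (force split: split_indicator)
    then show ?thesis using L2_compact_support_integrable[OF P(1), of R] by simp
  qed
  have "(\<lambda>n. \<integral>x. ?q n x \<partial>lborel) \<longlonglongrightarrow> (\<integral>x. ?D x \<partial>lborel)"
  proof (rule integral_dominated_convergence[where w="\<lambda>x. B * indicator (cball 0 (R + 1)) x"])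
    show "integrable lborel (\<lambda>x::real^3. B * indicator (cball 0 (R + 1)) x)"
      using emeasure_bounded_finite[of "cball (0::real^3) (R + 1)"] by (intro integrable_mult_right integrable_real_indicator) auto
    show "AE x in lborel. norm (?q n x) \<le> B * indicator (cball 0 (R + 1)) x" for n
      using qb[of n] q0[of _ n] by (intro AE_I2) (auto split: split_indicator simp: not_le)
    show "AE x in lborel. (\<lambda>n. ?q n x) \<longlonglongrightarrow> ?D x"
    proof (rule AE_I2)
      fix x
      have "(\<lambda>s. (1/s) *\<^sub>R (f (x + s *\<^sub>R ?e) - f x)) \<midarrow>0\<rightarrow> ?D x"
      proof -
        have K: "(\<lambda>s. cmod (f (x + s *\<^sub>R ?e) - f x - s *\<^sub>R ?D x) / \<bar>s\<bar>) \<midarrow>0\<rightarrow> 0"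
          using ld[of x 0] by (simp add: has_vector_derivative_def has_derivative_at)
        have "norm ((1/s) *\<^sub>R (f (x + s *\<^sub>R ?e) - f x) - ?D x) = cmod (f (x + s *\<^sub>R ?e) - f x - s *\<^sub>R ?D x) / \<bar>s\<bar>" if "s \<noteq> 0" for s
        proof -
          have "(1/s) *\<^sub>R (f (x + s *\<^sub>R ?e) - f x) - ?D x = (1/s) *\<^sub>R (f (x + s *\<^sub>R ?e) - f x - s *\<^sub>R ?D x)"
            using that by (simp add: scaleR_diff_right)
          then show ?thesis by (simp add: norm_scaleR)
        qed
        then have "\<forall>\<^sub>F s in at 0. cmod (f (x + s *\<^sub>R ?e) - f x - s *\<^sub>R ?D x) / \<bar>s\<bar> = norm ((1/s) *\<^sub>R (f (x + s *\<^sub>R ?e) - f x) - ?D x)"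
          by (auto simp: eventually_at intro!: exI[of _ 1])
        from Lim_transform_eventually[OF K this] show ?thesis
          by (rule LIM_zero_cancel[OF tendsto_norm_zero_cancel])
      qed
      moreover have "filterlim ?s (at 0) sequentially"
        by (intro filterlim_atI LIMSEQ_Suc[of "\<lambda>n. 1 / real n"] lim_1_over_n) auto
      ultimately have "(\<lambda>n. (1 / ?s n) *\<^sub>R (f (x + ?s n *\<^sub>R ?e) - f x)) \<longlonglongrightarrow> ?D x"
        by (rule filterlim_compose)
      then show "(\<lambda>n. ?q n x) \<longlonglongrightarrow> ?D x" by simp
    qed
  qed measurable
  moreover have "(\<integral>x. ?q n x \<partial>lborel) = 0" for n
  proof -
    have "integrable lborel (\<lambda>x. f (x + ?s n *\<^sub>R ?e))"
      using lborel_scale_shift(2)[of f 1 "?s n *\<^sub>R ?e"] fi by (simp add: add.commute)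
    moreover have "(\<integral>x. f (x + ?s n *\<^sub>R ?e) \<partial>lborel) = (\<integral>x. f x \<partial>lborel)"
      using lborel_scale_shift(1)[of f 1 "?s n *\<^sub>R ?e"] by (simp add: add.commute)
    ultimately show ?thesis using fi by simp
  qed
  ultimately show ?thesis by (simp add: LIMSEQ_const_iff)
qed

lemma test_functions_mult:
  assumes f: "f \<in> test_functions" and g: "\<And>k. Ck k g"
  shows "(\<lambda>x. f x * g x) \<in> test_functions"
proof -
  obtain R where R: "R > 0" "\<And>x. norm x > R \<Longrightarrow> f x = 0" using test_functions_support[OF f] by blast
  show ?thesis
    by (rule test_functionsI[of _ R]) (use f g R in \<open>auto simp: test_functions_def intro!: Ck_mult\<close>)
qed

lemma test_function_weak_gradient:
  assumes w: "w \<in> test_functions"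
  shows "is_weak_gradient w (\<lambda>x. \<chi> i. partial_deriv i w x)"
  unfolding is_weak_gradient_def
proof (intro conjI allI ballI)
  show "(\<lambda>x. \<chi> i. partial_deriv i w x) \<in> L2"
    by (rule L2_vec3_I) (use test_functions_partial(1)[OF w] in simp)
  fix i \<phi> assume p: "\<phi> \<in> test_functions"
  note W = test_functions_props(1,2)[OF w] test_functions_partial[OF w, of i] test_functions_props(3)[OF w]
    and P = test_functions_props(1,2)[OF p] test_functions_partial[OF p, of i] test_functions_props(3)[OF p]
  have "(\<lambda>x. w x * \<phi> x) \<in> test_functions" using w p by (intro test_functions_mult) (auto simp: test_functions_def)
  from integral_partial_deriv_zero[OF this, of i]
  have "0 = (\<integral>x. partial_deriv i (\<lambda>x. w x * \<phi> x) x \<partial>lborel)" by simp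
  also have "\<dots> = (\<integral>x. w x * partial_deriv i \<phi> x + partial_deriv i w x * \<phi> x \<partial>lborel)"
    using partial_deriv_eq[OF has_derivative_mult[OF W(6) P(6)], of i]
    by (intro Bochner_Integration.integral_cong) (auto simp: partial_deriv_def)
  also have "\<dots> = (\<integral>x. w x * partial_deriv i \<phi> x \<partial>lborel) + (\<integral>x. partial_deriv i w x * \<phi> x \<partial>lborel)"
    by (intro Bochner_Integration.integral_add L2_complex_mult_integrable W P)
  finally show "(\<integral>x. w x * partial_deriv i \<phi> x \<partial>lborel) = - (\<integral>x. (\<chi> i. partial_deriv i w x) $ i * \<phi> x \<partial>lborel)"
    by (simp add: eq_neg_iff_add_eq_0)
qed

text \<open>Gaussians are not compactly supported; they become admissible in the definition of the weak
  gradient after multiplication by the slowly varying \<open>bump (1 / n)\<close> and passage to the limit.\<close>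

lemma Ck_gauss: "Ck k (\<lambda>x. complex_of_real (gauss (x - y)))"
proof -
  let ?d = "\<lambda>i x. complex_of_real (x $ i) + complex_of_real (- y $ i)"
  have "complex_of_real (gauss (x - y)) = exp (complex_of_real (-1/2) * (?d 1 x * ?d 1 x + ?d 2 x * ?d 2 x + ?d 3 x * ?d 3 x))" for x
  proof -
    have "gauss (x - y) = exp (-1/2 * ((x$1 - y$1) * (x$1 - y$1) + (x$2 - y$2) * (x$2 - y$2) + (x$3 - y$3) * (x$3 - y$3)))"
      unfolding gauss_def norm_sq_vec3 unfolding power2_eq_square vector_minus_component
      by (rule arg_cong[where f=exp]) linarith
    then show ?thesis by (simp flip: exp_of_real)
  qed
  then show ?thesis
    by (simp only:) (intro Ck_exp Ck_mult Ck_add Ck_const Ck_coord)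
qed

lemma gauss_shift_derivative:
  "((\<lambda>x. complex_of_real (gauss (x - y))) has_derivative (\<lambda>v. complex_of_real (- ((x - y) \<bullet> v) * gauss (x - y)))) (at x)"
proof -
  have "((\<lambda>x. - ((x - y) \<bullet> (x - y)) / 2) has_derivative (\<lambda>v. - ((x - y) \<bullet> v))) (at x)"
    by (auto intro!: derivative_eq_intros simp: inner_commute fun_eq_iff inner_diff_right inner_diff_left field_simps)
  from has_derivative_compose[OF this DERIV_exp[unfolded has_field_derivative_def]]
  have "((\<lambda>x. gauss (x - y)) has_derivative (\<lambda>v. - ((x - y) \<bullet> v) * gauss (x - y))) (at x)"
    by (simp add: gauss_def[abs_def] power2_norm_eq_inner mult.commute)
  from has_derivative_of_real[OF this] show ?thesis .
qed

text \<open>Half of the Gaussian exponent absorbs the linear factor. The wider Gaussian then serves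
  as a common majorant in \<open>L2\<close> for the Gaussian and its derivatives.\<close>

lemma coord_gauss_bound: "\<bar>z $ j\<bar> * gauss z \<le> gauss ((1 / sqrt 2) *\<^sub>R z)"
proof -
  have 1: "\<bar>z $ j\<bar> \<le> norm z" by (rule component_le_norm_cart[of z j, unfolded real_norm_def])
  have "norm z \<le> 1 + (norm z)\<^sup>2 / 4" using zero_le_power2[of "norm z / 2 - 1"] by (simp add: power2_eq_square algebra_simps)
  also have "\<dots> \<le> exp ((norm z)\<^sup>2 / 4)" by (rule exp_ge_add_one_self)
  finally have "\<bar>z $ j\<bar> * gauss z \<le> exp ((norm z)\<^sup>2 / 4) * gauss z"
    using 1 by (intro mult_right_mono) (auto simp: less_imp_le)
  also have "\<dots> = gauss ((1 / sqrt 2) *\<^sub>R z)" by (simp add: gauss_def exp_add[symmetric] power_divide)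
  finally show ?thesis .
qed

lemma gauss_wide_le: "gauss z \<le> gauss ((1 / sqrt 2) *\<^sub>R z)"
  by (simp add: gauss_def power_divide)

lemma gauss_wide_L2: "(\<lambda>x. gauss ((1 / sqrt 2) *\<^sub>R (x - y))) \<in> L2"
  using L2_scale_shift(1)[OF gauss_L2, of "1 / sqrt 2" "- ((1 / sqrt 2) *\<^sub>R y)"] by (simp add: scaleR_diff_right)

lemma weak_gradient_gauss:
  assumes u: "u \<in> L2" and g: "is_weak_gradient u g"
  shows "(\<integral>x. u x * complex_of_real ((x - y) $ j * gauss (x - y)) \<partial>lborel) = (\<integral>x. g x $ j * complex_of_real (gauss (x - y)) \<partial>lborel)"
proof -
  have gL: "g \<in> L2" using g by (simp add: is_weak_gradient_def)
  let ?s = "\<lambda>n. 1 / real (Suc n)"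
  define G where "G x = complex_of_real (gauss (x - y))" for x
  define W where "W x = complex_of_real (gauss ((1 / sqrt 2) *\<^sub>R (x - y)))" for x
  \<comment> \<open>Widened bumps tend to their central value \<open>b0\<close> instead of 1; the
    constant appears on both sides and is cancelled at the end.\<close>
  define b0 where "b0 = flat 0 1"
  have b0: "b0 > 0" by (simp add: b0_def flat_def)
  define T where "T n x = complex_of_real (bump (?s n) x) * G x" for n x
  define D where "D n x = complex_of_real (bump (?s n) x) * complex_of_real (- ((x - y) $ j) * gauss (x - y))
      + complex_of_real (flat 2 (1 - (norm (?s n *\<^sub>R x))\<^sup>2) * (- (2 * (?s n)\<^sup>2 * (x $ j)))) * G x" for n x
  have "W \<in> borel_measurable borel" unfolding W_def by measurable
  then have WL: "W \<in> L2"
    using L2_norm_mono(1)[OF gauss_wide_L2, of W y] by (simp add: W_def less_imp_le)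
  have [measurable]: "G \<in> borel_measurable borel" unfolding G_def by measurable
  have sl: "(\<lambda>n. ?s n) \<longlonglongrightarrow> 0" by (intro LIMSEQ_Suc[of "\<lambda>n. 1 / real n"] lim_1_over_n)
  have bl: "(\<lambda>n. complex_of_real (bump (?s n) x)) \<longlonglongrightarrow> complex_of_real b0" for x
  proof -
    have "(\<lambda>n. 1 - (norm (?s n *\<^sub>R x))\<^sup>2) \<longlonglongrightarrow> 1 - (norm (0 *\<^sub>R x))\<^sup>2" by (intro tendsto_intros sl)
    then have "(\<lambda>n. flat 0 (1 - (norm (?s n *\<^sub>R x))\<^sup>2)) \<longlonglongrightarrow> flat 0 1"
      using isCont_tendsto_compose[OF DERIV_isCont[OF flat_deriv[of 0 1]]] by fastforce
    then show ?thesis unfolding bump_def b0_def by (rule tendsto_of_real)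
  qed
  \<comment> \<open>This is the term in which the derivative falls on the bump. On its support one
    factor \<open>?s n\<close> absorbs the coordinate of \<open>x\<close>; the other one makes the
    term vanish in the limit.\<close>
  have second: "norm (complex_of_real (flat 2 (1 - (norm (?s n *\<^sub>R x))\<^sup>2) * (- (2 * (?s n)\<^sup>2 * (x $ j)))) * G x) \<le> 4 * ?s n * gauss (x - y)" for n x
  proof (cases "norm (?s n *\<^sub>R x) \<le> 1")
    case True
    have "\<bar>x $ j\<bar> \<le> norm x" by (rule component_le_norm_cart[of x j, unfolded real_norm_def])
    then have "?s n * \<bar>x $ j\<bar> \<le> ?s n * norm x" by (intro mult_left_mono) auto
    also have "\<dots> \<le> 1" using True by simp
    finally have "?s n * \<bar>x $ j\<bar> \<le> 1" .
    then have 1: "2 * ?s n * (?s n * \<bar>x $ j\<bar>) \<le> 2 * ?s n * 1" by (intro mult_left_mono) auto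
    have 2: "\<bar>flat 2 (1 - (norm (?s n *\<^sub>R x))\<^sup>2)\<bar> \<le> 2"
      using flat_bound[of 2 "1 - (norm (?s n *\<^sub>R x))\<^sup>2" 0] by (simp add: fact_numeral)
    have "norm (complex_of_real (flat 2 (1 - (norm (?s n *\<^sub>R x))\<^sup>2) * (- (2 * (?s n)\<^sup>2 * (x $ j)))) * G x)
       = (\<bar>flat 2 (1 - (norm (?s n *\<^sub>R x))\<^sup>2)\<bar> * (2 * ?s n * (?s n * \<bar>x $ j\<bar>))) * gauss (x - y)"
      unfolding G_def norm_mult norm_of_real abs_mult abs_minus_cancel by (simp add: less_imp_le power2_eq_square)
    also have "\<dots> \<le> (2 * (2 * ?s n * 1)) * gauss (x - y)"
      by (intro mult_right_mono mult_mono 1 2) (auto simp: less_imp_le)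
    finally show ?thesis by simp
  next
    case False
    then have "1 \<le> (norm (?s n *\<^sub>R x))\<^sup>2" by (intro one_le_power) auto
    then have "flat 2 (1 - (norm (?s n *\<^sub>R x))\<^sup>2) = 0" by (simp add: flat_def)
    then show ?thesis by (simp add: less_imp_le)
  qed
  have T: "T n \<in> test_functions" for n
  proof -
    have "(\<lambda>x. complex_of_real (bump (?s n) x)) \<in> test_functions"
      by (rule test_functionsI[of _ "1 / ?s n"]) (auto intro!: Ck_bump bump_zero)
    from test_functions_mult[OF this Ck_gauss] show ?thesis unfolding T_def[abs_def] G_def .
  qed
  have TD: "partial_deriv j (T n) x = D n x" for n x
    unfolding T_def[abs_def] G_def
    by (subst partial_deriv_eq[OF has_derivative_mult[OF bump_derivative gauss_shift_derivative]])
       (simp add: D_def G_def inner_axis)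
  have Tb: "norm (T n x) \<le> norm (W x)" for n x
    using bump_nonneg[of "?s n" x] bump_le_1[of "?s n" x] gauss_wide_le[of "x - y"]
      mult_mono[of "bump (?s n) x" 1 "gauss (x - y)" "gauss ((1 / sqrt 2) *\<^sub>R (x - y))"]
    unfolding T_def G_def W_def norm_mult norm_of_real by (simp add: less_imp_le)
  have Db: "norm (D n x) \<le> norm (5 * W x)" for n x
  proof -
    have "norm (D n x) \<le> bump (?s n) x * (\<bar>(x - y) $ j\<bar> * gauss (x - y)) + 4 * ?s n * gauss (x - y)"
      unfolding D_def by (rule order_trans[OF norm_triangle_ineq add_mono[OF _ second]])
        (simp add: norm_mult abs_mult bump_nonneg less_imp_le abs_minus_commute del: of_real_mult)
    also have "\<dots> \<le> 1 * gauss ((1 / sqrt 2) *\<^sub>R (x - y)) + 4 * 1 * gauss ((1 / sqrt 2) *\<^sub>R (x - y))"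
      by (intro add_mono mult_mono bump_le_1 bump_nonneg coord_gauss_bound gauss_wide_le) (auto simp: less_imp_le)
    also have "\<dots> = norm (5 * W x)" by (simp add: W_def norm_mult less_imp_le)
    finally show ?thesis .
  qed
  have TL: "T n \<in> L2" "D n \<in> L2" for n
    using test_functions_props(1)[OF T] test_functions_partial(1)[OF T, of j n] ext[of "partial_deriv j (T n)" "D n", OF TD] by auto
  have Gl: "AE x in lborel. (\<lambda>n. T n x) \<longlonglongrightarrow> complex_of_real b0 * G x"
    unfolding T_def by (intro AE_I2 tendsto_intros bl)
  have Dl: "AE x in lborel. (\<lambda>n. D n x) \<longlonglongrightarrow> complex_of_real b0 * complex_of_real (- ((x - y) $ j) * gauss (x - y))"
  proof (rule AE_I2)
    fix x
    have "(\<lambda>n. 4 * ?s n * gauss (x - y)) \<longlonglongrightarrow> 4 * 0 * gauss (x - y)" by (intro tendsto_intros sl)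
    then have "(\<lambda>n. complex_of_real (flat 2 (1 - (norm (?s n *\<^sub>R x))\<^sup>2) * (- (2 * (?s n)\<^sup>2 * (x $ j)))) * G x) \<longlonglongrightarrow> 0"
      by (intro Lim_null_comparison[OF always_eventually[OF allI[OF second]]]) simp
    from tendsto_add[OF tendsto_mult_right[OF bl[of x], of "complex_of_real (- ((x - y) $ j) * gauss (x - y))"] this]
    show "(\<lambda>n. D n x) \<longlonglongrightarrow> complex_of_real b0 * complex_of_real (- ((x - y) $ j) * gauss (x - y))"
      unfolding D_def by simp
  qed
  have 1: "(\<lambda>n. L2_norm (\<lambda>x. T n x - complex_of_real b0 * G x)) \<longlonglongrightarrow> 0"
    by (rule L2_dominated_convergence[OF L2_measurable[OF TL(1)] _ WL Gl]) (use Tb in auto)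
  have 2: "(\<lambda>n. L2_norm (\<lambda>x. D n x - complex_of_real b0 * complex_of_real (- ((x - y) $ j) * gauss (x - y)))) \<longlonglongrightarrow> 0"
    by (rule L2_dominated_convergence[OF L2_measurable[OF TL(2)] _ L2_cmult[OF WL, of 5] Dl]) (use Db in auto)
  have GL: "G \<in> L2"
    by (rule L2_norm_mono(1)[OF WL]) (use gauss_wide_le in \<open>auto simp: G_def W_def less_imp_le\<close>)
  have DL: "(\<lambda>x. complex_of_real (- ((x - y) $ j) * gauss (x - y))) \<in> L2"
    by (rule L2_norm_mono(1)[OF WL])
       (use coord_gauss_bound[of "_ - y" j] in \<open>auto simp: W_def less_imp_le norm_mult abs_mult simp del: of_real_mult vector_minus_component\<close>)
  have u1: "(\<lambda>n. \<integral>x. u x * D n x \<partial>lborel) \<longlonglongrightarrow> (\<integral>x. u x * (complex_of_real b0 * complex_of_real (- ((x - y) $ j) * gauss (x - y))) \<partial>lborel)"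
    by (rule tendsto_L2_complex_mult[OF _ TL(2) u L2_cmult[OF DL] _ 2]) (auto simp: u)
  have u2: "(\<lambda>n. - (\<integral>x. g x $ j * T n x \<partial>lborel)) \<longlonglongrightarrow> - (\<integral>x. g x $ j * (complex_of_real b0 * G x) \<partial>lborel)"
    by (intro tendsto_minus tendsto_L2_complex_mult[OF _ TL(1) L2_component(1)[OF gL] L2_cmult[OF GL] _ 1]) (auto simp: L2_component gL)
  have "(\<integral>x. u x * D n x \<partial>lborel) = - (\<integral>x. g x $ j * T n x \<partial>lborel)" for n
  proof -
    have "(\<integral>x. u x * partial_deriv j (T n) x \<partial>lborel) = - (\<integral>x. g x $ j * T n x \<partial>lborel)"
      using g T[of n] unfolding is_weak_gradient_def by blast
    then show ?thesis by (simp only: TD)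
  qed
  with u1 u2 have "(\<integral>x. u x * (complex_of_real b0 * complex_of_real (- ((x - y) $ j) * gauss (x - y))) \<partial>lborel) = - (\<integral>x. g x $ j * (complex_of_real b0 * G x) \<partial>lborel)"
    using LIMSEQ_unique by fastforce
  moreover have "(\<integral>x. u x * (complex_of_real b0 * complex_of_real (- ((x - y) $ j) * gauss (x - y))) \<partial>lborel)
      = (\<integral>x. - complex_of_real b0 * (u x * complex_of_real ((x - y) $ j * gauss (x - y))) \<partial>lborel)"
    by (rule Bochner_Integration.integral_cong) (auto simp: algebra_simps)
  moreover have "(\<integral>x. g x $ j * (complex_of_real b0 * G x) \<partial>lborel) = (\<integral>x. complex_of_real b0 * (g x $ j * G x) \<partial>lborel)"
    by (rule Bochner_Integration.integral_cong) auto
  ultimately show ?thesis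
    using b0 unfolding integral_mult_right_zero G_def by simp
qed

lemma gauss_kernel_L1_L2:
  "(\<lambda>\<xi>. exp (\<i> * complex_of_real (y \<bullet> \<xi>)) * complex_of_real (gauss \<xi>)) \<in> L2" (is "?h \<in> _")
  "integrable lborel (\<lambda>\<xi>. exp (\<i> * complex_of_real (y \<bullet> \<xi>)) * complex_of_real (gauss \<xi>))"
  "(\<lambda>\<xi>. complex_of_real (\<xi> $ j) * (exp (\<i> * complex_of_real (y \<bullet> \<xi>)) * complex_of_real (gauss \<xi>))) \<in> L2" (is "?m \<in> _")
  "integrable lborel (\<lambda>\<xi>. complex_of_real (\<xi> $ j) * (exp (\<i> * complex_of_real (y \<bullet> \<xi>)) * complex_of_real (gauss \<xi>)))"
proof -
  show "?h \<in> L2"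
    by (rule L2_norm_mono(1)[OF gauss_L2]) (auto simp: norm_mult norm_exp_eq_Re)
  show "integrable lborel ?h"
    using cexp_gauss_scaled_integrable[of 1 y] by simp
  have "(\<lambda>\<xi>. gauss ((1 / sqrt 2) *\<^sub>R \<xi>)) \<in> L2" using gauss_wide_L2[of 0] by simp
  then show "?m \<in> L2"
  proof (rule L2_norm_mono(1))
    show "norm (?m \<xi>) \<le> norm (gauss ((1 / sqrt 2) *\<^sub>R \<xi>))" for \<xi>
      using coord_gauss_bound[of \<xi> j] by (simp add: norm_mult norm_exp_eq_Re less_imp_le)
  qed measurable
  show "integrable lborel ?m"
    using gauss_moment_integrable[of j y] by (simp add: inner_commute)
qed

lemma gauss_kernel_fourier:
  "fourier_integral (\<lambda>\<xi>. exp (\<i> * complex_of_real (y \<bullet> \<xi>)) * complex_of_real (gauss \<xi>)) x = complex_of_real (sqrt fkappa * gauss (x - y))"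
  "fourier_integral (\<lambda>\<xi>. complex_of_real (\<xi> $ j) * (exp (\<i> * complex_of_real (y \<bullet> \<xi>)) * complex_of_real (gauss \<xi>))) x
     = - \<i> * complex_of_real (sqrt fkappa) * complex_of_real ((x - y) $ j * gauss (x - y))"
proof -
  show "fourier_integral (\<lambda>\<xi>. exp (\<i> * complex_of_real (y \<bullet> \<xi>)) * complex_of_real (gauss \<xi>)) x = complex_of_real (sqrt fkappa * gauss (x - y))"
    using gauss_scaled_fourier[of 1 y x] by simp
  have "fourier_integral (\<lambda>\<xi>. complex_of_real (\<xi> $ j) * (exp (\<i> * complex_of_real (y \<bullet> \<xi>)) * complex_of_real (gauss \<xi>))) x
     = (\<integral>\<xi>. complex_of_real (\<xi> $ j) * (exp (\<i> * complex_of_real (\<xi> \<bullet> (y - x))) * complex_of_real (gauss \<xi>)) \<partial>lborel)"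
    unfolding fourier_integral_def
  proof (rule Bochner_Integration.integral_cong)
    fix \<xi> :: "real^3"
    have "exp (- \<i> * complex_of_real (\<xi> \<bullet> x)) * exp (\<i> * complex_of_real (y \<bullet> \<xi>)) = exp (\<i> * complex_of_real (\<xi> \<bullet> (y - x)))"
      by (simp add: exp_add[symmetric] inner_diff_right algebra_simps inner_commute)
    then show "exp (- \<i> * complex_of_real (\<xi> \<bullet> x)) * (complex_of_real (\<xi> $ j) * (exp (\<i> * complex_of_real (y \<bullet> \<xi>)) * complex_of_real (gauss \<xi>)))
        = complex_of_real (\<xi> $ j) * (exp (\<i> * complex_of_real (\<xi> \<bullet> (y - x))) * complex_of_real (gauss \<xi>))"
      by (simp add: mult_ac)
  qed simp
  also have "\<dots> = \<i> * complex_of_real ((y - x) $ j) * complex_of_real (sqrt fkappa * gauss (y - x))"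
    by (rule gauss_moment_fourier)
  also have "gauss (y - x) = gauss (x - y)" by (simp add: gauss_def norm_minus_commute)
  finally show "fourier_integral (\<lambda>\<xi>. complex_of_real (\<xi> $ j) * (exp (\<i> * complex_of_real (y \<bullet> \<xi>)) * complex_of_real (gauss \<xi>))) x
     = - \<i> * complex_of_real (sqrt fkappa) * complex_of_real ((x - y) $ j * gauss (x - y))"
    by (simp add: algebra_simps)
qed

text \<open>Test with Gaussians centred at \<open>y\<close>, which are transforms of modulated
  Gaussians. The resulting identities for all \<open>y\<close> say that the Fourier integral of
  \<open>k\<close> vanishes everywhere. The Gaussian factor in \<open>k\<close> makes it integrable
  and square integrable, so the isometry gives \<open>k = 0\<close>, and the Gaussian, being
  positive, can be divided out.\<close>

theorem FT_weak_gradient: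
  assumes u: "u \<in> L2" and g: "is_weak_gradient u g"
  shows "AE \<xi> in lborel. FT (\<lambda>x. g x $ j) \<xi> = \<i> * complex_of_real (\<xi> $ j) * FT u \<xi>"
proof -
  have gL: "(\<lambda>x. g x $ j) \<in> L2" using g L2_component(1) by (simp add: is_weak_gradient_def)
  define U where "U = FT u"
  define V where "V = FT (\<lambda>x. g x $ j)"
  have UL: "U \<in> L2" and VL: "V \<in> L2" unfolding U_def V_def using u gL by auto
  note [measurable] = L2_measurable[OF UL] L2_measurable[OF VL]
  define k where "k \<xi> = (complex_of_real (\<xi> $ j) * complex_of_real (gauss \<xi>)) * U \<xi> + (\<i> * complex_of_real (gauss \<xi>)) * V \<xi>" for \<xi>
  let ?h = "\<lambda>y \<xi>. exp (\<i> * complex_of_real (y \<bullet> \<xi>)) * complex_of_real (gauss \<xi>)"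
  let ?m = "\<lambda>y \<xi>. complex_of_real (\<xi> $ j) * ?h y \<xi>"
  have key: "(\<integral>\<xi>. U \<xi> * ?m y \<xi> \<partial>lborel) = - \<i> * (\<integral>\<xi>. V \<xi> * ?h y \<xi> \<partial>lborel)" for y
  proof -
    have "(\<integral>\<xi>. U \<xi> * ?m y \<xi> \<partial>lborel) = (\<integral>x. u x * FT (?m y) x \<partial>lborel)"
      unfolding U_def by (rule FT_mult_formula[OF u gauss_kernel_L1_L2(3)])
    also have "\<dots> = (\<integral>x. u x * (- \<i> * complex_of_real (sqrt fkappa) * complex_of_real ((x - y) $ j * gauss (x - y))) \<partial>lborel)"
    proof (rule integral_cong_AE)
      show "(\<lambda>x. u x * FT (?m y) x) \<in> borel_measurable lborel"
        using L2_measurable[OF u] L2_measurable[OF FT_L2[OF gauss_kernel_L1_L2(3)]] by measurable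
      show "(\<lambda>x. u x * (- \<i> * complex_of_real (sqrt fkappa) * complex_of_real ((x - y) $ j * gauss (x - y)))) \<in> borel_measurable lborel"
        using L2_measurable[OF u] by measurable
      show "AE x in lborel. u x * FT (?m y) x = u x * (- \<i> * complex_of_real (sqrt fkappa) * complex_of_real ((x - y) $ j * gauss (x - y)))"
        using FT_eq_fourier_integral[OF gauss_kernel_L1_L2(3,4)[of j y]]
        unfolding gauss_kernel_fourier(2) by eventually_elim simp
    qed
    also have "\<dots> = (\<integral>x. (- \<i> * complex_of_real (sqrt fkappa)) * (u x * complex_of_real ((x - y) $ j * gauss (x - y))) \<partial>lborel)"
      by (rule Bochner_Integration.integral_cong) auto
    also have "\<dots> = (- \<i> * complex_of_real (sqrt fkappa)) * (\<integral>x. g x $ j * complex_of_real (gauss (x - y)) \<partial>lborel)"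
      unfolding integral_mult_right_zero weak_gradient_gauss[OF u g] ..
    also have "\<dots> = - \<i> * (\<integral>x. complex_of_real (sqrt fkappa) * (g x $ j * complex_of_real (gauss (x - y))) \<partial>lborel)"
      unfolding integral_mult_right_zero by simp
    also have "(\<integral>x. complex_of_real (sqrt fkappa) * (g x $ j * complex_of_real (gauss (x - y))) \<partial>lborel) = (\<integral>x. g x $ j * FT (?h y) x \<partial>lborel)"
    proof (rule integral_cong_AE)
      show "(\<lambda>x. g x $ j * FT (?h y) x) \<in> borel_measurable lborel"
        using L2_measurable[OF gL] L2_measurable[OF FT_L2[OF gauss_kernel_L1_L2(1)]] by measurable
      show "(\<lambda>x. complex_of_real (sqrt fkappa) * (g x $ j * complex_of_real (gauss (x - y)))) \<in> borel_measurable lborel"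
        using L2_measurable[OF gL] by measurable
      show "AE x in lborel. complex_of_real (sqrt fkappa) * (g x $ j * complex_of_real (gauss (x - y))) = g x $ j * FT (?h y) x"
        using FT_eq_fourier_integral[OF gauss_kernel_L1_L2(1,2)[of y]]
        unfolding gauss_kernel_fourier(1) by eventually_elim simp
    qed
    also have "\<dots> = (\<integral>\<xi>. V \<xi> * ?h y \<xi> \<partial>lborel)"
      unfolding V_def by (rule FT_mult_formula[OF gL gauss_kernel_L1_L2(1), symmetric])
    finally show ?thesis .
  qed
  have bound: "\<bar>\<xi> $ j\<bar> * gauss \<xi> \<le> 1" for \<xi> using coord_gauss_bound[of \<xi> j] gauss_le_1 order_trans by blast
  have kL: "k \<in> L2"
    unfolding k_def
  proof (rule L2_add)
    show "(\<lambda>\<xi>. (complex_of_real (\<xi> $ j) * complex_of_real (gauss \<xi>)) * U \<xi>) \<in> L2"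
    proof (rule L2_norm_mono(1)[OF UL])
      show "norm ((complex_of_real (\<xi> $ j) * complex_of_real (gauss \<xi>)) * U \<xi>) \<le> norm (U \<xi>)" for \<xi>
        using bound[of \<xi>] by (simp add: norm_mult less_imp_le mult_left_le_one_le)
    qed measurable
    show "(\<lambda>\<xi>. (\<i> * complex_of_real (gauss \<xi>)) * V \<xi>) \<in> L2"
    proof (rule L2_norm_mono(1)[OF VL])
      show "norm ((\<i> * complex_of_real (gauss \<xi>)) * V \<xi>) \<le> norm (V \<xi>)" for \<xi>
        using gauss_le_1[of \<xi>] by (simp add: norm_mult less_imp_le mult_left_le_one_le)
    qed measurable
  qed
  have i1: "integrable lborel (\<lambda>\<xi>. U \<xi> * ?m y \<xi>)" and i2: "integrable lborel (\<lambda>\<xi>. V \<xi> * ?h y \<xi>)" for y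
    by (intro L2_complex_mult_integrable UL VL gauss_kernel_L1_L2)+
  have keq: "exp (\<i> * complex_of_real (y \<bullet> \<xi>)) * k \<xi> = U \<xi> * ?m y \<xi> + \<i> * (V \<xi> * ?h y \<xi>)" for y \<xi>
    by (simp add: k_def algebra_simps)
  have ki: "integrable lborel k"
    using Bochner_Integration.integrable_add[OF i1[of 0] integrable_mult_right[OF i2[of 0], of \<i>]]
    unfolding keq[symmetric] by simp
  have "fourier_integral k \<xi> = 0" for \<xi>
  proof -
    have "fourier_integral k \<xi> = (\<integral>x. exp (\<i> * complex_of_real ((- \<xi>) \<bullet> x)) * k x \<partial>lborel)"
      unfolding fourier_integral_def by (rule Bochner_Integration.integral_cong) (auto simp: inner_commute)
    also have "\<dots> = (\<integral>x. U x * ?m (- \<xi>) x \<partial>lborel) + \<i> * (\<integral>x. V x * ?h (- \<xi>) x \<partial>lborel)"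
      unfolding keq by (subst Bochner_Integration.integral_add[OF i1 integrable_mult_right[OF i2]]) (simp only: integral_mult_right_zero)
    also have "\<dots> = 0" unfolding key by simp
    finally show ?thesis .
  qed
  then have "L2_norm (fourier_integral k) = 0" by (simp add: L2_norm_def)
  then have "L2_norm k = 0" using fourier_integral_isometry[OF kL ki] by simp
  then have "AE \<xi> in lborel. k \<xi> = 0" using L2_norm_eq_0[OF kL] by simp
  then show ?thesis
  proof eventually_elim
    case (elim \<xi>)
    then have "complex_of_real (gauss \<xi>) * (complex_of_real (\<xi> $ j) * U \<xi> + \<i> * V \<xi>) = 0" by (simp add: k_def algebra_simps)
    then have "complex_of_real (\<xi> $ j) * U \<xi> + \<i> * V \<xi> = 0" using gauss_pos[of \<xi>] by simp
    then have "- \<i> * (complex_of_real (\<xi> $ j) * U \<xi> + \<i> * V \<xi>) = 0" by simp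
    then have "V \<xi> = \<i> * complex_of_real (\<xi> $ j) * U \<xi>" by (simp add: algebra_simps)
    then show ?case by (simp add: U_def V_def)
  qed
qed

section \<open>Uniqueness and calculus of weak gradients\<close>

lemma weak_gradient_L2: "is_weak_gradient u g \<Longrightarrow> g \<in> L2"
  by (simp add: is_weak_gradient_def)

lemma FT_eq_imp_AE_eq:
  assumes "f \<in> L2" "g \<in> L2" "AE \<xi> in lborel. FT f \<xi> = FT g \<xi>"
  shows "AE x in lborel. f x = g x"
proof -
  have "AE x in lborel. FT (\<lambda>x. f x - g x) x = 0"
    using FT_diff[OF assms(1,2)] assms(3) by eventually_elim simp
  from FT_inj[OF L2_diff[OF assms(1,2)] this] show ?thesis by (auto elim: eventually_mono)
qed

lemma weak_gradient_unique:
  assumes u: "u \<in> L2" and g: "is_weak_gradient u g" and h: "is_weak_gradient u h"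
  shows "AE x in lborel. g x = h x"
proof -
  have c: "AE x in lborel. g x $ j = h x $ j" for j
  proof (rule FT_eq_imp_AE_eq)
    show "AE \<xi> in lborel. FT (\<lambda>x. g x $ j) \<xi> = FT (\<lambda>x. h x $ j) \<xi>"
      using FT_weak_gradient[OF u g, of j] FT_weak_gradient[OF u h, of j] by eventually_elim simp
  qed (use L2_component weak_gradient_L2 g h in blast)+
  from c[of 1] c[of 2] c[of 3] show ?thesis
    by eventually_elim (simp add: vec_eq_iff forall_3)
qed

lemma H1_L2: "u \<in> H1 \<Longrightarrow> u \<in> L2" by (simp add: H1_def)

lemma H1_weak_grad: "u \<in> H1 \<Longrightarrow> is_weak_gradient u (weak_grad u)"
proof -
  assume "u \<in> H1"
  then obtain g where "is_weak_gradient u g" by (auto simp: H1_def)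
  then show ?thesis unfolding weak_grad_def by (rule someI[of "is_weak_gradient u"])
qed

lemma weak_grad_L2: "u \<in> H1 \<Longrightarrow> weak_grad u \<in> L2"
  using H1_weak_grad weak_gradient_L2 by blast

text \<open>\<open>weak_grad\<close> is a choice; uniqueness allows it to be computed from any weak
  gradient at hand.\<close>

lemma weak_grad_eqI:
  assumes "u \<in> L2" "is_weak_gradient u g"
  shows "u \<in> H1" "AE x in lborel. weak_grad u x = g x"
proof -
  show "u \<in> H1" using assms by (auto simp: H1_def)
  from weak_gradient_unique[OF assms(1) H1_weak_grad[OF this] assms(2)]
  show "AE x in lborel. weak_grad u x = g x" .
qed

lemma is_weak_gradient_add:
  assumes "u \<in> L2" "v \<in> L2" "is_weak_gradient u g" "is_weak_gradient v h"
  shows "is_weak_gradient (\<lambda>x. u x + v x) (\<lambda>x. g x + h x)"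
  unfolding is_weak_gradient_def
proof (intro conjI allI ballI)
  have gh: "g \<in> L2" "h \<in> L2" using assms weak_gradient_L2 by auto
  then show "(\<lambda>x. g x + h x) \<in> L2" by auto
  fix i \<phi> assume p: "\<phi> \<in> test_functions"
  note P = test_functions_props(1)[OF p] test_functions_partial(1)[OF p, of i]
  show "(\<integral>x. (u x + v x) * partial_deriv i \<phi> x \<partial>lborel) = - (\<integral>x. (g x + h x) $ i * \<phi> x \<partial>lborel)"
    using assms(3,4) p L2_complex_mult_integrable[OF assms(1) P(2)] L2_complex_mult_integrable[OF assms(2) P(2)]
      L2_complex_mult_integrable[OF L2_component(1)[OF gh(1), of i] P(1)] L2_complex_mult_integrable[OF L2_component(1)[OF gh(2), of i] P(1)]
    by (simp add: is_weak_gradient_def ring_distribs)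
qed

lemma is_weak_gradient_scaleR:
  assumes "is_weak_gradient u g"
  shows "is_weak_gradient (\<lambda>x. r *\<^sub>R u x) (\<lambda>x. r *\<^sub>R g x)"
  using assms unfolding is_weak_gradient_def by auto

lemma is_weak_gradient_limit:
  assumes u: "\<And>n. u n \<in> L2" "w \<in> L2" "(\<lambda>n. L2_norm (\<lambda>x. u n x - w x)) \<longlonglongrightarrow> 0"
    and g: "\<And>n. is_weak_gradient (u n) (g n)" "h \<in> L2" "(\<lambda>n. L2_norm (\<lambda>x. g n x - h x)) \<longlonglongrightarrow> 0"
  shows "is_weak_gradient w h"
  unfolding is_weak_gradient_def
proof (intro conjI allI ballI)
  show "h \<in> L2" by fact
  fix i \<phi> assume p: "\<phi> \<in> test_functions"
  note P = test_functions_props(1)[OF p] test_functions_partial(1)[OF p, of i]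
  have gL: "g n \<in> L2" for n using g(1) weak_gradient_L2 by blast
  have gi: "(\<lambda>n. L2_norm (\<lambda>x. g n x $ i - h x $ i)) \<longlonglongrightarrow> 0"
  proof (rule Lim_null_comparison[OF always_eventually g(3)])
    show "\<forall>n. norm (L2_norm (\<lambda>x. g n x $ i - h x $ i)) \<le> L2_norm (\<lambda>x. g n x - h x)"
      using L2_component(2)[OF L2_diff[OF gL g(2)], of _ i] by simp
  qed
  have 1: "(\<lambda>n. \<integral>x. u n x * partial_deriv i \<phi> x \<partial>lborel) \<longlonglongrightarrow> (\<integral>x. w x * partial_deriv i \<phi> x \<partial>lborel)"
    by (rule tendsto_L2_complex_mult[OF u(1) P(2) u(2) P(2) u(3)]) simp
  have 2: "(\<lambda>n. - (\<integral>x. g n x $ i * \<phi> x \<partial>lborel)) \<longlonglongrightarrow> - (\<integral>x. h x $ i * \<phi> x \<partial>lborel)"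
    by (intro tendsto_minus tendsto_L2_complex_mult[OF _ P(1) _ P(1) gi] L2_component gL g) simp
  have "(\<integral>x. u n x * partial_deriv i \<phi> x \<partial>lborel) = - (\<integral>x. g n x $ i * \<phi> x \<partial>lborel)" for n
    using g(1)[of n] p unfolding is_weak_gradient_def by blast
  with 1 2 show "(\<integral>x. w x * partial_deriv i \<phi> x \<partial>lborel) = - (\<integral>x. h x $ i * \<phi> x \<partial>lborel)"
    using LIMSEQ_unique by simp
qed

lemma Ck_scale: "Ck k f \<Longrightarrow> Ck k (\<lambda>x. f (r *\<^sub>R x))"
proof (induction k arbitrary: f)
  case 0
  then have "continuous_on UNIV f" by simp
  from continuous_on_compose2[OF this continuous_on_scaleR[OF continuous_on_const continuous_on_id]]
  show ?case by simp
next
  case (Suc k)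
  obtain f' where f: "\<And>x. (f has_derivative f' x) (at x)" "\<And>i. Ck k (\<lambda>x. f' x (axis i 1))"
    using Suc.prems by auto
  have d: "((\<lambda>x. f (r *\<^sub>R x)) has_derivative (\<lambda>v. f' (r *\<^sub>R x) (r *\<^sub>R v))) (at x)" for x
    by (rule has_derivative_compose[OF _ f(1)]) (auto intro!: derivative_eq_intros)
  have e: "f' (r *\<^sub>R x) (r *\<^sub>R v) = complex_of_real r * f' (r *\<^sub>R x) v" for x v
    using f(1)[of "r *\<^sub>R x"] by (simp add: has_derivative_bounded_linear bounded_linear.linear linear_cmul scaleR_conv_of_real[where 'a=complex])
  show ?case
    by (rule Ck_SucI[OF d]) (unfold e, intro Ck_mult Ck_const Suc.IH[OF f(2)])
qed

lemma test_functions_scale: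
  assumes f: "f \<in> test_functions" and "r > 0"
  shows "(\<lambda>x. f (r *\<^sub>R x)) \<in> test_functions"
    and "partial_deriv i (\<lambda>x. f (r *\<^sub>R x)) x = complex_of_real r * partial_deriv i f (r *\<^sub>R x)"
proof -
  obtain R where R: "R > 0" "\<And>x. norm x > R \<Longrightarrow> f x = 0" using test_functions_support[OF f] by blast
  show "(\<lambda>x. f (r *\<^sub>R x)) \<in> test_functions"
  proof (rule test_functionsI)
    show "Ck k (\<lambda>x. f (r *\<^sub>R x))" for k using f by (intro Ck_scale) (simp add: test_functions_def)
    show "f (r *\<^sub>R x) = 0" if "norm x > R / r" for x
      using that \<open>r > 0\<close> by (intro R(2)) (simp add: pos_divide_less_eq mult.commute)
  qed
  have "((\<lambda>x. f (r *\<^sub>R x)) has_derivative (\<lambda>v. frechet_derivative f (at (r *\<^sub>R x)) (r *\<^sub>R v))) (at x)"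
    by (rule has_derivative_compose[OF _ test_functions_props(3)[OF f]]) (auto intro!: derivative_eq_intros)
  from partial_deriv_eq[OF this, of i]
  show "partial_deriv i (\<lambda>x. f (r *\<^sub>R x)) x = complex_of_real r * partial_deriv i f (r *\<^sub>R x)"
    using test_functions_props(3)[OF f, of "r *\<^sub>R x"]
    by (simp add: partial_deriv_def has_derivative_bounded_linear bounded_linear.linear linear_cmul scaleR_conv_of_real[where 'a=complex])
qed

lemma is_weak_gradient_dilation:
  assumes u: "u \<in> L2" and g: "is_weak_gradient u g" and t: "t > 0"
  shows "is_weak_gradient (\<lambda>x. u (t *\<^sub>R x)) (\<lambda>x. t *\<^sub>R g (t *\<^sub>R x))"
  unfolding is_weak_gradient_def
proof (intro conjI allI ballI)
  have gL: "g \<in> L2" using g weak_gradient_L2 by blast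
  show "(\<lambda>x. t *\<^sub>R g (t *\<^sub>R x)) \<in> L2" using L2_scale_shift(1)[OF gL t, of 0] by (intro L2_scaleR) simp
  fix i \<phi> assume p: "\<phi> \<in> test_functions"
  have it: "1/t > 0" using t by simp
  \<comment> \<open>A change of variables moves the dilation from \<open>u\<close> to the test
    function, where it appears inverted.\<close>
  let ?p = "\<lambda>x. \<phi> ((1/t) *\<^sub>R x)"
  note P = test_functions_scale(1)[OF p it] test_functions_scale(2)[OF p it, of i]
  have [measurable]: "u \<in> borel_measurable borel" "(\<lambda>x. g x $ i) \<in> borel_measurable borel" "?p \<in> borel_measurable borel" "partial_deriv i ?p \<in> borel_measurable borel"
    using L2_measurable u L2_component(1)[OF gL] test_functions_props(1)[OF P(1)] test_functions_partial(1)[OF P(1)] by auto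
  have "(\<integral>x. u (t *\<^sub>R x) * partial_deriv i \<phi> x \<partial>lborel) = (\<integral>x. complex_of_real t * (u (0 + t *\<^sub>R x) * partial_deriv i ?p (0 + t *\<^sub>R x)) \<partial>lborel)"
    unfolding P(2) using t by (intro Bochner_Integration.integral_cong) auto
  also have "\<dots> = complex_of_real t * (\<integral>x. u (0 + t *\<^sub>R x) * partial_deriv i ?p (0 + t *\<^sub>R x) \<partial>lborel)"
    by (rule integral_mult_right_zero)
  also have "(\<integral>x. u (0 + t *\<^sub>R x) * partial_deriv i ?p (0 + t *\<^sub>R x) \<partial>lborel) = (1/t^3) *\<^sub>R (\<integral>x. u x * partial_deriv i ?p x \<partial>lborel)"
    by (rule lborel_scale_shift(1)[of "\<lambda>x. u x * partial_deriv i ?p x"]) (use t in measurable)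
  also have "(\<integral>x. u x * partial_deriv i ?p x \<partial>lborel) = - (\<integral>x. g x $ i * ?p x \<partial>lborel)"
    using g P(1) unfolding is_weak_gradient_def by blast
  also have "(1/t^3) *\<^sub>R (- (\<integral>x. g x $ i * ?p x \<partial>lborel)) = - (\<integral>x. g (0 + t *\<^sub>R x) $ i * ?p (0 + t *\<^sub>R x) \<partial>lborel)"
    by (subst lborel_scale_shift(1)[of "\<lambda>x. g x $ i * ?p x"]) (use t in auto)
  also have "complex_of_real t * - (\<integral>x. g (0 + t *\<^sub>R x) $ i * ?p (0 + t *\<^sub>R x) \<partial>lborel)
      = - (\<integral>x. complex_of_real t * (g (0 + t *\<^sub>R x) $ i * ?p (0 + t *\<^sub>R x)) \<partial>lborel)"
    unfolding integral_mult_right_zero by simp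
  also have "\<dots> = - (\<integral>x. (t *\<^sub>R g (t *\<^sub>R x)) $ i * \<phi> x \<partial>lborel)"
    using t by (intro arg_cong[where f=uminus] Bochner_Integration.integral_cong) (auto simp: scaleR_conv_of_real[where 'a=complex])
  finally show "(\<integral>x. u (t *\<^sub>R x) * partial_deriv i \<phi> x \<partial>lborel) = - (\<integral>x. (t *\<^sub>R g (t *\<^sub>R x)) $ i * \<phi> x \<partial>lborel)" .
qed

lemma H1_fourier_norm:
  assumes u: "u \<in> H1"
  shows "(\<lambda>\<xi>. norm \<xi> *\<^sub>R FT u \<xi>) \<in> L2" "L2_norm (\<lambda>\<xi>. norm \<xi> *\<^sub>R FT u \<xi>) = sqrt fkappa * L2_norm (weak_grad u)"
proof -
  note uL = H1_L2[OF u] and g = H1_weak_grad[OF u] and gL = weak_grad_L2[OF u]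
  note [measurable] = L2_measurable[OF FT_L2[OF uL]]
  let ?V = "\<lambda>j. FT (\<lambda>x. weak_grad u x $ j)"
  have VL: "?V j \<in> L2" for j using L2_component(1)[OF gL] by auto
  have ae: "AE \<xi> in lborel. (norm (norm \<xi> *\<^sub>R FT u \<xi>))\<^sup>2 = (cmod (?V 1 \<xi>))\<^sup>2 + (cmod (?V 2 \<xi>))\<^sup>2 + (cmod (?V 3 \<xi>))\<^sup>2"
    using FT_weak_gradient[OF uL g, of 1] FT_weak_gradient[OF uL g, of 2] FT_weak_gradient[OF uL g, of 3]
    by eventually_elim (simp add: norm_mult power_mult_distrib norm_sq_vec3 ring_distribs)
  have i: "integrable lborel (\<lambda>\<xi>. (cmod (?V 1 \<xi>))\<^sup>2 + (cmod (?V 2 \<xi>))\<^sup>2 + (cmod (?V 3 \<xi>))\<^sup>2)"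
    using L2_integrable[OF VL] by simp
  show "(\<lambda>\<xi>. norm \<xi> *\<^sub>R FT u \<xi>) \<in> L2"
  proof (rule L2I)
    show "integrable lborel (\<lambda>\<xi>. (norm (norm \<xi> *\<^sub>R FT u \<xi>))\<^sup>2)"
      by (rule Bochner_Integration.integrable_bound[OF i]) (use ae in \<open>auto elim: eventually_mono\<close>)
  qed measurable
  have "(L2_norm (\<lambda>\<xi>. norm \<xi> *\<^sub>R FT u \<xi>))\<^sup>2 = (\<integral>\<xi>. (cmod (?V 1 \<xi>))\<^sup>2 + (cmod (?V 2 \<xi>))\<^sup>2 + (cmod (?V 3 \<xi>))\<^sup>2 \<partial>lborel)"
    unfolding L2_norm_sq by (rule integral_cong_AE) (use ae VL[THEN L2_measurable] in auto)
  also have "\<dots> = (L2_norm (?V 1))\<^sup>2 + (L2_norm (?V 2))\<^sup>2 + (L2_norm (?V 3))\<^sup>2"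
    using L2_integrable[OF VL] by (simp add: L2_norm_sq)
  also have "\<dots> = (sqrt fkappa * L2_norm (weak_grad u))\<^sup>2"
    unfolding Plancherel[OF L2_component(1)[OF gL]] power_mult_distrib L2_norm_component_sum[OF gL] by (simp only: ring_distribs)
  finally show "L2_norm (\<lambda>\<xi>. norm \<xi> *\<^sub>R FT u \<xi>) = sqrt fkappa * L2_norm (weak_grad u)"
    by (subst (asm) power2_eq_iff_nonneg) (auto simp: less_imp_le)
qed

section \<open>Frequency truncation and the Gagliardo--Nirenberg inequality\<close>

lemma borel_cball3 [measurable]: "cball (0::real^3) R \<in> sets borel"
  by (intro borel_closed closed_cball)

lemma Finv_norm: "F \<in> L2 \<Longrightarrow> L2_norm (Finv F) = L2_norm F / sqrt fkappa"
proof -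
  assume F: "F \<in> L2"
  have "L2_norm F = L2_norm (FT (Finv F))"
    using FT_Finv[OF F] by (intro L2_norm_cong_AE L2_measurable FT_L2 Finv_L2 F) (auto elim: eventually_mono)
  also have "\<dots> = sqrt fkappa * L2_norm (Finv F)" by (rule Plancherel[OF Finv_L2[OF F]])
  finally show ?thesis by (simp add: less_imp_le)
qed

lemma Finv_diff:
  assumes "F \<in> L2" "G \<in> L2"
  shows "AE x in lborel. Finv (\<lambda>\<xi>. F \<xi> - G \<xi>) x = Finv F x - Finv G x"
  using FT_diff[OF L2_cnj[OF assms(1)] L2_cnj[OF assms(2)]]
  by eventually_elim (simp add: Finv_def diff_divide_distrib)

text \<open>An absolutely convergent integral rather than \<open>Finv\<close> of the truncated
  transform, because genuine pointwise values are needed for sup bounds and for differences along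
  rays.\<close>

definition low_freq :: "real \<Rightarrow> (real^3 \<Rightarrow> complex) \<Rightarrow> real^3 \<Rightarrow> complex" where
  "low_freq M F x = (\<integral>\<xi>. exp (\<i> * complex_of_real (x \<bullet> \<xi>)) * (indicator (cball 0 M) \<xi> *\<^sub>R F \<xi>) \<partial>lborel) / complex_of_real fkappa"

lemma low_freq_eq_Finv:
  assumes F: "F \<in> L2"
  shows "AE x in lborel. low_freq M F x = Finv (\<lambda>\<xi>. indicator (cball 0 M) \<xi> *\<^sub>R F \<xi>) x"
proof -
  have c: "(\<lambda>\<xi>. cnj (F \<xi>)) \<in> L2" using F by auto
  note T = fourier_truncations_L2[OF c, of M]
  have eq: "(\<lambda>\<xi>. cnj (indicator (cball 0 M) \<xi> *\<^sub>R F \<xi>)) = (\<lambda>\<xi>. indicator (cball 0 M) \<xi> *\<^sub>R cnj (F \<xi>))"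
    by (auto split: split_indicator)
  have "low_freq M F x = cnj (fourier_integral (\<lambda>\<xi>. indicator (cball 0 M) \<xi> *\<^sub>R cnj (F \<xi>)) x) / complex_of_real fkappa" for x
  proof -
    have "(\<integral>\<xi>. exp (\<i> * complex_of_real (x \<bullet> \<xi>)) * (indicator (cball 0 M) \<xi> *\<^sub>R F \<xi>) \<partial>lborel)
       = (\<integral>\<xi>. cnj (exp (- \<i> * complex_of_real (\<xi> \<bullet> x)) * (indicator (cball 0 M) \<xi> *\<^sub>R cnj (F \<xi>))) \<partial>lborel)"
      by (rule Bochner_Integration.integral_cong) (auto simp: exp_cnj inner_commute)
    then show ?thesis unfolding low_freq_def fourier_integral_def Bochner_Integration.integral_cnj by simp
  qed
  then show ?thesis
    using FT_eq_fourier_integral[OF T(1,2)] unfolding Finv_def eq by (auto elim: eventually_mono)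
qed

lemma low_freq_measurable [measurable]:
  assumes "F \<in> L2" shows "low_freq M F \<in> borel_measurable borel"
proof -
  note [measurable] = L2_measurable[OF assms]
  have "(\<lambda>x. \<integral>\<xi>. exp (\<i> * complex_of_real (x \<bullet> \<xi>)) * (indicator (cball 0 M) \<xi> *\<^sub>R F \<xi>) \<partial>lborel) \<in> borel_measurable borel"
    by (intro lborel.borel_measurable_lebesgue_integral) measurable
  then show ?thesis unfolding low_freq_def[abs_def] by measurable
qed

lemma low_freq_L2:
  assumes F: "F \<in> L2"
  shows "low_freq M F \<in> L2" "L2_norm (low_freq M F) \<le> L2_norm F / sqrt fkappa"
proof -
  have T: "(\<lambda>\<xi>. indicator (cball 0 M) \<xi> *\<^sub>R F \<xi>) \<in> L2" "L2_norm (\<lambda>\<xi>. indicator (cball 0 M) \<xi> *\<^sub>R F \<xi>) \<le> L2_norm F"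
    by (intro L2_truncate F borel_cball3)+
  show L: "low_freq M F \<in> L2"
    using low_freq_eq_Finv[OF F, of M] by (intro L2_cong_AE[OF Finv_L2[OF T(1)]] low_freq_measurable F) (auto elim: eventually_mono)
  have "L2_norm (low_freq M F) = L2_norm (Finv (\<lambda>\<xi>. indicator (cball 0 M) \<xi> *\<^sub>R F \<xi>))"
    by (intro L2_norm_cong_AE low_freq_eq_Finv F L2_measurable L Finv_L2 T)
  also have "\<dots> \<le> L2_norm F / sqrt fkappa"
    unfolding Finv_norm[OF T(1)] by (intro divide_right_mono T) (simp add: less_imp_le)
  finally show "L2_norm (low_freq M F) \<le> L2_norm F / sqrt fkappa" .
qed

lemma low_freq_error:
  assumes u: "u \<in> L2"
  shows "L2_norm (\<lambda>x. u x - low_freq M (FT u) x) = L2_norm (\<lambda>\<xi>. indicator (- cball 0 M) \<xi> *\<^sub>R FT u \<xi>) / sqrt fkappa"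
proof -
  let ?F = "FT u"
  have F: "?F \<in> L2" using u by auto
  have T: "(\<lambda>\<xi>. indicator (cball 0 M) \<xi> *\<^sub>R ?F \<xi>) \<in> L2"
    by (intro L2_truncate F borel_cball3)
  have eq: "(\<lambda>\<xi>. ?F \<xi> - indicator (cball 0 M) \<xi> *\<^sub>R ?F \<xi>) = (\<lambda>\<xi>. indicator (- cball 0 M) \<xi> *\<^sub>R ?F \<xi>)"
    by (auto split: split_indicator)
  have D: "(\<lambda>\<xi>. ?F \<xi> - indicator (cball 0 M) \<xi> *\<^sub>R ?F \<xi>) \<in> L2" using F T by auto
  have "AE x in lborel. u x - low_freq M ?F x = Finv (\<lambda>\<xi>. ?F \<xi> - indicator (cball 0 M) \<xi> *\<^sub>R ?F \<xi>) x"
    using Finv_FT[OF u] low_freq_eq_Finv[OF F, of M] Finv_diff[OF F T] by eventually_elim simp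
  then have "L2_norm (\<lambda>x. u x - low_freq M ?F x) = L2_norm (Finv (\<lambda>\<xi>. ?F \<xi> - indicator (cball 0 M) \<xi> *\<^sub>R ?F \<xi>))"
    by (intro L2_norm_cong_AE L2_measurable L2_diff u low_freq_L2 F Finv_L2 D)
  then show ?thesis using Finv_norm[OF D] unfolding eq by simp
qed

text \<open>A bound for the integral of \<open>1 / (norm \<xi>)\<^sup>2\<close> over the unit ball.
  Its exact value is \<open>4 * pi\<close>; the larger number is what the dyadic decomposition
  gives.\<close>

definition ball_const :: real where "ball_const = 32 * pi / 3"

lemma ball_const_pos: "ball_const > 0" by (simp add: ball_const_def)

text \<open>Dyadic decomposition: on the shell between radii \<open>?r (k+1)\<close> and
  \<open>?r k\<close> the integrand is at most \<open>4^(k+1) / M\<^sup>2\<close>, while the volume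
  of the ball decays like \<open>8^-k\<close>; a geometric series with ratio 1/2 remains.\<close>

lemma inverse_norm_ball:
  assumes "M \<ge> 0"
  shows "(\<lambda>\<xi>::real^3. indicator (cball 0 M) \<xi> / norm \<xi>) \<in> (L2 :: (real^3 \<Rightarrow> real) set)"
    "(L2_norm (\<lambda>\<xi>::real^3. indicator (cball 0 M) \<xi> / norm \<xi> :: real))\<^sup>2 \<le> ball_const * M"
proof -
  let ?r = "\<lambda>k. M * (1/2)^k"
  let ?c = "4/3 * pi"
  have pw: "ennreal ((norm (indicator (cball 0 M) \<xi> / norm \<xi> :: real))\<^sup>2) \<le> (\<Sum>k. ennreal (4^(k+1) / M\<^sup>2) * indicator (cball 0 (?r k)) \<xi>)" for \<xi> :: "real^3"
  proof (cases "\<xi> = 0 \<or> norm \<xi> > M")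
    case False
    then have x: "0 < norm \<xi>" "norm \<xi> \<le> M" by (auto simp: not_less)
    then have M: "M > 0" by linarith
    have "\<exists>n. ?r n < norm \<xi>"
    proof -
      have "(\<lambda>n. M * (1/2)^n) \<longlonglongrightarrow> M * 0" by (intro tendsto_intros LIMSEQ_realpow_zero) auto
      then have "\<forall>\<^sub>F n in sequentially. M * (1/2)^n < norm \<xi>" by (rule order_tendstoD(2)) (use x in simp)
      then show ?thesis using eventually_happens'[OF sequentially_bot] by blast
    qed
    \<comment> \<open>The first dyadic radius below \<open>norm \<xi>\<close>. It is not the zeroth
      one, so its predecessor \<open>k\<close> is the index of the shell containing
      \<open>\<xi>\<close>.\<close>
    define n where "n = (LEAST n. ?r n < norm \<xi>)"
    have n: "?r n < norm \<xi>" unfolding n_def using \<open>\<exists>n. ?r n < norm \<xi>\<close> by (rule LeastI_ex)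
    with x have "n \<noteq> 0" by (cases n) auto
    then obtain k where k: "n = Suc k" by (cases n) auto
    have "\<not> ?r k < norm \<xi>" using not_less_Least[of k "\<lambda>n. ?r n < norm \<xi>"] k unfolding n_def by simp
    then have in': "norm \<xi> \<le> ?r k" by simp
    have "(M * (1/2)^(k+1))\<^sup>2 \<le> (norm \<xi>)\<^sup>2" using n k M by (intro power_mono) auto
    then have "1 / (norm \<xi>)\<^sup>2 \<le> 1 / (M * (1/2)^(k+1))\<^sup>2"
      using x M by (intro divide_left_mono mult_pos_pos) auto
    also have "\<dots> = 4^(k+1) / M\<^sup>2"
      by (simp add: power_mult_distrib power_divide power2_eq_square power_mult_distrib[symmetric] field_simps)
    finally have "ennreal ((norm (indicator (cball 0 M) \<xi> / norm \<xi> :: real))\<^sup>2) \<le> ennreal (4^(k+1) / M\<^sup>2) * indicator (cball 0 (?r k)) \<xi>"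
      using x in' by (auto simp: power_divide intro!: ennreal_leI)
    also have "\<dots> \<le> (\<Sum>k. ennreal (4^(k+1) / M\<^sup>2) * indicator (cball 0 (?r k)) \<xi>)"
    proof -
      have "f k \<le> (\<Sum>i. f i)" for f :: "nat \<Rightarrow> ennreal" using sum_le_suminf[of f "{k}"] by simp
      then show ?thesis .
    qed
    finally show ?thesis .
  qed (auto split: split_indicator)
  have "(\<integral>\<^sup>+\<xi>. ennreal ((norm (indicator (cball 0 M) \<xi> / norm \<xi> :: real))\<^sup>2) \<partial>(lborel :: (real^3) measure))
     \<le> (\<integral>\<^sup>+\<xi>. (\<Sum>k. ennreal (4^(k+1) / M\<^sup>2) * indicator (cball 0 (?r k)) \<xi>) \<partial>(lborel :: (real^3) measure))"
    by (intro nn_integral_mono pw)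
  also have "\<dots> = (\<Sum>k. \<integral>\<^sup>+\<xi>. ennreal (4^(k+1) / M\<^sup>2) * indicator (cball 0 (?r k)) \<xi> \<partial>(lborel :: (real^3) measure))"
    by (rule nn_integral_suminf) measurable
  also have "\<dots> = (\<Sum>k. ennreal ((4 * ?c * M) * (1/2)^k))"
  proof (rule suminf_cong)
    fix k
    have "(\<integral>\<^sup>+\<xi>. ennreal (4^(k+1) / M\<^sup>2) * indicator (cball 0 (?r k)) \<xi> \<partial>(lborel :: (real^3) measure)) = ennreal (4^(k+1) / M\<^sup>2) * emeasure lborel (cball (0::real^3) (?r k))"
      by (rule nn_integral_cmult_indicator) simp
    also have "\<dots> = ennreal (4^(k+1) / M\<^sup>2 * (?c * (?r k)^3))"
      using \<open>M \<ge> 0\<close> by (subst emeasure_cball) (auto simp: unit_ball_vol_3 ennreal_mult'[symmetric])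
    also have "4^(k+1) / M\<^sup>2 * (?c * (?r k)^3) = (4 * ?c * M) * (1/2)^k"
    proof (cases "M = 0")
      case False
      have "(4::real)^k * ((1/2)^k)^3 = (1/2)^k"
        by (simp add: power_mult_distrib[symmetric] power_mult[symmetric] power_divide field_simps)
           (simp add: mult.commute[of k] power_mult power_mult_distrib[symmetric])
      then show ?thesis using False by (simp add: power_mult_distrib power2_eq_square power3_eq_cube field_simps)
    qed simp
    finally show "(\<integral>\<^sup>+\<xi>. ennreal (4^(k+1) / M\<^sup>2) * indicator (cball 0 (?r k)) \<xi> \<partial>(lborel :: (real^3) measure)) = ennreal ((4 * ?c * M) * (1/2)^k)" .
  qed
  also have "\<dots> = ennreal (\<Sum>k. (4 * ?c * M) * (1/2)^k)"
    using \<open>M \<ge> 0\<close> by (intro suminf_ennreal2 summable_mult summable_geometric) auto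
  also have "(\<Sum>k. (4 * ?c * M) * (1/2)^k) = ball_const * M"
    by (subst suminf_mult) (auto simp: suminf_geometric ball_const_def intro!: summable_geometric)
  finally have bd: "(\<integral>\<^sup>+\<xi>. ennreal ((norm (indicator (cball 0 M) \<xi> / norm \<xi> :: real))\<^sup>2) \<partial>(lborel :: (real^3) measure)) \<le> ennreal (ball_const * M)" .
  show "(\<lambda>\<xi>::real^3. indicator (cball 0 M) \<xi> / norm \<xi>) \<in> (L2 :: (real^3 \<Rightarrow> real) set)"
    "(L2_norm (\<lambda>\<xi>::real^3. indicator (cball 0 M) \<xi> / norm \<xi> :: real))\<^sup>2 \<le> ball_const * M"
    by (rule L2_bounded_nn[OF _ bd]; use \<open>M \<ge> 0\<close> ball_const_pos in simp)+
qed

text \<open>Divide and multiply the transform by \<open>norm \<xi>\<close> and apply Cauchy-Schwarz: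
  the multiplied factor is the gradient, and the reciprocal is square integrable on balls in
  dimension three.\<close>

lemma low_freq_pointwise:
  assumes u: "u \<in> H1" and "M \<ge> 0"
  shows "cmod (low_freq M (FT u) x) \<le> sqrt (ball_const / fkappa * M) * L2_norm (weak_grad u)"
proof -
  have F: "FT u \<in> L2" using H1_L2[OF u] by auto
  note G = H1_fourier_norm[OF u] and I = inverse_norm_ball[OF \<open>M \<ge> 0\<close>]
  let ?G = "\<lambda>\<xi>. norm \<xi> *\<^sub>R FT u \<xi>" and ?I = "\<lambda>\<xi>::real^3. indicator (cball 0 M) \<xi> / norm \<xi> :: real"
  have "cmod (\<integral>\<xi>. exp (\<i> * complex_of_real (x \<bullet> \<xi>)) * (indicator (cball 0 M) \<xi> *\<^sub>R FT u \<xi>) \<partial>lborel)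
     \<le> (\<integral>\<xi>. cmod (exp (\<i> * complex_of_real (x \<bullet> \<xi>)) * (indicator (cball 0 M) \<xi> *\<^sub>R FT u \<xi>)) \<partial>lborel)"
    by (rule integral_norm_bound)
  also have "\<dots> = (\<integral>\<xi>. norm (?I \<xi>) * norm (?G \<xi>) \<partial>lborel)"
  proof (rule integral_cong_AE)
    show "AE \<xi> in lborel. cmod (exp (\<i> * complex_of_real (x \<bullet> \<xi>)) * (indicator (cball 0 M) \<xi> *\<^sub>R FT u \<xi>)) = norm (?I \<xi>) * norm (?G \<xi>)"
      using AE_lborel_singleton[of 0] by eventually_elim (auto simp: norm_mult norm_exp_eq_Re split: split_indicator)
  qed (use L2_measurable[OF F] in measurable)
  also have "\<dots> \<le> L2_norm ?I * L2_norm ?G" by (rule L2_Cauchy_Schwarz[OF I(1) G(1)])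
  also have "\<dots> \<le> sqrt (ball_const * M) * (sqrt fkappa * L2_norm (weak_grad u))"
    unfolding G(2) using I(2) by (intro mult_right_mono real_le_rsqrt) (auto simp: less_imp_le)
  finally have "cmod (\<integral>\<xi>. exp (\<i> * complex_of_real (x \<bullet> \<xi>)) * (indicator (cball 0 M) \<xi> *\<^sub>R FT u \<xi>) \<partial>lborel) / fkappa
     \<le> sqrt (ball_const * M) * (sqrt fkappa * L2_norm (weak_grad u)) / fkappa"
    by (intro divide_right_mono) (auto simp: less_imp_le)
  also have "\<dots> = sqrt (ball_const / fkappa * M) * L2_norm (weak_grad u)"
  proof -
    have "sqrt fkappa * sqrt fkappa = fkappa" by (simp add: less_imp_le)
    then have "sqrt fkappa / fkappa = 1 / sqrt fkappa" by (simp add: field_simps)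
    moreover have "sqrt (ball_const * M) * (sqrt fkappa * L2_norm (weak_grad u)) / fkappa
       = sqrt (ball_const * M) * L2_norm (weak_grad u) * (sqrt fkappa / fkappa)" by simp
    moreover have "sqrt (ball_const / fkappa * M) = sqrt (ball_const * M) * (1 / sqrt fkappa)"
      by (simp add: real_sqrt_mult real_sqrt_divide)
    ultimately show ?thesis by (simp only: mult_ac)
  qed
  finally show ?thesis by (simp add: low_freq_def norm_divide less_imp_le)
qed

text \<open>The 32 is 8 times 4: integrating \<open>16 * h\<close> up to the threshold height
  \<open>L\<close> gives \<open>8 * L\<^sup>2\<close>, and \<open>L\<^sup>2\<close> contains the
  factor 4 from the choice of the cut-off \<open>M h\<close>.\<close>

definition gn_const :: real where "gn_const = 32 * (ball_const / fkappa)"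

lemma gn_const_pos: "gn_const > 0" by (simp add: gn_const_def ball_const_pos)

text \<open>Chemin and Xu's argument: in the layer-cake formula for \<open>\<integral>|u|\<^sup>4\<close> the frequency cut-off
  is chosen at each height \<open>h\<close> such that the low frequencies contribute at most \<open>h / 2\<close>.\<close>

theorem Gagliardo_Nirenberg:
  assumes u: "u \<in> H1"
  shows "particle_density u \<in> L2"
    "(L2_norm (particle_density u))\<^sup>2 \<le> gn_const * (L2_norm (weak_grad u)) ^ 3 * L2_norm u"
proof -
  note uL = H1_L2[OF u]
  define F where "F = FT u"
  have F: "F \<in> L2" unfolding F_def using uL by auto
  define A where "A = L2_norm (weak_grad u)"
  note [measurable] = L2_measurable[OF uL] L2_measurable[OF F]
  have rm [measurable]: "particle_density u \<in> borel_measurable borel"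
    unfolding particle_density_def[abs_def] by measurable
  note G = H1_fourier_norm[OF u, folded F_def A_def]
  let ?C = "gn_const * A^3 * L2_norm u"
  have C0: "?C \<ge> 0" using gn_const_pos by (simp add: A_def less_imp_le)
  have "(\<integral>\<^sup>+x. ennreal ((norm (particle_density u x))\<^sup>2) \<partial>lborel) \<le> ennreal ?C"
  proof (cases "A = 0")
    \<comment> \<open>The cut-off used in the other case divides by \<open>A\<close>. Here the
      transform is concentrated at the origin, so \<open>u\<close> vanishes almost
      everywhere.\<close>
    case True
    then have "AE \<xi> in lborel. norm \<xi> *\<^sub>R F \<xi> = 0" using L2_norm_eq_0[OF G(1)] G(2) by simp
    then have "AE \<xi> in lborel. F \<xi> = 0" using AE_lborel_singleton[of 0] by eventually_elim auto
    then have "AE x in lborel. u x = 0" using FT_inj[OF uL] unfolding F_def by simp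
    then have "AE x in lborel. ennreal ((norm (particle_density u x))\<^sup>2) = 0"
      by eventually_elim (simp add: particle_density_def)
    then have "(\<integral>\<^sup>+x. ennreal ((norm (particle_density u x))\<^sup>2) \<partial>lborel) = 0"
      by (subst nn_integral_0_iff_AE) auto
    then show ?thesis by simp
  next
    case False
    then have A: "A > 0" unfolding A_def using L2_norm_nonneg[of "weak_grad u"] by linarith
    define b where "b = ball_const / fkappa"
    have b: "b > 0" by (simp add: b_def ball_const_pos)
    \<comment> \<open>The solution of \<open>sqrt (b * M h) * A = h / 2\<close>, the equation that
      makes \<open>low_freq_pointwise\<close> give the bound \<open>h / 2\<close>.\<close>
    define M where "M h = h\<^sup>2 / (4 * b * A\<^sup>2)" for h
    define W where "W h \<xi> = ennreal (16 * h / fkappa) * indicator {0..} h * ennreal ((norm (indicator (- cball 0 (M h)) \<xi> *\<^sub>R F \<xi>))\<^sup>2)" for h and \<xi> :: "real^3"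
    have layer: "(\<integral>\<^sup>+x. ennreal (4 * h^3) * indicator {0..cmod (u x)} h \<partial>lborel) \<le> (\<integral>\<^sup>+\<xi>. W h \<xi> \<partial>lborel)" for h
    proof (cases "h > 0")
      case True
      have Mh: "M h \<ge> 0" using b A by (simp add: M_def)
      let ?v = "low_freq (M h) F"
      have "sqrt (b * M h) = h / (2 * A)"
        using b A True by (simp add: M_def real_sqrt_divide real_sqrt_mult)
      then have v: "cmod (?v x) \<le> h / 2" for x
        using low_freq_pointwise[OF u Mh, of x] A by (simp add: F_def A_def b_def)
      have DL: "(\<lambda>x. u x - ?v x) \<in> L2" using uL low_freq_L2(1)[OF F] by auto
      \<comment> \<open>Where \<open>cmod (u x)\<close> is at least \<open>h\<close>, the
        high-frequency remainder is at least \<open>h / 2\<close>; Chebyshev's inequality then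
        trades \<open>4 * h^3\<close> for \<open>16 * h\<close> times the squared remainder.\<close>
      have pt: "ennreal (4 * h^3) * indicator {0..cmod (u x)} h \<le> ennreal (16 * h) * ennreal ((norm (u x - ?v x))\<^sup>2)" for x
      proof (cases "h \<le> cmod (u x)")
        case True
        have "h / 2 \<le> norm (u x - ?v x)" using norm_triangle_ineq2[of "u x" "?v x"] v[of x] True by simp
        then have "(h/2)\<^sup>2 \<le> (norm (u x - ?v x))\<^sup>2" using \<open>h > 0\<close> by (intro power_mono) auto
        then have "16 * h * (h/2)\<^sup>2 \<le> 16 * h * (norm (u x - ?v x))\<^sup>2" using \<open>h > 0\<close> by (intro mult_left_mono) auto
        then have "4 * h^3 \<le> 16 * h * (norm (u x - ?v x))\<^sup>2" by (simp add: power2_eq_square power3_eq_cube)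
        then show ?thesis using True \<open>h > 0\<close> by (simp add: ennreal_mult[symmetric] ennreal_leI)
      qed simp
      have "(\<integral>\<^sup>+x. ennreal (4 * h^3) * indicator {0..cmod (u x)} h \<partial>lborel) \<le> (\<integral>\<^sup>+x. ennreal (16 * h) * ennreal ((norm (u x - ?v x))\<^sup>2) \<partial>lborel)"
        by (intro nn_integral_mono pt)
      also have "\<dots> = ennreal (16 * h) * ennreal ((L2_norm (\<lambda>x. u x - ?v x))\<^sup>2)"
        using L2_measurable[OF DL] by (subst nn_integral_cmult) (auto simp: L2_norm_sq_ennreal[OF DL])
      also have "(L2_norm (\<lambda>x. u x - ?v x))\<^sup>2 = (L2_norm (\<lambda>\<xi>. indicator (- cball 0 (M h)) \<xi> *\<^sub>R F \<xi>))\<^sup>2 / fkappa"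
        using low_freq_error[OF uL, of "M h"] by (simp add: F_def power_divide)
      also have "ennreal (16 * h) * ennreal ((L2_norm (\<lambda>\<xi>. indicator (- cball 0 (M h)) \<xi> *\<^sub>R F \<xi>))\<^sup>2 / fkappa)
        = ennreal (16 * h / fkappa) * ennreal ((L2_norm (\<lambda>\<xi>. indicator (- cball 0 (M h)) \<xi> *\<^sub>R F \<xi>))\<^sup>2)"
        using \<open>h > 0\<close> by (simp add: ennreal_mult[symmetric] less_imp_le)
      also have "\<dots> = (\<integral>\<^sup>+\<xi>. W h \<xi> \<partial>lborel)"
      proof -
        have TL: "(\<lambda>\<xi>. indicator (- cball 0 (M h)) \<xi> *\<^sub>R F \<xi>) \<in> L2" by (rule L2_truncate(1)[OF F]) simp
        have "(\<integral>\<^sup>+\<xi>. W h \<xi> \<partial>lborel) = (\<integral>\<^sup>+\<xi>. ennreal (16 * h / fkappa) * ennreal ((norm (indicator (- cball 0 (M h)) \<xi> *\<^sub>R F \<xi>))\<^sup>2) \<partial>lborel)"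
          using \<open>h > 0\<close> by (intro nn_integral_cong) (simp add: W_def)
        also have "\<dots> = ennreal (16 * h / fkappa) * (\<integral>\<^sup>+\<xi>. ennreal ((norm (indicator (- cball 0 (M h)) \<xi> *\<^sub>R F \<xi>))\<^sup>2) \<partial>lborel)"
          by (rule nn_integral_cmult) (use L2_measurable[OF TL] in measurable)
        finally show ?thesis unfolding L2_norm_sq_ennreal[OF TL] ..
      qed
      finally show ?thesis .
    next
      case False
      then have Z: "ennreal (4 * h^3) * indicator {0..cmod (u x)} h = 0" for x by (cases "h = 0") auto
      show ?thesis unfolding Z by simp
    qed
    have "ennreal ((norm (particle_density u x))\<^sup>2) = (\<integral>\<^sup>+h. ennreal (4 * h^3) * indicator {0..cmod (u x)} h \<partial>lborel)" for x
      by (subst nn_integral_FTC_Icc[where F="\<lambda>h. h^4"])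
         (auto intro!: derivative_eq_intros simp: particle_density_def norm_power power_mult[symmetric])
    then have "(\<integral>\<^sup>+x. ennreal ((norm (particle_density u x))\<^sup>2) \<partial>lborel) = (\<integral>\<^sup>+x. (\<integral>\<^sup>+h. ennreal (4 * h^3) * indicator {0..cmod (u x)} h \<partial>lborel) \<partial>lborel)"
      by simp
    also have "\<dots> = (\<integral>\<^sup>+h. (\<integral>\<^sup>+x. ennreal (4 * h^3) * indicator {0..cmod (u x)} h \<partial>lborel) \<partial>lborel)"
    proof (rule lborel_pair.Fubini')
      have "(\<lambda>(h, x). ennreal (4 * h^3) * indicator {0..cmod (u x)} h) = (\<lambda>(h, x). ennreal (4 * h^3) * (if 0 \<le> h \<and> h \<le> cmod (u x) then 1 else 0))"
        by (auto split: split_indicator)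
      moreover have "(\<lambda>(h, x). ennreal (4 * h^3) * (if 0 \<le> h \<and> h \<le> cmod (u x) then 1 else 0)) \<in> borel_measurable (lborel \<Otimes>\<^sub>M lborel)"
        by measurable
      ultimately show "(\<lambda>(h, x). ennreal (4 * h^3) * indicator {0..cmod (u x)} h) \<in> borel_measurable (lborel \<Otimes>\<^sub>M lborel)" by simp
    qed
    also have "\<dots> \<le> (\<integral>\<^sup>+h. (\<integral>\<^sup>+\<xi>. W h \<xi> \<partial>lborel) \<partial>lborel)"
      by (intro nn_integral_mono layer)
    also have "\<dots> = (\<integral>\<^sup>+\<xi>. (\<integral>\<^sup>+h. W h \<xi> \<partial>lborel) \<partial>lborel)"
    proof (rule lborel_pair.Fubini')
      have "(\<lambda>(\<xi>, h). W h \<xi>) = (\<lambda>(\<xi>, h). ennreal (16 * h / fkappa) * (if 0 \<le> h then 1 else 0) * ennreal ((norm ((if norm \<xi> > M h then 1 else 0) *\<^sub>R F \<xi>))\<^sup>2))"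
        by (auto simp: W_def split: split_indicator)
      moreover have "(\<lambda>(\<xi>, h). ennreal (16 * h / fkappa) * (if 0 \<le> h then 1 else 0) * ennreal ((norm ((if norm \<xi> > M h then 1 else 0) *\<^sub>R F \<xi>))\<^sup>2)) \<in> borel_measurable (lborel \<Otimes>\<^sub>M lborel)"
        unfolding M_def by measurable
      ultimately show "(\<lambda>(\<xi>, h). W h \<xi>) \<in> borel_measurable (lborel \<Otimes>\<^sub>M lborel)" by simp
    qed
    also have "\<dots> \<le> (\<integral>\<^sup>+\<xi>. ennreal (gn_const * A\<^sup>2 / fkappa) * ennreal (norm (norm \<xi> *\<^sub>R F \<xi>) * norm (F \<xi>)) \<partial>lborel)"
    proof (rule nn_integral_mono)
      fix \<xi> :: "real^3"
      \<comment> \<open>For fixed \<open>\<xi>\<close> the frequency lies outside the cut-off ball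
        only for heights below \<open>L\<close>, so the integral over \<open>h\<close> becomes
        elementary.\<close>
      define L where "L = sqrt (4 * b * A\<^sup>2 * norm \<xi>)"
      have L0: "L \<ge> 0" using b by (simp add: L_def)
      have L2: "L\<^sup>2 = 4 * b * A\<^sup>2 * norm \<xi>" using b by (simp add: L_def less_imp_le)
      have W_le: "W h \<xi> \<le> ennreal ((norm (F \<xi>))\<^sup>2 / fkappa * (16 * h)) * indicator {0..L} h" for h
      proof (cases "0 \<le> h \<and> norm \<xi> > M h")
        case True
        then have "h\<^sup>2 < 4 * b * A\<^sup>2 * norm \<xi>" using A b by (simp add: M_def divide_less_eq mult.commute)
        then have "h \<le> L" unfolding L_def by (intro real_le_rsqrt) simp
        then show ?thesis using True by (auto simp: W_def ennreal_mult'[symmetric] ennreal_mult''[symmetric] less_imp_le mult.commute divide_inverse mult.left_commute)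
      qed (auto simp: W_def split: split_indicator)
      have "(\<integral>\<^sup>+h. W h \<xi> \<partial>lborel) \<le> (\<integral>\<^sup>+h. ennreal ((norm (F \<xi>))\<^sup>2 / fkappa * (16 * h)) * indicator {0..L} h \<partial>lborel)"
        by (intro nn_integral_mono W_le)
      also have "\<dots> = ennreal ((norm (F \<xi>))\<^sup>2 / fkappa * (8 * L\<^sup>2) - (norm (F \<xi>))\<^sup>2 / fkappa * (8 * 0\<^sup>2))"
        by (rule nn_integral_FTC_Icc) (use L0 in \<open>auto intro!: derivative_eq_intros simp: less_imp_le\<close>)
      also have "\<dots> = ennreal (gn_const * A\<^sup>2 / fkappa * (norm (norm \<xi> *\<^sub>R F \<xi>) * norm (F \<xi>)))"
        unfolding L2 gn_const_def b_def by (simp add: power2_eq_square field_simps)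
      finally show "(\<integral>\<^sup>+h. W h \<xi> \<partial>lborel) \<le> ennreal (gn_const * A\<^sup>2 / fkappa) * ennreal (norm (norm \<xi> *\<^sub>R F \<xi>) * norm (F \<xi>))"
      proof (rule order_trans[OF _ eq_refl[OF ennreal_mult]])
      qed (use gn_const_pos in \<open>auto simp: less_imp_le\<close>)
    qed
    also have "\<dots> = ennreal (gn_const * A\<^sup>2 / fkappa) * (\<integral>\<^sup>+\<xi>. ennreal (norm (norm \<xi> *\<^sub>R F \<xi>) * norm (F \<xi>)) \<partial>lborel)"
      by (rule nn_integral_cmult) measurable
    also have "(\<integral>\<^sup>+\<xi>. ennreal (norm (norm \<xi> *\<^sub>R F \<xi>) * norm (F \<xi>)) \<partial>lborel) = ennreal (\<integral>\<xi>. norm (norm \<xi> *\<^sub>R F \<xi>) * norm (F \<xi>) \<partial>lborel)"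
      by (intro nn_integral_eq_integral L2_mult_integrable G F) auto
    also have "\<dots> \<le> ennreal (L2_norm (\<lambda>\<xi>. norm \<xi> *\<^sub>R F \<xi>) * L2_norm F)"
      by (intro ennreal_leI L2_Cauchy_Schwarz G F)
    also have "L2_norm (\<lambda>\<xi>. norm \<xi> *\<^sub>R F \<xi>) * L2_norm F = fkappa * (A * L2_norm u)"
    proof -
      have "L2_norm F = sqrt fkappa * L2_norm u" unfolding F_def by (rule Plancherel[OF uL])
      then have "L2_norm (\<lambda>\<xi>. norm \<xi> *\<^sub>R F \<xi>) * L2_norm F = (sqrt fkappa)\<^sup>2 * (A * L2_norm u)"
        unfolding G(2) by (simp only: power2_eq_square mult_ac)
      then show ?thesis by simp
    qed
    finally have "(\<integral>\<^sup>+x. ennreal ((norm (particle_density u x))\<^sup>2) \<partial>lborel) \<le> ennreal (gn_const * A\<^sup>2 / fkappa) * ennreal (fkappa * (A * L2_norm u))"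
      by (simp add: mult_left_mono)
    also have "\<dots> = ennreal ?C"
      using gn_const_pos A by (simp add: ennreal_mult[symmetric] less_imp_le power2_eq_square power3_eq_cube mult_ac)
    finally show ?thesis .
  qed
  from L2_bounded_nn[OF rm this C0] show "particle_density u \<in> L2"
    "(L2_norm (particle_density u))\<^sup>2 \<le> gn_const * (L2_norm (weak_grad u)) ^ 3 * L2_norm u"
    by (simp_all add: A_def)
qed

section \<open>Compactness\<close>

lemma iexp_diff_bound: "cmod (exp (- \<i> * complex_of_real a) - exp (- \<i> * complex_of_real b)) \<le> \<bar>a - b\<bar>"
proof -
  have "exp (- \<i> * complex_of_real a) - exp (- \<i> * complex_of_real b)
      = exp (- \<i> * complex_of_real b) * (exp (\<i> * complex_of_real (b - a)) - 1)"
    by (simp add: right_diff_distrib exp_add[symmetric] algebra_simps)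
  moreover have "cmod (exp (\<i> * complex_of_real (b - a)) - 1) \<le> \<bar>b - a\<bar>"
    using iexp_approx1[of "b - a" 0] by simp
  ultimately show ?thesis by (simp add: norm_mult norm_exp_eq_Re abs_minus_commute)
qed

lemma truncation_L1_bound:
  fixes u :: "real^3 \<Rightarrow> complex"
  assumes u: "u \<in> L2" and "R \<ge> 0"
  shows "(\<integral>x. cmod (indicator (cball 0 R) x *\<^sub>R u x) \<partial>lborel) \<le> sqrt (4/3 * pi * R^3) * L2_norm u"
proof -
  let ?I = "indicator (cball (0::real^3) R) :: real^3 \<Rightarrow> real"
  have sq: "(norm (?I x))\<^sup>2 = ?I x" for x by (simp split: split_indicator)
  have ei: "emeasure lborel (cball (0::real^3) R) = ennreal (4/3 * pi * R^3)"
    using \<open>R \<ge> 0\<close> by (subst emeasure_cball) (auto simp: unit_ball_vol_3)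
  have i: "integrable lborel ?I" using ei by (intro integrable_real_indicator) auto
  have IL: "?I \<in> L2" using i by (intro L2I) (auto simp only: sq borel_measurable_indicator borel_cball3)
  have In: "L2_norm ?I = sqrt (4/3 * pi * R^3)"
    unfolding L2_norm_def sq using ei \<open>R \<ge> 0\<close> by (simp add: measure_def)
  have "(\<integral>x. cmod (indicator (cball 0 R) x *\<^sub>R u x) \<partial>lborel) = (\<integral>x. norm (?I x) * norm (u x) \<partial>lborel)"
    by simp
  also have "\<dots> \<le> L2_norm ?I * L2_norm u" by (rule L2_Cauchy_Schwarz[OF IL u])
  finally show ?thesis by (simp add: In)
qed

text \<open>Bounded support in space makes the transform Lipschitz, uniformly over bounded sets of
  \<open>L2\<close>. Together with the sup bound from \<open>truncation_L1_bound\<close> this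
  prepares Arzela-Ascoli on balls of frequencies.\<close>

lemma truncation_fourier_Lipschitz:
  assumes u: "u \<in> L2" and "R \<ge> 0"
  shows "cmod (fourier_integral (\<lambda>x. indicator (cball 0 R) x *\<^sub>R u x) \<xi> - fourier_integral (\<lambda>x. indicator (cball 0 R) x *\<^sub>R u x) \<eta>)
    \<le> R * norm (\<xi> - \<eta>) * (sqrt (4/3 * pi * R^3) * L2_norm u)"
proof -
  let ?v = "\<lambda>x. indicator (cball 0 R) x *\<^sub>R u x"
  note T = fourier_truncations_L2[OF u, of R]
  let ?d = "\<lambda>x. (exp (- \<i> * complex_of_real (x \<bullet> \<xi>)) - exp (- \<i> * complex_of_real (x \<bullet> \<eta>))) * ?v x"
  have [measurable]: "?v \<in> borel_measurable borel" using T(1) by (rule L2_measurable)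
  have "fourier_integral ?v \<xi> - fourier_integral ?v \<eta> = (\<integral>x. ?d x \<partial>lborel)"
    unfolding fourier_integral_def left_diff_distrib
    by (intro Bochner_Integration.integral_diff[symmetric] fourier_kernel_integrable T)
  also have "cmod \<dots> \<le> (\<integral>x. cmod (?d x) \<partial>lborel)" by (rule integral_norm_bound)
  also have "\<dots> \<le> (\<integral>x. R * norm (\<xi> - \<eta>) * cmod (?v x) \<partial>lborel)"
  proof (rule integral_mono')
    show "integrable lborel (\<lambda>x. R * norm (\<xi> - \<eta>) * cmod (?v x))"
      using T(2) by (intro integrable_mult_right integrable_norm)
    fix x :: "real^3"
    show "0 \<le> R * norm (\<xi> - \<eta>) * cmod (?v x)" using \<open>R \<ge> 0\<close> by simp
    show "cmod (?d x) \<le> R * norm (\<xi> - \<eta>) * cmod (?v x)"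
    proof (cases "norm x \<le> R")
      case True
      have "cmod (exp (- \<i> * complex_of_real (x \<bullet> \<xi>)) - exp (- \<i> * complex_of_real (x \<bullet> \<eta>))) \<le> \<bar>x \<bullet> \<xi> - x \<bullet> \<eta>\<bar>"
        by (rule iexp_diff_bound)
      also have "\<dots> = \<bar>x \<bullet> (\<xi> - \<eta>)\<bar>" by (simp add: inner_diff_right)
      also have "\<dots> \<le> norm x * norm (\<xi> - \<eta>)" by (rule Cauchy_Schwarz_ineq2)
      also have "\<dots> \<le> R * norm (\<xi> - \<eta>)" using True by (intro mult_right_mono) auto
      finally show ?thesis unfolding norm_mult by (intro mult_right_mono) auto
    qed simp
  qed
  also have "\<dots> = R * norm (\<xi> - \<eta>) * (\<integral>x. cmod (?v x) \<partial>lborel)" by (rule integral_mult_right_zero)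
  also have "\<dots> \<le> R * norm (\<xi> - \<eta>) * (sqrt (4/3 * pi * R^3) * L2_norm u)"
    using \<open>R \<ge> 0\<close> by (intro mult_left_mono truncation_L1_bound u) auto
  finally show ?thesis .
qed

text \<open>Chebyshev's inequality, to be used both in space with the trap weight and in frequency
  with the transform of the gradient.\<close>

lemma L2_outside_ball:
  fixes f :: "real^3 \<Rightarrow> complex"
  assumes f: "(\<lambda>x. norm x *\<^sub>R f x) \<in> L2" and m: "f \<in> borel_measurable borel" and "R > 0"
  shows "L2_norm (\<lambda>x. indicator (- cball 0 R) x *\<^sub>R f x) \<le> (1/R) * L2_norm (\<lambda>x. norm x *\<^sub>R f x)"
proof (rule L2_mono(2)[OF f])
  show "(\<lambda>x. indicator (- cball 0 R) x *\<^sub>R f x) \<in> borel_measurable borel" using m by measurable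
  show "AE x in lborel. norm (indicator (- cball 0 R) x *\<^sub>R f x) \<le> 1 / R * norm (norm x *\<^sub>R f x)"
  proof (rule AE_I2)
    fix x :: "real^3"
    have "R * cmod (f x) \<le> norm x * cmod (f x)" if "norm x > R" using that by (intro mult_right_mono) auto
    then show "norm (indicator (- cball 0 R) x *\<^sub>R f x) \<le> 1 / R * norm (norm x *\<^sub>R f x)"
      using \<open>R > 0\<close> by (auto simp: pos_le_divide_eq mult.commute split: split_indicator)
  qed
qed (use \<open>R > 0\<close> in simp)

lemma L2_ball_sup_bound:
  fixes f :: "real^3 \<Rightarrow> complex"
  assumes m: "f \<in> borel_measurable borel" and "R \<ge> 0" and b: "\<And>x. x \<in> cball 0 R \<Longrightarrow> cmod (f x) \<le> e" and "e \<ge> 0"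
  shows "(\<lambda>x. indicator (cball 0 R) x *\<^sub>R f x) \<in> L2" "L2_norm (\<lambda>x. indicator (cball 0 R) x *\<^sub>R f x) \<le> e * sqrt (4/3 * pi * R^3)"
proof -
  let ?I = "indicator (cball (0::real^3) R) :: real^3 \<Rightarrow> real"
  have sq: "(norm (?I x))\<^sup>2 = ?I x" for x by (simp split: split_indicator)
  have ei: "emeasure lborel (cball (0::real^3) R) = ennreal (4/3 * pi * R^3)"
    using \<open>R \<ge> 0\<close> by (subst emeasure_cball) (auto simp: unit_ball_vol_3)
  have i: "integrable lborel ?I" using ei by (intro integrable_real_indicator) auto
  have IL: "?I \<in> L2" using i by (intro L2I) (auto simp only: sq borel_measurable_indicator borel_cball3)
  have In: "L2_norm ?I = sqrt (4/3 * pi * R^3)"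
    unfolding L2_norm_def sq using ei \<open>R \<ge> 0\<close> by (simp add: measure_def)
  have mm: "(\<lambda>x. indicator (cball 0 R) x *\<^sub>R f x) \<in> borel_measurable borel" using m by measurable
  have "AE x in lborel. norm (indicator (cball 0 R) x *\<^sub>R f x) \<le> e * norm (?I x)"
    using b by (intro AE_I2) (simp split: split_indicator)
  from L2_mono[OF IL mm this \<open>e \<ge> 0\<close>]
  show "(\<lambda>x. indicator (cball 0 R) x *\<^sub>R f x) \<in> L2" "L2_norm (\<lambda>x. indicator (cball 0 R) x *\<^sub>R f x) \<le> e * sqrt (4/3 * pi * R^3)"
    by (auto simp: In)
qed

lemma Sigma_H1: "u \<in> Sigma_space \<Longrightarrow> u \<in> H1"
  and Sigma_weight: "u \<in> Sigma_space \<Longrightarrow> (\<lambda>x. norm x *\<^sub>R u x) \<in> L2"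
  by (auto simp: Sigma_space_def)

lemma Sigma_L2: "u \<in> Sigma_space \<Longrightarrow> u \<in> L2"
  using Sigma_H1 H1_L2 by blast

text \<open>Work on the Fourier side. The weight makes truncation in space cheap, the gradient makes
  truncation in frequency cheap, and what remains are equicontinuous functions on a ball, to which
  Arzela-Ascoli applies; a diagonal sequence serves all radii. The conclusion is a Cauchy property,
  since the limit is only formed later in the stronger norm.\<close>

theorem Sigma_compact_L2:
  fixes u :: "nat \<Rightarrow> real^3 \<Rightarrow> complex"
  assumes u: "\<And>n. u n \<in> Sigma_space" and K: "\<And>n. L2_norm (u n) \<le> K"
    "\<And>n. L2_norm (weak_grad (u n)) \<le> K" "\<And>n. L2_norm (\<lambda>x. norm x *\<^sub>R u n x) \<le> K"
  obtains r where "strict_mono (r :: nat \<Rightarrow> nat)"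
    "\<And>e. e > 0 \<Longrightarrow> \<exists>N. \<forall>m\<ge>N. \<forall>n\<ge>N. L2_norm (\<lambda>x. u (r m) x - u (r n) x) < e"
proof -
  note uL = Sigma_L2[OF u] and uH = Sigma_H1[OF u]
  have K0: "K \<ge> 0" using K(1)[of 0] L2_norm_nonneg order_trans by blast
  define V where "V k n = fourier_integral (\<lambda>x. indicator (cball 0 (real k)) x *\<^sub>R u n x)" for k n
  \<comment> \<open>Uniform convergence is phrased as a Cauchy condition without naming the limit;
    in this form it passes to subsequences, as the diagonal construction demands.\<close>
  define P where "P k (s :: nat \<Rightarrow> nat) \<longleftrightarrow> (\<forall>e>0. \<exists>N. \<forall>m\<ge>N. \<forall>n\<ge>N. \<forall>\<xi>\<in>cball 0 (real k). cmod (V k (s m) \<xi> - V k (s n) \<xi>) \<le> e)" for k s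
  have ex: "\<exists>r'. strict_mono (r' :: nat \<Rightarrow> nat) \<and> P k (s \<circ> r')" if s: "strict_mono (s :: nat \<Rightarrow> nat)" for k s
  proof -
    define c where "c = sqrt (4/3 * pi * real k^3) * K"
    have c0: "c \<ge> 0" using K0 by (simp add: c_def)
    have Vb: "norm (V k (s n) \<xi>) \<le> c" for n \<xi>
      unfolding V_def c_def
      by (intro order_trans[OF fourier_integral_bound] order_trans[OF truncation_L1_bound[OF uL]] mult_left_mono K) auto
    have Vl: "norm (V k (s n) \<xi> - V k (s n) \<eta>) \<le> real k * norm (\<xi> - \<eta>) * c" for n \<xi> \<eta>
      unfolding V_def c_def
      by (rule order_trans[OF truncation_fourier_Lipschitz[OF uL]]) (auto intro!: mult_left_mono K)
    have "\<exists>d>0. \<forall>n \<eta>. \<eta> \<in> cball 0 (real k) \<and> norm (\<xi> - \<eta>) < d \<longrightarrow> norm (V k (s n) \<xi> - V k (s n) \<eta>) < e" if "e > 0" for \<xi> e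
    proof (intro exI[of _ "e / (real k * c + 1)"] conjI allI impI)
      have p: "real k * c + 1 > 0" using c0 by (simp add: add_nonneg_pos)
      then show "0 < e / (real k * c + 1)" using \<open>e > 0\<close> by simp
      fix n \<eta> assume "\<eta> \<in> cball 0 (real k) \<and> norm (\<xi> - \<eta>) < e / (real k * c + 1)"
      then have "norm (\<xi> - \<eta>) * (real k * c + 1) < e" using p by (simp add: pos_less_divide_eq)
      moreover have "real k * norm (\<xi> - \<eta>) * c \<le> norm (\<xi> - \<eta>) * (real k * c + 1)" by (simp add: algebra_simps)
      ultimately show "norm (V k (s n) \<xi> - V k (s n) \<eta>) < e" using Vl[of n \<xi> \<eta>] by linarith
    qed
    note equi = this
    obtain g r' where r': "strict_mono (r' :: nat \<Rightarrow> nat)"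
      and g: "\<And>e. 0 < e \<Longrightarrow> \<exists>N. \<forall>n x. n \<ge> N \<and> x \<in> cball 0 (real k) \<longrightarrow> norm (V k (s (r' n)) x - g x) < e"
    proof (rule Arzela_Ascoli[of "cball 0 (real k)" "\<lambda>n. V k (s n)" c])
      show "norm (V k (s n) \<xi>) \<le> c" for n \<xi> by (rule Vb)
      show "\<exists>d>0. \<forall>n y. y \<in> cball 0 (real k) \<and> norm (x - y) < d \<longrightarrow> norm (V k (s n) x - V k (s n) y) < e" if "0 < e" for x e
        by (rule equi[OF that])
    qed (auto intro: that)
    have "P k (s \<circ> r')"
      unfolding P_def
    proof (intro allI impI)
      fix e :: real assume "e > 0"
      then obtain N where N: "\<And>n x. n \<ge> N \<Longrightarrow> x \<in> cball 0 (real k) \<Longrightarrow> norm (V k (s (r' n)) x - g x) < e/2"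
        using g[of "e/2"] by auto
      have "cmod (V k ((s \<circ> r') m) \<xi> - V k ((s \<circ> r') n) \<xi>) \<le> e" if "m \<ge> N" "n \<ge> N" "\<xi> \<in> cball 0 (real k)" for m n \<xi>
        using norm_triangle_ineq4[of "V k (s (r' m)) \<xi> - g \<xi>" "V k (s (r' n)) \<xi> - g \<xi>"] N[OF that(1,3)] N[OF that(2,3)] by simp
      then show "\<exists>N. \<forall>m\<ge>N. \<forall>n\<ge>N. \<forall>\<xi>\<in>cball 0 (real k). cmod (V k ((s \<circ> r') m) \<xi> - V k ((s \<circ> r') n) \<xi>) \<le> e" by blast
    qed
    with r' show ?thesis by blast
  qed
  interpret subseqs P by unfold_locales (rule ex)
  \<comment> \<open>Only from index \<open>Suc k\<close> on is the diagonal sequence a subsequence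
    of the \<open>k\<close>-th selection. The shift reappears in the final threshold
    \<open>N + Suc k\<close>.\<close>
  have Pr: "P k (diagseq \<circ> ((+) (Suc k)))" for k
  proof (rule diagseq_holds)
    fix r s n assume r: "strict_mono (r :: nat \<Rightarrow> nat)" and P: "P n s"
    show "P n (s \<circ> r)"
      unfolding P_def
    proof (intro allI impI)
      fix e :: real assume "e > 0"
      then obtain N where N: "\<forall>m\<ge>N. \<forall>k\<ge>N. \<forall>\<xi>\<in>cball 0 (real n). cmod (V n (s m) \<xi> - V n (s k) \<xi>) \<le> e"
        using P unfolding P_def by blast
      have "r m \<ge> N" if "m \<ge> N" for m using seq_suble[OF r, of m] that by simp
      then show "\<exists>N. \<forall>m\<ge>N. \<forall>k\<ge>N. \<forall>\<xi>\<in>cball 0 (real n). cmod (V n ((s \<circ> r) m) \<xi> - V n ((s \<circ> r) k) \<xi>) \<le> e"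
        using N by (intro exI[of _ N]) auto
    qed
  qed
  show ?thesis
  proof (rule that[OF subseq_diagseq])
    fix e :: real assume "e > 0"
    define q where "q = sqrt fkappa"
    have q: "q > 0" by (simp add: q_def)
    \<comment> \<open>There are four tail errors of size \<open>K / k\<close>, two for each
      function. They are to stay below \<open>e / 2\<close> together, and the middle part adds
      \<open>e / 4\<close>.\<close>
    obtain k where "max (4 * K / (e/2)) 1 < real k" using reals_Archimedean2 by blast
    then have k: "real k > 4 * K / (e/2)" "k > 0" by auto
    then have k4: "4 * K / real k < e/2" using \<open>e > 0\<close> by (simp add: field_simps)
    define w where "w = sqrt (4/3 * pi * real k^3)"
    have w: "w > 0" using k by (simp add: w_def)
    have "q * (e/2) / (2 * w) > 0" using q w \<open>e > 0\<close> by simp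
    then obtain N where N: "\<And>m n \<xi>. m \<ge> N \<Longrightarrow> n \<ge> N \<Longrightarrow> \<xi> \<in> cball 0 (real k) \<Longrightarrow>
        cmod (V k (diagseq (Suc k + m)) \<xi> - V k (diagseq (Suc k + n)) \<xi>) \<le> q * (e/2) / (2 * w)"
      using Pr[of k] unfolding P_def o_def by blast
    have "L2_norm (\<lambda>x. u (diagseq m) x - u (diagseq n) x) < e" if mn: "m \<ge> N + Suc k" "n \<ge> N + Suc k" for m n
    proof -
      let ?I = "\<lambda>f \<xi>. indicator (cball 0 (real k)) \<xi> *\<^sub>R (f \<xi> :: complex)"
      let ?O = "\<lambda>f \<xi>. indicator (- cball 0 (real k)) \<xi> *\<^sub>R (f \<xi> :: complex)"
      have FL: "FT (u j) \<in> L2" for j using uL by auto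
      have VL: "V k j \<in> L2" for j unfolding V_def by (rule fourier_truncations_L2(3)[OF uL])
      \<comment> \<open>One error stems from cutting \<open>u j\<close> in space, the other from
        cutting its transform in frequency.\<close>
      have tail: "L2_norm (\<lambda>\<xi>. ?I (V k j) \<xi> - FT (u j) \<xi>) \<le> 2 * (q * (K / real k))" for j
      proof -
        have o: "L2_norm (?O (FT (u j))) \<le> q * (K / real k)"
        proof -
          have "L2_norm (?O (FT (u j))) \<le> (1 / real k) * L2_norm (\<lambda>\<xi>. norm \<xi> *\<^sub>R FT (u j) \<xi>)"
            using k by (intro L2_outside_ball H1_fourier_norm uH L2_measurable FL) auto
          also have "\<dots> = q * (L2_norm (weak_grad (u j)) / real k)" by (simp add: H1_fourier_norm(2)[OF uH] q_def)
          also have "\<dots> \<le> q * (K / real k)" using q by (intro mult_left_mono divide_right_mono K) auto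
          finally show ?thesis .
        qed
        have i: "L2_norm (\<lambda>\<xi>. V k j \<xi> - FT (u j) \<xi>) \<le> q * (K / real k)"
        proof -
          let ?v = "\<lambda>x. indicator (cball 0 (real k)) x *\<^sub>R u j x"
          note T = fourier_truncations_L2[OF uL[of j], of "real k"]
          have "L2_norm (\<lambda>\<xi>. V k j \<xi> - FT (u j) \<xi>) = L2_norm (FT (\<lambda>x. ?v x - u j x))"
            using FT_diff[OF T(1) uL[of j]] FT_eq_fourier_integral[OF T(1,2)]
            by (intro L2_norm_cong_AE L2_measurable L2_diff VL FL FT_L2 T uL) (auto simp: V_def elim: eventually_elim2)
          also have "\<dots> = q * L2_norm (\<lambda>x. ?v x - u j x)"
            unfolding q_def by (intro Plancherel L2_diff T uL)
          also have "L2_norm (\<lambda>x. ?v x - u j x) = L2_norm (?O (u j))"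
          proof -
            have "(norm (?v x - u j x))\<^sup>2 = (norm (?O (u j) x))\<^sup>2" for x by (simp split: split_indicator)
            then show ?thesis by (simp add: L2_norm_def)
          qed
          also have "\<dots> \<le> (1 / real k) * L2_norm (\<lambda>x. norm x *\<^sub>R u j x)"
            using k by (intro L2_outside_ball Sigma_weight u L2_measurable uL) auto
          also have "\<dots> \<le> (1 / real k) * K" by (intro mult_left_mono K) auto
          finally show ?thesis using q by simp
        qed
        have "L2_norm (\<lambda>\<xi>. ?I (V k j) \<xi> - FT (u j) \<xi>) \<le> L2_norm (\<lambda>\<xi>. ?I (\<lambda>\<xi>. V k j \<xi> - FT (u j) \<xi>) \<xi> - ?O (FT (u j)) \<xi>)"
          by (rule eq_refl, rule arg_cong[where f=L2_norm]) (auto split: split_indicator)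
        also have "\<dots> \<le> L2_norm (?I (\<lambda>\<xi>. V k j \<xi> - FT (u j) \<xi>)) + L2_norm (?O (FT (u j)))"
          by (intro L2_norm_triangle_minus L2_truncate L2_diff VL FL) auto
        also have "\<dots> \<le> q * (K / real k) + q * (K / real k)"
          by (intro add_mono o order_trans[OF L2_truncate(2) i] L2_diff VL FL) auto
        finally show ?thesis by (simp only: mult_2)
      qed
      define a where "a = diagseq m"
      define b where "b = diagseq n"
      have mid: "L2_norm (\<lambda>\<xi>. ?I (V k a) \<xi> - ?I (V k b) \<xi>) \<le> q * (e/2) / 2"
      proof -
        have "cmod (V k a \<xi> - V k b \<xi>) \<le> q * (e/2) / (2 * w)" if "\<xi> \<in> cball 0 (real k)" for \<xi>
          using N[of "m - Suc k" "n - Suc k" \<xi>] mn that by (simp add: a_def b_def)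
        then have "L2_norm (?I (\<lambda>\<xi>. V k a \<xi> - V k b \<xi>)) \<le> q * (e/2) / (2 * w) * sqrt (4/3 * pi * real k^3)"
          using q w \<open>e > 0\<close> by (intro L2_ball_sup_bound L2_measurable L2_diff VL) auto
        also have "\<dots> = q * (e/2) / 2" using w unfolding w_def[symmetric] by simp
        finally show ?thesis by (simp add: scaleR_diff_right)
      qed
      have IL: "?I (V k j) \<in> L2" for j by (intro L2_truncate VL) simp
      have "q * L2_norm (\<lambda>x. u a x - u b x) = L2_norm (\<lambda>\<xi>. FT (u a) \<xi> - FT (u b) \<xi>)"
        unfolding q_def Plancherel[OF L2_diff[OF uL uL], symmetric]
        by (intro L2_norm_cong_AE L2_measurable L2_diff FT_L2 uL FT_diff)
      also have "\<dots> \<le> L2_norm (\<lambda>\<xi>. FT (u a) \<xi> - ?I (V k a) \<xi>) + L2_norm (\<lambda>\<xi>. ?I (V k a) \<xi> - FT (u b) \<xi>)"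
        by (intro L2_norm_triangle_diff FL IL)
      also have "\<dots> \<le> L2_norm (\<lambda>\<xi>. FT (u a) \<xi> - ?I (V k a) \<xi>) + (L2_norm (\<lambda>\<xi>. ?I (V k a) \<xi> - ?I (V k b) \<xi>) + L2_norm (\<lambda>\<xi>. ?I (V k b) \<xi> - FT (u b) \<xi>))"
        by (intro add_mono order_refl L2_norm_triangle_diff FL IL)
      also have "\<dots> \<le> 2 * (q * (K / real k)) + (q * (e/2) / 2 + 2 * (q * (K / real k)))"
        using tail[of a] tail[of b] mid L2_norm_minus_commute[of "FT (u a)" "?I (V k a)"] by (intro add_mono) auto
      also have "\<dots> = q * (4 * K / real k + e/4)" by (simp add: algebra_simps)
      also have "\<dots> < q * e" using q k4 \<open>e > 0\<close> by (intro mult_strict_left_mono) auto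
      finally show ?thesis using q by (simp add: a_def b_def)
    qed
    then show "\<exists>N. \<forall>m\<ge>N. \<forall>n\<ge>N. L2_norm (\<lambda>x. u (diagseq m) x - u (diagseq n) x) < e" by blast
  qed
qed

section \<open>Dilations\<close>

lemma iexp_FTC:
  assumes "a \<le> b"
  shows "(\<integral>r. indicator {a..b} r *\<^sub>R (\<i> * complex_of_real th * exp (\<i> * complex_of_real (r * th))) \<partial>lborel)
    = exp (\<i> * complex_of_real (b * th)) - exp (\<i> * complex_of_real (a * th))"
proof (rule integral_FTC_Icc[OF assms])
  fix r
  have "((\<lambda>z. exp (\<i> * (z * complex_of_real th))) has_field_derivative \<i> * complex_of_real th * exp (\<i> * (complex_of_real r * complex_of_real th))) (at (complex_of_real r))"
    by (auto intro!: derivative_eq_intros simp: algebra_simps)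
  from has_vector_derivative_real_field[OF this]
  show "((\<lambda>r. exp (\<i> * complex_of_real (r * th))) has_vector_derivative \<i> * complex_of_real th * exp (\<i> * complex_of_real (r * th))) (at r within {a..b})"
    by (simp add: has_vector_derivative_at_within)
qed (intro continuous_intros)

text \<open>The fundamental theorem of calculus along the ray through \<open>x\<close>. It is
  applied to the band-limited part because \<open>u\<close> has no values on lines. The cut-off
  commutes with multiplication by \<open>\<i> * \<xi> $ j\<close>, so the derivative is the
  low-frequency part of the gradient.\<close>

lemma low_freq_line_difference:
  assumes u: "u \<in> H1" and ab: "a \<le> b"
  shows "ennreal (cmod (low_freq M (FT u) (b *\<^sub>R x) - low_freq M (FT u) (a *\<^sub>R x)))
    \<le> (\<integral>\<^sup>+r. indicator {a..b} r * ennreal (norm x * (\<Sum>j\<in>UNIV. cmod (low_freq M (FT (\<lambda>x. weak_grad u x $ j)) (r *\<^sub>R x)))) \<partial>lborel)"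
proof -
  define F where "F = FT u"
  have uL: "u \<in> L2" using u by (rule H1_L2)
  have F: "F \<in> L2" unfolding F_def using uL by auto
  define c where "c \<xi> = indicator (cball 0 M) \<xi> *\<^sub>R F \<xi>" for \<xi>
  have c: "integrable lborel c" unfolding c_def by (rule L2_compact_support_integrable[OF F])
  have ci: "integrable lborel (\<lambda>\<xi>. complex_of_real (x \<bullet> \<xi>) * c \<xi>)"
  proof (rule Bochner_Integration.integrable_bound)
    show "integrable lborel (\<lambda>\<xi>. (norm x * M) * norm (c \<xi>))" using c by (intro integrable_mult_right integrable_norm)
    show "(\<lambda>\<xi>. complex_of_real (x \<bullet> \<xi>) * c \<xi>) \<in> borel_measurable lborel" using borel_measurable_integrable[OF c] by measurable
    show "AE \<xi> in lborel. norm (complex_of_real (x \<bullet> \<xi>) * c \<xi>) \<le> norm ((norm x * M) * norm (c \<xi>))"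
    proof (rule AE_I2)
      fix \<xi> :: "real^3"
      show "norm (complex_of_real (x \<bullet> \<xi>) * c \<xi>) \<le> norm ((norm x * M) * norm (c \<xi>))"
      proof (cases "norm \<xi> \<le> M")
        case True
        have "\<bar>x \<bullet> \<xi>\<bar> \<le> norm x * norm \<xi>" by (rule Cauchy_Schwarz_ineq2)
        also have "\<dots> \<le> norm x * \<bar>M\<bar>" using True by (intro mult_left_mono) auto
        finally show ?thesis by (auto simp: norm_mult abs_mult intro!: mult_right_mono)
      qed (simp add: c_def)
    qed
  qed
  have [measurable]: "c \<in> borel_measurable borel" using borel_measurable_integrable[OF c] by simp
  let ?h = "\<lambda>r \<xi>. indicator {a..b} r *\<^sub>R (\<i> * complex_of_real (x \<bullet> \<xi>) * exp (\<i> * complex_of_real (r * (x \<bullet> \<xi>))) * c \<xi>)"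
  have nh: "norm (?h r \<xi>) = indicator {a..b} r * norm (complex_of_real (x \<bullet> \<xi>) * c \<xi>)" for r \<xi>
    by (simp add: norm_mult norm_exp_eq_Re)
  have ki: "integrable lborel (\<lambda>\<xi>. exp (\<i> * complex_of_real (s * (x \<bullet> \<xi>))) * c \<xi>)" for s
    by (rule Bochner_Integration.integrable_bound[OF c]) (auto simp: norm_mult norm_exp_eq_Re)
  have int: "integrable (lborel \<Otimes>\<^sub>M lborel) (case_prod ?h)"
  proof (rule lborel_pair.Fubini_integrable)
    show "case_prod ?h \<in> borel_measurable (lborel \<Otimes>\<^sub>M lborel)" by measurable
    have "integrable lborel (\<lambda>r. indicator {a..b} r * (\<integral>\<xi>. norm (complex_of_real (x \<bullet> \<xi>) * c \<xi>) \<partial>lborel) :: real)"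
      using ab by (intro integrable_mult_left integrable_real_indicator) auto
    then show "integrable lborel (\<lambda>r. \<integral>\<xi>. norm (case_prod ?h (r, \<xi>)) \<partial>lborel)"
      unfolding case_prod_conv nh by simp
    show "AE r in lborel. integrable lborel (\<lambda>\<xi>. case_prod ?h (r, \<xi>))"
    proof (rule AE_I2)
      fix r
      show "integrable lborel (\<lambda>\<xi>. case_prod ?h (r, \<xi>))"
        unfolding case_prod_conv
        by (rule Bochner_Integration.integrable_bound[OF ci]) (auto simp: norm_mult norm_exp_eq_Re split: split_indicator)
    qed
  qed
  have inner_r: "(\<integral>r. ?h r \<xi> \<partial>lborel) = (exp (\<i> * complex_of_real (b * (x \<bullet> \<xi>))) - exp (\<i> * complex_of_real (a * (x \<bullet> \<xi>)))) * c \<xi>" for \<xi>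
  proof -
    have "(\<integral>r. ?h r \<xi> \<partial>lborel) = (\<integral>r. (indicator {a..b} r *\<^sub>R (\<i> * complex_of_real (x \<bullet> \<xi>) * exp (\<i> * complex_of_real (r * (x \<bullet> \<xi>))))) * c \<xi> \<partial>lborel)"
      by simp
    then show ?thesis unfolding integral_mult_left_zero iexp_FTC[OF ab] .
  qed
  have lf: "low_freq M F (s *\<^sub>R x) = (\<integral>\<xi>. exp (\<i> * complex_of_real (s * (x \<bullet> \<xi>))) * c \<xi> \<partial>lborel) / complex_of_real fkappa" for s
    by (simp add: low_freq_def c_def)
  have "low_freq M F (b *\<^sub>R x) - low_freq M F (a *\<^sub>R x)
      = (\<integral>\<xi>. (\<integral>r. ?h r \<xi> \<partial>lborel) \<partial>lborel) / complex_of_real fkappa"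
    unfolding lf inner_r left_diff_distrib diff_divide_distrib[symmetric]
    by (subst Bochner_Integration.integral_diff[OF ki ki]) simp
  also have "\<dots> = (\<integral>r. (\<integral>\<xi>. ?h r \<xi> \<partial>lborel) \<partial>lborel) / complex_of_real fkappa"
    unfolding lborel_pair.Fubini_integral[OF int] ..
  also have "\<dots> = (\<integral>r. indicator {a..b} r *\<^sub>R (\<Sum>j\<in>UNIV. complex_of_real (x $ j) * low_freq M (FT (\<lambda>x. weak_grad u x $ j)) (r *\<^sub>R x)) \<partial>lborel)"
  proof -
    have gL: "(\<lambda>x. weak_grad u x $ j) \<in> L2" for j by (rule L2_component(1)[OF weak_grad_L2[OF u]])
    have lfg: "low_freq M (FT (\<lambda>x. weak_grad u x $ j)) (r *\<^sub>R x) = (\<integral>\<xi>. exp (\<i> * complex_of_real (r * (x \<bullet> \<xi>))) * (\<i> * complex_of_real (\<xi> $ j) * c \<xi>) \<partial>lborel) / complex_of_real fkappa" for j r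
    proof -
      have "(\<integral>\<xi>. exp (\<i> * complex_of_real (r *\<^sub>R x \<bullet> \<xi>)) * (indicator (cball 0 M) \<xi> *\<^sub>R FT (\<lambda>x. weak_grad u x $ j) \<xi>) \<partial>lborel)
          = (\<integral>\<xi>. exp (\<i> * complex_of_real (r * (x \<bullet> \<xi>))) * (\<i> * complex_of_real (\<xi> $ j) * c \<xi>) \<partial>lborel)"
      proof (rule integral_cong_AE)
        show "AE \<xi> in lborel. exp (\<i> * complex_of_real (r *\<^sub>R x \<bullet> \<xi>)) * (indicator (cball 0 M) \<xi> *\<^sub>R FT (\<lambda>x. weak_grad u x $ j) \<xi>)
           = exp (\<i> * complex_of_real (r * (x \<bullet> \<xi>))) * (\<i> * complex_of_real (\<xi> $ j) * c \<xi>)"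
          using FT_weak_gradient[OF uL H1_weak_grad[OF u], of j] by eventually_elim (simp add: c_def F_def)
      qed (use L2_measurable[OF FT_L2[OF gL]] in measurable)
      then show ?thesis unfolding low_freq_def by simp
    qed
    have ji: "integrable lborel (\<lambda>\<xi>. complex_of_real (x $ j) * (exp (\<i> * complex_of_real (r * (x \<bullet> \<xi>))) * (\<i> * complex_of_real (\<xi> $ j) * c \<xi>)))" for j r
    proof (rule integrable_mult_right, rule Bochner_Integration.integrable_bound)
      show "integrable lborel (\<lambda>\<xi>. \<bar>M\<bar> * norm (c \<xi>))" using c by (intro integrable_mult_right integrable_norm)
      show "AE \<xi> in lborel. norm (exp (\<i> * complex_of_real (r * (x \<bullet> \<xi>))) * (\<i> * complex_of_real (\<xi> $ j) * c \<xi>)) \<le> norm (\<bar>M\<bar> * norm (c \<xi>))"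
      proof (rule AE_I2)
        fix \<xi> :: "real^3"
        show "norm (exp (\<i> * complex_of_real (r * (x \<bullet> \<xi>))) * (\<i> * complex_of_real (\<xi> $ j) * c \<xi>)) \<le> norm (\<bar>M\<bar> * norm (c \<xi>))"
          using component_le_norm_cart[of \<xi> j]
          by (cases "norm \<xi> \<le> M") (auto simp: c_def norm_mult norm_exp_eq_Re intro!: mult_right_mono)
      qed
    qed measurable
    have "(\<integral>\<xi>. ?h r \<xi> \<partial>lborel) / complex_of_real fkappa = indicator {a..b} r *\<^sub>R (\<Sum>j\<in>UNIV. complex_of_real (x $ j) * low_freq M (FT (\<lambda>x. weak_grad u x $ j)) (r *\<^sub>R x))" for r
    proof -
      have "\<i> * complex_of_real (x \<bullet> \<xi>) * exp (\<i> * complex_of_real (r * (x \<bullet> \<xi>))) * c \<xi>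
         = (\<Sum>j\<in>UNIV. complex_of_real (x $ j) * (exp (\<i> * complex_of_real (r * (x \<bullet> \<xi>))) * (\<i> * complex_of_real (\<xi> $ j) * c \<xi>)))" for \<xi>
        by (simp add: inner_vec_def sum_distrib_left sum_distrib_right mult_ac)
      then have "(\<integral>\<xi>. \<i> * complex_of_real (x \<bullet> \<xi>) * exp (\<i> * complex_of_real (r * (x \<bullet> \<xi>))) * c \<xi> \<partial>lborel)
         = (\<Sum>j\<in>UNIV. complex_of_real (x $ j) * (\<integral>\<xi>. exp (\<i> * complex_of_real (r * (x \<bullet> \<xi>))) * (\<i> * complex_of_real (\<xi> $ j) * c \<xi>) \<partial>lborel))"
        using Bochner_Integration.integral_sum[of UNIV lborel "\<lambda>j \<xi>. complex_of_real (x $ j) * (exp (\<i> * complex_of_real (r * (x \<bullet> \<xi>))) * (\<i> * complex_of_real (\<xi> $ j) * c \<xi>))"] ji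
        by (simp only: integral_mult_right_zero)
      then show ?thesis unfolding lfg by (simp add: scaleR_conv_of_real flip: sum_divide_distrib)
    qed
    then show ?thesis by (simp only: integral_divide_zero[symmetric])
  qed
  finally have eq: "low_freq M F (b *\<^sub>R x) - low_freq M F (a *\<^sub>R x) = (\<integral>r. indicator {a..b} r *\<^sub>R (\<Sum>j\<in>UNIV. complex_of_real (x $ j) * low_freq M (FT (\<lambda>x. weak_grad u x $ j)) (r *\<^sub>R x)) \<partial>lborel)" (is "_ = (\<integral>r. ?w r \<partial>lborel)") .
  \<comment> \<open>Without integrability the left side is 0 by convention, so both cases are
    covered.\<close>
  have "ennreal (cmod (\<integral>r. ?w r \<partial>lborel)) \<le> (\<integral>\<^sup>+r. ennreal (norm (?w r)) \<partial>lborel)"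
  proof (cases "integrable lborel ?w")
    case True then show ?thesis by (rule integral_norm_bound_ennreal)
  next
    case False
    show ?thesis unfolding not_integrable_integral_eq[OF False] by simp
  qed
  also have "\<dots> \<le> (\<integral>\<^sup>+r. indicator {a..b} r * ennreal (norm x * (\<Sum>j\<in>UNIV. cmod (low_freq M (FT (\<lambda>x. weak_grad u x $ j)) (r *\<^sub>R x)))) \<partial>lborel)"
  proof (rule nn_integral_mono)
    fix r
    have "norm (\<Sum>j\<in>UNIV. complex_of_real (x $ j) * low_freq M (FT (\<lambda>x. weak_grad u x $ j)) (r *\<^sub>R x))
       \<le> (\<Sum>j\<in>UNIV. norm x * cmod (low_freq M (FT (\<lambda>x. weak_grad u x $ j)) (r *\<^sub>R x)))"
      by (rule order_trans[OF norm_sum]) (auto simp: norm_mult component_le_norm_cart intro!: sum_mono mult_right_mono)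
    then show "ennreal (norm (?w r)) \<le> indicator {a..b} r * ennreal (norm x * (\<Sum>j\<in>UNIV. cmod (low_freq M (FT (\<lambda>x. weak_grad u x $ j)) (r *\<^sub>R x))))"
      by (auto simp: sum_distrib_left intro!: ennreal_leI split: split_indicator)
  qed
  finally show ?thesis unfolding eq[symmetric] F_def .
qed

lemma low_freq_tendsto:
  assumes u: "u \<in> L2"
  shows "(\<lambda>n. L2_norm (\<lambda>x. low_freq (real n) (FT u) x - u x)) \<longlonglongrightarrow> 0"
proof -
  have F: "FT u \<in> L2" using u by auto
  have "L2_norm (\<lambda>x. low_freq (real n) (FT u) x - u x) = L2_norm (\<lambda>\<xi>. indicator (cball 0 (real n)) \<xi> *\<^sub>R FT u \<xi> - FT u \<xi>) / sqrt fkappa" for n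
  proof -
    have "(norm (indicator (cball 0 (real n)) \<xi> *\<^sub>R FT u \<xi> - FT u \<xi>))\<^sup>2 = (norm (indicator (- cball 0 (real n)) \<xi> *\<^sub>R FT u \<xi>))\<^sup>2" for \<xi>
      by (simp split: split_indicator)
    then have "L2_norm (\<lambda>\<xi>. indicator (cball 0 (real n)) \<xi> *\<^sub>R FT u \<xi> - FT u \<xi>) = L2_norm (\<lambda>\<xi>. indicator (- cball 0 (real n)) \<xi> *\<^sub>R FT u \<xi>)"
      by (simp add: L2_norm_def)
    then show ?thesis using low_freq_error[OF u, of "real n"] L2_norm_minus_commute[of u "low_freq (real n) (FT u)"] by simp
  qed
  then show ?thesis using tendsto_divide_zero[OF truncations_tendsto[OF F]] by simp
qed

lemma scale_powr_le_3: "1/2 \<le> (r::real) \<Longrightarrow> r powr (-3/2) \<le> 3"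
proof -
  assume r: "1/2 \<le> (r::real)"
  then have "1 / r \<le> 2" by (simp add: field_simps)
  have "(r powr (-3/2))\<^sup>2 = (1/r)^3"
  proof -
    have "(r powr (-3/2))\<^sup>2 = r powr (-3)" using r by (simp add: powr_power)
    also have "\<dots> = (1/r)^3" using r powr_realpow[of r 3] by (simp add: powr_minus_divide power_divide)
    finally show ?thesis .
  qed
  also have "\<dots> \<le> 2^3" using r \<open>1 / r \<le> 2\<close> by (intro power_mono) auto
  also have "\<dots> \<le> 3\<^sup>2" by simp
  finally show ?thesis by (rule power2_le_imp_le) simp
qed

text \<open>Formally the derivative of \<open>u (r *\<^sub>R x)\<close> in \<open>r\<close> is the
  product of \<open>x\<close> with the gradient, and a weighted gradient need not be in
  \<open>L2\<close>. Pairing with \<open>v\<close> lets the weight fall on \<open>v\<close> instead,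
  so the dependence on the dilation is Lipschitz in this weak sense. The bound is shown for
  band-limited parts, uniformly in the cut-off, and survives the limit.\<close>

lemma dilation_pairing_bound:
  assumes u: "u \<in> H1" and v: "v \<in> L2" and xv: "(\<lambda>x. norm x *\<^sub>R v x) \<in> L2" and ab: "1/2 \<le> a" "a \<le> b"
  shows "\<bar>rip v (\<lambda>x. u (b *\<^sub>R x) - u (a *\<^sub>R x))\<bar> \<le> 9 * (b - a) * (L2_norm (\<lambda>x. norm x *\<^sub>R v x) * L2_norm (weak_grad u))"
proof -
  note uL = H1_L2[OF u]
  have F: "FT u \<in> L2" using uL by auto
  have pos: "a > 0" "b > 0" using ab by auto
  have gL: "(\<lambda>x. weak_grad u x $ j) \<in> L2" for j by (rule L2_component(1)[OF weak_grad_L2[OF u]])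
  note [measurable] = L2_measurable[OF uL] L2_measurable[OF v]
  let ?C = "L2_norm (\<lambda>x. norm x *\<^sub>R v x) * L2_norm (weak_grad u)"
  have C0: "?C \<ge> 0" by simp
  define D where "D n x = low_freq (real n) (FT u) (b *\<^sub>R x) - low_freq (real n) (FT u) (a *\<^sub>R x)" for n x
  have sc: "(\<lambda>x. f (t *\<^sub>R x)) \<in> L2" "L2_norm (\<lambda>x. f (t *\<^sub>R x)) = t powr (-3/2) * L2_norm f" if "f \<in> L2" "t > 0" for f :: "real^3 \<Rightarrow> complex" and t
    using L2_scale_shift[OF that, of 0] by auto
  have LL: "low_freq M (FT u) \<in> L2" for M by (rule low_freq_L2(1)[OF F])
  have DL: "D n \<in> L2" for n unfolding D_def by (intro L2_diff sc LL pos)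
  have bound: "\<bar>rip v (D n)\<bar> \<le> 9 * (b - a) * ?C" for n
  proof -
    define G where "G j = low_freq (real n) (FT (\<lambda>x. weak_grad u x $ j))" for j
    have GL: "G j \<in> L2" "L2_norm (G j) \<le> L2_norm (weak_grad u)" for j
    proof -
      show "G j \<in> L2" unfolding G_def by (intro low_freq_L2(1) FT_L2 gL)
      have "L2_norm (G j) \<le> L2_norm (FT (\<lambda>x. weak_grad u x $ j)) / sqrt fkappa"
        unfolding G_def by (intro low_freq_L2(2) FT_L2 gL)
      also have "\<dots> = L2_norm (\<lambda>x. weak_grad u x $ j)" by (simp add: Plancherel[OF gL])
      also have "\<dots> \<le> L2_norm (weak_grad u)" by (rule L2_component(2)[OF weak_grad_L2[OF u]])
      finally show "L2_norm (G j) \<le> L2_norm (weak_grad u)" .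
    qed
    have [measurable]: "G j \<in> borel_measurable borel" for j using GL(1) by (rule L2_measurable)
    define S where "S r x = cmod (G 1 (r *\<^sub>R x)) + cmod (G 2 (r *\<^sub>R x)) + cmod (G 3 (r *\<^sub>R x))" for r x
    \<comment> \<open>The 9 counts three components of the gradient, each enlarged by at most 3
      through the dilation, since \<open>r\<close> is at least 1/2.\<close>
    have SL: "S r \<in> L2 \<and> L2_norm (S r) \<le> 9 * L2_norm (weak_grad u)" if "1/2 \<le> r" for r
    proof -
      have r: "r > 0" using that by simp
      have nL: "(\<lambda>x. cmod (G j (r *\<^sub>R x))) \<in> L2 \<and> L2_norm (\<lambda>x. cmod (G j (r *\<^sub>R x))) \<le> 3 * L2_norm (weak_grad u)" for j
      proof -
        note s = sc[OF GL(1)[of j] r]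
        have "L2_norm (\<lambda>x. cmod (G j (r *\<^sub>R x))) \<le> L2_norm (\<lambda>x. G j (r *\<^sub>R x))" "(\<lambda>x. cmod (G j (r *\<^sub>R x))) \<in> L2"
          by (rule L2_norm_mono[OF s(1)]; use L2_measurable[OF s(1)] in simp)+
        moreover have "L2_norm (\<lambda>x. G j (r *\<^sub>R x)) \<le> 3 * L2_norm (weak_grad u)"
          unfolding s(2) using scale_powr_le_3[OF that] GL(2)[of j] by (intro mult_mono) auto
        ultimately show ?thesis by linarith
      qed
      have "S r \<in> L2" unfolding S_def using nL by (intro L2_add) auto
      moreover have "L2_norm (S r) \<le> (L2_norm (\<lambda>x. cmod (G 1 (r *\<^sub>R x))) + L2_norm (\<lambda>x. cmod (G 2 (r *\<^sub>R x)))) + L2_norm (\<lambda>x. cmod (G 3 (r *\<^sub>R x)))"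
        unfolding S_def using nL
        by (intro order_trans[OF L2_norm_triangle] add_mono L2_norm_triangle order_refl L2_add) auto
      ultimately show ?thesis using nL[of 1] nL[of 2] nL[of 3] by linarith
    qed
    have "ennreal \<bar>rip v (D n)\<bar> \<le> ennreal (\<integral>x. norm (v x) * norm (D n x) \<partial>lborel)"
    proof (rule ennreal_leI)
      have "\<bar>rip v (D n)\<bar> \<le> (\<integral>x. \<bar>v x \<bullet> D n x\<bar> \<partial>lborel)" unfolding rip_def by (rule integral_abs_bound)
      also have "\<dots> \<le> (\<integral>x. norm (v x) * norm (D n x) \<partial>lborel)"
        by (intro integral_mono L2_mult_integrable v DL integrable_abs L2_inner_integrable) (simp add: Cauchy_Schwarz_ineq2)
      finally show "\<bar>rip v (D n)\<bar> \<le> (\<integral>x. norm (v x) * norm (D n x) \<partial>lborel)" .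
    qed
    also have "\<dots> = (\<integral>\<^sup>+x. ennreal (norm (v x) * norm (D n x)) \<partial>lborel)"
      by (intro nn_integral_eq_integral[symmetric] L2_mult_integrable v DL) auto
    also have "\<dots> \<le> (\<integral>\<^sup>+x. (\<integral>\<^sup>+r. indicator {a..b} r * ennreal (norm (norm x *\<^sub>R v x) * norm (S r x)) \<partial>lborel) \<partial>lborel)"
    proof (rule nn_integral_mono)
      fix x
      have "ennreal (norm (D n x)) \<le> (\<integral>\<^sup>+r. indicator {a..b} r * ennreal (norm x * S r x) \<partial>lborel)"
        using low_freq_line_difference[OF u ab(2), of "real n" x] by (simp add: D_def S_def G_def sum_3)
      then have "ennreal (norm (v x)) * ennreal (norm (D n x)) \<le> ennreal (norm (v x)) * (\<integral>\<^sup>+r. indicator {a..b} r * ennreal (norm x * S r x) \<partial>lborel)"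
        by (rule mult_left_mono) simp
      also have "\<dots> = (\<integral>\<^sup>+r. ennreal (norm (v x)) * (indicator {a..b} r * ennreal (norm x * S r x)) \<partial>lborel)"
        unfolding S_def by (rule nn_integral_cmult[symmetric]) measurable
      also have "\<dots> = (\<integral>\<^sup>+r. indicator {a..b} r * ennreal (norm (norm x *\<^sub>R v x) * norm (S r x)) \<partial>lborel)"
        by (intro nn_integral_cong) (auto simp: S_def ennreal_mult[symmetric] mult_ac split: split_indicator)
      finally show "ennreal (norm (v x) * norm (D n x)) \<le> (\<integral>\<^sup>+r. indicator {a..b} r * ennreal (norm (norm x *\<^sub>R v x) * norm (S r x)) \<partial>lborel)"
        by (simp add: ennreal_mult)
    qed
    also have "\<dots> = (\<integral>\<^sup>+r. (\<integral>\<^sup>+x. indicator {a..b} r * ennreal (norm (norm x *\<^sub>R v x) * norm (S r x)) \<partial>lborel) \<partial>lborel)"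
      unfolding S_def by (rule lborel_pair.Fubini') measurable
    also have "\<dots> \<le> (\<integral>\<^sup>+r. ennreal (9 * ?C) * indicator {a..b} r \<partial>lborel)"
    proof (rule nn_integral_mono)
      fix r
      show "(\<integral>\<^sup>+x. indicator {a..b} r * ennreal (norm (norm x *\<^sub>R v x) * norm (S r x)) \<partial>lborel) \<le> ennreal (9 * ?C) * indicator {a..b} r"
      proof (cases "r \<in> {a..b}")
        case True
        then have r: "1/2 \<le> r" using ab by simp
        have "(\<integral>\<^sup>+x. ennreal (norm (norm x *\<^sub>R v x) * norm (S r x)) \<partial>lborel) = ennreal (\<integral>x. norm (norm x *\<^sub>R v x) * norm (S r x) \<partial>lborel)"
          using SL[OF r] by (intro nn_integral_eq_integral L2_mult_integrable xv) auto
        also have "\<dots> \<le> ennreal (L2_norm (\<lambda>x. norm x *\<^sub>R v x) * L2_norm (S r))"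
          using SL[OF r] by (intro ennreal_leI L2_Cauchy_Schwarz xv) auto
        also have "\<dots> \<le> ennreal (L2_norm (\<lambda>x. norm x *\<^sub>R v x) * (9 * L2_norm (weak_grad u)))"
          using SL[OF r] by (intro ennreal_leI mult_left_mono) auto
        finally show ?thesis using True by (simp add: mult_ac)
      qed simp
    qed
    also have "\<dots> = ennreal (9 * ?C) * emeasure lborel {a..b}" by (rule nn_integral_cmult_indicator) simp
    also have "\<dots> = ennreal (9 * (b - a) * ?C)"
      using ab by (simp add: ennreal_mult[symmetric] mult_ac)
    finally show ?thesis using ab by (subst (asm) ennreal_le_iff) auto
  qed
  have DD: "(\<lambda>n. L2_norm (\<lambda>x. D n x - (u (b *\<^sub>R x) - u (a *\<^sub>R x)))) \<longlonglongrightarrow> 0"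
  proof (rule Lim_null_comparison[OF always_eventually])
    let ?e = "\<lambda>n x. low_freq (real n) (FT u) x - u x"
    have eL: "?e n \<in> L2" for n by (intro L2_diff LL uL)
    show "\<forall>n. norm (L2_norm (\<lambda>x. D n x - (u (b *\<^sub>R x) - u (a *\<^sub>R x)))) \<le> b powr (-3/2) * L2_norm (?e n) + a powr (-3/2) * L2_norm (?e n)"
    proof
      fix n
      have "L2_norm (\<lambda>x. D n x - (u (b *\<^sub>R x) - u (a *\<^sub>R x))) = L2_norm (\<lambda>x. ?e n (b *\<^sub>R x) - ?e n (a *\<^sub>R x))"
        by (rule arg_cong[where f=L2_norm]) (auto simp: D_def)
      also have "\<dots> \<le> L2_norm (\<lambda>x. ?e n (b *\<^sub>R x)) + L2_norm (\<lambda>x. ?e n (a *\<^sub>R x))"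
        by (intro L2_norm_triangle_minus sc(1)[OF eL] pos)
      also have "\<dots> = b powr (-3/2) * L2_norm (?e n) + a powr (-3/2) * L2_norm (?e n)"
        by (simp only: sc(2)[OF eL pos(1)] sc(2)[OF eL pos(2)])
      finally show "norm (L2_norm (\<lambda>x. D n x - (u (b *\<^sub>R x) - u (a *\<^sub>R x)))) \<le> b powr (-3/2) * L2_norm (?e n) + a powr (-3/2) * L2_norm (?e n)"
        by simp
    qed
    have "(\<lambda>n. b powr (-3/2) * L2_norm (?e n) + a powr (-3/2) * L2_norm (?e n)) \<longlonglongrightarrow> b powr (-3/2) * 0 + a powr (-3/2) * 0"
      by (intro tendsto_intros low_freq_tendsto uL)
    then show "(\<lambda>n. b powr (-3/2) * L2_norm (?e n) + a powr (-3/2) * L2_norm (?e n)) \<longlonglongrightarrow> 0" by simp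
  qed
  have LimL: "(\<lambda>x. u (b *\<^sub>R x) - u (a *\<^sub>R x)) \<in> L2" by (intro L2_diff sc uL pos)
  have "(\<lambda>n. rip (D n) v) \<longlonglongrightarrow> rip (\<lambda>x. u (b *\<^sub>R x) - u (a *\<^sub>R x)) v"
    by (rule tendsto_rip[OF DL LimL v DD])
  then have "(\<lambda>n. \<bar>rip v (D n)\<bar>) \<longlonglongrightarrow> \<bar>rip v (\<lambda>x. u (b *\<^sub>R x) - u (a *\<^sub>R x))\<bar>"
    unfolding rip_commute[of _ v] by (rule tendsto_rabs)
  then show ?thesis by (rule LIMSEQ_le_const2) (use bound in blast)
qed

text \<open>\<open>t * sqrt t\<close> is the power 3/2 of \<open>t\<close>, the factor for which the
  dilation keeps the mass, so the curve stays on the mass sphere.\<close>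

definition dilate :: "real \<Rightarrow> (real^3 \<Rightarrow> complex) \<Rightarrow> real^3 \<Rightarrow> complex" where
  "dilate t u x = (t * sqrt t) *\<^sub>R u (t *\<^sub>R x)"

lemma sqrt_cube_powr: "t > 0 \<Longrightarrow> t powr (-3/2) = 1 / (t * sqrt t)"
proof -
  assume t: "t > 0"
  have "t * sqrt t = t powr 1 * t powr (1/2)" using t by (simp add: powr_half_sqrt)
  also have "\<dots> = t powr (3/2)" by (simp only: powr_add[symmetric]) simp
  finally show ?thesis using powr_minus_divide[of t "3/2"] by simp
qed

lemma dilate_L2:
  fixes u :: "real^3 \<Rightarrow> complex"
  assumes "u \<in> L2" "t > 0"
  shows "dilate t u \<in> L2" "L2_norm (dilate t u) = L2_norm u"
proof -
  have "(\<lambda>x. u (t *\<^sub>R x)) \<in> L2" "L2_norm (\<lambda>x. u (t *\<^sub>R x)) = t powr (-3/2) * L2_norm u"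
    using L2_scale_shift[OF assms, of 0] by auto
  then show "dilate t u \<in> L2" "L2_norm (dilate t u) = L2_norm u"
    using \<open>t > 0\<close> sqrt_cube_powr[OF \<open>t > 0\<close>] unfolding dilate_def[abs_def] by (auto simp: L2_norm_scaleR abs_mult)
qed

lemma dilate_weak_gradient:
  assumes u: "u \<in> L2" and g: "is_weak_gradient u g" and t: "t > 0"
  shows "is_weak_gradient (dilate t u) (\<lambda>x. (t * (t * sqrt t)) *\<^sub>R g (t *\<^sub>R x))"
  using is_weak_gradient_scaleR[OF is_weak_gradient_dilation[OF u g t], of "t * sqrt t"]
  by (simp add: dilate_def[abs_def] mult.commute mult.left_commute)

lemma dilate_Sigma:
  assumes u: "u \<in> Sigma_space" and t: "t > 0"
  shows "dilate t u \<in> Sigma_space" "L2_norm (weak_grad (dilate t u)) = t * L2_norm (weak_grad u)"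
    "L2_norm (\<lambda>x. norm x *\<^sub>R dilate t u x) = (1/t) * L2_norm (\<lambda>x. norm x *\<^sub>R u x)"
    "particle_density (dilate t u) = (\<lambda>x. t^3 *\<^sub>R particle_density u (t *\<^sub>R x))"
proof -
  note uL = Sigma_L2[OF u] and uH = Sigma_H1[OF u] and uW = Sigma_weight[OF u]
  note g = H1_weak_grad[OF uH] and gL = weak_grad_L2[OF uH]
  note dL = dilate_L2(1)[OF uL t]
  note W = weak_grad_eqI[OF dL dilate_weak_gradient[OF uL g t]]
  have weq: "(\<lambda>x. norm x *\<^sub>R dilate t u x) = (\<lambda>x. (1/t) *\<^sub>R dilate t (\<lambda>x. norm x *\<^sub>R u x) x)"
    using t by (auto simp: dilate_def)
  have "(\<lambda>x. norm x *\<^sub>R dilate t u x) \<in> L2" unfolding weq by (intro L2_scaleR dilate_L2 uW t)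
  with W(1) show "dilate t u \<in> Sigma_space" by (simp add: Sigma_space_def)
  have gt: "(\<lambda>x. weak_grad u (t *\<^sub>R x)) \<in> L2" "L2_norm (\<lambda>x. weak_grad u (t *\<^sub>R x)) = t powr (-3/2) * L2_norm (weak_grad u)"
    using L2_scale_shift[OF gL t, of 0] by auto
  have "L2_norm (weak_grad (dilate t u)) = L2_norm (\<lambda>x. (t * (t * sqrt t)) *\<^sub>R weak_grad u (t *\<^sub>R x))"
    by (intro L2_norm_cong_AE W(2) L2_measurable weak_grad_L2 W(1) L2_scaleR gt)
  also have "\<dots> = t * L2_norm (weak_grad u)"
    unfolding L2_norm_scaleR gt(2) sqrt_cube_powr[OF t] using t by (simp add: abs_mult)
  finally show "L2_norm (weak_grad (dilate t u)) = t * L2_norm (weak_grad u)" .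
  show "L2_norm (\<lambda>x. norm x *\<^sub>R dilate t u x) = (1/t) * L2_norm (\<lambda>x. norm x *\<^sub>R u x)"
    unfolding weq L2_norm_scaleR dilate_L2(2)[OF uW t] using t by simp
  show "particle_density (dilate t u) = (\<lambda>x. t^3 *\<^sub>R particle_density u (t *\<^sub>R x))"
  proof
    fix x
    have "(cmod (dilate t u x))\<^sup>2 = t\<^sup>2 * (sqrt t)\<^sup>2 * (cmod (u (t *\<^sub>R x)))\<^sup>2"
      by (simp add: dilate_def power_mult_distrib abs_mult)
    also have "\<dots> = t^3 * (cmod (u (t *\<^sub>R x)))\<^sup>2" using t by (simp add: power2_eq_square power3_eq_cube)
    finally show "particle_density (dilate t u) x = t^3 *\<^sub>R particle_density u (t *\<^sub>R x)"
      by (simp add: particle_density_def scaleR_conv_of_real)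
  qed
qed

text \<open>Pair \<open>d\<close> with itself after splitting it into \<open>s\<close> times a pure
  dilation difference and \<open>s - 1\<close> times \<open>u\<close>. Here \<open>s\<close> is at
  most 3 and \<open>s - 1\<close> at most \<open>3 * (t - 1)\<close> in absolute value, and 27 is 3
  times the 9 of \<open>dilation_pairing_bound\<close>.\<close>

lemma dilate_difference_bound:
  assumes u: "u \<in> Sigma_space" and t: "1/2 \<le> t" "t \<le> 2"
  defines "d \<equiv> \<lambda>x. dilate t u x - u x"
  shows "(L2_norm d)\<^sup>2 \<le> \<bar>t - 1\<bar> * (27 * (L2_norm (\<lambda>x. norm x *\<^sub>R d x) * L2_norm (weak_grad u)) + 3 * (L2_norm d * L2_norm u))"
proof -
  have t0: "t > 0" using t by simp
  note uL = Sigma_L2[OF u] and uH = Sigma_H1[OF u] and uW = Sigma_weight[OF u]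
  note S = dilate_Sigma[OF u t0]
  have dL: "d \<in> L2" unfolding d_def by (intro L2_diff dilate_L2 uL t0)
  have xd: "(\<lambda>x. norm x *\<^sub>R d x) \<in> L2"
    using L2_diff[OF Sigma_weight[OF S(1)] uW] by (simp add: d_def scaleR_diff_right)
  define s where "s = t * sqrt t"
  have st: "1/2 \<le> sqrt t" "sqrt t \<le> 3/2"
  proof -
    have "(1/2)\<^sup>2 \<le> t" "t \<le> (3/2)\<^sup>2" using t by (simp_all add: power2_eq_square)
    then show "1/2 \<le> sqrt t" "sqrt t \<le> 3/2" using t by (intro real_le_rsqrt real_le_lsqrt; simp)+
  qed
  have s3: "0 \<le> s" "s \<le> 3" using st t mult_mono[of t 2 "sqrt t" "3/2"] by (auto simp: s_def)
  have s1: "\<bar>s - 1\<bar> \<le> 3 * \<bar>t - 1\<bar>"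
  proof -
    have "\<bar>sqrt t - 1\<bar> * (sqrt t + 1) = \<bar>(sqrt t - 1) * (sqrt t + 1)\<bar>" using st by (simp add: abs_mult)
    also have "(sqrt t - 1) * (sqrt t + 1) = t - 1" using t by (simp add: algebra_simps)
    finally have "\<bar>sqrt t - 1\<bar> * 1 \<le> \<bar>t - 1\<bar>"
      using mult_left_mono[of 1 "sqrt t + 1" "\<bar>sqrt t - 1\<bar>"] st t0 by simp
    moreover have "\<bar>(t - 1) * sqrt t\<bar> \<le> \<bar>t - 1\<bar> * (3/2)" unfolding abs_mult using st by (intro mult_left_mono) auto
    moreover have "s - 1 = (t - 1) * sqrt t + (sqrt t - 1)" by (simp add: s_def algebra_simps)
    moreover have "\<bar>t - 1\<bar> \<ge> 0" by simp
    moreover have "\<bar>S\<bar> \<le> 3 * T" if "\<bar>p\<bar> * 1 \<le> T" "\<bar>m\<bar> \<le> T * (3/2)" "S = m + p" "T \<ge> 0" for S p m T :: real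
      using that by linarith
    ultimately show ?thesis by blast
  qed
  let ?e = "\<lambda>x. u (t *\<^sub>R x) - u x"
  have eL: "?e \<in> L2" using L2_diff[OF L2_scale_shift(1)[OF uL t0, of 0] uL] by simp
  let ?X = "L2_norm (\<lambda>x. norm x *\<^sub>R d x) * L2_norm (weak_grad u)"
  have pair: "\<bar>rip d ?e\<bar> \<le> 9 * \<bar>t - 1\<bar> * ?X"
  proof (cases "t \<ge> 1")
    case True
    then show ?thesis using dilation_pairing_bound[OF uH dL xd _ True] by simp
  next
    case False
    have "rip d ?e = - rip d (\<lambda>x. u (1 *\<^sub>R x) - u (t *\<^sub>R x))"
      using rip_scaleR_right[of d "-1" "\<lambda>x. u x - u (t *\<^sub>R x)"] by simp
    then show ?thesis using dilation_pairing_bound[OF uH dL xd t(1), of 1] False by simp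
  qed
  have deq: "d = (\<lambda>x. s *\<^sub>R ?e x + (s - 1) *\<^sub>R u x)" by (auto simp: d_def dilate_def s_def algebra_simps)
  have "(L2_norm d)\<^sup>2 = rip d (\<lambda>x. s *\<^sub>R ?e x + (s - 1) *\<^sub>R u x)" using rip_self[of d] deq by simp
  also have "\<dots> = s * rip d ?e + (s - 1) * rip d u"
    by (simp add: rip_add_right[OF L2_scaleR[OF eL] L2_scaleR[OF uL] dL] rip_scaleR_right)
  also have "\<dots> \<le> s * \<bar>rip d ?e\<bar> + \<bar>s - 1\<bar> * \<bar>rip d u\<bar>"
    using s3 by (intro add_mono mult_left_mono) (auto simp: abs_mult[symmetric])
  also have "\<dots> \<le> 3 * (9 * \<bar>t - 1\<bar> * ?X) + 3 * \<bar>t - 1\<bar> * (L2_norm d * L2_norm u)"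
    by (intro add_mono mult_mono s3 s1 pair rip_CS dL uL) auto
  finally show ?thesis by (simp add: algebra_simps)
qed

section \<open>The energy space\<close>

lemma Sigma_add:
  assumes u: "u \<in> Sigma_space" and v: "v \<in> Sigma_space"
  shows "(\<lambda>x. u x + v x) \<in> Sigma_space" "AE x in lborel. weak_grad (\<lambda>x. u x + v x) x = weak_grad u x + weak_grad v x"
proof -
  note W = weak_grad_eqI[OF L2_add[OF Sigma_L2[OF u] Sigma_L2[OF v]]
      is_weak_gradient_add[OF Sigma_L2[OF u] Sigma_L2[OF v] H1_weak_grad[OF Sigma_H1[OF u]] H1_weak_grad[OF Sigma_H1[OF v]]]]
  show "AE x in lborel. weak_grad (\<lambda>x. u x + v x) x = weak_grad u x + weak_grad v x" by (rule W(2))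
  show "(\<lambda>x. u x + v x) \<in> Sigma_space"
    using W(1) L2_add[OF Sigma_weight[OF u] Sigma_weight[OF v]] by (simp add: Sigma_space_def scaleR_add_right)
qed

lemma Sigma_scaleR:
  assumes u: "u \<in> Sigma_space"
  shows "(\<lambda>x. r *\<^sub>R u x) \<in> Sigma_space" "AE x in lborel. weak_grad (\<lambda>x. r *\<^sub>R u x) x = r *\<^sub>R weak_grad u x"
proof -
  note W = weak_grad_eqI[OF L2_scaleR[OF Sigma_L2[OF u]] is_weak_gradient_scaleR[OF H1_weak_grad[OF Sigma_H1[OF u]]]]
  show "AE x in lborel. weak_grad (\<lambda>x. r *\<^sub>R u x) x = r *\<^sub>R weak_grad u x" by (rule W(2))
  show "(\<lambda>x. r *\<^sub>R u x) \<in> Sigma_space"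
    using W(1) L2_scaleR[OF Sigma_weight[OF u], of r] by (simp add: Sigma_space_def mult.commute)
qed

lemma Sigma_diff:
  assumes u: "u \<in> Sigma_space" and v: "v \<in> Sigma_space"
  shows "(\<lambda>x. u x - v x) \<in> Sigma_space" "AE x in lborel. weak_grad (\<lambda>x. u x - v x) x = weak_grad u x - weak_grad v x"
proof -
  note V = Sigma_scaleR[OF v, of "-1"]
  show "(\<lambda>x. u x - v x) \<in> Sigma_space" using Sigma_add(1)[OF u V(1)] by simp
  have "AE x in lborel. weak_grad (\<lambda>x. u x - v x) x = weak_grad u x + weak_grad (\<lambda>x. (-1) *\<^sub>R v x) x"
    using Sigma_add(2)[OF u V(1)] by simp
  with V(2) show "AE x in lborel. weak_grad (\<lambda>x. u x - v x) x = weak_grad u x - weak_grad v x"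
    by eventually_elim simp
qed

text \<open>Gradient and scaled weight are packed into one function in \<open>L2\<close>. Half of
  its squared norm \<open>(pnorm a u)\<^sup>2\<close> is the quadratic part of the energy, so
  triangle inequality, polarisation and completeness are inherited from \<open>L2\<close>.\<close>

definition jet :: "real \<Rightarrow> (real^3 \<Rightarrow> complex) \<Rightarrow> real^3 \<Rightarrow> (complex^3) \<times> complex" where
  "jet a u x = (weak_grad u x, (a * norm x) *\<^sub>R u x)"

definition pnorm :: "real \<Rightarrow> (real^3 \<Rightarrow> complex) \<Rightarrow> real" where
  "pnorm a u = L2_norm (jet a u)"

lemma jet_L2:
  assumes u: "u \<in> Sigma_space"
  shows "jet a u \<in> L2"
proof (rule L2I)
  note gL = weak_grad_L2[OF Sigma_H1[OF u]] and w = L2_scaleR[OF Sigma_weight[OF u], of a]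
  note [measurable] = L2_measurable[OF gL] L2_measurable[OF Sigma_L2[OF u]]
  show "jet a u \<in> borel_measurable borel" unfolding jet_def[abs_def] by measurable
  show "integrable lborel (\<lambda>x. (norm (jet a u x))\<^sup>2)"
    using Bochner_Integration.integrable_add[OF L2_integrable[OF gL] L2_integrable[OF w]]
    by (simp add: jet_def norm_Pair abs_mult)
qed

lemma pnorm_sq:
  assumes u: "u \<in> Sigma_space"
  shows "(pnorm a u)\<^sup>2 = (L2_norm (weak_grad u))\<^sup>2 + a\<^sup>2 * (L2_norm (\<lambda>x. norm x *\<^sub>R u x))\<^sup>2"
proof -
  note gL = weak_grad_L2[OF Sigma_H1[OF u]] and w = L2_scaleR[OF Sigma_weight[OF u], of a]
  have "(pnorm a u)\<^sup>2 = (\<integral>x. (norm (weak_grad u x))\<^sup>2 + (norm (a *\<^sub>R norm x *\<^sub>R u x))\<^sup>2 \<partial>lborel)"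
    unfolding pnorm_def L2_norm_sq by (simp add: jet_def norm_Pair abs_mult)
  also have "\<dots> = (L2_norm (weak_grad u))\<^sup>2 + (L2_norm (\<lambda>x. a *\<^sub>R norm x *\<^sub>R u x))\<^sup>2"
    unfolding L2_norm_sq by (rule Bochner_Integration.integral_add[OF L2_integrable[OF gL] L2_integrable[OF w]])
  finally show ?thesis unfolding L2_norm_scaleR by (simp add: power_mult_distrib)
qed

lemma pnorm_nonneg [simp]: "0 \<le> pnorm a u" by (simp add: pnorm_def)

lemma jet_add:
  assumes u: "u \<in> Sigma_space" and v: "v \<in> Sigma_space"
  shows "AE x in lborel. jet a (\<lambda>x. u x + v x) x = jet a u x + jet a v x"
  using Sigma_add(2)[OF u v] by eventually_elim (simp add: jet_def scaleR_add_right)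

lemma jet_scaleR:
  assumes u: "u \<in> Sigma_space"
  shows "AE x in lborel. jet a (\<lambda>x. r *\<^sub>R u x) x = r *\<^sub>R jet a u x"
  using Sigma_scaleR(2)[OF u, of r] by eventually_elim (simp add: jet_def mult.commute)

lemma jet_diff:
  assumes u: "u \<in> Sigma_space" and v: "v \<in> Sigma_space"
  shows "AE x in lborel. jet a (\<lambda>x. u x - v x) x = jet a u x - jet a v x"
  using Sigma_diff(2)[OF u v] by eventually_elim (simp add: jet_def scaleR_diff_right)

lemma pnorm_add_eq:
  assumes u: "u \<in> Sigma_space" and v: "v \<in> Sigma_space"
  shows "pnorm a (\<lambda>x. u x + v x) = L2_norm (\<lambda>x. jet a u x + jet a v x)"
    "pnorm a (\<lambda>x. u x - v x) = L2_norm (\<lambda>x. jet a u x - jet a v x)"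
  unfolding pnorm_def
  by (intro L2_norm_cong_AE jet_add jet_diff u v L2_measurable jet_L2 Sigma_add Sigma_diff L2_add L2_diff)+

lemma pnorm_triangle:
  assumes u: "u \<in> Sigma_space" and v: "v \<in> Sigma_space"
  shows "pnorm a (\<lambda>x. u x + v x) \<le> pnorm a u + pnorm a v"
  unfolding pnorm_add_eq[OF u v] pnorm_def[of a u] pnorm_def[of a v] by (intro L2_norm_triangle jet_L2 u v)

lemma pnorm_scaleR:
  assumes u: "u \<in> Sigma_space"
  shows "pnorm a (\<lambda>x. r *\<^sub>R u x) = \<bar>r\<bar> * pnorm a u"
proof -
  have "pnorm a (\<lambda>x. r *\<^sub>R u x) = L2_norm (\<lambda>x. r *\<^sub>R jet a u x)"
    unfolding pnorm_def by (intro L2_norm_cong_AE jet_scaleR u L2_measurable jet_L2 Sigma_scaleR L2_scaleR)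
  then show ?thesis by (simp add: L2_norm_scaleR pnorm_def)
qed

lemma pnorm_abs_diff:
  assumes u: "u \<in> Sigma_space" and v: "v \<in> Sigma_space"
  shows "\<bar>pnorm a u - pnorm a v\<bar> \<le> pnorm a (\<lambda>x. u x - v x)"
  unfolding pnorm_add_eq[OF u v] pnorm_def[of a u] pnorm_def[of a v] by (intro L2_norm_abs_diff jet_L2 u v)

lemma pnorm_add_sq:
  assumes u: "u \<in> Sigma_space" and v: "v \<in> Sigma_space"
  shows "(pnorm a (\<lambda>x. u x + v x))\<^sup>2 = (pnorm a u)\<^sup>2 + 2 * rip (jet a u) (jet a v) + (pnorm a v)\<^sup>2"
    "(pnorm a (\<lambda>x. u x - v x))\<^sup>2 = (pnorm a u)\<^sup>2 - 2 * rip (jet a u) (jet a v) + (pnorm a v)\<^sup>2"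
  unfolding pnorm_add_eq[OF u v] pnorm_def[of a u] pnorm_def[of a v]
  by (intro L2_norm_add_sq L2_norm_diff_sq jet_L2 u v)+

section \<open>Comparison of the norms and completeness of the energy space\<close>

lemma Sigma_norm_nonneg [simp]: "0 \<le> Sigma_norm u" by (simp add: Sigma_norm_def)

lemma Sigma_norm_sq: "(Sigma_norm u)\<^sup>2 = (L2_norm u)\<^sup>2 + (L2_norm (weak_grad u))\<^sup>2 + (L2_norm (\<lambda>x. norm x *\<^sub>R u x))\<^sup>2"
  by (simp add: Sigma_norm_def)

lemma Sigma_norm_pnorm: "u \<in> Sigma_space \<Longrightarrow> (Sigma_norm u)\<^sup>2 = (L2_norm u)\<^sup>2 + (pnorm 1 u)\<^sup>2"
  by (simp add: Sigma_norm_sq pnorm_sq)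

lemma L2_norm_le_Sigma: "L2_norm u \<le> Sigma_norm u"
  by (rule power2_le_imp_le) (simp_all add: Sigma_norm_sq)

lemma pnorm_le_Sigma:
  assumes "u \<in> Sigma_space" "a > 0"
  shows "pnorm a u \<le> (1 + a) * Sigma_norm u"
proof (rule power2_le_imp_le)
  have "(pnorm a u)\<^sup>2 \<le> (1 + a)\<^sup>2 * (L2_norm (weak_grad u))\<^sup>2 + (1 + a)\<^sup>2 * (L2_norm (\<lambda>x. norm x *\<^sub>R u x))\<^sup>2"
  proof -
    have "1 \<le> (1 + a)\<^sup>2" "a\<^sup>2 \<le> (1 + a)\<^sup>2" using assms(2) by (auto intro: one_le_power power_mono)
    then show ?thesis
      unfolding pnorm_sq[OF assms(1)]
      using mult_right_mono[of 1 "(1 + a)\<^sup>2" "(L2_norm (weak_grad u))\<^sup>2"] by (intro add_mono mult_right_mono) auto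
  qed
  also have "\<dots> \<le> (1 + a)\<^sup>2 * (Sigma_norm u)\<^sup>2"
    unfolding ring_distribs[symmetric] by (intro mult_left_mono) (auto simp: Sigma_norm_sq)
  finally show "(pnorm a u)\<^sup>2 \<le> ((1 + a) * Sigma_norm u)\<^sup>2" by (simp add: power_mult_distrib)
qed (use assms in simp)

lemma Sigma_norm_le_pnorm:
  assumes "u \<in> Sigma_space" "a > 0"
  shows "Sigma_norm u \<le> L2_norm u + (1 + 1/a) * pnorm a u"
proof (rule power2_le_imp_le)
  have p1: "pnorm 1 u \<le> (1 + 1/a) * pnorm a u"
  proof (rule power2_le_imp_le)
    have "1 \<le> (1 + 1/a)\<^sup>2" using assms(2) by (intro one_le_power) simp
    have "1 \<le> (1 + 1/a)\<^sup>2 * a\<^sup>2"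
    proof -
      have "(1 + 1/a) * a = a + 1" using assms(2) by (simp add: field_simps)
      then have "(1 + 1/a)\<^sup>2 * a\<^sup>2 = (a + 1)\<^sup>2" by (simp add: power_mult_distrib[symmetric])
      then show ?thesis using assms(2) by (simp add: one_le_power)
    qed
    then have "1 * (L2_norm (\<lambda>x. norm x *\<^sub>R u x))\<^sup>2 \<le> ((1 + 1/a)\<^sup>2 * a\<^sup>2) * (L2_norm (\<lambda>x. norm x *\<^sub>R u x))\<^sup>2"
      by (intro mult_right_mono) auto
    moreover have "1 * (L2_norm (weak_grad u))\<^sup>2 \<le> (1 + 1/a)\<^sup>2 * (L2_norm (weak_grad u))\<^sup>2"
      using \<open>1 \<le> (1 + 1/a)\<^sup>2\<close> by (intro mult_right_mono) auto
    ultimately show "(pnorm 1 u)\<^sup>2 \<le> ((1 + 1/a) * pnorm a u)\<^sup>2"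
      unfolding power_mult_distrib unfolding pnorm_sq[OF assms(1)] distrib_left[of "(1 + 1/a)\<^sup>2"] by (simp add: mult.assoc)
  qed (use assms in simp)
  have "(Sigma_norm u)\<^sup>2 = (L2_norm u)\<^sup>2 + (pnorm 1 u)\<^sup>2" by (rule Sigma_norm_pnorm[OF assms(1)])
  also have "\<dots> \<le> (L2_norm u)\<^sup>2 + ((1 + 1/a) * pnorm a u)\<^sup>2" using p1 by (intro add_left_mono power_mono) auto
  also have "\<dots> \<le> (L2_norm u + (1 + 1/a) * pnorm a u)\<^sup>2"
    using assms(2) by (simp add: power2_sum)
  finally show "(Sigma_norm u)\<^sup>2 \<le> (L2_norm u + (1 + 1/a) * pnorm a u)\<^sup>2" .
qed (use assms in simp)

text \<open>The limit of the jets has to be recognised as the jet of the \<open>L2\<close> limit.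
  The gradient part is closed by \<open>is_weak_gradient_limit\<close>; the weight part is
  identified on balls, where multiplication by \<open>norm x\<close> is bounded.\<close>

theorem Sigma_complete:
  fixes u :: "nat \<Rightarrow> real^3 \<Rightarrow> complex"
  assumes u: "\<And>n. u n \<in> Sigma_space"
    and c: "\<And>e. e > 0 \<Longrightarrow> \<exists>N. \<forall>m\<ge>N. \<forall>n\<ge>N. L2_norm (\<lambda>x. u m x - u n x) < e"
    and p: "\<And>e. e > 0 \<Longrightarrow> \<exists>N. \<forall>m\<ge>N. \<forall>n\<ge>N. pnorm 1 (\<lambda>x. u m x - u n x) < e"
  obtains w where "w \<in> Sigma_space" "(\<lambda>n. L2_norm (\<lambda>x. u n x - w x)) \<longlonglongrightarrow> 0" "(\<lambda>n. pnorm 1 (\<lambda>x. u n x - w x)) \<longlonglongrightarrow> 0"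
proof -
  note uL = Sigma_L2[OF u]
  obtain w where w: "w \<in> L2" "(\<lambda>n. L2_norm (\<lambda>x. u n x - w x)) \<longlonglongrightarrow> 0" by (rule L2_complete[OF uL c])
  have "\<exists>N. \<forall>m\<ge>N. \<forall>n\<ge>N. L2_norm (\<lambda>x. jet 1 (u m) x - jet 1 (u n) x) < e" if "e > 0" for e
    using p[OF that] unfolding pnorm_add_eq[OF u u] .
  from L2_complete[OF jet_L2[OF u] this] obtain k where k: "k \<in> L2" "(\<lambda>n. L2_norm (\<lambda>x. jet 1 (u n) x - k x)) \<longlonglongrightarrow> 0" by blast
  note [measurable] = L2_measurable[OF w(1)] L2_measurable[OF k(1)] L2_measurable[OF uL]
  define h where "h x = fst (k x)" for x
  define z where "z x = snd (k x)" for x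
  have fs: "norm (fst q) \<le> norm q" "norm (snd q) \<le> norm q" for q :: "(complex^3) \<times> complex"
    using norm_fst_le[of "fst q" "snd q"] norm_snd_le[of "snd q" "fst q"] by simp_all
  have hm [measurable]: "h \<in> borel_measurable borel"
    unfolding h_def[abs_def]
    by (rule measurable_compose[OF L2_measurable[OF k(1)] borel_measurable_continuous_onI]) (intro continuous_intros)
  have zm [measurable]: "z \<in> borel_measurable borel"
    unfolding z_def[abs_def]
    by (rule measurable_compose[OF L2_measurable[OF k(1)] borel_measurable_continuous_onI]) (intro continuous_intros)
  have hz: "h \<in> L2" "z \<in> L2"
    using L2_norm_mono(1)[OF k(1) hm] L2_norm_mono(1)[OF k(1) zm] fs by (simp_all add: h_def z_def)
  have gL: "weak_grad (u n) \<in> L2" for n by (intro weak_grad_L2 Sigma_H1 u)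
  have hl: "(\<lambda>n. L2_norm (\<lambda>x. weak_grad (u n) x - h x)) \<longlonglongrightarrow> 0"
  proof (rule Lim_null_comparison[OF always_eventually k(2)], rule allI)
    fix n
    have "L2_norm (\<lambda>x. weak_grad (u n) x - h x) \<le> L2_norm (\<lambda>x. jet 1 (u n) x - k x)"
    proof (rule L2_norm_mono(2)[OF L2_diff[OF jet_L2[OF u] k(1)]])
      show "norm (weak_grad (u n) x - h x) \<le> norm (jet 1 (u n) x - k x)" for x
        using fs(1)[of "jet 1 (u n) x - k x"] by (simp add: jet_def h_def)
    qed (use L2_measurable[OF gL] in measurable)
    then show "norm (L2_norm (\<lambda>x. weak_grad (u n) x - h x)) \<le> L2_norm (\<lambda>x. jet 1 (u n) x - k x)" by simp
  qed
  have zl: "(\<lambda>n. L2_norm (\<lambda>x. norm x *\<^sub>R u n x - z x)) \<longlonglongrightarrow> 0"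
  proof (rule Lim_null_comparison[OF always_eventually k(2)], rule allI)
    fix n
    have "L2_norm (\<lambda>x. norm x *\<^sub>R u n x - z x) \<le> L2_norm (\<lambda>x. jet 1 (u n) x - k x)"
    proof (rule L2_norm_mono(2)[OF L2_diff[OF jet_L2[OF u] k(1)]])
      show "norm (norm x *\<^sub>R u n x - z x) \<le> norm (jet 1 (u n) x - k x)" for x
        using fs(2)[of "jet 1 (u n) x - k x"] by (simp add: jet_def z_def)
    qed measurable
    then show "norm (L2_norm (\<lambda>x. norm x *\<^sub>R u n x - z x)) \<le> L2_norm (\<lambda>x. jet 1 (u n) x - k x)" by simp
  qed
  have g: "is_weak_gradient w h"
    by (rule is_weak_gradient_limit[OF uL w H1_weak_grad[OF Sigma_H1[OF u]] hz(1) hl])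
  have zae: "AE x in lborel. z x = norm x *\<^sub>R w x"
  proof -
    have "AE x in lborel. indicator (cball 0 (real R)) x *\<^sub>R z x = indicator (cball 0 (real R)) x *\<^sub>R (norm x *\<^sub>R w x)" for R :: nat
    proof (rule L2_LIMSEQ_unique[where F="\<lambda>n x. indicator (cball 0 (real R)) x *\<^sub>R (norm x *\<^sub>R u n x)"])
      let ?I = "\<lambda>x::real^3. indicator (cball 0 (real R)) x :: real"
      have bd: "norm (?I x *\<^sub>R (norm x *\<^sub>R y)) \<le> real R * norm y" for x and y :: complex
        by (auto simp: mult_right_mono split: split_indicator)
      have mw: "(\<lambda>x. ?I x *\<^sub>R (norm x *\<^sub>R f x)) \<in> L2 \<and> L2_norm (\<lambda>x. ?I x *\<^sub>R (norm x *\<^sub>R f x)) \<le> real R * L2_norm f" if "f \<in> L2" for f :: "real^3 \<Rightarrow> complex"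
      proof -
        have m: "(\<lambda>x. ?I x *\<^sub>R (norm x *\<^sub>R f x)) \<in> borel_measurable borel" using L2_measurable[OF that] by measurable
        show ?thesis using L2_mono[OF that m AE_I2[OF bd]] by simp
      qed
      show "(\<lambda>x. ?I x *\<^sub>R (norm x *\<^sub>R u n x)) \<in> L2" for n using mw[OF uL] by blast
      show "(\<lambda>x. ?I x *\<^sub>R z x) \<in> L2" by (intro L2_truncate hz) simp
      show "(\<lambda>x. ?I x *\<^sub>R (norm x *\<^sub>R w x)) \<in> L2" using mw[OF w(1)] by blast
      show "(\<lambda>n. L2_norm (\<lambda>x. ?I x *\<^sub>R (norm x *\<^sub>R u n x) - ?I x *\<^sub>R z x)) \<longlonglongrightarrow> 0"
      proof (rule Lim_null_comparison[OF always_eventually zl], rule allI)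
        fix n
        show "norm (L2_norm (\<lambda>x. ?I x *\<^sub>R (norm x *\<^sub>R u n x) - ?I x *\<^sub>R z x)) \<le> L2_norm (\<lambda>x. norm x *\<^sub>R u n x - z x)"
          using L2_truncate(2)[OF L2_diff[OF Sigma_weight[OF u] hz(2)], of "cball 0 (real R)" n] by (simp add: scaleR_diff_right)
      qed
      show "(\<lambda>n. L2_norm (\<lambda>x. ?I x *\<^sub>R (norm x *\<^sub>R u n x) - ?I x *\<^sub>R (norm x *\<^sub>R w x))) \<longlonglongrightarrow> 0"
      proof (rule Lim_null_comparison[OF always_eventually tendsto_mult_right_zero[OF w(2), of "real R"]], rule allI)
        fix n
        show "norm (L2_norm (\<lambda>x. ?I x *\<^sub>R (norm x *\<^sub>R u n x) - ?I x *\<^sub>R (norm x *\<^sub>R w x))) \<le> real R * L2_norm (\<lambda>x. u n x - w x)"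
          using mw[OF L2_diff[OF uL w(1)], of n] by (simp add: scaleR_diff_right)
      qed
    qed
    then have "AE x in lborel. \<forall>R::nat. indicator (cball 0 (real R)) x *\<^sub>R z x = indicator (cball 0 (real R)) x *\<^sub>R (norm x *\<^sub>R w x)"
      by (simp add: AE_all_countable)
    then show ?thesis
    proof eventually_elim
      case (elim x)
      obtain R :: nat where "norm x \<le> real R" using real_arch_simple by blast
      then show ?case using elim[rule_format, of R] by simp
    qed
  qed
  have wW: "(\<lambda>x. norm x *\<^sub>R w x) \<in> L2"
    by (rule L2_cong_AE[OF hz(2)]) (use zae in auto)
  note W = weak_grad_eqI[OF w(1) g]
  have wS: "w \<in> Sigma_space" using W(1) wW by (simp add: Sigma_space_def)
  have "L2_norm (\<lambda>x. jet 1 (u n) x - k x) = pnorm 1 (\<lambda>x. u n x - w x)" for n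
    unfolding pnorm_add_eq[OF u wS]
  proof (intro L2_norm_cong_AE L2_measurable L2_diff jet_L2 u k wS)
    show "AE x in lborel. jet 1 (u n) x - k x = jet 1 (u n) x - jet 1 w x"
      using zae W(2) by eventually_elim (simp add: jet_def z_def h_def prod_eq_iff)
  qed
  then show ?thesis using that[OF wS w(2)] k(2) by simp
qed

section \<open>The energy functional\<close>

text \<open>The square of the norm of \<open>u\<close> in the Lebesgue space of exponent 4.\<close>

definition qn :: "(real^3 \<Rightarrow> complex) \<Rightarrow> real" where
  "qn u = L2_norm (particle_density u)"

definition nlin :: "real \<Rightarrow> real \<Rightarrow> (real^3 \<Rightarrow> complex) \<Rightarrow> real" where
  "nlin l1 l2 u = 1/2 * dform l1 l2 (particle_density u) (particle_density u)"

text \<open>The polarisation of \<open>particle_density\<close>, kept complex-valued so that it is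
  an argument of \<open>dform\<close>.\<close>

definition cross :: "(real^3 \<Rightarrow> complex) \<Rightarrow> (real^3 \<Rightarrow> complex) \<Rightarrow> real^3 \<Rightarrow> complex" where
  "cross u v x = complex_of_real (u x \<bullet> v x)"

lemma qn_nonneg [simp]: "0 \<le> qn u" by (simp add: qn_def)

lemma density_L2: "u \<in> Sigma_space \<Longrightarrow> particle_density u \<in> L2"
  using Gagliardo_Nirenberg(1) Sigma_H1 by blast

lemma energy_eq:
  assumes "u \<in> Sigma_space"
  shows "energy l1 l2 a u = 1/2 * (pnorm a u)\<^sup>2 + nlin l1 l2 u"
  unfolding energy_dform[OF density_L2[OF assms]] pnorm_sq[OF assms] nlin_def by (simp add: algebra_simps)

lemma grad_le_pnorm:
  assumes "u \<in> Sigma_space"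
  shows "L2_norm (weak_grad u) \<le> pnorm a u"
  by (rule power2_le_imp_le) (simp_all add: pnorm_sq[OF assms])

lemma weight_le_pnorm:
  assumes "u \<in> Sigma_space" "a > 0"
  shows "L2_norm (\<lambda>x. norm x *\<^sub>R u x) \<le> pnorm a u / a"
proof -
  have "a * L2_norm (\<lambda>x. norm x *\<^sub>R u x) \<le> pnorm a u"
    by (rule power2_le_imp_le) (simp_all add: pnorm_sq[OF assms(1)] power_mult_distrib)
  then show ?thesis using assms(2) by (simp add: pos_le_divide_eq mult.commute)
qed

lemma qn_sq_bound:
  assumes u: "u \<in> Sigma_space"
  shows "(qn u)\<^sup>2 \<le> gn_const * (pnorm a u)^3 * L2_norm u"
proof -
  have "(qn u)\<^sup>2 \<le> gn_const * (L2_norm (weak_grad u))^3 * L2_norm u"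
    unfolding qn_def by (rule Gagliardo_Nirenberg(2)[OF Sigma_H1[OF u]])
  also have "\<dots> \<le> gn_const * (pnorm a u)^3 * L2_norm u"
    using gn_const_pos by (intro mult_right_mono mult_left_mono power_mono grad_le_pnorm u) (auto simp: less_imp_le)
  finally show ?thesis .
qed

lemma qn_le_R:
  assumes u: "u \<in> Sigma_space" and "pnorm a u \<le> R" "L2_norm u \<le> R"
  shows "qn u \<le> sqrt gn_const * R\<^sup>2"
proof (rule power2_le_imp_le)
  have R: "R \<ge> 0" using assms(3) L2_norm_nonneg order_trans by blast
  have "(qn u)\<^sup>2 \<le> gn_const * (pnorm a u)^3 * L2_norm u" by (rule qn_sq_bound[OF u])
  also have "\<dots> \<le> gn_const * R^3 * R"
    using gn_const_pos R assms by (intro mult_mono mult_left_mono power_mono) (auto simp: less_imp_le)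
  also have "\<dots> = (sqrt gn_const * R\<^sup>2)\<^sup>2"
    using gn_const_pos by (simp add: power_mult_distrib less_imp_le power2_eq_square power3_eq_cube)
  finally show "(qn u)\<^sup>2 \<le> (sqrt gn_const * R\<^sup>2)\<^sup>2" .
qed (use gn_const_pos in \<open>simp add: less_imp_le\<close>)

text \<open>The constant of \<open>(L2_norm d)\<^sup>2\<close> comes from Young's inequality applied to
  \<open>gn_const * p\<^sup>3 * m \<le> (h * p\<^sup>2 + C * m\<^sup>2)\<^sup>2\<close>.\<close>

lemma qn_Young:
  assumes d: "d \<in> Sigma_space" and h: "h > 0"
  shows "qn d \<le> h * (pnorm a d)\<^sup>2 + gn_const\<^sup>2 / (8 * h^3) * (L2_norm d)\<^sup>2"
proof (rule power2_le_imp_le)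
  define p m G C where "p = pnorm a d" and "m = L2_norm d" and "G = gn_const" and "C = G\<^sup>2 / (8 * h^3)"
  have pos: "p \<ge> 0" "m \<ge> 0" "C \<ge> 0" using h by (auto simp: p_def m_def C_def)
  \<comment> \<open>Expanding this square bounds \<open>G * p^3 * m\<close> by two of the three
    terms of the target square; only \<open>C\<^sup>2 * m^4\<close> has to be added.\<close>
  have "0 \<le> (h * p\<^sup>2 - G / (2 * h) * (p * m))\<^sup>2" by simp
  also have "\<dots> = h\<^sup>2 * p^4 - G * p^3 * m + G\<^sup>2 / (4 * h\<^sup>2) * (p\<^sup>2 * m\<^sup>2)"
    using h by (simp add: power2_diff power_mult_distrib power_divide power2_eq_square power3_eq_cube power4_eq_xxxx field_simps)
  also have "G\<^sup>2 / (4 * h\<^sup>2) = 2 * h * C"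
    using h by (simp add: C_def power2_eq_square power3_eq_cube)
  finally have "G * p^3 * m \<le> h\<^sup>2 * p^4 + 2 * h * C * (p\<^sup>2 * m\<^sup>2)" by simp
  also have "\<dots> \<le> h\<^sup>2 * p^4 + 2 * h * C * (p\<^sup>2 * m\<^sup>2) + C\<^sup>2 * m^4" using pos by simp
  also have "\<dots> = (h * p\<^sup>2 + C * m\<^sup>2)\<^sup>2"
    by (simp add: power2_sum power_mult_distrib power2_eq_square power4_eq_xxxx algebra_simps)
  finally show "(qn d)\<^sup>2 \<le> (h * (pnorm a d)\<^sup>2 + gn_const\<^sup>2 / (8 * h^3) * (L2_norm d)\<^sup>2)\<^sup>2"
    using qn_sq_bound[OF d, of a] unfolding p_def m_def G_def C_def by linarith
qed (use h in simp)

lemma cross_L2: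
  assumes u: "u \<in> Sigma_space" and v: "v \<in> Sigma_space"
  shows "cross u v \<in> L2" "(L2_norm (cross u v))\<^sup>2 \<le> qn u * qn v"
proof -
  note [measurable] = L2_measurable[OF Sigma_L2[OF u]] L2_measurable[OF Sigma_L2[OF v]]
  note D = density_L2[OF u] density_L2[OF v]
  have m: "cross u v \<in> borel_measurable borel" unfolding cross_def[abs_def] by measurable
  have pt: "(norm (cross u v x))\<^sup>2 \<le> norm (particle_density u x) * norm (particle_density v x)" for x
  proof -
    have "\<bar>u x \<bullet> v x\<bar>\<^sup>2 \<le> (cmod (u x) * cmod (v x))\<^sup>2" by (intro power_mono Cauchy_Schwarz_ineq2) simp
    then show ?thesis by (simp add: cross_def particle_density_def power_mult_distrib norm_power)
  qed
  have i: "integrable lborel (\<lambda>x. norm (particle_density u x) * norm (particle_density v x))"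
    by (rule L2_mult_integrable[OF D])
  have j: "integrable lborel (\<lambda>x. (norm (cross u v x))\<^sup>2)"
    by (rule Bochner_Integration.integrable_bound[OF i]) (use m pt in auto)
  show "cross u v \<in> L2" using m j by (rule L2I)
  have "(L2_norm (cross u v))\<^sup>2 \<le> (\<integral>x. norm (particle_density u x) * norm (particle_density v x) \<partial>lborel)"
    unfolding L2_norm_sq by (intro integral_mono i j pt)
  also have "\<dots> \<le> qn u * qn v" unfolding qn_def by (rule L2_Cauchy_Schwarz[OF D])
  finally show "(L2_norm (cross u v))\<^sup>2 \<le> qn u * qn v" .
qed

lemma cross_norm:
  assumes u: "u \<in> Sigma_space" and v: "v \<in> Sigma_space"
  shows "L2_norm (cross u v) \<le> sqrt (qn u * qn v)"
  using cross_L2(2)[OF assms] by (intro real_le_rsqrt)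

lemma density_add: "particle_density (\<lambda>x. u x + v x) = (\<lambda>x. particle_density u x + (2 *\<^sub>R cross u v x + particle_density v x))"
proof
  fix x
  have "(cmod (u x + v x))\<^sup>2 = (cmod (u x))\<^sup>2 + (2 * (u x \<bullet> v x) + (cmod (v x))\<^sup>2)"
    by (simp add: power2_norm_eq_inner inner_add_left inner_add_right inner_commute)
  then show "particle_density (\<lambda>x. u x + v x) x = particle_density u x + (2 *\<^sub>R cross u v x + particle_density v x)"
    by (simp only: particle_density_def cross_def of_real_add of_real_mult scaleR_conv_of_real)
qed

lemma density_diff_cross: "(\<lambda>x. particle_density u x - particle_density v x) = cross (\<lambda>x. u x - v x) (\<lambda>x. u x + v x)"
proof
  fix x
  have "(cmod (u x))\<^sup>2 - (cmod (v x))\<^sup>2 = (u x - v x) \<bullet> (u x + v x)"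
    by (simp add: power2_norm_eq_inner inner_diff_left inner_add_right inner_diff_right inner_commute)
  then show "particle_density u x - particle_density v x = cross (\<lambda>x. u x - v x) (\<lambda>x. u x + v x) x"
    by (simp only: particle_density_def cross_def of_real_diff[symmetric])
qed

lemma density_scaleR: "particle_density (\<lambda>x. r *\<^sub>R u x) = (\<lambda>x. r\<^sup>2 *\<^sub>R particle_density u x)"
  unfolding particle_density_def norm_scaleR power_mult_distrib power2_abs of_real_mult
  by (simp add: scaleR_conv_of_real)

lemma qn_scaleR: "qn (\<lambda>x. r *\<^sub>R u x) = r\<^sup>2 * qn u"
  unfolding qn_def density_scaleR L2_norm_scaleR by simp

lemma nlin_scaleR:
  assumes "u \<in> Sigma_space"
  shows "nlin l1 l2 (\<lambda>x. r *\<^sub>R u x) = r^4 * nlin l1 l2 u"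
  unfolding nlin_def density_scaleR
  by (simp add: dform_scaleR_left dform_scaleR_right L2_scaleR density_L2[OF assms] power2_eq_square power4_eq_xxxx)

lemma nlin_bound:
  assumes "u \<in> Sigma_space"
  shows "\<bar>nlin l1 l2 u\<bar> \<le> 1/2 * (dbound l1 l2 * (qn u)\<^sup>2)"
  using dform_bound[OF density_L2[OF assms] density_L2[OF assms], of l1 l2]
  by (simp add: nlin_def qn_def power2_eq_square)

lemma qn_add_le:
  assumes u: "u \<in> Sigma_space" and v: "v \<in> Sigma_space"
  shows "qn (\<lambda>x. u x + v x) \<le> 2 * qn u + 2 * qn v"
proof -
  have "norm (particle_density (\<lambda>x. u x + v x) x) \<le> norm (2 *\<^sub>R particle_density u x + 2 *\<^sub>R particle_density v x)" for x
  proof -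
    have "(cmod (u x + v x))\<^sup>2 \<le> (cmod (u x) + cmod (v x))\<^sup>2" by (intro power_mono norm_triangle_ineq) simp
    also have "\<dots> \<le> 2 * (cmod (u x))\<^sup>2 + 2 * (cmod (v x))\<^sup>2"
      using zero_le_power2[of "cmod (u x) - cmod (v x)"] by (simp add: power2_sum power2_diff)
    also have "\<dots> = norm (complex_of_real (2 * (cmod (u x))\<^sup>2 + 2 * (cmod (v x))\<^sup>2))" unfolding norm_of_real by simp
    finally show ?thesis by (simp add: particle_density_def scaleR_conv_of_real norm_power)
  qed
  then have "qn (\<lambda>x. u x + v x) \<le> L2_norm (\<lambda>x. 2 *\<^sub>R particle_density u x + 2 *\<^sub>R particle_density v x)"
    unfolding qn_def
    by (intro L2_norm_mono(2) L2_add L2_scaleR density_L2 u v L2_measurable Sigma_add)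
  also have "\<dots> \<le> 2 * qn u + 2 * qn v"
    using L2_norm_triangle[OF L2_scaleR[OF density_L2[OF u], of 2] L2_scaleR[OF density_L2[OF v], of 2]]
    by (simp add: L2_norm_scaleR qn_def)
  finally show ?thesis .
qed

text \<open>The quadratic form in the density is differenced as a product, and the difference of the
  densities is the cross term of \<open>u - v\<close> and \<open>u + v\<close>. Gagliardo-Nirenberg
  for \<open>u - v\<close> contributes the fourth root of its \<open>L2\<close> norm; the fourth
  power on the left avoids roots. Hence on bounded sets of the energy space the interaction is
  continuous for convergence in \<open>L2\<close>.\<close>

lemma nlin_diff_bound:
  assumes u: "u \<in> Sigma_space" and v: "v \<in> Sigma_space"
    and R: "pnorm a u \<le> R" "pnorm a v \<le> R" "L2_norm u \<le> R" "L2_norm v \<le> R"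
  shows "(nlin l1 l2 u - nlin l1 l2 v)^4 \<le> (2^7 * (dbound l1 l2)^4 * gn_const^4 * R^15) * L2_norm (\<lambda>x. u x - v x)"
proof -
  note D = density_L2[OF u] density_L2[OF v]
  note S = Sigma_diff(1)[OF u v] Sigma_add(1)[OF u v]
  have R0: "R \<ge> 0" using R(3) L2_norm_nonneg order_trans by blast
  define b where "b = dbound l1 l2"
  define g where "g = sqrt gn_const"
  have g: "g \<ge> 0" "g\<^sup>2 = gn_const" using gn_const_pos by (auto simp: g_def less_imp_le)
  have b: "b \<ge> 0" by (simp add: b_def)
  let ?x = "\<lambda>x. particle_density u x - particle_density v x" and ?y = "\<lambda>x. particle_density u x + particle_density v x"
  have "dform l1 l2 ?x ?y = 2 * nlin l1 l2 u - 2 * nlin l1 l2 v"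
  proof -
    have "dform l1 l2 ?x ?y = dform l1 l2 (particle_density u) ?y + dform l1 l2 (\<lambda>x. (-1) *\<^sub>R particle_density v x) ?y"
      using dform_add_left[OF D(1) L2_scaleR[OF D(2), of "-1"] L2_add[OF D], of l1 l2] by simp
    also have "dform l1 l2 (\<lambda>x. (-1) *\<^sub>R particle_density v x) ?y = - dform l1 l2 (particle_density v) ?y"
      using dform_scaleR_left[OF D(2) L2_add[OF D], of l1 l2 "-1"] by simp
    finally show ?thesis
      by (simp add: dform_add_right[OF D(1) D] dform_add_right[OF D(2) D] nlin_def dform_commute[of _ _ "particle_density v" "particle_density u"])
  qed
  then have "2 * \<bar>nlin l1 l2 u - nlin l1 l2 v\<bar> = \<bar>dform l1 l2 ?x ?y\<bar>"
    by (simp only: right_diff_distrib[symmetric] abs_mult abs_numeral)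
  also have "\<dots> \<le> b * (L2_norm ?x * L2_norm ?y)" unfolding b_def by (intro dform_bound L2_diff L2_add D)
  finally have 1: "2 * \<bar>nlin l1 l2 u - nlin l1 l2 v\<bar> \<le> b * (L2_norm ?x * L2_norm ?y)" .
  have y: "L2_norm ?y \<le> 2 * (g * R\<^sup>2)"
    using L2_norm_triangle[OF D] qn_le_R[OF u R(1,3)] qn_le_R[OF v R(2,4)] by (simp add: qn_def g_def)
  define m where "m = L2_norm (\<lambda>x. u x - v x)"
  have pd: "pnorm a (\<lambda>x. u x - v x) \<le> 2 * R" "pnorm a (\<lambda>x. u x + v x) \<le> 2 * R" "L2_norm (\<lambda>x. u x + v x) \<le> 2 * R"
  proof -
    have "pnorm a (\<lambda>x. u x - v x) \<le> pnorm a u + pnorm a v"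
      unfolding pnorm_add_eq[OF u v] pnorm_def[of a u] pnorm_def[of a v] by (intro L2_norm_triangle_minus jet_L2 u v)
    then show "pnorm a (\<lambda>x. u x - v x) \<le> 2 * R" using R by simp
    show "pnorm a (\<lambda>x. u x + v x) \<le> 2 * R" using pnorm_triangle[OF u v, of a] R by simp
    show "L2_norm (\<lambda>x. u x + v x) \<le> 2 * R" using L2_norm_triangle[OF Sigma_L2[OF u] Sigma_L2[OF v]] R by simp
  qed
  have qd: "(qn (\<lambda>x. u x - v x))\<^sup>2 \<le> g\<^sup>2 * (2 * R)^3 * m"
  proof -
    have "(qn (\<lambda>x. u x - v x))\<^sup>2 \<le> gn_const * (pnorm a (\<lambda>x. u x - v x))^3 * m"
      unfolding m_def by (rule qn_sq_bound[OF S(1)])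
    also have "\<dots> \<le> gn_const * (2 * R)^3 * m"
      using gn_const_pos pd(1) by (intro mult_right_mono mult_left_mono power_mono) (auto simp: m_def less_imp_le)
    finally show ?thesis by (simp add: g)
  qed
  have qs: "qn (\<lambda>x. u x + v x) \<le> g * (2 * R)\<^sup>2"
    unfolding g_def by (rule qn_le_R[OF S(2) pd(2,3)])
  have "(L2_norm ?x)\<^sup>2 \<le> qn (\<lambda>x. u x - v x) * qn (\<lambda>x. u x + v x)"
    unfolding density_diff_cross by (rule cross_L2(2)[OF S])
  then have "((L2_norm ?x)\<^sup>2)\<^sup>2 \<le> (qn (\<lambda>x. u x - v x) * qn (\<lambda>x. u x + v x))\<^sup>2" by (intro power_mono) auto
  also have "\<dots> = (qn (\<lambda>x. u x - v x))\<^sup>2 * (qn (\<lambda>x. u x + v x))\<^sup>2" by (rule power_mult_distrib)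
  \<comment> \<open>Three of the seven factors \<open>2 * R\<close> come from Gagliardo-Nirenberg
    for the difference, four from the squared bound for the sum.\<close>
  also have "\<dots> \<le> (g\<^sup>2 * (2 * R)^3 * m) * (g * (2 * R)\<^sup>2)\<^sup>2"
    using qd qs R0 g gn_const_pos by (intro mult_mono power_mono mult_nonneg_nonneg) (simp_all add: m_def)
  also have "\<dots> = 2^7 * g^4 * R^7 * m" by algebra
  also have "((L2_norm ?x)\<^sup>2)\<^sup>2 = (L2_norm ?x)^4" by simp
  finally have x4: "(L2_norm ?x)^4 \<le> 2^7 * g^4 * R^7 * m" .
  have "(2 * \<bar>nlin l1 l2 u - nlin l1 l2 v\<bar>)^4 \<le> (b * (L2_norm ?x * (2 * (g * R\<^sup>2))))^4"
    using 1 y b by (intro power_mono order_trans[OF 1] mult_left_mono) auto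
  also have "\<dots> = (b^4 * 2^4 * g^4 * R^8) * (L2_norm ?x)^4"
    by (simp add: power_mult_distrib power_mult[symmetric])
  also have "\<dots> \<le> (b^4 * 2^4 * g^4 * R^8) * (2^7 * g^4 * R^7 * m)"
    using x4 b g R0 by (intro mult_left_mono) auto
  also have "\<dots> = 2^4 * ((2^7 * b^4 * (g\<^sup>2)^4 * R^15) * m)"
  proof -
    have eqs: "g^4 * g^4 = (g\<^sup>2)^4" "R^8 * R^7 = R^15" by (simp_all flip: power_add power_mult)
    have gen: "(b' * 2^4 * g' * r) * (2^7 * g' * r' * m) = 2^4 * ((2^7 * b' * (g' * g') * (r * r')) * m)" for b' g' r r' m :: real
      by (simp only: ac_simps)
    show ?thesis unfolding gen eqs by (rule refl)
  qed
  finally have "2^4 * (nlin l1 l2 u - nlin l1 l2 v)^4 \<le> 2^4 * ((2^7 * b^4 * (g\<^sup>2)^4 * R^15) * m)"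
    by (simp add: power_mult_distrib)
  then have "(nlin l1 l2 u - nlin l1 l2 v)^4 \<le> (2^7 * b^4 * (g\<^sup>2)^4 * R^15) * m" by (simp only: mult_le_cancel_left_pos zero_less_numeral zero_less_power)
  then show ?thesis by (simp only: g b_def m_def)
qed

section \<open>First variation of the energy\<close>

definition dE :: "real \<Rightarrow> real \<Rightarrow> real \<Rightarrow> (real^3 \<Rightarrow> complex) \<Rightarrow> (real^3 \<Rightarrow> complex) \<Rightarrow> real" where
  "dE l1 l2 a u d = rip (jet a u) (jet a d) + dform l1 l2 (particle_density u) (\<lambda>x. 2 *\<^sub>R cross u d x)"

text \<open>The term \<open>1/2 * (pnorm a d)\<^sup>2\<close> is kept exact instead of being put
  into the error, because the virial argument lives on its sign. The 5 is 1 from the pairing of the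
  two densities plus 4 from the squared cross term.\<close>

lemma energy_expand:
  assumes u: "u \<in> Sigma_space" and d: "d \<in> Sigma_space"
  shows "\<bar>energy l1 l2 a (\<lambda>x. u x + d x) - energy l1 l2 a u - dE l1 l2 a u d - 1/2 * (pnorm a d)\<^sup>2\<bar>
    \<le> dbound l1 l2 * (5 * qn u * qn d + (qn d)\<^sup>2)"
proof -
  let ?r = "particle_density u" and ?c = "\<lambda>x. 2 *\<^sub>R cross u d x" and ?e = "particle_density d"
  let ?s = "\<lambda>x. ?c x + ?e x"
  have r: "?r \<in> L2" and e: "?e \<in> L2" by (intro density_L2 u d)+
  have c: "?c \<in> L2" by (intro L2_scaleR cross_L2 u d)
  have s: "?s \<in> L2" by (intro L2_add c e)
  have "2 * nlin l1 l2 (\<lambda>x. u x + d x) = dform l1 l2 ?r ?r + 2 * dform l1 l2 ?r ?s + dform l1 l2 ?s ?s"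
    unfolding nlin_def density_add
    by (simp add: dform_add_left[OF r s L2_add[OF r s]] dform_add_right[OF r r s] dform_add_right[OF s r s] dform_commute[of _ _ ?s ?r])
  also have "dform l1 l2 ?r ?s = dform l1 l2 ?r ?c + dform l1 l2 ?r ?e" by (rule dform_add_right[OF r c e])
  finally have N: "nlin l1 l2 (\<lambda>x. u x + d x) = nlin l1 l2 u + dform l1 l2 ?r ?c + (dform l1 l2 ?r ?e + 1/2 * dform l1 l2 ?s ?s)"
    by (simp add: nlin_def)
  have gen: "1/2 * (p + 2 * r + q) + (n + f + z) - (1/2 * p + n) - (r + f) - 1/2 * q = z" for p q r n f z :: real
    by (simp add: algebra_simps)
  have gen2: "\<bar>y + 1/2 * z\<bar> \<le> \<bar>y\<bar> + 1/2 * \<bar>z\<bar>" for y z :: real by linarith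
  have eq: "energy l1 l2 a (\<lambda>x. u x + d x) - energy l1 l2 a u - dE l1 l2 a u d - 1/2 * (pnorm a d)\<^sup>2
     = dform l1 l2 ?r ?e + 1/2 * dform l1 l2 ?s ?s"
    unfolding energy_eq[OF u] energy_eq[OF Sigma_add(1)[OF u d]] pnorm_add_sq(1)[OF u d] N dE_def by (rule gen)
  have "\<bar>energy l1 l2 a (\<lambda>x. u x + d x) - energy l1 l2 a u - dE l1 l2 a u d - 1/2 * (pnorm a d)\<^sup>2\<bar>
      \<le> \<bar>dform l1 l2 ?r ?e\<bar> + 1/2 * \<bar>dform l1 l2 ?s ?s\<bar>" unfolding eq by (rule gen2)
  also have "\<dots> \<le> dbound l1 l2 * (qn u * qn d) + 1/2 * (dbound l1 l2 * (L2_norm ?s)\<^sup>2)"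
    using add_mono[OF dform_bound[OF r e, of l1 l2] mult_left_mono[OF dform_bound[OF s s, of l1 l2], of "1/2"]]
    by (simp only: qn_def power2_eq_square zero_le_divide_1_iff zero_le_numeral simp_thms)
  finally have 1: "\<bar>energy l1 l2 a (\<lambda>x. u x + d x) - energy l1 l2 a u - dE l1 l2 a u d - 1/2 * (pnorm a d)\<^sup>2\<bar>
    \<le> dbound l1 l2 * (qn u * qn d) + 1/2 * (dbound l1 l2 * (L2_norm ?s)\<^sup>2)" .
  have "(L2_norm ?s)\<^sup>2 \<le> 8 * (qn u * qn d) + 2 * (qn d)\<^sup>2"
  proof -
    have "L2_norm ?s \<le> 2 * L2_norm (cross u d) + qn d"
      using L2_norm_triangle[OF c e] by (simp add: L2_norm_scaleR qn_def)
    then have "(L2_norm ?s)\<^sup>2 \<le> (2 * L2_norm (cross u d) + qn d)\<^sup>2" by (intro power_mono) auto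
    also have "\<dots> \<le> 2 * (2 * L2_norm (cross u d))\<^sup>2 + 2 * (qn d)\<^sup>2"
      using zero_le_power2[of "2 * L2_norm (cross u d) - qn d"] by (simp add: power2_sum power2_diff)
    also have "\<dots> \<le> 8 * (qn u * qn d) + 2 * (qn d)\<^sup>2" using cross_L2(2)[OF u d] by (simp add: power_mult_distrib)
    finally show ?thesis .
  qed
  then have "dbound l1 l2 * (qn u * qn d) + 1/2 * (dbound l1 l2 * (L2_norm ?s)\<^sup>2)
      \<le> dbound l1 l2 * (qn u * qn d) + 1/2 * (dbound l1 l2 * (8 * (qn u * qn d) + 2 * (qn d)\<^sup>2))"
    by (rule add_left_mono[OF mult_left_mono[OF mult_left_mono]]) simp_all
  also have "\<dots> = dbound l1 l2 * (5 * qn u * qn d + (qn d)\<^sup>2)" by (simp add: algebra_simps)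
  finally show ?thesis using 1 by (rule order_trans[rotated])
qed

lemma dE_add:
  assumes u: "u \<in> Sigma_space" and v: "v \<in> Sigma_space" and w: "w \<in> Sigma_space"
  shows "dE l1 l2 a u (\<lambda>x. v x + w x) = dE l1 l2 a u v + dE l1 l2 a u w"
proof -
  have "rip (jet a u) (jet a (\<lambda>x. v x + w x)) = rip (jet a u) (\<lambda>x. jet a v x + jet a w x)"
    by (intro rip_cong_AE jet_L2 Sigma_add L2_add jet_add u v w) simp
  also have "\<dots> = rip (jet a u) (jet a v) + rip (jet a u) (jet a w)" by (intro rip_add_right jet_L2 u v w)
  moreover have "(\<lambda>x. 2 *\<^sub>R cross u (\<lambda>x. v x + w x) x) = (\<lambda>x. 2 *\<^sub>R cross u v x + 2 *\<^sub>R cross u w x)"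
    by (auto simp: cross_def inner_add_right scaleR_add_right)
  ultimately show ?thesis
    unfolding dE_def by (simp add: dform_add_right density_L2 u v w L2_scaleR cross_L2)
qed

lemma dE_scaleR:
  assumes u: "u \<in> Sigma_space" and v: "v \<in> Sigma_space"
  shows "dE l1 l2 a u (\<lambda>x. r *\<^sub>R v x) = r * dE l1 l2 a u v"
proof -
  have "rip (jet a u) (jet a (\<lambda>x. r *\<^sub>R v x)) = rip (jet a u) (\<lambda>x. r *\<^sub>R jet a v x)"
    by (intro rip_cong_AE jet_L2 Sigma_scaleR L2_scaleR jet_scaleR u v) simp
  moreover have "(\<lambda>x. 2 *\<^sub>R cross u (\<lambda>x. r *\<^sub>R v x) x) = (\<lambda>x. r *\<^sub>R (2 *\<^sub>R cross u v x))"
    unfolding cross_def inner_scaleR_right by (simp add: scaleR_conv_of_real mult.left_commute)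
  ultimately show ?thesis
    unfolding dE_def by (simp only: rip_scaleR_right dform_scaleR_right[OF density_L2[OF u] L2_scaleR[OF cross_L2(1)[OF u v]]] ring_distribs)
qed

lemma qn_le_Sigma:
  assumes d: "d \<in> Sigma_space"
  shows "qn d \<le> sqrt gn_const * (2 * Sigma_norm d)\<^sup>2"
  using qn_le_R[OF d, of 1 "2 * Sigma_norm d"] pnorm_le_Sigma[OF d, of 1] L2_norm_le_Sigma[of d] Sigma_norm_nonneg[of d] by simp

lemma energy_has_derivative:
  assumes u: "u \<in> Sigma_space" and a: "a > 0"
  shows "has_Sigma_derivative (energy l1 l2 a) (dE l1 l2 a u) u"
  unfolding has_Sigma_derivative_def
proof (intro conjI ballI allI impI)
  define b where "b = dbound l1 l2"
  define g where "g = sqrt gn_const"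
  have b: "b \<ge> 0" and g: "g \<ge> 0" using gn_const_pos by (auto simp: b_def g_def less_imp_le)
  show "dE l1 l2 a u (\<lambda>x. v x + w x) = dE l1 l2 a u v + dE l1 l2 a u w" if "v \<in> Sigma_space" "w \<in> Sigma_space" for v w
    using that by (intro dE_add u)
  show "dE l1 l2 a u (\<lambda>x. r *\<^sub>R v x) = r * dE l1 l2 a u v" if "v \<in> Sigma_space" for v r
    using that by (intro dE_scaleR u)
  show "\<exists>C. \<forall>v\<in>Sigma_space. \<bar>dE l1 l2 a u v\<bar> \<le> C * Sigma_norm v"
  proof (intro exI ballI)
    fix v assume v: "v \<in> Sigma_space"
    have sq: "sqrt (qn u * qn v) \<le> sqrt (qn u * g) * (2 * Sigma_norm v)"
    proof -
      have "qn u * qn v \<le> (qn u * g) * (2 * Sigma_norm v)\<^sup>2"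
        using mult_left_mono[OF qn_le_Sigma[OF v], of "qn u"] by (simp add: g_def mult.assoc)
      then have "sqrt (qn u * qn v) \<le> sqrt ((qn u * g) * (2 * Sigma_norm v)\<^sup>2)" by simp
      then show ?thesis by (simp add: real_sqrt_mult)
    qed
    have "\<bar>dE l1 l2 a u v\<bar> \<le> \<bar>rip (jet a u) (jet a v)\<bar> + \<bar>dform l1 l2 (particle_density u) (\<lambda>x. 2 *\<^sub>R cross u v x)\<bar>"
      unfolding dE_def by (rule abs_triangle_ineq)
    also have "\<dots> \<le> pnorm a u * pnorm a v + b * (qn u * (2 * L2_norm (cross u v)))"
      using dform_bound[OF density_L2[OF u] L2_scaleR[OF cross_L2(1)[OF u v]], of l1 l2 2] rip_CS[OF jet_L2[OF u] jet_L2[OF v]]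
      by (intro add_mono) (simp_all add: pnorm_def b_def qn_def L2_norm_scaleR)
    also have "\<dots> \<le> pnorm a u * ((1 + a) * Sigma_norm v) + b * (qn u * (2 * (sqrt (qn u * g) * (2 * Sigma_norm v))))"
      using cross_norm[OF u v] sq b by (intro add_mono mult_left_mono pnorm_le_Sigma v a) auto
    also have "\<dots> = (pnorm a u * (1 + a) + b * qn u * 4 * sqrt (qn u * g)) * Sigma_norm v" by (simp add: algebra_simps)
    finally show "\<bar>dE l1 l2 a u v\<bar> \<le> (pnorm a u * (1 + a) + b * qn u * 4 * sqrt (qn u * g)) * Sigma_norm v" .
  qed
  fix \<epsilon> :: real assume e: "\<epsilon> > 0"
  \<comment> \<open>As long as the norm of \<open>v\<close> is at most 1, the quartic remainder is
    dominated by the quadratic one, and \<open>K\<close> collects both.\<close>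
  define K where "K = (1 + a)\<^sup>2 / 2 + b * (20 * qn u * g + 16 * g\<^sup>2)"
  have K: "K \<ge> 0" using a b g by (simp add: K_def)
  show "\<exists>\<delta>>0. \<forall>v\<in>Sigma_space. Sigma_norm v < \<delta> \<longrightarrow> \<bar>energy l1 l2 a (\<lambda>x. u x + v x) - energy l1 l2 a u - dE l1 l2 a u v\<bar> \<le> \<epsilon> * Sigma_norm v"
  proof (intro exI[of _ "min 1 (\<epsilon> / (K + 1))"] conjI ballI impI)
    show "0 < min 1 (\<epsilon> / (K + 1))" using e K by simp
    fix v assume v: "v \<in> Sigma_space" and "Sigma_norm v < min 1 (\<epsilon> / (K + 1))"
    define s where "s = Sigma_norm v"
    have s: "0 \<le> s" "s \<le> 1" "s * (K + 1) \<le> \<epsilon>"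
      using \<open>Sigma_norm v < _\<close> K by (auto simp: s_def pos_less_divide_eq less_imp_le)
    have q: "qn v \<le> 4 * g * s\<^sup>2" using qn_le_Sigma[OF v] by (simp add: g_def s_def power_mult_distrib)
    have s4: "s\<^sup>2 * s\<^sup>2 \<le> s\<^sup>2 * 1" using s by (intro mult_left_mono power_le_one) auto
    have q2: "(qn v)\<^sup>2 \<le> 16 * g\<^sup>2 * s\<^sup>2"
    proof -
      have "(qn v)\<^sup>2 \<le> (4 * g * s\<^sup>2)\<^sup>2" using q by (intro power_mono) auto
      also have "\<dots> = 16 * g\<^sup>2 * (s\<^sup>2 * s\<^sup>2)" by (simp add: power_mult_distrib power2_eq_square)
      also have "\<dots> \<le> 16 * g\<^sup>2 * (s\<^sup>2 * 1)" by (intro mult_left_mono s4) simp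
      finally show ?thesis by simp
    qed
    have p2: "(pnorm a v)\<^sup>2 \<le> (1 + a)\<^sup>2 * s\<^sup>2"
      using power_mono[OF pnorm_le_Sigma[OF v a], of 2] by (simp add: s_def power_mult_distrib)
    have "\<bar>energy l1 l2 a (\<lambda>x. u x + v x) - energy l1 l2 a u - dE l1 l2 a u v\<bar> \<le> 1/2 * (pnorm a v)\<^sup>2 + b * (5 * qn u * qn v + (qn v)\<^sup>2)"
      using energy_expand[OF u v, of l1 l2 a] zero_le_power2[of "pnorm a v"] unfolding b_def by linarith
    also have "\<dots> \<le> 1/2 * ((1 + a)\<^sup>2 * s\<^sup>2) + b * (5 * qn u * (4 * g * s\<^sup>2) + 16 * g\<^sup>2 * s\<^sup>2)"
      using b by (intro add_mono mult_left_mono p2 q q2) auto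
    also have "\<dots> = K * s * s" by (simp add: K_def power2_eq_square algebra_simps)
    also have "\<dots> \<le> \<epsilon> * s" using s by (intro mult_right_mono) (auto simp: algebra_simps)
    finally show "\<bar>energy l1 l2 a (\<lambda>x. u x + v x) - energy l1 l2 a u - dE l1 l2 a u v\<bar> \<le> \<epsilon> * Sigma_norm v" by (simp add: s_def)
  qed
qed

section \<open>Critical points and the Lagrange multiplier\<close>

lemma Sigma_norm_scaleR:
  assumes "v \<in> Sigma_space"
  shows "Sigma_norm (\<lambda>x. r *\<^sub>R v x) = \<bar>r\<bar> * Sigma_norm v"
proof -
  have "(Sigma_norm (\<lambda>x. r *\<^sub>R v x))\<^sup>2 = (\<bar>r\<bar> * Sigma_norm v)\<^sup>2"
    unfolding Sigma_norm_pnorm[OF Sigma_scaleR(1)[OF assms]] power_mult_distrib Sigma_norm_pnorm[OF assms]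
    by (simp add: L2_norm_scaleR pnorm_scaleR[OF assms] power_mult_distrib ring_distribs)
  then show ?thesis by (subst (asm) power2_eq_iff_nonneg) auto
qed

text \<open>The definition of \<open>critical_points\<close> only asserts some derivative. Comparing
  two of them on short multiples of \<open>v\<close> identifies it with the explicit
  \<open>dE\<close>.\<close>

lemma Sigma_derivative_unique:
  assumes D: "has_Sigma_derivative J D u" and D': "has_Sigma_derivative J D' u" and v: "v \<in> Sigma_space"
  shows "D v = D' v"
proof (rule ccontr)
  assume ne: "D v \<noteq> D' v"
  \<comment> \<open>With this choice the two error terms together amount to at most half of the
    supposed difference; the added 1 covers a \<open>v\<close> of norm zero.\<close>
  define e where "e = \<bar>D v - D' v\<bar> / (4 * (Sigma_norm v + 1))"
  have s: "Sigma_norm v + 1 > 0" using Sigma_norm_nonneg[of v] by linarith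
  have e: "e > 0" using ne s by (simp add: e_def)
  from D have "\<forall>\<epsilon>>0. \<exists>\<delta>>0. \<forall>w\<in>Sigma_space. Sigma_norm w < \<delta> \<longrightarrow> \<bar>J (\<lambda>x. u x + w x) - J u - D w\<bar> \<le> \<epsilon> * Sigma_norm w"
    unfolding has_Sigma_derivative_def by (elim conjE)
  from this[rule_format, OF e] obtain d1 where d1: "d1 > 0" "\<And>w. w \<in> Sigma_space \<Longrightarrow> Sigma_norm w < d1 \<Longrightarrow> \<bar>J (\<lambda>x. u x + w x) - J u - D w\<bar> \<le> e * Sigma_norm w"
    by blast
  from D' have "\<forall>\<epsilon>>0. \<exists>\<delta>>0. \<forall>w\<in>Sigma_space. Sigma_norm w < \<delta> \<longrightarrow> \<bar>J (\<lambda>x. u x + w x) - J u - D' w\<bar> \<le> \<epsilon> * Sigma_norm w"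
    unfolding has_Sigma_derivative_def by (elim conjE)
  from this[rule_format, OF e] obtain d2 where d2: "d2 > 0" "\<And>w. w \<in> Sigma_space \<Longrightarrow> Sigma_norm w < d2 \<Longrightarrow> \<bar>J (\<lambda>x. u x + w x) - J u - D' w\<bar> \<le> e * Sigma_norm w"
    by blast
  define r where "r = min d1 d2 / (2 * (Sigma_norm v + 1))"
  have r: "r > 0" using d1(1) d2(1) s by (simp add: r_def)
  let ?w = "\<lambda>x. r *\<^sub>R v x"
  have w: "?w \<in> Sigma_space" by (rule Sigma_scaleR(1)[OF v])
  have wn: "Sigma_norm ?w = r * Sigma_norm v" using r by (simp add: Sigma_norm_scaleR[OF v])
  have "r * (Sigma_norm v + 1) = min d1 d2 / 2"
  proof -
    have "x / (2 * y) * y = x / 2" if "y > 0" for x y :: real using that by simp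
    from this[OF s] show ?thesis unfolding r_def .
  qed
  then have "r * Sigma_norm v < min d1 d2" using r d1(1) d2(1) by (simp add: ring_distribs min_def split: if_splits)
  then have b: "\<bar>J (\<lambda>x. u x + ?w x) - J u - D ?w\<bar> \<le> e * Sigma_norm ?w" "\<bar>J (\<lambda>x. u x + ?w x) - J u - D' ?w\<bar> \<le> e * Sigma_norm ?w"
    using d1(2)[OF w] d2(2)[OF w] wn by auto
  have hom: "D ?w = r * D v" "D' ?w = r * D' v"
    using D[unfolded has_Sigma_derivative_def, THEN conjunct2, THEN conjunct1, rule_format, OF v, of r]
      D'[unfolded has_Sigma_derivative_def, THEN conjunct2, THEN conjunct1, rule_format, OF v, of r] by simp_all
  have "\<bar>y - z\<bar> \<le> 2 * s" if "\<bar>p - y\<bar> \<le> s" "\<bar>p - z\<bar> \<le> s" for p y z s :: real using that by linarith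
  from this[OF b] have "\<bar>D ?w - D' ?w\<bar> \<le> 2 * (e * Sigma_norm ?w)" .
  then have "r * \<bar>D v - D' v\<bar> \<le> r * (2 * (e * Sigma_norm v))"
    using r unfolding hom wn by (simp add: right_diff_distrib[symmetric] abs_mult mult.left_commute)
  then have "\<bar>D v - D' v\<bar> \<le> 2 * (e * Sigma_norm v)" using r by simp
  also have "\<dots> \<le> 2 * (e * (Sigma_norm v + 1))" using e by simp
  also have "\<dots> = \<bar>D v - D' v\<bar> / 2"
  proof -
    have "2 * (x / (4 * y) * y) = x / 2" if "y > 0" for x y :: real using that by simp
    from this[OF s] show ?thesis unfolding e_def .
  qed
  finally show False using ne by simp
qed

text \<open>Subtracting from \<open>v\<close> its component along \<open>u\<close> produces a
  tangent vector, on which the derivative vanishes.\<close>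

lemma critical_multiplier:
  assumes c: "c > 0" and a: "a > 0" and u: "u \<in> critical_points (energy l1 l2 a) c"
  obtains \<mu> where "\<And>v. v \<in> Sigma_space \<Longrightarrow> dE l1 l2 a u v = \<mu> * rip v u"
proof -
  have uS: "u \<in> Sigma_space" "(L2_norm u)\<^sup>2 = c" using u by (auto simp: critical_points_def mass_sphere_def)
  obtain D where D: "has_Sigma_derivative (energy l1 l2 a) D u" and t: "\<And>v. v \<in> Sigma_space \<Longrightarrow> Re (\<integral>x. v x * cnj (u x) \<partial>lborel) = 0 \<Longrightarrow> D v = 0"
    using u unfolding critical_points_def by blast
  have eq: "dE l1 l2 a u v = D v" if "v \<in> Sigma_space" for v
    by (rule Sigma_derivative_unique[OF energy_has_derivative[OF uS(1) a] D that])
  show ?thesis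
  proof (rule that[of "dE l1 l2 a u u / c"])
    fix v assume v: "v \<in> Sigma_space"
    define r where "r = rip v u / c"
    let ?w = "\<lambda>x. v x + (- r) *\<^sub>R u x"
    have w: "?w \<in> Sigma_space" by (intro Sigma_add Sigma_scaleR v uS)
    have "rip ?w u = rip v u + (- r) * rip u u"
      using rip_add_left[OF Sigma_L2[OF v] L2_scaleR[OF Sigma_L2[OF uS(1)], of "- r"] Sigma_L2[OF uS(1)]] by (simp only: rip_scaleR_left)
    also have "\<dots> = 0" using c by (simp add: rip_self uS r_def)
    finally have "Re (\<integral>x. ?w x * cnj (u x) \<partial>lborel) = 0" using rip_eq_Re[OF Sigma_L2[OF w] Sigma_L2[OF uS(1)]] by simp
    then have "dE l1 l2 a u ?w = 0" using t[OF w] eq[OF w] by simp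
    then have "dE l1 l2 a u v + (- r) * dE l1 l2 a u u = 0"
      using dE_add[OF uS(1) v Sigma_scaleR(1)[OF uS(1), of "- r"], of l1 l2 a] dE_scaleR[OF uS(1) uS(1), of l1 l2 a "- r"] by simp
    then show "dE l1 l2 a u v = dE l1 l2 a u u / c * rip v u" by (simp add: r_def)
  qed
qed

section \<open>The energy along dilations and the virial identity\<close>

lemma energy_dilate:
  assumes u: "u \<in> Sigma_space" and t: "t > 0"
  shows "energy l1 l2 a (dilate t u) = t\<^sup>2 * (1/2 * (L2_norm (weak_grad u))\<^sup>2) + (1/t)\<^sup>2 * (a\<^sup>2 / 2 * (L2_norm (\<lambda>x. norm x *\<^sub>R u x))\<^sup>2) + t^3 * nlin l1 l2 u"
proof -
  note S = dilate_Sigma[OF u t] and D = density_L2[OF u]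
  have Dt: "(\<lambda>x. particle_density u (t *\<^sub>R x)) \<in> L2" using L2_scale_shift(1)[OF D t, of 0] by simp
  have "nlin l1 l2 (dilate t u) = 1/2 * (t^3 * (t^3 * ((1/t^3) * dform l1 l2 (particle_density u) (particle_density u))))"
    unfolding nlin_def S(4) by (simp add: dform_scaleR_left dform_scaleR_right L2_scaleR Dt dform_scale[OF D D t])
  also have "\<dots> = t^3 * nlin l1 l2 u" using t by (simp add: nlin_def)
  finally show ?thesis
    unfolding energy_eq[OF S(1)] pnorm_sq[OF S(1)] S(2,3) power_mult_distrib by (simp add: algebra_simps)
qed

lemma qn_dilate:
  assumes u: "u \<in> Sigma_space" and t: "1/2 \<le> t" "t \<le> 2"
  shows "qn (dilate t u) \<le> 3 * qn u"
proof -
  have t0: "t > 0" using t by simp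
  have "qn (dilate t u) = t^3 * (t powr (-3/2) * qn u)"
    unfolding qn_def dilate_Sigma(4)[OF u t0] L2_norm_scaleR
    using L2_scale_shift(2)[OF density_L2[OF u] t0, of 0] t0 by simp
  also have "\<dots> = (t * sqrt t) * qn u"
  proof -
    have "t * t * t = (t * sqrt t) * (t * sqrt t)" using t0 by simp
    then show ?thesis unfolding sqrt_cube_powr[OF t0] using t0 by (simp add: power3_eq_cube field_simps)
  qed
  also have "\<dots> \<le> 3 * qn u"
  proof (rule mult_right_mono)
    have "sqrt t \<le> 3/2" using t by (intro real_le_lsqrt) (auto simp: power2_eq_square)
    then show "t * sqrt t \<le> 3" using mult_mono[of t 2 "sqrt t" "3/2"] t by simp
  qed simp
  finally show ?thesis .
qed

text \<open>If \<open>z\<close> exceeded the bound it would exceed \<open>\<tau>\<close>, so one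
  factor \<open>\<tau>\<close> in the first term could be replaced by \<open>z\<close> and a factor
  \<open>z\<close> cancelled. This closes estimates in which the unknown occurs on both
  sides.\<close>

lemma quadratic_absorb:
  fixes z :: real
  assumes "z\<^sup>2 \<le> X * \<tau>\<^sup>2 + Y * \<tau> * z" "0 \<le> z" "0 \<le> \<tau>" "0 \<le> X" "0 \<le> Y"
  shows "z \<le> (X + Y + 1) * \<tau>"
proof (rule ccontr)
  assume "\<not> z \<le> (X + Y + 1) * \<tau>"
  then have z: "z > (X + Y + 1) * \<tau>" by simp
  moreover have "(X + Y + 1) * \<tau> \<ge> 1 * \<tau>" using assms by (intro mult_right_mono) auto
  ultimately have zt: "z > \<tau>" by simp
  have "X * \<tau>\<^sup>2 \<le> X * \<tau> * z" using zt assms by (simp add: power2_eq_square mult_left_mono mult.assoc)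
  then have "z\<^sup>2 \<le> (X + Y) * \<tau> * z" using assms(1) by (simp add: algebra_simps)
  moreover have "(X + Y) * \<tau> * z < z * z"
  proof (rule mult_strict_right_mono)
    show "(X + Y) * \<tau> < z" using z assms by (simp add: algebra_simps)
    show "0 < z" using zt assms by simp
  qed
  ultimately show False by (simp add: power2_eq_square)
qed

text \<open>The virial identity without regularity theory. Adding the expansions of the energy along
  \<open>dilate t u\<close> and \<open>dilate (1/t) u\<close> cancels the first variation and controls \<open>pnorm a d\<close> by
  \<open>L2_norm d\<close>, while \<open>dilate_difference_bound\<close> controls \<open>(L2_norm d)\<^sup>2\<close> by \<open>\<bar>t - 1\<bar>\<close> times
  the norm of \<open>d\<close> itself; together \<open>d = O(\<bar>t - 1\<bar>)\<close>.\<close>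

theorem virial_identity:
  assumes c: "c > 0" and a: "a > 0" and u: "u \<in> critical_points (energy l1 l2 a) c"
  shows "(L2_norm (weak_grad u))\<^sup>2 - a\<^sup>2 * (L2_norm (\<lambda>x. norm x *\<^sub>R u x))\<^sup>2 + 3 * nlin l1 l2 u = 0"
proof -
  have uS: "u \<in> Sigma_space" using u by (auto simp: critical_points_def mass_sphere_def)
  from critical_multiplier[OF c a u] obtain \<mu> where mu: "\<And>v. v \<in> Sigma_space \<Longrightarrow> dE l1 l2 a u v = \<mu> * rip v u"
    by blast
  note uL = Sigma_L2[OF uS]
  define A where "A = (L2_norm (weak_grad u))\<^sup>2"
  define B where "B = a\<^sup>2 * (L2_norm (\<lambda>x. norm x *\<^sub>R u x))\<^sup>2"
  define N where "N = nlin l1 l2 u"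
  define e where "e t = t\<^sup>2 * (1/2 * A) + (1/t)\<^sup>2 * (1/2 * B) + t^3 * N" for t :: real
  have et: "energy l1 l2 a (dilate t u) = e t" if "t > 0" for t
    using energy_dilate[OF uS that, of l1 l2 a] by (simp add: e_def A_def B_def N_def)
  have e1: "energy l1 l2 a u = e 1"
    using et[of 1] by (simp add: dilate_def[abs_def])
  define b where "b = dbound l1 l2"
  define Q where "Q = qn u"
  define d where "d t x = dilate t u x - u x" for t x
  define p where "p t = pnorm a (d t)" for t
  define m where "m t = L2_norm (d t)" for t
  have b0: "b \<ge> 0" and Q0: "Q \<ge> 0" and p0: "p t \<ge> 0" and m0: "m t \<ge> 0" for t by (auto simp: b_def Q_def p_def m_def)
  have dS: "d t \<in> Sigma_space" if "t > 0" for t unfolding d_def by (intro Sigma_diff dilate_Sigma uS that)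
  \<comment> \<open>13 is 5 from \<open>energy_expand\<close> plus 8 from replacing one factor of
    \<open>(qn (d t))\<^sup>2\<close> by the crude bound \<open>q8\<close>.\<close>
  define K1 where "K1 = b * (13 * Q)"
  have K1: "K1 \<ge> 0" using b0 Q0 by (simp add: K1_def)
  \<comment> \<open>Small enough that the part of the error proportional to
    \<open>(p t)\<^sup>2\<close> takes only half of the exact term
    \<open>1/2 * (p t)\<^sup>2\<close>.\<close>
  define h where "h = 1 / (4 * (K1 + 1))"
  have h: "h > 0" "K1 * h \<le> 1/4" using K1 by (auto simp: h_def field_simps)
  define K2 where "K2 = K1 * (gn_const\<^sup>2 / (8 * h^3)) + \<bar>\<mu>\<bar> / 2"
  have K2: "K2 \<ge> 0" using K1 h by (simp add: K2_def)
  have expand: "\<bar>e t - e 1 - 1/2 * (p t)\<^sup>2\<bar> \<le> 1/4 * (p t)\<^sup>2 + K2 * (m t)\<^sup>2" if t: "1/2 \<le> t" "t \<le> 2" for t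
  proof -
    have t0: "t > 0" using t by simp
    have ud: "(\<lambda>x. u x + d t x) = dilate t u" by (auto simp: d_def)
    have q8: "qn (d t) \<le> 8 * Q"
    proof -
      have "d t = (\<lambda>x. dilate t u x + (-1) *\<^sub>R u x)" by (auto simp: d_def)
      then have "qn (d t) \<le> 2 * qn (dilate t u) + 2 * qn (\<lambda>x. (-1) *\<^sub>R u x)"
        using qn_add_le[OF dilate_Sigma(1)[OF uS t0] Sigma_scaleR(1)[OF uS, of "-1"]] by simp
      also have "\<dots> \<le> 2 * (3 * Q) + 2 * Q"
        using qn_dilate[OF uS t] unfolding qn_scaleR by (simp add: Q_def)
      finally show ?thesis by simp
    qed
    have "\<bar>e t - e 1 - dE l1 l2 a u (d t) - 1/2 * (p t)\<^sup>2\<bar> \<le> b * (5 * Q * qn (d t) + (qn (d t))\<^sup>2)"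
      using energy_expand[OF uS dS[OF t0], of l1 l2 a] unfolding ud et[OF t0] e1 by (simp add: b_def Q_def p_def)
    also have "\<dots> \<le> b * (5 * Q * qn (d t) + 8 * Q * qn (d t))"
      using q8 b0 by (intro mult_left_mono add_left_mono) (auto simp: power2_eq_square intro!: mult_right_mono)
    also have "\<dots> = K1 * qn (d t)" by (simp add: K1_def algebra_simps)
    also have "\<dots> \<le> K1 * (h * (p t)\<^sup>2 + gn_const\<^sup>2 / (8 * h^3) * (m t)\<^sup>2)"
      unfolding p_def m_def by (intro mult_left_mono qn_Young dS t0 h K1)
    also have "\<dots> = (K1 * h) * (p t)\<^sup>2 + K1 * (gn_const\<^sup>2 / (8 * h^3)) * (m t)\<^sup>2" by (simp add: algebra_simps)
    also have "\<dots> \<le> 1/4 * (p t)\<^sup>2 + K1 * (gn_const\<^sup>2 / (8 * h^3)) * (m t)\<^sup>2"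
      using h(2) by (intro add_right_mono mult_right_mono) auto
    finally have 1: "\<bar>e t - e 1 - dE l1 l2 a u (d t) - 1/2 * (p t)\<^sup>2\<bar> \<le> 1/4 * (p t)\<^sup>2 + K1 * (gn_const\<^sup>2 / (8 * h^3)) * (m t)\<^sup>2" .
    \<comment> \<open>Equality of the masses determines the pairing of \<open>d t\<close> with
      \<open>u\<close>: through the multiplier, the first variation is of second order in
      \<open>m t\<close>.\<close>
    have "(L2_norm (dilate t u))\<^sup>2 = (L2_norm u)\<^sup>2 + 2 * rip u (d t) + (m t)\<^sup>2"
      using L2_norm_add_sq[OF uL Sigma_L2[OF dS[OF t0]]] unfolding ud by (simp add: m_def)
    then have "rip (d t) u = - (m t)\<^sup>2 / 2" by (simp add: dilate_L2(2)[OF uL t0] rip_commute[of u])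
    then have "\<bar>dE l1 l2 a u (d t)\<bar> = \<bar>\<mu>\<bar> / 2 * (m t)\<^sup>2" by (simp add: mu[OF dS[OF t0]] abs_mult)
    then show ?thesis using 1 unfolding K2_def distrib_right by linarith
  qed
  define al where "al = L2_norm (weak_grad u)"
  define be where "be = L2_norm u"
  define K5 where "K5 = 27 * al / a + 3 * be"
  have K5: "K5 \<ge> 0" using a by (simp add: K5_def al_def be_def)
  have mass: "(m t)\<^sup>2 \<le> \<bar>t - 1\<bar> * (K5 * (p t + m t))" if t: "1/2 \<le> t" "t \<le> 2" for t
  proof -
    have t0: "t > 0" using t by simp
    have "(m t)\<^sup>2 \<le> \<bar>t - 1\<bar> * (27 * (L2_norm (\<lambda>x. norm x *\<^sub>R d t x) * al) + 3 * (m t * be))"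
      using dilate_difference_bound[OF uS t] by (simp add: m_def d_def[abs_def] al_def be_def)
    also have "\<dots> \<le> \<bar>t - 1\<bar> * (27 * (p t / a * al) + 3 * (m t * be))"
      unfolding p_def by (intro mult_left_mono add_right_mono mult_right_mono weight_le_pnorm dS t0 a) (auto simp: al_def)
    also have "\<dots> \<le> \<bar>t - 1\<bar> * (K5 * (p t + m t))"
    proof (rule mult_left_mono)
      have "K5 * (p t + m t) = 27 * (p t / a * al) + 3 * (m t * be) + (27 * al / a * m t + 3 * be * p t)" by (simp add: K5_def algebra_simps add_divide_distrib)
      moreover have "27 * al / a * m t + 3 * be * p t \<ge> 0" using a p0 m0 by (simp add: al_def be_def)
      ultimately show "27 * (p t / a * al) + 3 * (m t * be) \<le> K5 * (p t + m t)" by linarith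
    qed simp
    finally show ?thesis .
  qed
  define K4 where "K4 = 9 * (1/2 * A + 1/2 * B) + 392 * \<bar>N\<bar>"
  have AB: "A \<ge> 0" "B \<ge> 0" by (auto simp: A_def B_def)
  have K4: "K4 \<ge> 0" using AB by (simp add: K4_def)
  \<comment> \<open>The function \<open>e\<close> is explicit, and in the sum over \<open>t\<close>
    and \<open>1/t\<close> its first-order term at 1 drops out.\<close>
  have ebound: "e t + e (1/t) - 2 * e 1 \<le> K4 * (t - 1)\<^sup>2" if t: "1 \<le> t" "t \<le> 2" for t
  proof -
    have t0: "t > 0" using t by simp
    have i: "1/t \<le> 1" using t by simp
    have "\<bar>t - 1/t\<bar> \<le> 3 * (t - 1)"
    proof -
      have "t - 1/t = (t - 1) * (1 + 1/t)" using t0 by (simp add: field_simps)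
      also have "\<dots> \<le> (t - 1) * 3"
      proof (rule mult_left_mono)
        show "1 + 1/t \<le> 3" using i by linarith
      qed (use t in simp)
      finally have "t - 1/t \<le> 3 * (t - 1)" by simp
      moreover have "t - 1/t \<ge> 0" using t i by linarith
      ultimately show ?thesis by simp
    qed
    then have "\<bar>t - 1/t\<bar>\<^sup>2 \<le> (3 * (t - 1))\<^sup>2" by (intro power_mono) auto
    moreover have "\<bar>t - 1/t\<bar>\<^sup>2 = t\<^sup>2 + (1/t)\<^sup>2 - 2" using t0 by (simp add: power2_diff)
    moreover have "(3 * (t - 1))\<^sup>2 = 9 * (t - 1)\<^sup>2" by (simp only: power_mult_distrib) simp
    ultimately have s1: "t\<^sup>2 + (1/t)\<^sup>2 - 2 \<le> 9 * (t - 1)\<^sup>2" by linarith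
    have s2: "0 \<le> t^3 + (1/t)^3 - 2" "t^3 + (1/t)^3 - 2 \<le> 392 * (t - 1)\<^sup>2"
    proof -
      have eq: "t^3 + (1/t)^3 - 2 = (1/t)^3 * (t^3 - 1)\<^sup>2"
        using t0 by (simp add: power2_diff power_divide field_simps power_add[symmetric] power_mult[symmetric])
      show "0 \<le> t^3 + (1/t)^3 - 2" unfolding eq using t0 by simp
      have "t^3 - 1 = (t - 1) * (t\<^sup>2 + t + 1)" by (simp add: power2_eq_square power3_eq_cube algebra_simps)
      moreover have "(t - 1) * (t\<^sup>2 + t + 1) \<le> (t - 1) * 7"
      proof (rule mult_left_mono)
        have "t\<^sup>2 \<le> 2\<^sup>2" using t by (intro power_mono) auto
        then show "t\<^sup>2 + t + 1 \<le> 7" using t by simp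
      qed (use t in simp)
      moreover have "0 \<le> t^3 - 1" using t by (simp add: one_le_power)
      ultimately have "(t^3 - 1)\<^sup>2 \<le> ((t - 1) * 7)\<^sup>2" by (intro power_mono) auto
      then have "(1/t)^3 * (t^3 - 1)\<^sup>2 \<le> 1 * ((t - 1) * 7)\<^sup>2"
        using i t0 by (intro mult_mono power_le_one) auto
      also have "\<dots> \<le> 392 * (t - 1)\<^sup>2"
      proof -
        have "1 * (x * 7\<^sup>2) \<le> 392 * x" if "x \<ge> 0" for x :: real using that by simp
        then show ?thesis unfolding power_mult_distrib by simp
      qed
      finally show "t^3 + (1/t)^3 - 2 \<le> 392 * (t - 1)\<^sup>2" unfolding eq .
    qed
    have "e t + e (1/t) - 2 * e 1 = (1/2 * A + 1/2 * B) * (t\<^sup>2 + (1/t)\<^sup>2 - 2) + N * (t^3 + (1/t)^3 - 2)"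
      using t0 by (simp add: e_def algebra_simps)
    also have "\<dots> \<le> (1/2 * A + 1/2 * B) * (9 * (t - 1)\<^sup>2) + \<bar>N\<bar> * (392 * (t - 1)\<^sup>2)"
    proof (rule add_mono)
      show "(1/2 * A + 1/2 * B) * (t\<^sup>2 + (1/t)\<^sup>2 - 2) \<le> (1/2 * A + 1/2 * B) * (9 * (t - 1)\<^sup>2)"
        using AB by (intro mult_left_mono s1) auto
      have "N * (t^3 + (1/t)^3 - 2) \<le> \<bar>N\<bar> * (t^3 + (1/t)^3 - 2)" using s2 by (intro mult_right_mono) auto
      also have "\<dots> \<le> \<bar>N\<bar> * (392 * (t - 1)\<^sup>2)" using s2 by (intro mult_left_mono) auto
      finally show "N * (t^3 + (1/t)^3 - 2) \<le> \<bar>N\<bar> * (392 * (t - 1)\<^sup>2)" .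
    qed
    also have "\<dots> = K4 * (t - 1)\<^sup>2" by (simp add: K4_def algebra_simps)
    finally show ?thesis .
  qed
  define X where "X = 16 * K4"
  define Y where "Y = (16 * K2 + 4) * K5"
  have XY: "X \<ge> 0" "Y \<ge> 0" using K4 K2 K5 by (auto simp: X_def Y_def)
  define K where "K = (3/4 + K2) * (X + Y + 1)\<^sup>2"
  have main: "\<bar>e t - e 1\<bar> \<le> K * (t - 1)\<^sup>2" if t: "1 \<le> t" "t \<le> 2" for t
  proof -
    define r where "r = 1/t"
    have r1: "r \<le> 1" "1/2 \<le> r" using t by (auto simp: r_def field_simps)
    have r: "1/2 \<le> r" "r \<le> 2" "r \<le> 1" using r1 by auto
    have t': "1/2 \<le> t" using t by simp
    define \<tau> where "\<tau> = t - 1"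
    have tau: "\<tau> \<ge> 0" "\<bar>t - 1\<bar> \<le> \<tau>" using t by (auto simp: \<tau>_def)
    have rt: "\<bar>r - 1\<bar> \<le> \<tau>"
    proof -
      have "(t - 1) * (1/t) \<le> (t - 1) * 1" using t by (intro mult_left_mono) auto
      then show ?thesis using r t by (simp add: r_def \<tau>_def field_simps)
    qed
    \<comment> \<open>The energy estimate couples both values of \<open>p\<close> to both values of
      \<open>m\<close>, and the mass estimate couples \<open>m\<close> back to \<open>p\<close>; the
      four norms can only be bounded together.\<close>
    define z where "z = p t + p r + m t + m r"
    have z0: "z \<ge> 0" using p0 m0 by (simp add: z_def)
    have mt: "(m t)\<^sup>2 \<le> \<tau> * (K5 * (p t + m t))"
      by (rule order_trans[OF mass[OF t' t(2)] mult_right_mono[OF tau(2)]]) (use K5 p0 m0 in simp)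
    have mr: "(m r)\<^sup>2 \<le> \<tau> * (K5 * (p r + m r))"
      by (rule order_trans[OF mass[OF r(1,2)] mult_right_mono[OF rt]]) (use K5 p0 m0 in simp)
    have msum: "(m t)\<^sup>2 + (m r)\<^sup>2 \<le> \<tau> * (K5 * z)" 
    proof -
      have "\<tau> * (K5 * z) = \<tau> * (K5 * (p t + m t)) + \<tau> * (K5 * (p r + m r))" by (simp add: z_def algebra_simps)
      then show ?thesis using mt mr by linarith
    qed
    have "1/4 * ((p t)\<^sup>2 + (p r)\<^sup>2) \<le> K4 * \<tau>\<^sup>2 + K2 * ((m t)\<^sup>2 + (m r)\<^sup>2)"
    proof -
      have "1/4 * (P + R) \<le> z + K2 * (M + N)"
        if "\<bar>x - w - 1/2 * P\<bar> \<le> 1/4 * P + K2 * M" "\<bar>y - w - 1/2 * R\<bar> \<le> 1/4 * R + K2 * N" "x + y - 2 * w \<le> z"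
        for P R M N x y w z :: real
      proof -
        have "1/4 * P + 1/4 * R \<le> z + (K2 * M + K2 * N)"
          if "\<bar>x - w - 1/2 * P\<bar> \<le> 1/4 * P + K2 * M" "\<bar>y - w - 1/2 * R\<bar> \<le> 1/4 * R + K2 * N" "x + y - 2 * w \<le> z"
          using abs_le_D2[OF that(1)] abs_le_D2[OF that(2)] that(3) by linarith
        from this[OF that] have "1/4 * P + 1/4 * R \<le> z + (K2 * M + K2 * N)" .
        then show ?thesis by (simp only: distrib_left)
      qed
      from this[OF expand[OF t' t(2)] expand[OF r(1,2)] ebound[OF t, folded r_def \<tau>_def]] show ?thesis .
    qed
    also have "\<dots> \<le> K4 * \<tau>\<^sup>2 + K2 * (\<tau> * (K5 * z))" by (intro add_left_mono mult_left_mono msum K2)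
    finally have "1/4 * ((p t)\<^sup>2 + (p r)\<^sup>2) \<le> K4 * \<tau>\<^sup>2 + K2 * (\<tau> * (K5 * z))" .
    moreover have "x \<le> 4 * y + 4 * w" if "1/4 * x \<le> y + w" for x y w :: real using that by linarith
    ultimately have psum: "(p t)\<^sup>2 + (p r)\<^sup>2 \<le> 4 * (K4 * \<tau>\<^sup>2) + 4 * (K2 * (\<tau> * (K5 * z)))" by blast
    have "z\<^sup>2 \<le> 4 * ((p t)\<^sup>2 + (p r)\<^sup>2 + ((m t)\<^sup>2 + (m r)\<^sup>2))"
    proof -
      have "(x1 + x2 + x3 + x4)\<^sup>2 \<le> 4 * (x1\<^sup>2 + x2\<^sup>2 + (x3\<^sup>2 + x4\<^sup>2))" for x1 x2 x3 x4 :: real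
        using zero_le_power2[of "x1 - x2"] zero_le_power2[of "x1 - x3"] zero_le_power2[of "x1 - x4"]
          zero_le_power2[of "x2 - x3"] zero_le_power2[of "x2 - x4"] zero_le_power2[of "x3 - x4"]
        by (simp add: power2_eq_square algebra_simps)
      then show ?thesis unfolding z_def .
    qed
    also have "\<dots> \<le> 4 * (4 * (K4 * \<tau>\<^sup>2) + 4 * (K2 * (\<tau> * (K5 * z))) + \<tau> * (K5 * z))"
      using add_mono[OF psum msum] by (rule mult_left_mono) simp
    also have "\<dots> = X * \<tau>\<^sup>2 + Y * \<tau> * z" by (simp add: X_def Y_def algebra_simps)
    finally have zb: "z \<le> (X + Y + 1) * \<tau>" by (rule quadratic_absorb) (use z0 tau XY in auto)
    have pz: "(p t)\<^sup>2 \<le> z\<^sup>2" "(m t)\<^sup>2 \<le> z\<^sup>2" using p0 m0 by (intro power_mono; simp add: z_def)+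
    have "\<bar>e t - e 1\<bar> \<le> 3/4 * (p t)\<^sup>2 + K2 * (m t)\<^sup>2"
    proof -
      have "\<bar>x - 1/2 * P\<bar> \<le> 1/4 * P + M \<Longrightarrow> 0 \<le> P \<Longrightarrow> \<bar>x\<bar> \<le> 3/4 * P + M" for x P M :: real by linarith
      from this[OF expand[OF t' t(2)]] show ?thesis by simp
    qed
    also have "\<dots> \<le> 3/4 * z\<^sup>2 + K2 * z\<^sup>2" using pz K2 by (intro add_mono mult_left_mono) auto
    also have "\<dots> = (3/4 + K2) * z\<^sup>2" by (simp add: algebra_simps)
    also have "\<dots> \<le> (3/4 + K2) * ((X + Y + 1) * \<tau>)\<^sup>2" using zb z0 K2 by (intro mult_left_mono power_mono) auto
    finally show ?thesis unfolding K_def \<tau>_def power_mult_distrib mult.assoc .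
  qed
  \<comment> \<open>The explicit derivative of \<open>e\<close> at 1 is the virial expression, while
    \<open>main\<close> makes the difference quotient from the right vanish in the limit.\<close>
  have "(e has_real_derivative (A - B + 3 * N)) (at 1)"
    unfolding e_def by (auto intro!: derivative_eq_intros)
  then have "((\<lambda>t. (e t - e 1) / (t - 1)) \<longlongrightarrow> A - B + 3 * N) (at_right 1)"
    by (intro tendsto_within_subset[OF iffD1[OF has_field_derivative_iff]]) auto
  moreover have "((\<lambda>t. (e t - e 1) / (t - 1)) \<longlongrightarrow> 0) (at_right 1)"
  proof (rule Lim_null_comparison)
    have "\<forall>\<^sub>F t in at_right (1::real). t \<in> {1<..<2}" by (rule eventually_at_right_real) simp
    then show "\<forall>\<^sub>F t in at_right 1. norm ((e t - e 1) / (t - 1)) \<le> K * (t - 1)"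
    proof eventually_elim
      case (elim t)
      then have "\<bar>e t - e 1\<bar> / (t - 1) \<le> K * (t - 1)\<^sup>2 / (t - 1)" using main[of t] by (intro divide_right_mono) auto
      then show ?case using elim by (simp add: power2_eq_square)
    qed
    have "((\<lambda>t. K * (t - 1)) \<longlongrightarrow> K * (1 - 1)) (at_right 1)" by (intro tendsto_intros)
    then show "((\<lambda>t. K * (t - 1)) \<longlongrightarrow> 0) (at_right 1)" by simp
  qed
  ultimately have "A - B + 3 * N = 0" by (rule tendsto_unique[OF trivial_limit_at_right_real])
  then show ?thesis by (simp add: A_def B_def N_def)
qed

text \<open>With \<open>A\<close> and \<open>B\<close> the gradient and trap parts, eliminating the
  interaction by the virial identity turns the energy into \<open>A / 6 + 5 * B / 6\<close>.\<close>

lemma critical_energy_lower: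
  assumes c: "c > 0" and a: "a > 0" and u: "u \<in> critical_points (energy l1 l2 a) c"
  shows "(pnorm a u)\<^sup>2 \<le> 6 * energy l1 l2 a u"
proof -
  have uS: "u \<in> Sigma_space" using u by (auto simp: critical_points_def mass_sphere_def)
  have "A + B \<le> 6 * (1/2 * (A + B) + N)" if "B \<ge> 0" "A - B + 3 * N = 0" for A B N :: real
  proof -
    have "6 * (1/2 * (A + B) + N) = A + 5 * B + 2 * (A - B + 3 * N)" by (simp add: algebra_simps)
    then show ?thesis using that by simp
  qed
  from this[OF _ virial_identity[OF assms]] show ?thesis unfolding energy_eq[OF uS] pnorm_sq[OF uS] by simp
qed

section \<open>Minimisation over a small ball of the mass sphere\<close>

text \<open>Dictated by \<open>nlin_small\<close>. With \<open>d = dbound l1 l2 * gn_const\<close>,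
  mass at most \<open>4 * c\<close> and level at most \<open>2 * k\<close>, the interaction is small
  once \<open>8 * k * d\<^sup>2 * c\<close> is at most 1/4, that is,
  \<open>32 * k * d\<^sup>2 * c\<close> at most 1; the added ones keep the denominator
  positive.\<close>

definition well_radius :: "real \<Rightarrow> real \<Rightarrow> real \<Rightarrow> real" where
  "well_radius l1 l2 c = 1 / (32 * (dbound l1 l2 * gn_const + 1)\<^sup>2 * (c + 1))"

text \<open>The assumption \<open>small\<close> is where the smallness of the trap enters;
  \<open>spread_out_element\<close> provides it.\<close>

locale energy_well =
  fixes l1 l2 c a :: real
  assumes c: "c > 0" and a: "a > 0"
    and small: "\<exists>w\<in>mass_sphere c. (pnorm a w)\<^sup>2 \<le> well_radius l1 l2 c / 64"
begin

abbreviation E where "E \<equiv> energy l1 l2 a"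

definition k where "k = well_radius l1 l2 c"

definition V where "V = {u \<in> mass_sphere c. (pnorm a u)\<^sup>2 \<le> k}"

definition m where "m = Inf (E ` V)"

lemma k_pos: "k > 0"
proof -
  have "dbound l1 l2 * gn_const \<ge> 0" using gn_const_pos by (intro mult_nonneg_nonneg) auto
  then have "(dbound l1 l2 * gn_const + 1)\<^sup>2 > 0" by simp
  then show ?thesis using c by (simp add: k_def well_radius_def)
qed

lemma nlin_small:
  assumes u: "u \<in> Sigma_space" and M: "(L2_norm u)\<^sup>2 \<le> 4 * c" and p: "(pnorm a u)\<^sup>2 \<le> 2 * k"
  shows "\<bar>nlin l1 l2 u\<bar> \<le> (pnorm a u)\<^sup>2 / 4"
proof -
  define b where "b = dbound l1 l2"
  define d where "d = b * gn_const"
  define P where "P = pnorm a u"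
  define L where "L = L2_norm u"
  have b: "b \<ge> 0" by (simp add: b_def)
  have d: "d \<ge> 0" using b gn_const_pos by (simp add: d_def)
  have P: "P \<ge> 0" "P\<^sup>2 \<le> 2 * k" and L: "L \<ge> 0" "L\<^sup>2 \<le> 4 * c" using p M by (auto simp: P_def L_def)
  have k1: "k * (32 * (d + 1)\<^sup>2 * (c + 1)) = 1"
  proof -
    have "32 * (d + 1)\<^sup>2 * (c + 1) \<noteq> 0" using d c by simp
    then show ?thesis by (simp add: k_def well_radius_def d_def b_def)
  qed
  have "(d * (P * L))\<^sup>2 = d\<^sup>2 * (P\<^sup>2 * L\<^sup>2)" by (simp add: power_mult_distrib)
  also have "\<dots> \<le> d\<^sup>2 * ((2 * k) * (4 * c))"
    using P L k_pos by (intro mult_left_mono mult_mono) auto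
  also have "\<dots> = 8 * k * (d\<^sup>2 * c)" by simp
  also have "\<dots> \<le> 8 * k * ((d + 1)\<^sup>2 * (c + 1))"
    using d c k_pos by (intro mult_left_mono mult_mono power_mono) auto
  also have "\<dots> = 1/4 * (k * (32 * (d + 1)\<^sup>2 * (c + 1)))" by simp
  also have "\<dots> = (1/2)\<^sup>2" unfolding k1 by (simp add: power2_eq_square)
  finally have dPL: "d * (P * L) \<le> 1/2" by (rule power2_le_imp_le) simp
  have "\<bar>nlin l1 l2 u\<bar> \<le> 1/2 * (b * (qn u)\<^sup>2)" unfolding b_def by (rule nlin_bound[OF u])
  also have "\<dots> \<le> 1/2 * (b * (gn_const * P^3 * L))"
    unfolding P_def L_def by (intro mult_left_mono qn_sq_bound u b) simp
  also have "\<dots> = 1/2 * (P\<^sup>2 * (d * (P * L)))" by (simp add: d_def power2_eq_square power3_eq_cube)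
  also have "\<dots> \<le> 1/2 * (P\<^sup>2 * (1/2))" by (intro mult_left_mono dPL) auto
  finally show ?thesis by (simp add: P_def)
qed

lemma energy_coercive:
  assumes "u \<in> Sigma_space" "(L2_norm u)\<^sup>2 \<le> 4 * c" "(pnorm a u)\<^sup>2 \<le> 2 * k"
  shows "(pnorm a u)\<^sup>2 / 4 \<le> E u" "E u \<le> 3/4 * (pnorm a u)\<^sup>2"
  using nlin_small[OF assms] unfolding energy_eq[OF assms(1)] by linarith+

lemma VD:
  assumes "u \<in> V"
  shows "u \<in> Sigma_space" "(L2_norm u)\<^sup>2 = c" "(pnorm a u)\<^sup>2 \<le> k" "(L2_norm u)\<^sup>2 \<le> 4 * c" "(pnorm a u)\<^sup>2 \<le> 2 * k"
    "0 \<le> E u"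
proof -
  show 1: "u \<in> Sigma_space" "(L2_norm u)\<^sup>2 = c" "(pnorm a u)\<^sup>2 \<le> k" using assms by (auto simp: V_def mass_sphere_def)
  show 2: "(L2_norm u)\<^sup>2 \<le> 4 * c" "(pnorm a u)\<^sup>2 \<le> 2 * k" using 1 c k_pos by auto
  show "0 \<le> E u" by (rule order_trans[OF _ energy_coercive(1)[OF 1(1) 2]]) simp
qed

lemma bdd_below_V: "bdd_below (E ` V)"
  using VD(6) by (intro bdd_belowI2)

lemma V_nonempty: "V \<noteq> {}" and m_bounds: "0 \<le> m" "m \<le> k / 32"
proof -
  obtain w where w: "w \<in> mass_sphere c" "(pnorm a w)\<^sup>2 \<le> k / 64" using small unfolding k_def by blast
  have wV: "w \<in> V" using w k_pos by (simp add: V_def)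
  then show "V \<noteq> {}" by blast
  then show "0 \<le> m" unfolding m_def using VD(6) by (intro cINF_greatest)
  have "m \<le> E w" unfolding m_def by (rule cINF_lower[OF bdd_below_V wV])
  also have "\<dots> \<le> 3/4 * (pnorm a w)\<^sup>2" by (rule energy_coercive(2)[OF VD(1,4,5)[OF wV]])
  finally show "m \<le> k / 32" using w(2) k_pos by linarith
qed

text \<open>Between the levels \<open>k\<close> and \<open>2 * k\<close> coercivity alone gives more
  than \<open>k / 4\<close>, hence more than \<open>m\<close>. The extra room is used by
  \<open>m_lower_off_sphere\<close>, whose rescaling may double the level.\<close>

lemma m_lower:
  assumes u: "u \<in> mass_sphere c" and p: "(pnorm a u)\<^sup>2 \<le> 2 * k"
  shows "m \<le> E u"
proof (cases "(pnorm a u)\<^sup>2 \<le> k")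
  case True
  then have "u \<in> V" using u by (simp add: V_def)
  then show ?thesis unfolding m_def by (rule cINF_lower[OF bdd_below_V])
next
  case False
  have "(pnorm a u)\<^sup>2 / 4 \<le> E u" using u p c by (intro energy_coercive) (auto simp: mass_sphere_def)
  then show ?thesis using False m_bounds k_pos by linarith
qed

text \<open>Rescale \<open>z\<close> onto the mass sphere; the energy changes at most in proportion
  to \<open>\<bar>s - 1\<bar> * k\<close>, and \<open>\<bar>s - 1\<bar>\<close> is at most
  \<open>2 / c\<close> times the mass defect. It serves the midpoints in the parallelogram argument
  and the straight variations of a minimiser, neither of which stay on the sphere.\<close>

lemma m_lower_off_sphere:
  assumes z: "z \<in> Sigma_space" and M: "c / 2 \<le> (L2_norm z)\<^sup>2" "(L2_norm z)\<^sup>2 \<le> 4 * c" and p: "(pnorm a z)\<^sup>2 \<le> k"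
  shows "m \<le> E z + 4 * k / c * \<bar>(L2_norm z)\<^sup>2 - c\<bar>"
proof -
  define L where "L = (L2_norm z)\<^sup>2"
  define s where "s = c / L"
  define P where "P = (pnorm a z)\<^sup>2"
  define N where "N = nlin l1 l2 z"
  have L: "L > 0" "c / 2 \<le> L" using M c by (auto simp: L_def)
  have s: "s > 0" "s \<le> 2" using L c by (auto simp: s_def field_simps)
  have P: "0 \<le> P" "P \<le> k" using p by (auto simp: P_def)
  let ?y = "\<lambda>x. sqrt s *\<^sub>R z x"
  have yS: "?y \<in> Sigma_space" by (rule Sigma_scaleR(1)[OF z])
  have py: "(pnorm a ?y)\<^sup>2 = s * P" using s by (simp add: pnorm_scaleR[OF z] P_def power_mult_distrib)
  have "(L2_norm ?y)\<^sup>2 = s * L" using s by (simp add: L2_norm_scaleR L_def power_mult_distrib)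
  then have y: "?y \<in> mass_sphere c" using yS L by (simp add: mass_sphere_def s_def)
  have "s * P \<le> 2 * k" using s P by (intro mult_mono) auto
  then have "m \<le> E ?y" by (intro m_lower y) (simp add: py)
  also have "E ?y = 1/2 * (s * P) + s\<^sup>2 * N"
  proof -
    have "sqrt s ^ 4 = (sqrt s ^ 2) ^ 2" by simp
    also have "\<dots> = s\<^sup>2" using s by simp
    finally show ?thesis unfolding energy_eq[OF yS] py nlin_scaleR[OF z] N_def by simp
  qed
  finally have 1: "m \<le> 1/2 * (s * P) + s\<^sup>2 * N" .
  have N: "\<bar>N\<bar> \<le> k / 4" using nlin_small[OF z M(2)] p k_pos by (simp add: N_def)
  have i1: "1/2 * (s * P) + s\<^sup>2 * N = (1/2 * P + N) + (1/2 * ((s - 1) * P) + (s - 1) * ((s + 1) * N))"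
    by (simp add: field_simps power2_eq_square)
  have i2: "(s - 1) * P \<le> \<bar>s - 1\<bar> * k"
    using mult_mono[of "s - 1" "\<bar>s - 1\<bar>" P k] P by (cases "s \<ge> 1") (auto intro: order_trans[OF mult_nonpos_nonneg])
  have i3: "(s - 1) * ((s + 1) * N) \<le> 3/4 * (\<bar>s - 1\<bar> * k)"
  proof -
    have "(s - 1) * ((s + 1) * N) \<le> \<bar>s - 1\<bar> * (\<bar>s + 1\<bar> * \<bar>N\<bar>)" by (metis abs_ge_self abs_mult)
    also have "\<dots> \<le> \<bar>s - 1\<bar> * (3 * (k / 4))" using s N by (intro mult_left_mono mult_mono) auto
    finally show ?thesis by simp
  qed
  have gen: "m \<le> X + 2 * Z"
    if "m \<le> Y" "Y = X + (1/2 * A + B)" "A \<le> Z" "B \<le> 3/4 * Z" "0 \<le> Z" for X Y Z A B :: real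
    using that by linarith
  have 2: "m \<le> E z + 2 * (\<bar>s - 1\<bar> * k)"
    using gen[OF 1 i1 i2 i3] k_pos unfolding energy_eq[OF z] P_def[symmetric] N_def[symmetric] by simp
  have "\<bar>s - 1\<bar> = \<bar>L - c\<bar> / L" using L by (simp add: s_def abs_if field_simps)
  also have "\<dots> \<le> \<bar>L - c\<bar> / (c / 2)" using L c by (intro divide_left_mono) auto
  finally have "2 * (\<bar>s - 1\<bar> * k) \<le> 2 * (\<bar>L - c\<bar> / (c / 2) * k)" using k_pos by (intro mult_left_mono mult_right_mono) auto
  also have "\<dots> = 4 * k / c * \<bar>L - c\<bar>" by simp
  finally show ?thesis using 2 unfolding L_def by linarith
qed

section \<open>Compactness of almost minimisers\<close>

definition R where "R = sqrt k + sqrt (4 * c)"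

lemma R_bounds:
  assumes "(L2_norm u)\<^sup>2 \<le> 4 * c" "(pnorm a u)\<^sup>2 \<le> k"
  shows "pnorm a u \<le> R" "L2_norm u \<le> R"
proof -
  have "pnorm a u \<le> sqrt k" "L2_norm u \<le> sqrt (4 * c)" using assms by (auto intro: real_le_rsqrt)
  moreover have "sqrt k \<ge> 0" "sqrt (4 * c) \<ge> 0" using k_pos c by auto
  ultimately show "pnorm a u \<le> R" "L2_norm u \<le> R" unfolding R_def by linarith+
qed

text \<open>Stated for an arbitrary filter, since it is applied to sequences and also to pairs of
  indices.\<close>

lemma nlin_diff_tendsto:
  assumes S: "\<And>i. x i \<in> Sigma_space" "\<And>i. y i \<in> Sigma_space"
    and M: "\<And>i. (L2_norm (x i))\<^sup>2 \<le> 4 * c" "\<And>i. (L2_norm (y i))\<^sup>2 \<le> 4 * c"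
    and p: "\<And>i. (pnorm a (x i))\<^sup>2 \<le> k" "\<And>i. (pnorm a (y i))\<^sup>2 \<le> k"
    and d: "((\<lambda>i. L2_norm (\<lambda>t. x i t - y i t)) \<longlongrightarrow> 0) F"
  shows "((\<lambda>i. nlin l1 l2 (x i) - nlin l1 l2 (y i)) \<longlongrightarrow> 0) F"
proof -
  define C where "C = 2^7 * (dbound l1 l2)^4 * gn_const^4 * R^15"
  have "((\<lambda>i. (nlin l1 l2 (x i) - nlin l1 l2 (y i))^4) \<longlongrightarrow> 0) F"
  proof (rule Lim_null_comparison)
    show "((\<lambda>i. C * L2_norm (\<lambda>t. x i t - y i t)) \<longlongrightarrow> 0) F" by (rule tendsto_mult_right_zero[OF d])
    have "(nlin l1 l2 (x i) - nlin l1 l2 (y i))^4 \<le> C * L2_norm (\<lambda>t. x i t - y i t)" for i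
      unfolding C_def by (rule nlin_diff_bound[OF S R_bounds(1)[OF M(1) p(1)] R_bounds(1)[OF M(2) p(2)] R_bounds(2)[OF M(1) p(1)] R_bounds(2)[OF M(2) p(2)]])
    then show "\<forall>\<^sub>F i in F. norm ((nlin l1 l2 (x i) - nlin l1 l2 (y i))^4) \<le> C * L2_norm (\<lambda>t. x i t - y i t)"
      by (intro always_eventually allI) simp
  qed
  then show ?thesis by simp
qed

definition mid :: "(real^3 \<Rightarrow> complex) \<Rightarrow> (real^3 \<Rightarrow> complex) \<Rightarrow> real^3 \<Rightarrow> complex" where
  "mid x y t = (1/2) *\<^sub>R (x t + y t)"

lemma mid:
  assumes x: "x \<in> Sigma_space" and y: "y \<in> Sigma_space"
  shows "mid x y \<in> Sigma_space"
    "(L2_norm (mid x y))\<^sup>2 = 1/2 * (L2_norm x)\<^sup>2 + 1/2 * (L2_norm y)\<^sup>2 - 1/4 * (L2_norm (\<lambda>t. x t - y t))\<^sup>2"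
    "(pnorm a (mid x y))\<^sup>2 = 1/2 * (pnorm a x)\<^sup>2 + 1/2 * (pnorm a y)\<^sup>2 - 1/4 * (pnorm a (\<lambda>t. x t - y t))\<^sup>2"
    "L2_norm (\<lambda>t. x t - mid x y t) = 1/2 * L2_norm (\<lambda>t. x t - y t)"
    "L2_norm (\<lambda>t. y t - mid x y t) = 1/2 * L2_norm (\<lambda>t. x t - y t)"
proof -
  have eq: "mid x y = (\<lambda>t. (1/2) *\<^sub>R (x t + y t))" by (rule ext) (rule mid_def)
  note S = Sigma_add(1)[OF x y]
  note P = pnorm_add_sq[OF x y, of a] and L = L2_norm_add_sq[OF Sigma_L2[OF x] Sigma_L2[OF y]] L2_norm_diff_sq[OF Sigma_L2[OF x] Sigma_L2[OF y]]
  have gen: "(\<bar>1/2\<bar> * z)\<^sup>2 = 1/2 * u + 1/2 * v - 1/4 * w" if "z\<^sup>2 = u + 2 * r + v" "w = u - 2 * r + v" for z u v w r :: real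
    unfolding power_mult_distrib that by (simp add: power2_eq_square field_simps)
  show "mid x y \<in> Sigma_space" unfolding eq by (rule Sigma_scaleR(1)[OF S])
  show "(L2_norm (mid x y))\<^sup>2 = 1/2 * (L2_norm x)\<^sup>2 + 1/2 * (L2_norm y)\<^sup>2 - 1/4 * (L2_norm (\<lambda>t. x t - y t))\<^sup>2"
    unfolding eq L2_norm_scaleR by (rule gen[OF L])
  show "(pnorm a (mid x y))\<^sup>2 = 1/2 * (pnorm a x)\<^sup>2 + 1/2 * (pnorm a y)\<^sup>2 - 1/4 * (pnorm a (\<lambda>t. x t - y t))\<^sup>2"
    unfolding eq pnorm_scaleR[OF S] by (rule gen[OF P])
  have e: "z - (1/2) *\<^sub>R (z + z') = (1/2) *\<^sub>R (z - z')" "z' - (1/2) *\<^sub>R (z + z') = (-(1/2)) *\<^sub>R (z - z')" for z z' :: complex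
    by (simp_all add: complex_eq_iff field_simps)
  have e1: "(\<lambda>t. x t - mid x y t) = (\<lambda>t. (1/2) *\<^sub>R (x t - y t))" and e2: "(\<lambda>t. y t - mid x y t) = (\<lambda>t. (-(1/2)) *\<^sub>R (x t - y t))"
    unfolding mid_def e by (rule refl)+
  show "L2_norm (\<lambda>t. x t - mid x y t) = 1/2 * L2_norm (\<lambda>t. x t - y t)" unfolding e1 L2_norm_scaleR by simp
  show "L2_norm (\<lambda>t. y t - mid x y t) = 1/2 * L2_norm (\<lambda>t. x t - y t)" unfolding e2 L2_norm_scaleR by simp
qed

text \<open>Up to the compactly behaving \<open>nlin\<close>, the energy is the square of a Hilbert norm, so that the
  parallelogram identity upgrades \<open>L\<^sup>2\<close> closeness of almost minimisers.\<close>

lemma almost_minimisers_close: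
  assumes S: "\<And>i. x i \<in> Sigma_space" "\<And>i. y i \<in> Sigma_space"
    and M: "\<And>i. (L2_norm (x i))\<^sup>2 \<le> 4 * c" "\<And>i. (L2_norm (y i))\<^sup>2 \<le> 4 * c"
    and p: "\<And>i. (pnorm a (x i))\<^sup>2 \<le> k" "\<And>i. (pnorm a (y i))\<^sup>2 \<le> k"
    and Mt: "((\<lambda>i. (L2_norm (x i))\<^sup>2) \<longlongrightarrow> c) F" "((\<lambda>i. (L2_norm (y i))\<^sup>2) \<longlongrightarrow> c) F"
    and Et: "((\<lambda>i. E (x i)) \<longlongrightarrow> m) F" "((\<lambda>i. E (y i)) \<longlongrightarrow> m) F"
    and d: "((\<lambda>i. L2_norm (\<lambda>t. x i t - y i t)) \<longlongrightarrow> 0) F"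
  shows "((\<lambda>i. pnorm a (\<lambda>t. x i t - y i t)) \<longlongrightarrow> 0) F"
proof -
  define w where "w i = mid (x i) (y i)" for i
  note md = mid[OF S]
  have wS: "w i \<in> Sigma_space" for i unfolding w_def by (rule md)
  have wM: "(L2_norm (w i))\<^sup>2 \<le> 4 * c" for i
    using md(2)[of i i] M[of i] zero_le_power2[of "L2_norm (\<lambda>t. x i t - y i t)"] unfolding w_def by linarith
  have wp: "(pnorm a (w i))\<^sup>2 \<le> k" for i
    using md(3)[of i i] p[of i] zero_le_power2[of "pnorm a (\<lambda>t. x i t - y i t)"] unfolding w_def by linarith
  have wMt: "((\<lambda>i. (L2_norm (w i))\<^sup>2) \<longlongrightarrow> c) F"
  proof -
    have "((\<lambda>i. 1/2 * (L2_norm (x i))\<^sup>2 + 1/2 * (L2_norm (y i))\<^sup>2 - 1/4 * (L2_norm (\<lambda>t. x i t - y i t))\<^sup>2)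
        \<longlongrightarrow> 1/2 * c + 1/2 * c - 1/4 * 0\<^sup>2) F"
      by (intro tendsto_intros Mt d)
    then show ?thesis unfolding w_def md(2) by simp
  qed
  have h: "((\<lambda>i. 1/2 * L2_norm (\<lambda>t. x i t - y i t)) \<longlongrightarrow> 0) F" by (rule tendsto_mult_right_zero[OF d])
  have n1: "((\<lambda>i. nlin l1 l2 (x i) - nlin l1 l2 (w i)) \<longlongrightarrow> 0) F"
    by (rule nlin_diff_tendsto[OF S(1) wS M(1) wM p(1) wp]) (use h in \<open>simp only: w_def md(4)\<close>)
  have n2: "((\<lambda>i. nlin l1 l2 (y i) - nlin l1 l2 (w i)) \<longlongrightarrow> 0) F"
    by (rule nlin_diff_tendsto[OF S(2) wS M(2) wM p(2) wp]) (use h in \<open>simp only: w_def md(5)\<close>)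
  \<comment> \<open>The parallelogram identity solved for the distance, with the energy of the
    midpoint bounded below by \<open>m\<close> up to the mass defect. The interactions of
    \<open>x i\<close> and \<open>y i\<close> are compared with that of the midpoint.\<close>
  define B where "B i = 4 * (E (x i) - m) + 4 * (E (y i) - m) - 4 * (nlin l1 l2 (x i) - nlin l1 l2 (w i))
      - 4 * (nlin l1 l2 (y i) - nlin l1 l2 (w i)) + 8 * (4 * k / c * \<bar>(L2_norm (w i))\<^sup>2 - c\<bar>)" for i
  have "(B \<longlongrightarrow> 4 * (m - m) + 4 * (m - m) - 4 * 0 - 4 * 0 + 8 * (4 * k / c * \<bar>c - c\<bar>)) F"
    unfolding B_def by (intro tendsto_intros Et n1 n2 wMt)
  then have B: "(B \<longlongrightarrow> 0) F" by simp
  have "\<forall>\<^sub>F i in F. c / 2 < (L2_norm (w i))\<^sup>2" using c by (intro order_tendstoD(1)[OF wMt]) simp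
  then have ev: "\<forall>\<^sub>F i in F. norm ((pnorm a (\<lambda>t. x i t - y i t))\<^sup>2) \<le> B i"
  proof eventually_elim
    case (elim i)
    have gen: "dd \<le> 4 * (1/2 * px + nx - m) + 4 * (1/2 * py + ny - m) - 4 * (nx - nw) - 4 * (ny - nw) + 8 * er"
      if "m \<le> (1/2 * pw + nw) + er" "pw = 1/2 * px + 1/2 * py - 1/4 * dd" for dd px py pw nx ny nw er :: real
      using that by (simp add: field_simps)
    have "m \<le> E (w i) + 4 * k / c * \<bar>(L2_norm (w i))\<^sup>2 - c\<bar>"
      using elim by (intro m_lower_off_sphere wS wM wp) simp
    then have "m \<le> (1/2 * (pnorm a (w i))\<^sup>2 + nlin l1 l2 (w i)) + 4 * k / c * \<bar>(L2_norm (w i))\<^sup>2 - c\<bar>"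
      unfolding energy_eq[OF wS] .
    from gen[OF this md(3)[of i i, folded w_def]]
    have "(pnorm a (\<lambda>t. x i t - y i t))\<^sup>2 \<le> B i"
      unfolding B_def energy_eq[OF S(1)] energy_eq[OF S(2)] .
    then show ?case by simp
  qed
  have "((\<lambda>i. (pnorm a (\<lambda>t. x i t - y i t))\<^sup>2) \<longlongrightarrow> 0) F" by (rule Lim_null_comparison[OF ev B])
  then show ?thesis by simp
qed

lemma pnorm_one_le:
  assumes "u \<in> Sigma_space"
  shows "pnorm 1 u \<le> L2_norm u + (1 + 1/a) * pnorm a u"
proof -
  have "pnorm 1 u \<le> Sigma_norm u"
    by (rule power2_le_imp_le) (simp_all add: Sigma_norm_pnorm[OF assms])
  then show ?thesis using Sigma_norm_le_pnorm[OF assms a] by linarith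
qed

text \<open>The trap yields a subsequence that is Cauchy in \<open>L2\<close>. Applied to pairs of
  its members, \<open>almost_minimisers_close\<close> makes it Cauchy in the energy norm, so the
  limit is strong. The masses are only required to tend to \<open>c\<close>, because for stability
  the sequence consists of states evolved from perturbed data.\<close>

theorem minimising_sequence_compact:
  fixes u :: "nat \<Rightarrow> real^3 \<Rightarrow> complex"
  assumes S: "\<And>n. u n \<in> Sigma_space" and M: "\<And>n. (L2_norm (u n))\<^sup>2 \<le> 4 * c" and p: "\<And>n. (pnorm a (u n))\<^sup>2 \<le> k"
    and Mt: "(\<lambda>n. (L2_norm (u n))\<^sup>2) \<longlonglongrightarrow> c" and Et: "(\<lambda>n. E (u n)) \<longlonglongrightarrow> m"
  obtains r w where "strict_mono (r :: nat \<Rightarrow> nat)" "w \<in> V" "E w = m" "(\<lambda>n. Sigma_norm (\<lambda>x. u (r n) x - w x)) \<longlonglongrightarrow> 0"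
proof -
  define K where "K = R + R / a"
  note Rb = R_bounds[OF M p]
  have R0: "R \<ge> 0" using Rb(1)[of 0] pnorm_nonneg order_trans by blast
  have Ra: "R \<le> K" "R / a \<le> K" using R0 a by (auto simp: K_def)
  have K1: "L2_norm (u n) \<le> K" for n using Rb(2)[of n] Ra by linarith
  have K2: "L2_norm (weak_grad (u n)) \<le> K" for n using grad_le_pnorm[OF S[of n], of a] Rb(1)[of n] Ra by linarith
  have K3: "L2_norm (\<lambda>x. norm x *\<^sub>R u n x) \<le> K" for n
  proof -
    have "pnorm a (u n) / a \<le> R / a" using Rb(1)[of n] a by (intro divide_right_mono) auto
    then show ?thesis using weight_le_pnorm[OF S[of n] a] Ra by linarith
  qed
  from Sigma_compact_L2[of u, OF S K1 K2 K3] obtain r where r: "strict_mono (r :: nat \<Rightarrow> nat)"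
    and rc: "\<And>e. e > 0 \<Longrightarrow> \<exists>N. \<forall>m\<ge>N. \<forall>n\<ge>N. L2_norm (\<lambda>x. u (r m) x - u (r n) x) < e"
    by blast
  \<comment> \<open>Convergence to 0 along this filter on pairs of indices is the Cauchy
    property.\<close>
  define F where "F = (sequentially \<times>\<^sub>F sequentially :: (nat \<times> nat) filter)"
  have ru: "filterlim r sequentially sequentially" by (rule filterlim_subseq[OF r])
  have f1: "filterlim (\<lambda>q. r (fst q)) sequentially F" and f2: "filterlim (\<lambda>q. r (snd q)) sequentially F"
    unfolding F_def by (intro filterlim_compose[OF ru] filterlim_fst filterlim_snd)+
  have dL: "((\<lambda>q. L2_norm (\<lambda>x. u (r (fst q)) x - u (r (snd q)) x)) \<longlongrightarrow> 0) F"
  proof (rule tendstoI)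
    fix e :: real assume "e > 0"
    then show "\<forall>\<^sub>F q in F. dist (L2_norm (\<lambda>x. u (r (fst q)) x - u (r (snd q)) x)) 0 < e"
      unfolding F_def using rc[of e] by (simp add: eventually_prod_sequentially) blast
  qed
  have dp: "((\<lambda>q. pnorm a (\<lambda>x. u (r (fst q)) x - u (r (snd q)) x)) \<longlongrightarrow> 0) F"
    by (rule almost_minimisers_close[OF S S M M p p filterlim_compose[OF Mt f1] filterlim_compose[OF Mt f2]
        filterlim_compose[OF Et f1] filterlim_compose[OF Et f2] dL])
  have d1: "((\<lambda>q. pnorm 1 (\<lambda>x. u (r (fst q)) x - u (r (snd q)) x)) \<longlongrightarrow> 0) F"
  proof (rule Lim_null_comparison)
    have "((\<lambda>q. L2_norm (\<lambda>x. u (r (fst q)) x - u (r (snd q)) x) + (1 + 1/a) * pnorm a (\<lambda>x. u (r (fst q)) x - u (r (snd q)) x)) \<longlongrightarrow> 0 + (1 + 1/a) * 0) F"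
      by (intro tendsto_intros dL dp)
    then show "((\<lambda>q. L2_norm (\<lambda>x. u (r (fst q)) x - u (r (snd q)) x) + (1 + 1/a) * pnorm a (\<lambda>x. u (r (fst q)) x - u (r (snd q)) x)) \<longlongrightarrow> 0) F"
      by simp
    show "\<forall>\<^sub>F q in F. norm (pnorm 1 (\<lambda>x. u (r (fst q)) x - u (r (snd q)) x))
        \<le> L2_norm (\<lambda>x. u (r (fst q)) x - u (r (snd q)) x) + (1 + 1/a) * pnorm a (\<lambda>x. u (r (fst q)) x - u (r (snd q)) x)"
      using pnorm_one_le[OF Sigma_diff(1)[OF S S]] by (intro always_eventually allI) simp
  qed
  have pc: "\<exists>N. \<forall>i\<ge>N. \<forall>j\<ge>N. pnorm 1 (\<lambda>x. u (r i) x - u (r j) x) < e" if "e > 0" for e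
    using tendstoD[OF d1 that] unfolding F_def by (simp add: eventually_prod_sequentially) blast
  from Sigma_complete[of "\<lambda>n. u (r n)", OF S rc pc] obtain w where w: "w \<in> Sigma_space"
    "(\<lambda>n. L2_norm (\<lambda>x. u (r n) x - w x)) \<longlonglongrightarrow> 0" "(\<lambda>n. pnorm 1 (\<lambda>x. u (r n) x - w x)) \<longlonglongrightarrow> 0"
    by blast
  have Sn: "(\<lambda>n. Sigma_norm (\<lambda>x. u (r n) x - w x)) \<longlonglongrightarrow> 0"
  proof (rule Lim_null_comparison)
    have "(\<lambda>n. L2_norm (\<lambda>x. u (r n) x - w x) + (1 + 1/1) * pnorm 1 (\<lambda>x. u (r n) x - w x)) \<longlonglongrightarrow> 0 + (1 + 1/1) * 0"
      by (intro tendsto_intros w)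
    then show "(\<lambda>n. L2_norm (\<lambda>x. u (r n) x - w x) + (1 + 1/1) * pnorm 1 (\<lambda>x. u (r n) x - w x)) \<longlonglongrightarrow> 0" by simp
    show "\<forall>\<^sub>F n in sequentially. norm (Sigma_norm (\<lambda>x. u (r n) x - w x)) \<le> L2_norm (\<lambda>x. u (r n) x - w x) + (1 + 1/1) * pnorm 1 (\<lambda>x. u (r n) x - w x)"
      using Sigma_norm_le_pnorm[OF Sigma_diff(1)[OF S w(1)], of 1] by (intro always_eventually allI) simp
  qed
  have pa: "(\<lambda>n. pnorm a (\<lambda>x. u (r n) x - w x)) \<longlonglongrightarrow> 0"
  proof (rule Lim_null_comparison)
    show "(\<lambda>n. (1 + a) * Sigma_norm (\<lambda>x. u (r n) x - w x)) \<longlonglongrightarrow> 0" by (rule tendsto_mult_right_zero[OF Sn])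
    show "\<forall>\<^sub>F n in sequentially. norm (pnorm a (\<lambda>x. u (r n) x - w x)) \<le> (1 + a) * Sigma_norm (\<lambda>x. u (r n) x - w x)"
      using pnorm_le_Sigma[OF Sigma_diff(1)[OF S w(1)] a] by (intro always_eventually allI) simp
  qed
  have pw: "(\<lambda>n. pnorm a (u (r n))) \<longlonglongrightarrow> pnorm a w"
  proof -
    have "(\<lambda>n. pnorm a (u (r n)) - pnorm a w) \<longlonglongrightarrow> 0"
      by (rule Lim_null_comparison[OF _ pa]) (use pnorm_abs_diff[OF S w(1), of a] in \<open>simp add: always_eventually\<close>)
    then show ?thesis by (rule LIM_zero_cancel)
  qed
  have lw: "(\<lambda>n. L2_norm (u (r n))) \<longlonglongrightarrow> L2_norm w"
    by (rule tendsto_L2_norm[OF Sigma_L2[OF S] Sigma_L2[OF w(1)] w(2)])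
  have wM: "(L2_norm w)\<^sup>2 = c"
    by (rule LIMSEQ_unique[OF tendsto_power[OF lw] filterlim_compose[OF Mt ru]])
  have wp: "(pnorm a w)\<^sup>2 \<le> k"
    by (rule LIMSEQ_le_const2[OF tendsto_power[OF pw]]) (use p in blast)
  have wV: "w \<in> V" using w(1) wM wp by (simp add: V_def mass_sphere_def)
  have nl: "(\<lambda>n. nlin l1 l2 (u (r n)) - nlin l1 l2 w) \<longlonglongrightarrow> 0"
    by (rule nlin_diff_tendsto[OF S w(1) M VD(4)[OF wV] p wp w(2)])
  have "(\<lambda>n. E (u (r n))) \<longlonglongrightarrow> E w"
    unfolding energy_eq[OF S] energy_eq[OF w(1)] by (intro tendsto_intros pw LIM_zero_cancel[OF nl])
  then have "E w = m" by (rule LIMSEQ_unique[OF _ filterlim_compose[OF Et ru]])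
  from that[OF r wV this Sn] show ?thesis .
qed

section \<open>Minimisers in the well and ground states\<close>

lemma minimiser_exists: "\<exists>w\<in>V. E w = m"
proof -
  have "\<exists>u\<in>V. E u < m + 1 / real (Suc n)" for n
    using cINF_less_iff[OF V_nonempty bdd_below_V, of "m + 1 / real (Suc n)"] unfolding m_def by simp
  then obtain u where u: "\<And>n. u n \<in> V" "\<And>n. E (u n) < m + 1 / real (Suc n)" by metis
  have "(\<lambda>n. E (u n)) \<longlonglongrightarrow> m"
  proof (rule tendsto_sandwich)
    show "\<forall>\<^sub>F n in sequentially. m \<le> E (u n)" using cINF_lower[OF bdd_below_V u(1)] by (simp add: m_def)
    show "\<forall>\<^sub>F n in sequentially. E (u n) \<le> m + 1 / real (Suc n)" using u(2) by (simp add: less_imp_le)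
    have "(\<lambda>n. m + 1 / real (Suc n)) \<longlonglongrightarrow> m + 0" by (intro tendsto_intros LIMSEQ_Suc[OF lim_1_over_n])
    then show "(\<lambda>n. m + 1 / real (Suc n)) \<longlonglongrightarrow> m" by simp
  qed simp
  moreover have "(\<lambda>n. (L2_norm (u n))\<^sup>2) \<longlonglongrightarrow> c" unfolding VD(2)[OF u(1)] by simp
  ultimately obtain w where "w \<in> V" "E w = m"
    using minimising_sequence_compact[of u, OF VD(1)[OF u(1)] VD(4)[OF u(1)] VD(3)[OF u(1)]] by blast
  then show ?thesis by blast
qed

text \<open>A minimiser keeps away from the edge of the well, so the constraint on the level
  contributes nothing to its first variation.\<close>

lemma minimiser_inner:
  assumes "w \<in> V" "E w = m"
  shows "(pnorm a w)\<^sup>2 \<le> k / 8"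
  using energy_coercive(1)[OF VD(1,4,5)[OF assms(1)]] assms(2) m_bounds by linarith

text \<open>For \<open>v\<close> orthogonal to \<open>w\<close> the mass along
  \<open>w + s *\<^sub>R v\<close> differs from \<open>c\<close> only at second order, so by
  \<open>m_lower_off_sphere\<close> leaving the sphere costs a multiple of the square of
  \<open>s\<close>. A negative derivative would gain a multiple of \<open>s\<close>.\<close>

lemma minimiser_variation_nonneg:
  assumes w: "w \<in> V" "E w = m" and v: "v \<in> Sigma_space" and o: "rip v w = 0"
  shows "0 \<le> dE l1 l2 a w v"
proof (rule ccontr)
  assume "\<not> 0 \<le> dE l1 l2 a w v"
  define d where "d = - dE l1 l2 a w v"
  have d: "d > 0" using \<open>\<not> 0 \<le> dE l1 l2 a w v\<close> by (simp add: d_def)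
  define N L P where "N = Sigma_norm v" and "L = (L2_norm v)\<^sup>2" and "P = pnorm a v"
  have N: "N \<ge> 0" and L: "L \<ge> 0" and P: "P \<ge> 0" by (auto simp: N_def L_def P_def)
  define e where "e = d / (2 * (N + 1))"
  have e: "e > 0" "e * N \<le> d / 2" using d N by (auto simp: e_def field_simps)
  have D: "\<forall>e>0. \<exists>\<delta>>0. \<forall>z\<in>Sigma_space. Sigma_norm z < \<delta> \<longrightarrow> \<bar>E (\<lambda>x. w x + z x) - E w - dE l1 l2 a w z\<bar> \<le> e * Sigma_norm z"
    using energy_has_derivative[OF VD(1)[OF w(1)] a, of l1 l2] unfolding has_Sigma_derivative_def by (elim conjE)
  from D[rule_format, OF e(1)] obtain \<delta> where \<delta>: "\<delta> > 0"
    "\<And>z. z \<in> Sigma_space \<Longrightarrow> Sigma_norm z < \<delta> \<Longrightarrow> \<bar>E (\<lambda>x. w x + z x) - E w - dE l1 l2 a w z\<bar> \<le> e * Sigma_norm z"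
    by blast
  have lim: "((\<lambda>s. s * q) \<longlongrightarrow> 0) (at_right (0::real))" for q :: real
    by (rule tendsto_mult_left_zero) (simp add: tendsto_ident_at)
  have lim2: "((\<lambda>s. s\<^sup>2 * q) \<longlongrightarrow> 0) (at_right (0::real))" for q :: real
    by (rule tendsto_mult_left_zero) (auto intro!: tendsto_eq_intros)
  \<comment> \<open>The step is taken so short that the expansion is valid, the level stays below
    \<open>k\<close>, the mass stays between \<open>c\<close> and \<open>2 * c\<close>, and the
    second-order cost is less than half of the gain.\<close>
  have "\<forall>\<^sub>F s in at_right (0::real). s > 0" by (simp add: eventually_at_right_less)
  moreover have "\<forall>\<^sub>F s in at_right (0::real). s * N < \<delta>" by (rule order_tendstoD(2)[OF lim \<delta>(1)])
  moreover have "\<forall>\<^sub>F s in at_right (0::real). s * P < sqrt k / 2" using k_pos by (intro order_tendstoD(2)[OF lim]) simp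
  moreover have "\<forall>\<^sub>F s in at_right (0::real). s\<^sup>2 * L < c" using c by (intro order_tendstoD(2)[OF lim2]) simp
  moreover have "\<forall>\<^sub>F s in at_right (0::real). s * (4 * k / c * L) < d / 2" using d by (intro order_tendstoD(2)[OF lim]) simp
  ultimately have "\<forall>\<^sub>F s in at_right (0::real). s > 0 \<and> s * N < \<delta> \<and> s * P < sqrt k / 2 \<and> s\<^sup>2 * L < c \<and> s * (4 * k / c * L) < d / 2"
    by eventually_elim simp
  from eventually_happens'[OF trivial_limit_at_right_real this] obtain s :: real
    where s: "s > 0" "s * N < \<delta>" "s * P < sqrt k / 2" "s\<^sup>2 * L < c" "s * (4 * k / c * L) < d / 2" by blast
  note wS = VD(1)[OF w(1)]
  let ?v = "\<lambda>x. s *\<^sub>R v x" and ?z = "\<lambda>x. w x + s *\<^sub>R v x"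
  have vS: "?v \<in> Sigma_space" and zS: "?z \<in> Sigma_space" by (intro Sigma_add(1) Sigma_scaleR(1) wS v)+
  have zM: "(L2_norm ?z)\<^sup>2 = c + s\<^sup>2 * L"
  proof -
    have "(L2_norm ?z)\<^sup>2 = (L2_norm w)\<^sup>2 + 2 * rip w ?v + (L2_norm ?v)\<^sup>2"
      by (rule L2_norm_add_sq[OF Sigma_L2[OF wS] Sigma_L2[OF vS]])
    then show ?thesis using o VD(2)[OF w(1)]
      by (simp add: rip_scaleR_right rip_commute[of w] L2_norm_scaleR power_mult_distrib L_def)
  qed
  have sL: "0 \<le> s\<^sup>2 * L" using L by simp
  have zp: "(pnorm a ?z)\<^sup>2 \<le> k"
  proof -
    have "pnorm a w \<le> sqrt k / 2"
      by (rule power2_le_imp_le) (use minimiser_inner[OF w] k_pos in \<open>auto simp: power_divide\<close>)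
    moreover have "pnorm a ?v = s * P" using s by (simp add: pnorm_scaleR[OF v] P_def)
    ultimately have "pnorm a ?z \<le> sqrt k" using pnorm_triangle[OF wS vS, of a] s(3) by linarith
    then have "(pnorm a ?z)\<^sup>2 \<le> (sqrt k)\<^sup>2" by (intro power_mono) auto
    then show ?thesis using k_pos by simp
  qed
  have "m \<le> E ?z + 4 * k / c * \<bar>(L2_norm ?z)\<^sup>2 - c\<bar>"
    using s(4) sL c by (intro m_lower_off_sphere zS zp) (auto simp: zM)
  then have 1: "m \<le> E ?z + 4 * k / c * (s\<^sup>2 * L)" unfolding zM using sL by simp
  have vn: "Sigma_norm ?v = s * N" using s by (simp add: Sigma_norm_scaleR[OF v] N_def)
  have "\<bar>E ?z - E w - dE l1 l2 a w ?v\<bar> \<le> e * (s * N)" using \<delta>(2)[OF vS] s(2) unfolding vn by simp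
  then have 2: "E ?z \<le> m - s * d + s * (e * N)"
    unfolding w(2) dE_scaleR[OF wS v] d_def by (simp add: mult.left_commute abs_le_iff)
  have "4 * k / c * (s\<^sup>2 * L) = s * (s * (4 * k / c * L))" by (simp add: power2_eq_square)
  then have "s * d \<le> s * (e * N) + s * (s * (4 * k / c * L))" using 1 2 by linarith
  also have "\<dots> < s * (d / 2) + s * (d / 2)"
    using s e by (intro add_le_less_mono mult_left_mono mult_strict_left_mono) auto
  finally show False using s by simp
qed

lemma minimiser_critical:
  assumes w: "w \<in> V" "E w = m"
  shows "w \<in> critical_points E c"
  unfolding critical_points_def
proof (intro CollectI conjI exI[of _ "dE l1 l2 a w"] ballI impI)
  note wS = VD(1)[OF w(1)]
  show "w \<in> mass_sphere c" using w by (simp add: V_def)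
  show "has_Sigma_derivative E (dE l1 l2 a w) w" by (rule energy_has_derivative[OF wS a])
  fix v assume v: "v \<in> Sigma_space" and "Re (\<integral>x. v x * cnj (w x) \<partial>lborel) = 0"
  then have o: "rip v w = 0" by (simp add: rip_eq_Re[OF Sigma_L2[OF v] Sigma_L2[OF wS]])
  let ?v = "\<lambda>x. (-1) *\<^sub>R v x"
  have "rip ?v w = 0" unfolding rip_scaleR_left o by simp
  from minimiser_variation_nonneg[OF w Sigma_scaleR(1)[OF v] this]
  have "0 \<le> - dE l1 l2 a w v" unfolding dE_scaleR[OF wS v] by simp
  then show "dE l1 l2 a w v = 0" using minimiser_variation_nonneg[OF w v o] by linarith
qed

lemma critical_low_energy:
  assumes u: "u \<in> critical_points E c" and "E u \<le> m"
  shows "u \<in> V \<and> E u = m"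
proof -
  have "(pnorm a u)\<^sup>2 \<le> 6 * E u" by (rule critical_energy_lower[OF c a u])
  then have "(pnorm a u)\<^sup>2 \<le> k" using assms(2) m_bounds k_pos by linarith
  then have uV: "u \<in> V" using u by (simp add: V_def critical_points_def)
  then have "m \<le> E u" unfolding m_def by (rule cINF_lower[OF bdd_below_V])
  then show ?thesis using uV assms(2) by simp
qed

theorem ground_states_eq: "ground_states l1 l2 a c = {w \<in> V. E w = m}"
proof -
  obtain w where w: "w \<in> V" "E w = m" using minimiser_exists by blast
  have inf: "(INF z\<in>critical_points E c. ereal (E z)) = ereal m"
  proof (rule antisym)
    show "(INF z\<in>critical_points E c. ereal (E z)) \<le> ereal m"
      using INF_lower[OF minimiser_critical[OF w], of "\<lambda>z. ereal (E z)"] w(2) by simp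
    show "ereal m \<le> (INF z\<in>critical_points E c. ereal (E z))"
    proof (rule INF_greatest)
      fix z assume z: "z \<in> critical_points E c"
      show "ereal m \<le> ereal (E z)"
        using critical_low_energy[OF z] by (cases "E z \<le> m") auto
    qed
  qed
  show ?thesis
    unfolding ground_states_def inf using minimiser_critical critical_low_energy by auto
qed

end

section \<open>Orbital stability\<close>

text \<open>A solution agrees with its initial datum only almost everywhere at time 0, whereas
  \<open>weak_grad\<close> might depend on the representative.\<close>

lemma pnorm_cong_AE:
  assumes u: "u \<in> Sigma_space" and v: "v \<in> Sigma_space" and e: "AE x in lborel. u x = v x"
  shows "pnorm a u = pnorm a v"
proof -
  note [measurable] = L2_measurable[OF Sigma_L2[OF u]] L2_measurable[OF Sigma_L2[OF v]]
  note g = H1_weak_grad[OF Sigma_H1[OF v]]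
  have "is_weak_gradient u (weak_grad v)"
    unfolding is_weak_gradient_def
  proof (intro conjI allI ballI)
    show "weak_grad v \<in> L2" by (rule weak_grad_L2[OF Sigma_H1[OF v]])
    fix i \<phi> assume \<phi>: "\<phi> \<in> test_functions"
    note [measurable] = L2_measurable[OF test_functions_partial(1)[OF \<phi>]]
    have "(\<integral>x. u x * partial_deriv i \<phi> x \<partial>lborel) = (\<integral>x. v x * partial_deriv i \<phi> x \<partial>lborel)"
      by (intro integral_cong_AE) (use e in auto)
    then show "(\<integral>x. u x * partial_deriv i \<phi> x \<partial>lborel) = - (\<integral>x. (weak_grad v x $ i) * \<phi> x \<partial>lborel)"
      using g \<phi> unfolding is_weak_gradient_def by simp
  qed
  then have "AE x in lborel. weak_grad u x = weak_grad v x" by (rule weak_grad_eqI(2)[OF Sigma_L2[OF u]])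
  then have "L2_norm (weak_grad u) = L2_norm (weak_grad v)"
    by (intro L2_norm_cong_AE L2_measurable weak_grad_L2 Sigma_H1 u v)
  moreover have "L2_norm (\<lambda>x. norm x *\<^sub>R u x) = L2_norm (\<lambda>x. norm x *\<^sub>R v x)"
    by (intro L2_norm_cong_AE L2_measurable Sigma_weight u v) (use e in auto)
  ultimately have "(pnorm a u)\<^sup>2 = (pnorm a v)\<^sup>2" by (simp add: pnorm_sq[OF u] pnorm_sq[OF v])
  then show ?thesis by simp
qed

section \<open>A competitor deep in the well\<close>

lemma nonzero_element: "\<exists>w\<in>Sigma_space. L2_norm w > 0"
proof -
  define w where "w x = complex_of_real (bump 1 x)" for x
  have zero: "w x = 0" if "norm x > 1" for x using bump_zero[of 1 x] that by (simp add: w_def)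
  have t: "w \<in> test_functions"
    by (rule test_functionsI[of _ 1]) (use Ck_bump zero in \<open>auto simp: w_def[abs_def]\<close>)
  note P = test_functions_props[OF t]
  note [measurable] = L2_measurable[OF P(1)]
  have "norm (norm x *\<^sub>R w x) \<le> 1" for x
  proof (cases "norm x \<le> 1")
    case True
    have "norm (w x) \<le> 1" using bump_le_1[of 1 x] bump_nonneg[of 1 x] by (simp add: w_def)
    then show ?thesis using True by (simp add: mult_le_one)
  qed (use zero in simp)
  then have "(\<lambda>x. norm x *\<^sub>R w x) \<in> L2" by (intro bounded_support_L2[of _ 1 1]) (use zero in auto)
  then have S: "w \<in> Sigma_space"
    using weak_grad_eqI(1)[OF P(1) test_function_weak_gradient[OF t]] by (simp add: Sigma_space_def)
  have "L2_norm w \<noteq> 0"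
  proof
    assume "L2_norm w = 0"
    then have "AE x in lborel. w x = 0" using L2_norm_eq_0[OF P(1)] by simp
    \<comment> \<open>The zero set of a continuous function is closed; having full measure it would
      contain the origin, where the bump is positive.\<close>
    then have "AE x in lebesgue. x \<in> {x. w x = 0}" by (simp add: AE_completion)
    moreover have "closed {x. w x = 0}" using P(2) by (intro closed_Collect_eq continuous_on_const)
    ultimately have "0 \<in> {x. w x = 0}" by (intro mem_closed_if_AE_lebesgue)
    then show False by (simp add: w_def bump_def flat_def)
  qed
  then show ?thesis using S by (intro bexI[of _ w]) (simp add: less_le)
qed

text \<open>Dilating a fixed element by \<open>t = sqrt a\<close> balances gradient and trap:
  \<open>t\<^sup>2 * A + a\<^sup>2 * (B / t\<^sup>2)\<close> equals
  \<open>a * (A + B)\<close>.\<close>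

lemma spread_out_element:
  assumes c: "c > 0" and h: "h > 0"
  shows "\<exists>a0>0. \<forall>a. 0 < a \<and> a \<le> a0 \<longrightarrow> (\<exists>w\<in>mass_sphere c. (pnorm a w)\<^sup>2 \<le> h)"
proof -
  obtain w where w: "w \<in> Sigma_space" "L2_norm w > 0" using nonzero_element by blast
  define r where "r = sqrt c / L2_norm w"
  let ?u = "\<lambda>x. r *\<^sub>R w x"
  have r: "r > 0" using c w(2) by (simp add: r_def)
  have uS: "?u \<in> Sigma_space" by (rule Sigma_scaleR(1)[OF w(1)])
  have uM: "(L2_norm ?u)\<^sup>2 = c" unfolding L2_norm_scaleR using c w(2) by (simp add: r_def)
  define A B where "A = (L2_norm (weak_grad ?u))\<^sup>2" and "B = (L2_norm (\<lambda>x. norm x *\<^sub>R ?u x))\<^sup>2"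
  have AB: "A \<ge> 0" "B \<ge> 0" by (auto simp: A_def B_def)
  show ?thesis
  proof (intro exI[of _ "h / (A + B + 1)"] conjI allI impI)
    show "0 < h / (A + B + 1)" using h AB by simp
    fix a :: real assume "0 < a \<and> a \<le> h / (A + B + 1)"
    then have a: "a > 0" "a * (A + B + 1) \<le> h" using AB by (auto simp: pos_le_divide_eq)
    define t where "t = sqrt a"
    have t: "t > 0" "t\<^sup>2 = a" using a by (auto simp: t_def)
    note D = dilate_Sigma[OF uS t(1)]
    have "(pnorm a (dilate t ?u))\<^sup>2 = t\<^sup>2 * A + a\<^sup>2 * (B / t\<^sup>2)"
      unfolding pnorm_sq[OF D(1)] D(2,3) by (simp add: A_def B_def power_mult_distrib power_divide)
    also have "\<dots> = a * (A + B)" unfolding t(2) using a by (simp add: power2_eq_square algebra_simps)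
    also have "\<dots> \<le> a * (A + B + 1)" using a by simp
    also have "\<dots> \<le> h" by (rule a(2))
    finally have "(pnorm a (dilate t ?u))\<^sup>2 \<le> h" .
    moreover have "dilate t ?u \<in> mass_sphere c"
      using D(1) uM by (simp add: mass_sphere_def dilate_L2(2)[OF Sigma_L2[OF uS] t(1)])
    ultimately show "\<exists>w\<in>mass_sphere c. (pnorm a w)\<^sup>2 \<le> h" by blast
  qed
qed

section \<open>Trapping and stability of the set of ground states\<close>

context energy_well begin

text \<open>Within this distance of a minimiser the mass is at most \<open>4 * c\<close>, and
  \<open>pnorm a\<close> grows by at most an eighth of \<open>sqrt k\<close>, from at most 3/8 to at
  most 1/2 of it.\<close>

definition \<eta> where "\<eta> = min (sqrt c) (sqrt k / (8 * (1 + a)))"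

lemma eta_pos: "\<eta> > 0" using c k_pos a by (simp add: \<eta>_def)

lemma near_minimiser:
  assumes v: "v \<in> V" "E v = m" and u: "u \<in> Sigma_space" and d: "Sigma_norm (\<lambda>x. v x - u x) < \<eta>"
  shows "(L2_norm u)\<^sup>2 \<le> 4 * c" "(pnorm a u)\<^sup>2 \<le> k / 4" "(pnorm a u)\<^sup>2 < k" "E u < k / 4"
proof -
  note vS = VD(1)[OF v(1)]
  have sc: "L2_norm v = sqrt c" using VD(2)[OF v(1)] by (intro real_sqrt_unique[symmetric]) auto
  have "\<bar>L2_norm v - L2_norm u\<bar> \<le> \<eta>"
    using L2_norm_abs_diff[OF Sigma_L2[OF vS] Sigma_L2[OF u]] L2_norm_le_Sigma[of "\<lambda>x. v x - u x"] d by linarith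
  then have "L2_norm u \<le> 2 * sqrt c" unfolding sc \<eta>_def by linarith
  then have "(L2_norm u)\<^sup>2 \<le> (2 * sqrt c)\<^sup>2" by (intro power_mono) auto
  then show M: "(L2_norm u)\<^sup>2 \<le> 4 * c" using c by (simp add: power_mult_distrib)
  have "pnorm a v \<le> 3/8 * sqrt k"
    by (rule power2_le_imp_le) (use minimiser_inner[OF v] k_pos in \<open>auto simp: power_mult_distrib power_divide\<close>)
  moreover have "\<bar>pnorm a v - pnorm a u\<bar> \<le> 1/8 * sqrt k"
  proof -
    have "\<bar>pnorm a v - pnorm a u\<bar> \<le> pnorm a (\<lambda>x. v x - u x)" by (rule pnorm_abs_diff[OF vS u])
    also have "\<dots> \<le> (1 + a) * Sigma_norm (\<lambda>x. v x - u x)" by (rule pnorm_le_Sigma[OF Sigma_diff(1)[OF vS u] a])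
    also have "\<dots> \<le> (1 + a) * (sqrt k / (8 * (1 + a)))" using d a by (intro mult_left_mono) (auto simp: \<eta>_def)
    also have "\<dots> = 1/8 * sqrt k" using a by (simp add: field_simps)
    finally show ?thesis .
  qed
  ultimately have "pnorm a u \<le> 1/2 * sqrt k" by linarith
  then have "(pnorm a u)\<^sup>2 \<le> (1/2 * sqrt k)\<^sup>2" by (intro power_mono) auto
  then show p: "(pnorm a u)\<^sup>2 \<le> k / 4" using k_pos by (simp add: power_mult_distrib power_divide)
  show "(pnorm a u)\<^sup>2 < k" using p k_pos by linarith
  have "E u \<le> 3/4 * (pnorm a u)\<^sup>2" using p k_pos by (intro energy_coercive(2) u M) linarith
  then show "E u < k / 4" using p k_pos by linarith
qed

text \<open>The nearby minimiser varies with \<open>n\<close>, so continuity of the energy at one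
  point is not enough. The two parts are compared uniformly on the well: the quadratic one by
  factoring a difference of squares, the interaction by \<open>nlin_diff_tendsto\<close>.\<close>

lemma near_minimiser_energy:
  assumes v: "\<And>n. v n \<in> V" "\<And>n. E (v n) = m" and u: "\<And>n. u n \<in> Sigma_space"
    and \<eta>: "\<And>n. Sigma_norm (\<lambda>x. v n x - u n x) < \<eta>"
    and d: "(\<lambda>n. Sigma_norm (\<lambda>x. v n x - u n x)) \<longlonglongrightarrow> 0"
  shows "(\<lambda>n. (L2_norm (u n))\<^sup>2) \<longlonglongrightarrow> c" "(\<lambda>n. E (u n)) \<longlonglongrightarrow> m"
proof -
  note vS = VD(1)[OF v(1)] and N = near_minimiser[OF v u \<eta>]
  have sc: "L2_norm (v n) = sqrt c" for n using VD(2)[OF v(1)] by (intro real_sqrt_unique[symmetric]) auto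
  have "(\<lambda>n. L2_norm (u n) - sqrt c) \<longlonglongrightarrow> 0"
  proof (rule Lim_null_comparison[OF _ d])
    have "\<bar>L2_norm (v n) - L2_norm (u n)\<bar> \<le> Sigma_norm (\<lambda>x. v n x - u n x)" for n
      using L2_norm_abs_diff[OF Sigma_L2[OF vS] Sigma_L2[OF u], of n n] L2_norm_le_Sigma[of "\<lambda>x. v n x - u n x"] by linarith
    then show "\<forall>\<^sub>F n in sequentially. norm (L2_norm (u n) - sqrt c) \<le> Sigma_norm (\<lambda>x. v n x - u n x)"
      unfolding sc by (simp add: abs_minus_commute)
  qed
  then have "(\<lambda>n. (L2_norm (u n))\<^sup>2) \<longlonglongrightarrow> (sqrt c)\<^sup>2" by (rule tendsto_power[OF LIM_zero_cancel])
  then show "(\<lambda>n. (L2_norm (u n))\<^sup>2) \<longlonglongrightarrow> c" using c by simp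
  have dL: "(\<lambda>n. L2_norm (\<lambda>x. v n x - u n x)) \<longlonglongrightarrow> 0"
    by (rule Lim_null_comparison[OF _ d]) (simp add: L2_norm_le_Sigma)
  have nl: "(\<lambda>n. nlin l1 l2 (v n) - nlin l1 l2 (u n)) \<longlonglongrightarrow> 0"
    by (rule nlin_diff_tendsto[OF vS u VD(4)[OF v(1)] N(1) VD(3)[OF v(1)] less_imp_le[OF N(3)] dL])
  have dp: "(\<lambda>n. (pnorm a (v n))\<^sup>2 - (pnorm a (u n))\<^sup>2) \<longlonglongrightarrow> 0"
  proof (rule Lim_null_comparison)
    show "(\<lambda>n. (2 * R * (1 + a)) * Sigma_norm (\<lambda>x. v n x - u n x)) \<longlonglongrightarrow> 0" by (rule tendsto_mult_right_zero[OF d])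
    have "\<bar>(pnorm a (v n))\<^sup>2 - (pnorm a (u n))\<^sup>2\<bar> \<le> (2 * R * (1 + a)) * Sigma_norm (\<lambda>x. v n x - u n x)" for n
    proof -
      have "pnorm a (v n) \<le> R" "pnorm a (u n) \<le> R"
        using R_bounds(1)[OF VD(4,3)[OF v(1)]] R_bounds(1)[OF N(1) less_imp_le[OF N(3)]] by auto
      then have s: "pnorm a (v n) + pnorm a (u n) \<le> 2 * R" by linarith
      have "\<bar>(pnorm a (v n))\<^sup>2 - (pnorm a (u n))\<^sup>2\<bar> = (pnorm a (v n) + pnorm a (u n)) * \<bar>pnorm a (v n) - pnorm a (u n)\<bar>"
        by (simp add: square_diff_square_factored power2_eq_square abs_mult)
      also have "\<dots> \<le> (2 * R) * ((1 + a) * Sigma_norm (\<lambda>x. v n x - u n x))"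
      proof (rule mult_mono[OF s])
        show "\<bar>pnorm a (v n) - pnorm a (u n)\<bar> \<le> (1 + a) * Sigma_norm (\<lambda>x. v n x - u n x)"
          by (rule order_trans[OF pnorm_abs_diff[OF vS u] pnorm_le_Sigma[OF Sigma_diff(1)[OF vS u] a]])
        show "0 \<le> 2 * R" using s add_nonneg_nonneg[OF pnorm_nonneg pnorm_nonneg, of a "v n" a "u n"] by linarith
      qed simp
      finally show ?thesis by (simp add: mult.assoc)
    qed
    then show "\<forall>\<^sub>F n in sequentially. norm ((pnorm a (v n))\<^sup>2 - (pnorm a (u n))\<^sup>2) \<le> (2 * R * (1 + a)) * Sigma_norm (\<lambda>x. v n x - u n x)"
      by simp
  qed
  have "(\<lambda>n. E (v n) - (1/2 * ((pnorm a (v n))\<^sup>2 - (pnorm a (u n))\<^sup>2) + (nlin l1 l2 (v n) - nlin l1 l2 (u n)))) \<longlonglongrightarrow> m - (1/2 * 0 + 0)"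
    unfolding v(2) by (intro tendsto_intros dp nl)
  moreover have "E (v n) - (1/2 * ((pnorm a (v n))\<^sup>2 - (pnorm a (u n))\<^sup>2) + (nlin l1 l2 (v n) - nlin l1 l2 (u n))) = E (u n)" for n
    unfolding energy_eq[OF vS] energy_eq[OF u] by (simp add: algebra_simps)
  ultimately show "(\<lambda>n. E (u n)) \<longlonglongrightarrow> m" by simp
qed

text \<open>A trajectory cannot leave the well, since on its boundary the energy is at least \<open>k / 4\<close>.\<close>

lemma trapped:
  assumes L: "local_theory l1 l2 a" and q: "q \<in> Sigma_space"
    and M: "(L2_norm q)\<^sup>2 \<le> 4 * c" and p: "(pnorm a q)\<^sup>2 < k" and Eq: "E q < k / 4"
  obtains \<psi> where "maximal_solution l1 l2 a q \<infinity> \<psi>"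
    "\<And>t. 0 \<le> t \<Longrightarrow> \<psi> t \<in> Sigma_space \<and> (pnorm a (\<psi> t))\<^sup>2 < k \<and> L2_norm (\<psi> t) = L2_norm q \<and> E (\<psi> t) = E q"
proof -
  from L q have "\<exists>T \<psi>. maximal_solution l1 l2 a q T \<psi> \<and>
     (\<forall>t. 0 \<le> t \<and> ereal t < T \<longrightarrow> L2_norm (\<psi> t) = L2_norm q \<and> E (\<psi> t) = E q) \<and>
     (T = \<infinity> \<or> filterlim (\<lambda>t. L2_norm (weak_grad (\<psi> t))) at_top (at_left (real_of_ereal T)))"
    unfolding local_theory_def by (rule bspec)
  then obtain T \<psi> where mx: "maximal_solution l1 l2 a q T \<psi>"
    and cons: "\<And>t. 0 \<le> t \<Longrightarrow> ereal t < T \<Longrightarrow> L2_norm (\<psi> t) = L2_norm q \<and> E (\<psi> t) = E q"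
    and blow: "T = \<infinity> \<or> filterlim (\<lambda>t. L2_norm (weak_grad (\<psi> t))) at_top (at_left (real_of_ereal T))"
    by blast
  define I where "I = {t. 0 \<le> t \<and> ereal t < T}"
  have sol: "solves_on l1 l2 a q T \<psi>" using mx unfolding maximal_solution_def by (rule conjunct1)
  have T: "0 < T" and init: "AE x in lborel. \<psi> 0 x = q x" and S: "\<And>t. t \<in> I \<Longrightarrow> \<psi> t \<in> Sigma_space"
    and ct: "\<And>t. t \<in> I \<Longrightarrow> ((\<lambda>s. Sigma_norm (\<lambda>x. \<psi> s x - \<psi> t x)) \<longlongrightarrow> 0) (at t within I)"
    using sol unfolding solves_on_def Let_def I_def by auto
  have zI: "0 \<in> I" using T by (simp add: I_def zero_ereal_def)
  have cp: "continuous_on I (\<lambda>t. (pnorm a (\<psi> t))\<^sup>2)"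
  proof (intro continuous_on_power)
    show "continuous_on I (\<lambda>t. pnorm a (\<psi> t))" unfolding continuous_on
    proof
      fix t assume t: "t \<in> I"
      have "((\<lambda>s. pnorm a (\<psi> s) - pnorm a (\<psi> t)) \<longlongrightarrow> 0) (at t within I)"
      proof (rule Lim_null_comparison)
        show "((\<lambda>s. (1 + a) * Sigma_norm (\<lambda>x. \<psi> s x - \<psi> t x)) \<longlongrightarrow> 0) (at t within I)"
          by (rule tendsto_mult_right_zero[OF ct[OF t]])
        have "\<bar>pnorm a (\<psi> s) - pnorm a (\<psi> t)\<bar> \<le> (1 + a) * Sigma_norm (\<lambda>x. \<psi> s x - \<psi> t x)" if "s \<in> I" for s
          by (rule order_trans[OF pnorm_abs_diff[OF S S] pnorm_le_Sigma[OF Sigma_diff(1)[OF S S] a]]) (fact that t)+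
        then show "\<forall>\<^sub>F s in at t within I. norm (pnorm a (\<psi> s) - pnorm a (\<psi> t)) \<le> (1 + a) * Sigma_norm (\<lambda>x. \<psi> s x - \<psi> t x)"
          by (simp add: eventually_at_filter)
      qed
      then show "((\<lambda>t. pnorm a (\<psi> t)) \<longlongrightarrow> pnorm a (\<psi> t)) (at t within I)" by (rule LIM_zero_cancel)
    qed
  qed
  have tr: "(pnorm a (\<psi> t))\<^sup>2 < k" if t: "t \<in> I" for t
  proof (rule ccontr)
    assume "\<not> (pnorm a (\<psi> t))\<^sup>2 < k"
    then have ge: "k \<le> (pnorm a (\<psi> t))\<^sup>2" by simp
    have t0: "0 \<le> t" using t by (simp add: I_def)
    have sub: "{0..t} \<subseteq> I"
    proof
      fix s assume s: "s \<in> {0..t}"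
      then have "ereal s \<le> ereal t" by simp
      also have "ereal t < T" using t by (simp add: I_def)
      finally show "s \<in> I" using s by (simp add: I_def)
    qed
    have "(pnorm a (\<psi> 0))\<^sup>2 \<le> k" using p pnorm_cong_AE[OF S[OF zI] q init, of a] by simp
    from IVT'[of "\<lambda>t. (pnorm a (\<psi> t))\<^sup>2", OF this ge t0 continuous_on_subset[OF cp sub]]
    obtain s where s: "0 \<le> s" "s \<le> t" "(pnorm a (\<psi> s))\<^sup>2 = k" by blast
    then have sI: "s \<in> I" using sub by auto
    then have cs: "L2_norm (\<psi> s) = L2_norm q" "E (\<psi> s) = E q" using cons[of s] by (auto simp: I_def)
    have "(pnorm a (\<psi> s))\<^sup>2 / 4 \<le> E (\<psi> s)"
      by (rule energy_coercive(1)[OF S[OF sI]]) (use M s k_pos in \<open>simp_all add: cs\<close>)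
    then show False using s Eq cs by simp
  qed
  have "T = \<infinity>"
  proof (rule ccontr)
    assume ninf: "T \<noteq> \<infinity>"
    then obtain T' where T': "T = ereal T'" using T by (cases T) auto
    have T'0: "T' > 0" using T T' by simp
    have fl: "filterlim (\<lambda>t. L2_norm (weak_grad (\<psi> t))) at_top (at_left T')" using blow ninf T' by simp
    \<comment> \<open>In the well the norm of the gradient is at most \<open>sqrt k\<close>, which
      contradicts its divergence at a finite end time.\<close>
    have "\<forall>\<^sub>F t in at_left T'. sqrt k + 1 \<le> L2_norm (weak_grad (\<psi> t))"
      using fl unfolding filterlim_at_top by (rule spec)
    moreover have "\<forall>\<^sub>F t in at_left T'. t \<in> {0<..<T'}" by (rule eventually_at_left_real[OF T'0])
    ultimately have "\<forall>\<^sub>F t in at_left T'. False"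
    proof eventually_elim
      case (elim t)
      then have t: "t \<in> I" by (simp add: I_def T')
      have "L2_norm (weak_grad (\<psi> t)) \<le> pnorm a (\<psi> t)" by (rule grad_le_pnorm[OF S[OF t]])
      also have "\<dots> \<le> sqrt k" using tr[OF t] by (intro real_le_rsqrt) simp
      finally show False using elim by simp
    qed
    then show False by (simp add: trivial_limit_at_left_real)
  qed
  show ?thesis
  proof (rule that[of \<psi>])
    show "maximal_solution l1 l2 a q \<infinity> \<psi>" using mx \<open>T = \<infinity>\<close> by simp
    fix t :: real assume "0 \<le> t"
    then have "t \<in> I" by (simp add: I_def \<open>T = \<infinity>\<close>)
    then show "\<psi> t \<in> Sigma_space \<and> (pnorm a (\<psi> t))\<^sup>2 < k \<and> L2_norm (\<psi> t) = L2_norm q \<and> E (\<psi> t) = E q"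
      using S tr cons[of t] by (simp add: I_def)
  qed
qed

text \<open>Along a sequence of counterexamples with shrinking \<open>\<delta>\<close>, the states
  at the bad times inherit mass and energy from the initial data. Hence they form a minimising
  sequence inside the well, and a subsequence converges to a ground state although every member
  keeps distance \<open>\<epsilon>\<close> from all of them.\<close>

theorem ground_states_stable:
  assumes L: "local_theory l1 l2 a" and \<epsilon>: "\<epsilon> > 0"
  shows "\<exists>\<delta>>0. \<forall>\<psi>0\<in>Sigma_space.
       (INF v\<in>ground_states l1 l2 a c. Sigma_norm (\<lambda>x. v x - \<psi>0 x)) < \<delta> \<longrightarrow>
       (\<exists>\<psi>. maximal_solution l1 l2 a \<psi>0 \<infinity> \<psi> \<and>
          (\<forall>t>0. (INF v\<in>ground_states l1 l2 a c. Sigma_norm (\<lambda>x. \<psi> t x - v x)) < \<epsilon>))"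
proof (rule ccontr)
  define G where "G = ground_states l1 l2 a c"
  \<comment> \<open>The infima in the statement are taken in the reals, where they have their
    meaning only over nonempty sets bounded below.\<close>
  have Gne: "G \<noteq> {}" using minimiser_exists unfolding G_def ground_states_eq by blast
  have bd: "bdd_below ((\<lambda>v. Sigma_norm (f v)) ` G)" for f by (rule bdd_belowI2[of _ 0]) simp
  assume neg: "\<not> ?thesis"
  have step: "\<exists>q z v. q \<in> Sigma_space \<and> v \<in> G \<and> Sigma_norm (\<lambda>x. v x - q x) < min \<eta> (1 / real (Suc n)) \<and>
      z \<in> Sigma_space \<and> (pnorm a z)\<^sup>2 \<le> k \<and> L2_norm z = L2_norm q \<and> E z = E q \<and>
      \<epsilon> \<le> (INF v\<in>G. Sigma_norm (\<lambda>x. z x - v x))" for n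
  proof -
    \<comment> \<open>The cap \<open>\<eta>\<close> puts every datum into the region where
      \<open>trapped\<close> applies.\<close>
    have "min \<eta> (1 / real (Suc n)) > 0" using eta_pos by simp
    with neg obtain q where q: "q \<in> Sigma_space" "(INF v\<in>G. Sigma_norm (\<lambda>x. v x - q x)) < min \<eta> (1 / real (Suc n))"
      "\<not> (\<exists>\<psi>. maximal_solution l1 l2 a q \<infinity> \<psi> \<and> (\<forall>t>0. (INF v\<in>G. Sigma_norm (\<lambda>x. \<psi> t x - v x)) < \<epsilon>))"
      unfolding G_def by blast
    from q(2) obtain v where v: "v \<in> G" "Sigma_norm (\<lambda>x. v x - q x) < min \<eta> (1 / real (Suc n))"
      unfolding cINF_less_iff[OF Gne bd] by blast
    have vV: "v \<in> V" "E v = m" using v(1) by (auto simp: G_def ground_states_eq)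
    have "Sigma_norm (\<lambda>x. v x - q x) < \<eta>" using v(2) by simp
    note N = near_minimiser[OF vV q(1) this]
    from trapped[OF L q(1) N(1,3,4)] obtain \<psi> where \<psi>: "maximal_solution l1 l2 a q \<infinity> \<psi>"
      "\<And>t. 0 \<le> t \<Longrightarrow> \<psi> t \<in> Sigma_space \<and> (pnorm a (\<psi> t))\<^sup>2 < k \<and> L2_norm (\<psi> t) = L2_norm q \<and> E (\<psi> t) = E q"
      by blast
    from q(3) \<psi>(1) obtain t where t: "t > 0" "\<not> (INF v\<in>G. Sigma_norm (\<lambda>x. \<psi> t x - v x)) < \<epsilon>" by blast
    from \<psi>(2)[of t] t q(1) v show ?thesis
      by (intro exI[of _ q] exI[of _ "\<psi> t"] exI[of _ v]) (simp add: less_imp_le)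
  qed
  from step have "\<forall>n. \<exists>s. fst s \<in> Sigma_space \<and> snd (snd s) \<in> G \<and> Sigma_norm (\<lambda>x. snd (snd s) x - fst s x) < min \<eta> (1 / real (Suc n)) \<and>
      fst (snd s) \<in> Sigma_space \<and> (pnorm a (fst (snd s)))\<^sup>2 \<le> k \<and> L2_norm (fst (snd s)) = L2_norm (fst s) \<and> E (fst (snd s)) = E (fst s) \<and>
      \<epsilon> \<le> (INF v\<in>G. Sigma_norm (\<lambda>x. fst (snd s) x - v x))" by simp
  from choice[OF this] obtain s where s: "\<And>n. fst (s n) \<in> Sigma_space" "\<And>n. snd (snd (s n)) \<in> G"
    "\<And>n. Sigma_norm (\<lambda>x. snd (snd (s n)) x - fst (s n) x) < min \<eta> (1 / real (Suc n))"
    "\<And>n. fst (snd (s n)) \<in> Sigma_space" "\<And>n. (pnorm a (fst (snd (s n))))\<^sup>2 \<le> k"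
    "\<And>n. L2_norm (fst (snd (s n))) = L2_norm (fst (s n))" "\<And>n. E (fst (snd (s n))) = E (fst (s n))"
    "\<And>n. \<epsilon> \<le> (INF v\<in>G. Sigma_norm (\<lambda>x. fst (snd (s n)) x - v x))" by blast
  define q where "q n = fst (s n)" for n
  define z where "z n = fst (snd (s n))" for n
  define v where "v n = snd (snd (s n))" for n
  note s = s[folded q_def z_def v_def]
  have vV: "v n \<in> V" "E (v n) = m" for n using s(2)[of n] by (auto simp: G_def ground_states_eq)
  have e1: "Sigma_norm (\<lambda>x. v n x - q n x) < \<eta>" for n using s(3)[of n] by simp
  have "(\<lambda>n. Sigma_norm (\<lambda>x. v n x - q n x)) \<longlonglongrightarrow> 0"
  proof (rule Lim_null_comparison[OF _ LIMSEQ_Suc[OF lim_1_over_n]])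
    show "\<forall>\<^sub>F n in sequentially. norm (Sigma_norm (\<lambda>x. v n x - q n x)) \<le> 1 / real (Suc n)"
      using s(3) by (simp add: less_imp_le)
  qed
  note Q = near_minimiser_energy[OF vV s(1) e1 this]
  have "(\<lambda>n. (L2_norm (z n))\<^sup>2) \<longlonglongrightarrow> c" "(\<lambda>n. E (z n)) \<longlonglongrightarrow> m" using Q unfolding s(6,7) by auto
  moreover have "(L2_norm (z n))\<^sup>2 \<le> 4 * c" for n unfolding s(6) by (rule near_minimiser(1)[OF vV s(1) e1])
  ultimately obtain r w where r: "w \<in> V" "E w = m" "(\<lambda>n. Sigma_norm (\<lambda>x. z (r n) x - w x)) \<longlonglongrightarrow> 0"
    using minimising_sequence_compact[of z, OF s(4) _ s(5)] by blast
  have wG: "w \<in> G" using r by (simp add: G_def ground_states_eq)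
  have "\<epsilon> \<le> Sigma_norm (\<lambda>x. z (r n) x - w x)" for n
    by (rule order_trans[OF s(8) cINF_lower[OF bd wG]])
  then have "\<epsilon> \<le> 0" by (intro LIMSEQ_le_const[OF r(3)]) blast
  then show False using \<epsilon> by simp
qed

end

theorem theorem1p7:
  fixes c lam1 lam2 :: real
  assumes "c > 0"
    and "unstable_regime lam1 lam2"
    and known_local_theory: "\<And>a. a > 0 \<Longrightarrow> local_theory lam1 lam2 a"
  shows "\<exists>a0>0. \<forall>a. 0 < a \<and> a \<le> a0 \<longrightarrow>
    ground_states lam1 lam2 a c \<noteq> {} \<and>
    (\<forall>\<epsilon>>0. \<exists>\<delta>>0. \<forall>\<psi>0\<in>Sigma_space.
       (INF v\<in>ground_states lam1 lam2 a c. Sigma_norm (\<lambda>x. v x - \<psi>0 x)) < \<delta> \<longrightarrow>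
       (\<exists>\<psi>. maximal_solution lam1 lam2 a \<psi>0 \<infinity> \<psi> \<and>
          (\<forall>t>0. (INF v\<in>ground_states lam1 lam2 a c. Sigma_norm (\<lambda>x. \<psi> t x - v x)) < \<epsilon>)))"
proof -
  have "dbound lam1 lam2 * gn_const \<ge> 0" using gn_const_pos by (intro mult_nonneg_nonneg) auto
  then have "well_radius lam1 lam2 c / 64 > 0" using assms(1) by (simp add: well_radius_def)
  \<comment> \<open>The threshold \<open>a0\<close> only has to supply the competitor; the radius of
    the well is already fixed by the couplings and \<open>c\<close>.\<close>
  from spread_out_element[OF assms(1) this] obtain a0 where a0: "a0 > 0"
    "\<And>a. 0 < a \<Longrightarrow> a \<le> a0 \<Longrightarrow> \<exists>w\<in>mass_sphere c. (pnorm a w)\<^sup>2 \<le> well_radius lam1 lam2 c / 64"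
    by blast
  show ?thesis
  proof (rule exI[of _ a0], intro conjI allI impI a0(1))
    fix a assume a: "0 < a \<and> a \<le> a0"
    then interpret energy_well lam1 lam2 c a by unfold_locales (use assms(1) a0(2) in auto)
    show "ground_states lam1 lam2 a c \<noteq> {}" using minimiser_exists unfolding ground_states_eq by blast
    fix \<epsilon> :: real assume "0 < \<epsilon>"
    then show "\<exists>\<delta>>0. \<forall>\<psi>0\<in>Sigma_space.
       (INF v\<in>ground_states lam1 lam2 a c. Sigma_norm (\<lambda>x. v x - \<psi>0 x)) < \<delta> \<longrightarrow>
       (\<exists>\<psi>. maximal_solution lam1 lam2 a \<psi>0 \<infinity> \<psi> \<and>
          (\<forall>t>0. (INF v\<in>ground_states lam1 lam2 a c. Sigma_norm (\<lambda>x. \<psi> t x - v x)) < \<epsilon>))"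
      using a by (intro ground_states_stable known_local_theory) auto
  qed
qed

end
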